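(* Let $\Omega\subset\mathbb{R}^n$ ($n\ge2$) be bounded and open, $T>0$, $\Omega_T=\Omega\times(0,T)$, $N>1$. Let $H(z,s)=s^p+a(z)s^q$ for $z\in\Omega_T$, $s\ge0$, where $\frac{2n}{n+2}<p\le q$, $0\le a(z)\le L$ in $\Omega_T$, $|a(z_1)-a(z_2)|\le L(|x_1-x_2|^\alpha+|t_1-t_2|^{\alpha/2})$ for all $z_1=(x_1,t_1),z_2=(x_2,t_2)\in\Omega_T$ with some $\alpha\in(0,1]$, and $$q\le p+\frac{p\alpha}{n+2}.$$ Let $\mathbf{A}:\Omega_T\times\mathbb{R}^{N\times n}\to\mathbb{R}^{N\times n}$ satisfy (A1), (A2), (A3) in the context, for some $0<\nu\le L$ and $\beta_0\in(0,1)$, and let $\mathbf{u}$ be a weak solution to $\mathbf{u}_t-\operatorname{div}\mathbf{A}(z,D\mathbf{u})=\mathbf{0}$ in $\Omega_T$. Then there is a constant $\hat c=\hat c(n,N,p,q,L,\nu)>0$ such that, for every pair of concentric cylinders $Q_{r_1,\rho_1}(z_0)\subset Q_{r_2,\rho_2}(z_0)\Subset\Omega_T$ with $z_0=(x_0,t_0)$, $0<r_1<r_2\le1$ and $0<\rho_1<\rho_2\le1$, and every linear map $\boldsymbol\ell(x)=\mathbf{P}(x-x_0)+\mathbf{b}$ with $\mathbf{P}\in\mathbb{R}^{N\times n}$, $\mathbf{b}\in\mathbb{R}^N$, setting $\mathbf{u}_{\boldsymbol\ell}(z):=\mathbf{u}(z)-\boldsymbol\ell(x)$, one has $$\begin{aligned}&\operatorname*{ess\,sup}_{t\in(t_0-\rho_1,t_0+\rho_1)}\int_{B_{r_1}(x_0)}|\mathbf{u}_{\boldsymbol\ell}(x,t)|^2\,dx+\iint_{Q_{r_1,\rho_1}(z_0)}H_{1+|D\boldsymbol\ell|}(z,|D\mathbf{u}_{\boldsymbol\ell}|)\,dz\\&\quad\le\hat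 c\iint_{Q_{r_2,\rho_2}(z_0)}\left[\frac{|\mathbf{u}_{\boldsymbol\ell}|^2}{\rho_2-\rho_1}+H_{1+|D\boldsymbol\ell|}\Big(z,\frac{|\mathbf{u}_{\boldsymbol\ell}|}{r_2-r_1}\Big)\right]dz+\hat c\,|Q_{r_2,\rho_2}|\max\Big\{C_1^{\frac{\tilde p}{\tilde p-1}},C_1^{\frac{\tilde q}{\tilde q-1}}\Big\}H(z^+,1+|D\boldsymbol\ell|),\end{aligned}$$ where $$C_1:=(r_2+\sqrt{\rho_2})^{\beta_0}+(r_2+\sqrt{\rho_2})^{\alpha}(1+|D\boldsymbol\ell|)^{q-p},\qquad \tilde p:=\min\{p,2\},\quad\tilde q:=\max\{q,2\},$$ and $z^+\in\overline{Q_{r_2,\rho_2}(z_0)}$ is such that $a(z^+)=\sup_{z\in Q_{r_2,\rho_2}(z_0)}a(z)$.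
   Context: Structure conditions. $D_{\boldsymbol\xi}\mathbf{A}$ is the derivative of $\mathbf{A}(z,\boldsymbol\xi)$ in $\boldsymbol\xi$; $H'(z,s)$, $H''(z,s)$ are the first and second derivatives of $H$ in $s$; "$:$" is the Euclidean inner product of $\mathbb{R}^{N\times n}$ and "$\cdot$" that of $\mathbb{R}^N$. For all $z,z_1=(x_1,t_1),z_2=(x_2,t_2)\in\Omega_T$ and $\boldsymbol\xi,\boldsymbol\lambda\in\mathbb{R}^{N\times n}$: (A1) $|\mathbf{A}(z,\boldsymbol\xi)|+(1+|\boldsymbol\xi|)|D_{\boldsymbol\xi}\mathbf{A}(z,\boldsymbol\xi)|\le L\,H'(z,1+|\boldsymbol\xi|)$; (A2) $[D_{\boldsymbol\xi}\mathbf{A}(z,\boldsymbol\xi)\boldsymbol\lambda]:\boldsymbol\lambda\ge\nu\,H''(z,1+|\boldsymbol\xi|)|\boldsymbol\lambda|^2$; (A3) $|\mathbf{A}(z_1,\boldsymbol\xi)-\mathbf{A}(z_2,\boldsymbol\xi)|\le L(|x_1-x_2|+\sqrt{|t_1-t_2|})^{\beta_0}\big(H'(z_1,1+|\boldsymbol\xi|)+H'(z_2,1+|\boldsymbol\xi|)\big)+L|a(z_1)-a(z_2)|(1+|\boldsymbol\xi|)^{q-1}$. Weak solution. $\mathbf{u}\in C_{\mathrm{loc}}(0,T;L^2_{\mathrm{loc}}(\Omega,\mathbb{R}^N))\cap L^p_{\mathrm{loc}}(0,T;W^{1,p}_{\mathrm{loc}}(\Omega,\mathbb{R}^N))$ with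 $H(\cdot,|D\mathbf{u}|)\in L^1_{\mathrm{loc}}(\Omega_T)$ is a weak solution if $-\iint_{\Omega_T}\mathbf{u}\cdot\boldsymbol\zeta_t\,dz+\iint_{\Omega_T}\mathbf{A}(z,D\mathbf{u}):D\boldsymbol\zeta\,dz=0$ for all $\boldsymbol\zeta\in C_c^\infty(\Omega_T,\mathbb{R}^N)$. $D$ denotes the spatial gradient, $z=(x,t)$. Notation. $Q_{r,\tau}(z_0)=B_r(x_0)\times(t_0-\tau,t_0+\tau)$ for $z_0=(x_0,t_0)$. For $\sigma\ge0$ the shifted function is $H_\sigma(z,s):=\int_0^s\frac{H'(z,\sigma+\tilde s)\,\tilde s}{\sigma+\tilde s}\,d\tilde s$. *)

theory Defs
  imports "HOL-Analysis.Analysis" "HOL-Probability.Essential_Supremum"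
begin

text \<open>
  A space-time point is a pair \<open>z = (x, t)\<close> of type \<open>(real^'n) \<times> real\<close>. A matrix in
  \<open>\<real>\<^sup>N\<^sup>\<times>\<^sup>n\<close> has type \<open>real^'n^'N\<close> (rows indexed by \<open>'N\<close>); \<open>\<bullet>\<close> and \<open>norm\<close> on this type are the
  Euclidean inner product \<open>:\<close> and the Euclidean norm. All measure theory is with respect to
  Lebesgue (not Borel) measurability.
\<close>

section \<open>The double phase function\<close>

text \<open>
  The real power \<open>powr\<close> on negative arguments is irrelevant: \<open>dphase\<close> is evaluated only at
  \<open>s \<ge> 0\<close>, its derivatives only at \<open>s > 0\<close> (up to a null set in \<open>dphase_shift\<close>).
\<close>

definition dphase :: "real \<Rightarrow> real \<Rightarrow> ('z \<Rightarrow> real) \<Rightarrow> 'z \<Rightarrow> real \<Rightarrow> real" where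
  "dphase p q a z s = s powr p + a z * s powr q"

definition dphase' :: "real \<Rightarrow> real \<Rightarrow> ('z \<Rightarrow> real) \<Rightarrow> 'z \<Rightarrow> real \<Rightarrow> real" where
  "dphase' p q a z s = deriv (dphase p q a z) s"

definition dphase'' :: "real \<Rightarrow> real \<Rightarrow> ('z \<Rightarrow> real) \<Rightarrow> 'z \<Rightarrow> real \<Rightarrow> real" where
  "dphase'' p q a z s = deriv (dphase' p q a z) s"

definition dphase_shift :: "real \<Rightarrow> real \<Rightarrow> ('z \<Rightarrow> real) \<Rightarrow> real \<Rightarrow> 'z \<Rightarrow> real \<Rightarrow> real" where
  "dphase_shift p q a \<sigma> z s =
     (LINT r:{0..s}|lebesgue. dphase' p q a z (\<sigma> + r) * r / (\<sigma> + r))"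

lemma dphase'_eq:
  assumes "s > 0"
  shows "dphase' p q a z s = p * s powr (p - 1) + a z * q * s powr (q - 1)"
  unfolding dphase'_def dphase_def [abs_def]
  by (rule DERIV_imp_deriv) (use assms in \<open>auto intro!: derivative_eq_intros\<close>)

lemma dphase''_eq:
  assumes "s > 0"
  shows "dphase'' p q a z s =
    p * (p - 1) * s powr (p - 2) + a z * q * (q - 1) * s powr (q - 2)"
proof -
  have "((\<lambda>s. p * s powr (p - 1) + a z * q * s powr (q - 1)) has_real_derivative
      p * (p - 1) * s powr (p - 2) + a z * q * (q - 1) * s powr (q - 2)) (at s)"
    using assms by (auto intro!: derivative_eq_intros)
  then have "(dphase' p q a z has_real_derivative
      p * (p - 1) * s powr (p - 2) + a z * q * (q - 1) * s powr (q - 2)) (at s)"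
    by (rule has_field_derivative_transform_within_open [where S = "{0<..}"])
      (use assms in \<open>auto simp: dphase'_eq\<close>)
  then show ?thesis
    unfolding dphase''_def by (rule DERIV_imp_deriv)
qed

section \<open>Structure conditions on the vector field\<close>

text \<open>
  \<open>D\<^sub>\<xi>A(z,\<xi>)\<close> is the Frechet derivative in the matrix variable, a linear map of matrices measured
  in the operator norm; this is bounded by its Euclidean norm and equivalent to it up to a factor
  depending only on \<open>n\<close> and \<open>N\<close>.
\<close>

definition condA1 ::
  "real \<Rightarrow> real \<Rightarrow> real \<Rightarrow> ((real^'n) \<times> real) set \<Rightarrow> ((real^'n) \<times> real \<Rightarrow> real) \<Rightarrow>
   ((real^'n) \<times> real \<Rightarrow> real^'n^'N \<Rightarrow> real^'n^'N) \<Rightarrow> bool" where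
  "condA1 p q L \<Omega>T a A \<longleftrightarrow>
     (\<forall>z\<in>\<Omega>T. \<forall>\<xi>. A z differentiable (at \<xi>) \<and>
        norm (A z \<xi>) + (1 + norm \<xi>) * onorm (frechet_derivative (A z) (at \<xi>))
          \<le> L * dphase' p q a z (1 + norm \<xi>))"

definition condA2 ::
  "real \<Rightarrow> real \<Rightarrow> real \<Rightarrow> ((real^'n) \<times> real) set \<Rightarrow> ((real^'n) \<times> real \<Rightarrow> real) \<Rightarrow>
   ((real^'n) \<times> real \<Rightarrow> real^'n^'N \<Rightarrow> real^'n^'N) \<Rightarrow> bool" where
  "condA2 p q \<nu> \<Omega>T a A \<longleftrightarrow>
     (\<forall>z\<in>\<Omega>T. \<forall>\<xi> \<eta>. frechet_derivative (A z) (at \<xi>) \<eta> \<bullet> \<eta>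
          \<ge> \<nu> * dphase'' p q a z (1 + norm \<xi>) * (norm \<eta>)\<^sup>2)"

definition condA3 ::
  "real \<Rightarrow> real \<Rightarrow> real \<Rightarrow> real \<Rightarrow> ((real^'n) \<times> real) set \<Rightarrow> ((real^'n) \<times> real \<Rightarrow> real) \<Rightarrow>
   ((real^'n) \<times> real \<Rightarrow> real^'n^'N \<Rightarrow> real^'n^'N) \<Rightarrow> bool" where
  "condA3 p q L \<beta>\<^sub>0 \<Omega>T a A \<longleftrightarrow>
     (\<forall>(x1, t1)\<in>\<Omega>T. \<forall>(x2, t2)\<in>\<Omega>T. \<forall>\<xi>.
        norm (A (x1, t1) \<xi> - A (x2, t2) \<xi>)
          \<le> L * (norm (x1 - x2) + sqrt \<bar>t1 - t2\<bar>) powr \<beta>\<^sub>0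
              * (dphase' p q a (x1, t1) (1 + norm \<xi>) + dphase' p q a (x2, t2) (1 + norm \<xi>))
            + L * \<bar>a (x1, t1) - a (x2, t2)\<bar> * (1 + norm \<xi>) powr (q - 1))"

section \<open>Test functions and function spaces\<close>

primrec Ck :: "nat \<Rightarrow> ('a::euclidean_space \<Rightarrow> 'b::real_normed_vector) \<Rightarrow> bool" where
  "Ck 0 f \<longleftrightarrow> continuous_on UNIV f"
| "Ck (Suc k) f \<longleftrightarrow>
     (\<forall>x. f differentiable (at x)) \<and> (\<forall>i\<in>Basis. Ck k (\<lambda>x. frechet_derivative f (at x) i))"

text \<open>\<open>C\<^sub>c\<^sup>\<infinity>(U)\<close>, its elements being extended by zero to the whole space.\<close>

definition test_function ::
  "'a::euclidean_space set \<Rightarrow> ('a \<Rightarrow> 'b::real_normed_vector) \<Rightarrow> bool" where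
  "test_function U \<phi> \<longleftrightarrow> (\<forall>k. Ck k \<phi>) \<and>
     compact (closure {x. \<phi> x \<noteq> 0}) \<and> closure {x. \<phi> x \<noteq> 0} \<subseteq> U"

definition time_deriv ::
  "((real^'n) \<times> real \<Rightarrow> real^'N) \<Rightarrow> (real^'n) \<times> real \<Rightarrow> real^'N" where
  "time_deriv \<zeta> z = vector_derivative (\<lambda>s. \<zeta> (fst z, s)) (at (snd z))"

definition space_grad ::
  "((real^'n) \<times> real \<Rightarrow> real^'N) \<Rightarrow> (real^'n) \<times> real \<Rightarrow> real^'n^'N" where
  "space_grad \<zeta> z = jacobian (\<lambda>y. \<zeta> (y, snd z)) (at (fst z))"

definition Lp_loc ::
  "'a::euclidean_space set \<Rightarrow> real \<Rightarrow> ('a \<Rightarrow> 'b::euclidean_space) \<Rightarrow> bool" where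
  "Lp_loc U p f \<longleftrightarrow> set_borel_measurable lebesgue U f \<and>
     (\<forall>K. compact K \<and> K \<subseteq> U \<longrightarrow> set_integrable lebesgue K (\<lambda>x. norm (f x) powr p))"

text \<open>\<open>G\<close> is the distributional gradient of \<open>v\<close> in \<open>\<Omega>\<close>.\<close>

definition weak_gradient ::
  "(real^'n) set \<Rightarrow> (real^'n \<Rightarrow> real^'N) \<Rightarrow> (real^'n \<Rightarrow> real^'n^'N) \<Rightarrow> bool" where
  "weak_gradient \<Omega> v G \<longleftrightarrow> Lp_loc \<Omega> 1 v \<and> Lp_loc \<Omega> 1 G \<and>
     (\<forall>\<phi> :: real^'n \<Rightarrow> real. test_function \<Omega> \<phi> \<longrightarrow>
        (\<forall>i j. (LINT x:\<Omega>|lebesgue. v x $ i * frechet_derivative \<phi> (at x) (axis j 1))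
               = - (LINT x:\<Omega>|lebesgue. G x $ i $ j * \<phi> x)))"

text \<open>\<open>v \<in> W\<^sup>1\<^sup>,\<^sup>p\<^sub>l\<^sub>o\<^sub>c(\<Omega>; \<real>\<^sup>N)\<close> with gradient \<open>G\<close>.\<close>

definition W1p_loc ::
  "(real^'n) set \<Rightarrow> real \<Rightarrow> (real^'n \<Rightarrow> real^'N) \<Rightarrow> (real^'n \<Rightarrow> real^'n^'N) \<Rightarrow> bool" where
  "W1p_loc \<Omega> p v G \<longleftrightarrow> Lp_loc \<Omega> p v \<and> Lp_loc \<Omega> p G \<and> weak_gradient \<Omega> v G"

text \<open>
  \<open>u \<in> L\<^sup>p\<^sub>l\<^sub>o\<^sub>c(0,T; W\<^sup>1\<^sup>,\<^sup>p\<^sub>l\<^sub>o\<^sub>c(\<Omega>; \<real>\<^sup>N))\<close> with spatial gradient \<open>Du\<close>. By Tonelli, local integrability of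
  \<open>|u|\<^sup>p + |Du|\<^sup>p\<close> on \<open>\<Omega> \<times> (0,T)\<close> says that \<open>t \<mapsto> \<parallel>u(\<cdot>,t)\<parallel>\<close> in \<open>W\<^sup>1\<^sup>,\<^sup>p(K)\<close> belongs to \<open>L\<^sup>p(t\<^sub>1,t\<^sub>2)\<close>
  for all compact \<open>K \<subseteq> \<Omega>\<close> and \<open>[t\<^sub>1,t\<^sub>2] \<subseteq> (0,T)\<close>.
\<close>

definition Lp_loc_W1p_loc ::
  "(real^'n) set \<Rightarrow> real \<Rightarrow> real \<Rightarrow> ((real^'n) \<times> real \<Rightarrow> real^'N) \<Rightarrow>
   ((real^'n) \<times> real \<Rightarrow> real^'n^'N) \<Rightarrow> bool" where
  "Lp_loc_W1p_loc \<Omega> T p u Du \<longleftrightarrow>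
     Lp_loc (\<Omega> \<times> {0<..<T}) p u \<and> Lp_loc (\<Omega> \<times> {0<..<T}) p Du \<and>
     (AE t in lebesgue. t \<in> {0<..<T} \<longrightarrow> W1p_loc \<Omega> p (\<lambda>x. u (x, t)) (\<lambda>x. Du (x, t)))"

text \<open>
  \<open>u \<in> C\<^sub>l\<^sub>o\<^sub>c(0,T; L\<^sup>2\<^sub>l\<^sub>o\<^sub>c(\<Omega>; \<real>\<^sup>N))\<close>; here \<open>u\<close> is the representative for which every time slice, not
  only almost every one, is the value of the continuous curve.
\<close>

definition C_loc_L2_loc ::
  "(real^'n) set \<Rightarrow> real \<Rightarrow> ((real^'n) \<times> real \<Rightarrow> real^'N) \<Rightarrow> bool" where
  "C_loc_L2_loc \<Omega> T u \<longleftrightarrow>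
     (\<forall>t\<in>{0<..<T}. Lp_loc \<Omega> 2 (\<lambda>x. u (x, t))) \<and>
     (\<forall>K. compact K \<and> K \<subseteq> \<Omega> \<longrightarrow>
        (\<forall>t\<in>{0<..<T}.
           ((\<lambda>s. LINT x:K|lebesgue. (norm (u (x, s) - u (x, t)))\<^sup>2) \<longlongrightarrow> 0)
             (at t within {0<..<T})))"

text \<open>\<open>u\<close>, with spatial weak gradient \<open>Du\<close>, is a weak solution of \<open>u\<^sub>t - div A(z,Du) = 0\<close> in
  \<open>\<Omega> \<times> (0,T)\<close>.\<close>

definition weak_solution ::
  "real \<Rightarrow> real \<Rightarrow> ((real^'n) \<times> real \<Rightarrow> real) \<Rightarrow> (real^'n) set \<Rightarrow> real \<Rightarrow>
   ((real^'n) \<times> real \<Rightarrow> real^'n^'N \<Rightarrow> real^'n^'N) \<Rightarrow>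
   ((real^'n) \<times> real \<Rightarrow> real^'N) \<Rightarrow> ((real^'n) \<times> real \<Rightarrow> real^'n^'N) \<Rightarrow> bool" where
  "weak_solution p q a \<Omega> T A u Du \<longleftrightarrow>
     C_loc_L2_loc \<Omega> T u \<and>
     Lp_loc_W1p_loc \<Omega> T p u Du \<and>
     Lp_loc (\<Omega> \<times> {0<..<T}) 1 (\<lambda>z. dphase p q a z (norm (Du z))) \<and>
     (\<forall>\<zeta>. test_function (\<Omega> \<times> {0<..<T}) \<zeta> \<longrightarrow>
        - (LINT z:\<Omega> \<times> {0<..<T}|lebesgue. u z \<bullet> time_deriv \<zeta> z)
        + (LINT z:\<Omega> \<times> {0<..<T}|lebesgue. A z (Du z) \<bullet> space_grad \<zeta> z) = 0)"

definition cylinder :: "real \<Rightarrow> real \<Rightarrow> (real^'n) \<times> real \<Rightarrow> ((real^'n) \<times> real) set" where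
  "cylinder r \<tau> z\<^sub>0 = ball (fst z\<^sub>0) r \<times> {snd z\<^sub>0 - \<tau><..<snd z\<^sub>0 + \<tau>}"

end

theory Submission
  imports Defs
begin

text \<open>
  The inequality is what one obtains by testing the system with \<open>\<eta> (u - \<ell>)\<close>, where \<open>\<eta>\<close> is a
  cut-off function. If the right-hand side is infinite, it holds trivially; otherwise \<open>|u - \<ell>|\<^sup>2\<close>
  and the energy of \<open>u - \<ell>\<close> are integrable on the large cylinder.

  The function \<open>\<eta> (u - \<ell>)\<close> is not admissible, and the main work is to justify the test. Write
  \<open>v = u - \<ell>\<close> and \<open>B\<close> for the flux minus a constant matrix. Testing with the translates of a
  kernel that lives on a parabolic cylinder of size \<open>\<epsilon>\<close> shows that the mollified functions satisfy
  \<open>\<partial>\<^sub>t v\<^sub>\<epsilon> = div B\<^sub>\<epsilon>\<close> classically. This equation is multiplied by \<open>\<eta> v\<^sub>\<epsilon>\<close> and integrated by parts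
  (\<open>mollified_energy_identity\<close>). To let \<open>\<epsilon>\<close> tend to \<open>0\<close> one has to dominate \<open>B\<^sub>\<epsilon> : Dv\<^sub>\<epsilon>\<close> and
  \<open>B\<^sub>\<epsilon> v\<^sub>\<epsilon>\<close>. If the coefficient \<open>a\<close> were constant, Jensen's inequality would bound the double
  phase energy of \<open>Dv\<^sub>\<epsilon>\<close> by the mollified energy of \<open>Dv\<close>, which converges in \<open>L\<^sup>1\<close>. Replacing \<open>a\<close>
  by a lower bound on the \<open>\<epsilon>\<close>-cylinder costs a multiple of \<open>\<epsilon>\<^sup>\<alpha> |Dv\<^sub>\<epsilon>|\<^sup>q\<close>. As the kernel is
  bounded by a multiple of \<open>\<epsilon>\<close> to the power \<open>-(n + 2)\<close>, so is \<open>|Dv\<^sub>\<epsilon>|\<^sup>p\<close>, and the cost is at most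
  a multiple of \<open>|Dv\<^sub>\<epsilon>|\<^sup>p\<close> because \<open>q \<le> p + p \<alpha> / (n + 2)\<close> (\<open>powr_divide_power_le\<close>,
  \<open>conv_double_phase_le\<close>). The result is \<open>energy_identity\<close>, and \<open>solution_energy_identity\<close> for the
  solution.

  The remaining estimates are pointwise. Subtract the constant \<open>A(z\<^sub>0, D\<ell>)\<close> from the flux and
  split \<open>A(z, Du) - A(z\<^sub>0, D\<ell>)\<close> into \<open>A(z, Du) - A(z, D\<ell>)\<close> and \<open>A(z, D\<ell>) - A(z\<^sub>0, D\<ell>)\<close>.
  Integrating the structure conditions along a segment bounds the first difference, from above and
  in the direction of \<open>Dv\<close> from below, by the density \<open>G\<close> of the shifted function \<open>H\<^sub>\<sigma>\<close> with
  \<open>\<sigma> = 1 + |D\<ell>|\<close> (\<open>growth_shift_flux\<close>, \<open>monotonicity_shift_flux\<close>), and \<open>s G(s)\<close> is comparable to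
  \<open>H\<^sub>\<sigma>(z, s)\<close>. The second difference is at most a multiple of \<open>C\<^sub>1 H'(z, \<sigma>)\<close>
  (\<open>frozen_coefficient_error\<close>). Two forms of Young's inequality then absorb all terms with \<open>Dv\<close>
  into the left-hand side and leave the two terms on the right (\<open>absorption_constant_exists\<close>).

  The supremum in time comes from cut-offs that decrease from \<open>1\<close> to \<open>0\<close> on \<open>(\<tau>, \<tau> + h)\<close>. They
  bound the mean of \<open>t \<mapsto> \<integral>|v(\<cdot>, t)|\<^sup>2\<close> over the middle of this interval (\<open>energy_estimate\<close>), and
  continuity of the solution in \<open>L\<^sup>2\<close> turns the limit \<open>h \<rightarrow> 0\<close> into a bound at the time \<open>\<tau>\<close>
  (\<open>slice_sup_le\<close>).
\<close>

section \<open>Smooth functions\<close>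

lemma Ck_imp_continuous: "Ck k f \<Longrightarrow> continuous_on UNIV f"
  by (cases k) (auto intro!: continuous_at_imp_continuous_on differentiable_imp_continuous_within)

lemma Ck_Suc_imp_Ck: "Ck (Suc k) f \<Longrightarrow> Ck k f"
proof (induction k arbitrary: f)
  case 0
  then show ?case using Ck_imp_continuous[of "Suc 0" f] by simp
next
  case (Suc k)
  then show ?case by simp
qed

lemma frechet_derivative_eqI: "(f has_derivative f') (at x) \<Longrightarrow> frechet_derivative f (at x) = f'"
  by (rule frechet_derivative_at[symmetric])

lemma Ck_has_derivative:
  "Ck (Suc k) f \<Longrightarrow> (f has_derivative frechet_derivative f (at x)) (at x)"
  by (simp add: frechet_derivative_works)

lemma Ck_SucI:
  assumes "\<And>x. (f has_derivative f' x) (at x)" "\<And>i. i \<in> Basis \<Longrightarrow> Ck k (\<lambda>x. f' x i)"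
  shows "Ck (Suc k) f"
  using assms by (auto simp: frechet_derivative_eqI[OF assms(1)] differentiable_def)

lemma Ck_const: "Ck k (\<lambda>x. c)"
proof (induction k arbitrary: c)
  case (Suc k)
  show ?case by (rule Ck_SucI[where f'="\<lambda>x h. 0"]) (simp_all add: Suc)
qed simp

lemma Ck_add: "Ck k f \<Longrightarrow> Ck k g \<Longrightarrow> Ck k (\<lambda>x. f x + g x)"
proof (induction k arbitrary: f g)
  case (Suc k)
  show ?case
  proof (rule Ck_SucI)
    show "((\<lambda>x. f x + g x) has_derivative
        (\<lambda>h. frechet_derivative f (at x) h + frechet_derivative g (at x) h)) (at x)" for x
      using Ck_has_derivative[OF Suc.prems(1)] Ck_has_derivative[OF Suc.prems(2)]
      by (rule has_derivative_add)
  qed (use Suc in auto)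
qed (simp add: continuous_on_add)

lemma Ck_linear_image:
  assumes "bounded_linear L"
  shows "Ck k f \<Longrightarrow> Ck k (\<lambda>x. L (f x))"
proof (induction k arbitrary: f)
  case 0
  then show ?case
    by (auto intro: continuous_on_compose2[OF linear_continuous_on[OF assms], of UNIV])
next
  case (Suc k)
  show ?case
  proof (rule Ck_SucI)
    show "((\<lambda>x. L (f x)) has_derivative (\<lambda>h. L (frechet_derivative f (at x) h))) (at x)" for x
      by (rule bounded_linear.has_derivative[OF assms Ck_has_derivative[OF Suc.prems]])
  qed (use Suc in auto)
qed

lemma Ck_sum: "(\<And>i. i \<in> S \<Longrightarrow> Ck k (f i)) \<Longrightarrow> Ck k (\<lambda>x. \<Sum>i\<in>S. f i x)"
  by (induction S rule: infinite_finite_induct) (auto intro: Ck_const Ck_add)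

lemma Ck_affine_vimage:
  fixes f :: "'b::euclidean_space \<Rightarrow> 'c::real_normed_vector" and T :: "'a::euclidean_space \<Rightarrow> 'b"
  assumes T: "bounded_linear T"
  shows "Ck k f \<Longrightarrow> Ck k (\<lambda>x. f (c + T x))"
proof (induction k arbitrary: f)
  case 0
  then show ?case
    by (auto intro!: continuous_on_compose2[of UNIV f] continuous_intros linear_continuous_on[OF T])
next
  case (Suc k)
  let ?D = "\<lambda>x. frechet_derivative f (at (c + T x))"
  show ?case
  proof (rule Ck_SucI)
    show "((\<lambda>x. f (c + T x)) has_derivative (\<lambda>h. ?D x (T h))) (at x)" for x
    proof -
      have "((\<lambda>x. c + T x) has_derivative T) (at x)"
        using bounded_linear_imp_has_derivative[OF T] by (auto intro!: derivative_eq_intros)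
      then show ?thesis
        using diff_chain_at[OF _ Ck_has_derivative[OF Suc.prems]] by (simp add: o_def)
    qed
    fix i :: 'a assume "i \<in> Basis"
    have lin: "linear (?D x)" for x
      by (rule has_derivative_linear[OF Ck_has_derivative[OF Suc.prems]])
    have "?D x (T i) = (\<Sum>b\<in>Basis. (T i \<bullet> b) *\<^sub>R ?D x b)" for x
    proof -
      have "?D x (T i) = ?D x (\<Sum>b\<in>Basis. (T i \<bullet> b) *\<^sub>R b)" by (simp add: euclidean_representation)
      also have "\<dots> = (\<Sum>b\<in>Basis. (T i \<bullet> b) *\<^sub>R ?D x b)"
        by (simp add: linear_sum[OF lin] linear_scale[OF lin])
      finally show ?thesis .
    qed
    moreover have "Ck k (\<lambda>x. \<Sum>b\<in>Basis. (T i \<bullet> b) *\<^sub>R ?D x b)"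
      by (intro Ck_sum Ck_linear_image[OF bounded_linear_scaleR_right] Suc.IH) (use Suc.prems in auto)
    ultimately show "Ck k (\<lambda>x. ?D x (T i))" by simp
  qed
qed

lemma Ck_mult:
  fixes f g :: "'a::euclidean_space \<Rightarrow> real"
  shows "Ck k f \<Longrightarrow> Ck k g \<Longrightarrow> Ck k (\<lambda>x. f x * g x)"
proof (induction k arbitrary: f g)
  case (Suc k)
  show ?case
  proof (rule Ck_SucI)
    show "((\<lambda>x. f x * g x) has_derivative
        (\<lambda>h. f x * frechet_derivative g (at x) h + frechet_derivative f (at x) h * g x)) (at x)" for x
      using Ck_has_derivative[OF Suc.prems(1)] Ck_has_derivative[OF Suc.prems(2)]
      by (rule has_derivative_mult)
    show "Ck k (\<lambda>x. f x * frechet_derivative g (at x) i + frechet_derivative f (at x) i * g x)"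
      if "i \<in> Basis" for i
      using Suc.prems that Ck_Suc_imp_Ck[OF Suc.prems(1)] Ck_Suc_imp_Ck[OF Suc.prems(2)]
      by (intro Ck_add Suc.IH) simp_all
  qed
qed (simp add: continuous_on_mult)

section \<open>A smooth bump\<close>

text \<open>The functions \<open>p(1/t) exp (-1/t)\<close> on the positive half-line are closed under differentiation, the
  polynomial factor absorbing the inner derivative; all of them vanish at \<open>0\<close> to infinite order.\<close>

definition flat_exp :: "real poly \<Rightarrow> real \<Rightarrow> real" where
  "flat_exp p t = (if t > 0 then poly p (1 / t) * exp (- (1 / t)) else 0)"

lemma flat_exp_tendsto_0: "(flat_exp p \<longlongrightarrow> 0) (at 0)"
proof -
  have "((\<lambda>x. \<Sum>i\<le>degree p. coeff p i * (x ^ i / exp x)) \<longlongrightarrow> (\<Sum>i\<le>degree p. coeff p i * 0)) at_top"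
    by (intro tendsto_intros tendsto_power_div_exp_0)
  then have "((\<lambda>x. poly p x * exp (- x)) \<longlongrightarrow> 0) at_top"
    by (simp add: poly_altdef sum_distrib_right sum_divide_distrib exp_minus field_simps)
  then have "((\<lambda>t. poly p (1 / t) * exp (- (1 / t))) \<longlongrightarrow> 0) (at_right 0)"
    by (rule filterlim_compose) (simp add: filterlim_inverse_at_top_right flip: inverse_eq_divide)
  then have "(flat_exp p \<longlongrightarrow> 0) (at_right 0)"
    by (rule Lim_transform_eventually)
      (auto simp: flat_exp_def eventually_at_right[of 0 1] intro!: exI[of _ 1])
  moreover have "(flat_exp p \<longlongrightarrow> 0) (at_left 0)"
    by (rule Lim_transform_eventually[of "\<lambda>_. 0"])
      (auto simp: flat_exp_def eventually_at_left[of "-1" 0] intro!: exI[of _ "-1"])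
  ultimately show ?thesis by (simp add: filterlim_at_split)
qed

lemma flat_exp_derivative:
  "(flat_exp p has_real_derivative flat_exp ([:0, 0, 1:] * (p - pderiv p)) t) (at t)"
proof -
  consider "t > 0" | "t < 0" | "t = 0" by linarith
  then show ?thesis
  proof cases
    case 1
    have "((\<lambda>t. poly p (1 / t) * exp (- (1 / t))) has_real_derivative
        flat_exp ([:0, 0, 1:] * (p - pderiv p)) t) (at t)"
      using 1 by (auto intro!: derivative_eq_intros poly_DERIV[THEN DERIV_chain2]
          simp: flat_exp_def field_simps power2_eq_square)
    then show ?thesis
      by (rule has_field_derivative_transform_within_open[where S="{0<..}"])
        (use 1 in \<open>auto simp: flat_exp_def\<close>)
  next
    case 2
    have "((\<lambda>t. 0) has_real_derivative flat_exp ([:0, 0, 1:] * (p - pderiv p)) t) (at t)"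
      using 2 by (simp add: flat_exp_def)
    then show ?thesis
      by (rule has_field_derivative_transform_within_open[where S="{..<0}"])
        (use 2 in \<open>auto simp: flat_exp_def\<close>)
  next
    case 3
    have "flat_exp p h / h = flat_exp ([:0, 1:] * p) h" for h
      by (simp add: flat_exp_def)
    then show ?thesis
      using flat_exp_tendsto_0[of "[:0, 1:] * p"] 3 unfolding DERIV_def
      by (simp add: flat_exp_def[of _ 0])
  qed
qed

text \<open>This algebra is closed under partial derivatives, so that smoothness of its members follows by
  induction on the order, without formulas for higher derivatives.\<close>

inductive bump_algebra :: "('a::euclidean_space \<Rightarrow> real) \<Rightarrow> bool" where
  "bump_algebra (\<lambda>z. flat_exp p (1 - z \<bullet> z))"
| "bump_algebra (\<lambda>z. z \<bullet> b)"
| "bump_algebra (\<lambda>z. c)"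
| "bump_algebra f \<Longrightarrow> bump_algebra g \<Longrightarrow> bump_algebra (\<lambda>z. f z + g z)"
| "bump_algebra f \<Longrightarrow> bump_algebra g \<Longrightarrow> bump_algebra (\<lambda>z. f z * g z)"

lemma bump_algebra_derivative:
  "bump_algebra f \<Longrightarrow> \<exists>f'. (\<forall>x. (f has_derivative f' x) (at x)) \<and> (\<forall>i. bump_algebra (\<lambda>x. f' x i))"
proof (induction rule: bump_algebra.induct)
  case (1 p)
  let ?q = "[:0, 0, 1:] * (p - pderiv p)"
  have "((\<lambda>z. flat_exp p (1 - z \<bullet> z)) has_derivative
      (\<lambda>h. flat_exp ?q (1 - x \<bullet> x) * ((-2) * (x \<bullet> h)))) (at x)" for x :: 'a
  proof -
    have "((\<lambda>z. 1 - z \<bullet> z) has_derivative (\<lambda>h. (-2) * (x \<bullet> h))) (at x)"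
      by (auto intro!: derivative_eq_intros simp: inner_commute)
    from diff_chain_at[OF this flat_exp_derivative[unfolded has_field_derivative_def]]
    show ?thesis by (simp add: o_def)
  qed
  then show ?case
    by (intro exI[of _ "\<lambda>x h. flat_exp ?q (1 - x \<bullet> x) * ((-2) * (x \<bullet> h))"] conjI allI
        bump_algebra.intros(5)[OF bump_algebra.intros(1)
          bump_algebra.intros(5)[OF bump_algebra.intros(3) bump_algebra.intros(2)]])
next
  case (2 b)
  have "((\<lambda>z. z \<bullet> b) has_derivative (\<lambda>h. h \<bullet> b)) (at x)" for x
    by (auto intro!: derivative_eq_intros)
  then show ?case by (intro exI[of _ "\<lambda>x h. h \<bullet> b"]) (auto intro: bump_algebra.intros)
next
  case (3 c)
  then show ?case by (intro exI[of _ "\<lambda>x h. 0"]) (auto intro: bump_algebra.intros)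
next
  case (4 f g)
  then obtain f' g' where "\<And>x. (f has_derivative f' x) (at x)" "\<And>i. bump_algebra (\<lambda>x. f' x i)"
    "\<And>x. (g has_derivative g' x) (at x)" "\<And>i. bump_algebra (\<lambda>x. g' x i)" by blast
  then show ?case
    by (intro exI[of _ "\<lambda>x h. f' x h + g' x h"]) (auto intro!: bump_algebra.intros has_derivative_add)
next
  case (5 f g)
  then obtain f' g' where "\<And>x. (f has_derivative f' x) (at x)" "\<And>i. bump_algebra (\<lambda>x. f' x i)"
    "\<And>x. (g has_derivative g' x) (at x)" "\<And>i. bump_algebra (\<lambda>x. g' x i)" by blast
  with 5 show ?case
    by (intro exI[of _ "\<lambda>x h. f x * g' x h + f' x h * g x"])
      (auto intro!: bump_algebra.intros has_derivative_mult)
qed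

lemma bump_algebra_Ck: "bump_algebra f \<Longrightarrow> Ck k f"
proof (induction k arbitrary: f)
  case 0
  obtain f' where "\<And>x. (f has_derivative f' x) (at x)"
    using bump_algebra_derivative[OF 0] by blast
  then show ?case
    by (auto intro!: continuous_at_imp_continuous_on has_derivative_continuous)
next
  case (Suc k)
  then show ?case using bump_algebra_derivative[OF Suc.prems] by (metis Ck_SucI)
qed

section \<open>Compactly supported functions\<close>

lemma integrable_continuous_bounded_support:
  fixes f :: "'a::euclidean_space \<Rightarrow> real"
  assumes "continuous_on UNIV f" "\<And>x. norm x > R \<Longrightarrow> f x = 0"
  shows "integrable lebesgue f"
proof -
  have "integrable lborel (\<lambda>x. indicator (cball 0 R) x *\<^sub>R f x)"
    by (rule borel_integrable_compact) (auto intro: continuous_on_subset[OF assms(1)])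
  moreover have "(\<lambda>x. indicator (cball 0 R) x *\<^sub>R f x) = f"
    using assms(2) by (auto simp: indicator_def not_le intro!: ext)
  ultimately show ?thesis
    by (metis integrable_completion borel_measurable_integrable)
qed

lemma bounded_support_uniformly_continuous:
  fixes g :: "'a::euclidean_space \<Rightarrow> real"
  assumes "continuous_on UNIV g" "\<And>x. norm x > R \<Longrightarrow> g x = 0" "e > 0"
  shows "\<exists>d>0. \<forall>x h. norm h < d \<longrightarrow> \<bar>g (x + h) - g x\<bar> < e"
proof -
  have "uniformly_continuous_on (cball 0 (R + 1)) g"
    by (rule compact_uniformly_continuous) (auto intro: continuous_on_subset[OF assms(1)])
  then obtain d where d: "d > 0"
    "\<And>x y. norm x \<le> R + 1 \<Longrightarrow> norm y \<le> R + 1 \<Longrightarrow> dist y x < d \<Longrightarrow> dist (g y) (g x) < e"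
    using \<open>e > 0\<close> unfolding uniformly_continuous_on_def by (metis mem_cball_0)
  have "\<bar>g (x + h) - g x\<bar> < e" if "norm h < min d 1" for x h
  proof (cases "norm x \<le> R + 1 \<and> norm (x + h) \<le> R + 1")
    case True
    then show ?thesis using d(2)[of x "x + h"] that by (simp add: dist_norm)
  next
    case False
    then have "norm x > R" "norm (x + h) > R"
      using that norm_triangle_ineq[of x h] norm_triangle_ineq4[of "x + h" h] by auto
    then show ?thesis using assms by simp
  qed
  then show ?thesis using d(1) by (intro exI[of _ "min d 1"]) auto
qed

lemma frechet_derivative_zero_outside:
  assumes "\<And>x. norm x > R \<Longrightarrow> f x = (0::real)" "norm x > R"
  shows "frechet_derivative f (at x) h = 0"
proof -
  have "open {x::'a. norm x > R}" by (intro open_Collect_less continuous_intros)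
  then have "(f has_derivative (\<lambda>h. 0)) (at x)"
    using assms
    by (intro has_derivative_transform_within_open[of "\<lambda>x. 0" "\<lambda>h. 0" x UNIV "{x. norm x > R}" f])
      auto
  then show ?thesis by (simp add: frechet_derivative_eqI)
qed

lemma C1_frechet_basis:
  fixes f :: "'a::euclidean_space \<Rightarrow> real"
  assumes "Ck (Suc 0) f"
  shows "frechet_derivative f (at x) h = (\<Sum>i\<in>Basis. (h \<bullet> i) * frechet_derivative f (at x) i)"
proof -
  have lin: "linear (frechet_derivative f (at x))"
    by (rule has_derivative_linear[OF Ck_has_derivative[OF assms]])
  have "frechet_derivative f (at x) h = frechet_derivative f (at x) (\<Sum>i\<in>Basis. (h \<bullet> i) *\<^sub>R i)"
    by (simp add: euclidean_representation)
  then show ?thesis by (simp add: linear_sum[OF lin] linear_scale[OF lin])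
qed

text \<open>Uniformity in the base point makes differentiation under a convolution with a merely integrable
  function possible.\<close>

lemma C1_uniformly_differentiable:
  fixes f :: "'a::euclidean_space \<Rightarrow> real"
  assumes C: "Ck (Suc 0) f" and R: "\<And>x. norm x > R \<Longrightarrow> f x = 0" and "e > 0"
  shows "\<exists>d>0. \<forall>x h. norm h < d \<longrightarrow>
    \<bar>f (x + h) - f x - frechet_derivative f (at x) h\<bar> \<le> e * norm h"
proof -
  define e' where "e' = e / DIM('a)"
  have "e' > 0" using \<open>e > 0\<close> by (simp add: e'_def)
  have "\<forall>i\<in>Basis. \<exists>d>0. \<forall>x h. norm h < d \<longrightarrow>
      \<bar>frechet_derivative f (at (x + h)) i - frechet_derivative f (at x) i\<bar> < e'"
    using C
    by (intro ballI bounded_support_uniformly_continuous[where R=R] \<open>e' > 0\<close>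
        frechet_derivative_zero_outside[where R=R] R) simp_all
  then obtain d where d: "\<And>i. i \<in> Basis \<Longrightarrow> d i > 0"
    "\<And>i x h. i \<in> Basis \<Longrightarrow> norm h < d i \<Longrightarrow>
      \<bar>frechet_derivative f (at (x + h)) i - frechet_derivative f (at x) i\<bar> < e'"
    by metis
  define \<delta> where "\<delta> = Min (d ` (Basis::'a set))"
  have "\<delta> > 0" using d(1) by (auto simp: \<delta>_def)
  have \<delta>: "\<delta> \<le> d i" if "i \<in> Basis" for i using that by (auto simp: \<delta>_def)
  have "\<bar>f (x + h) - f x - frechet_derivative f (at x) h\<bar> \<le> e * norm h" if h: "norm h < \<delta>" for x h
  proof -
    have "norm (f (x + h) - f x - frechet_derivative f (at x) ((x + h) - x)) \<le> norm ((x + h) - x) * e"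
    proof (rule differentiable_bound_linearization[where S="ball x \<delta>" and f'="\<lambda>x. frechet_derivative f (at x)"])
      show "x + t *\<^sub>R (x + h - x) \<in> ball x \<delta>" if "t \<in> {0..1}" for t
      proof -
        have "\<bar>t\<bar> * norm h \<le> 1 * norm h" using that by (intro mult_right_mono) auto
        then show ?thesis using h by (simp add: dist_norm)
      qed
      show "(f has_derivative frechet_derivative f (at y)) (at y within ball x \<delta>)" for y
        by (rule has_derivative_at_withinI[OF Ck_has_derivative[OF C]])
      show "x \<in> ball x \<delta>" using \<open>\<delta> > 0\<close> by simp
      fix y assume y: "y \<in> ball x \<delta>"
      show "onorm (frechet_derivative f (at y) - frechet_derivative f (at x)) \<le> e"
      proof (rule onorm_le)
        fix k
        have "\<bar>frechet_derivative f (at y) i - frechet_derivative f (at x) i\<bar> \<le> e'" if "i \<in> Basis" for i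
          using d(2)[OF that, of "y - x" x] \<delta>[OF that] y by (auto simp: dist_norm norm_minus_commute)
        then have "\<bar>\<Sum>i\<in>Basis. (k \<bullet> i) * (frechet_derivative f (at y) i - frechet_derivative f (at x) i)\<bar>
            \<le> (\<Sum>i\<in>(Basis::'a set). norm k * e')"
          by (intro order_trans[OF sum_abs] sum_mono) (auto simp: abs_mult intro!: mult_mono Basis_le_norm)
        also have "\<dots> = e * norm k" by (simp add: e'_def)
        finally show "norm ((frechet_derivative f (at y) - frechet_derivative f (at x)) k) \<le> e * norm k"
          by (simp add: C1_frechet_basis[OF C, of _ k] right_diff_distrib sum_subtractf)
      qed
    qed
    then show ?thesis by (simp add: mult.commute)
  qed
  with \<open>\<delta> > 0\<close> show ?thesis by blast
qed

lemma continuous_bounded_support_bounded: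
  fixes g :: "'a::euclidean_space \<Rightarrow> real"
  assumes "continuous_on UNIV g" "\<And>x. norm x > R \<Longrightarrow> g x = 0"
  shows "\<exists>M\<ge>0. \<forall>x. \<bar>g x\<bar> \<le> M"
proof -
  have "bounded (g ` cball 0 R)"
    by (intro compact_imp_bounded compact_continuous_image continuous_on_subset[OF assms(1)]) auto
  then obtain M where "M > 0" "\<And>x. x \<in> cball 0 R \<Longrightarrow> \<bar>g x\<bar> \<le> M"
    unfolding bounded_pos by auto
  then have "\<bar>g x\<bar> \<le> M" for x
    using assms(2)[of x] by (cases "norm x \<le> R") auto
  then show ?thesis using \<open>M > 0\<close> by (intro exI[of _ M]) auto
qed

section \<open>Convolution\<close>

definition conv :: "('a::euclidean_space \<Rightarrow> real) \<Rightarrow> ('a \<Rightarrow> real) \<Rightarrow> 'a \<Rightarrow> real" where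
  "conv \<phi> f z = (LINT y|lebesgue. \<phi> (z - y) * f y)"

lemma conv_integrable:
  fixes \<phi> :: "'a::euclidean_space \<Rightarrow> real"
  assumes "continuous_on UNIV \<phi>" "\<And>x. norm x > R \<Longrightarrow> \<phi> x = 0" "integrable lebesgue f"
  shows "integrable lebesgue (\<lambda>y. \<phi> (z - y) * f y)"
proof -
  obtain M where M: "\<And>x. \<bar>\<phi> x\<bar> \<le> M" using continuous_bounded_support_bounded[OF assms(1,2)] by blast
  have "continuous_on UNIV (\<lambda>y. \<phi> (z - y))"
    by (intro continuous_on_compose2[OF assms(1)] continuous_intros) auto
  then have "(\<lambda>y. \<phi> (z - y)) \<in> borel_measurable lebesgue"
    by (intro measurable_completion) (simp add: borel_measurable_continuous_onI)
  then have meas: "(\<lambda>y. \<phi> (z - y) * f y) \<in> borel_measurable lebesgue"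
    by (intro borel_measurable_times borel_measurable_integrable[OF assms(3)])
  have "norm (\<phi> (z - y) * f y) \<le> norm (M * f y)" for y
  proof -
    have "\<bar>\<phi> (z - y)\<bar> \<le> \<bar>M\<bar>" using M[of "z - y"] by linarith
    then show ?thesis by (simp add: abs_mult mult_right_mono)
  qed
  then show ?thesis
    by (intro Bochner_Integration.integrable_bound[OF integrable_mult_right[OF assms(3), of M] meas]) simp
qed

lemma conv_linear_sum:
  fixes \<phi> :: "'i \<Rightarrow> 'a::euclidean_space \<Rightarrow> real"
  assumes "\<And>i. i \<in> I \<Longrightarrow> continuous_on UNIV (\<phi> i)" "\<And>i x. i \<in> I \<Longrightarrow> norm x > R \<Longrightarrow> \<phi> i x = 0"
    "integrable lebesgue f"
  shows "conv (\<lambda>x. \<Sum>i\<in>I. c i * \<phi> i x) f z = (\<Sum>i\<in>I. c i * conv (\<phi> i) f z)"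
proof -
  have "integrable lebesgue (\<lambda>y. \<phi> i (z - y) * f y)" if "i \<in> I" for i
    by (rule conv_integrable[where R=R]) (use assms that in auto)
  then show ?thesis
    unfolding conv_def by (simp add: sum_distrib_right mult.assoc)
qed

lemma conv_continuous:
  fixes \<phi> :: "'a::euclidean_space \<Rightarrow> real"
  assumes "continuous_on UNIV \<phi>" "\<And>x. norm x > R \<Longrightarrow> \<phi> x = 0" "integrable lebesgue f"
  shows "continuous_on UNIV (conv \<phi> f)"
proof (rule continuous_at_imp_continuous_on, rule ballI)
  fix z
  note int = conv_integrable[OF assms]
  define I where "I = (LINT y|lebesgue. \<bar>f y\<bar>)"
  have "I \<ge> 0" by (simp add: I_def)
  show "isCont (conv \<phi> f) z"
    unfolding isCont_def LIM_def
  proof (intro allI impI)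
    fix e :: real assume "e > 0"
    define e' where "e' = e / (I + 1)"
    have "e' > 0" using \<open>e > 0\<close> \<open>I \<ge> 0\<close> by (simp add: e'_def)
    then obtain d where d: "d > 0" "\<And>x h. norm h < d \<Longrightarrow> \<bar>\<phi> (x + h) - \<phi> x\<bar> < e'"
      using bounded_support_uniformly_continuous[OF assms(1,2)] by metis
    have "dist (conv \<phi> f x) (conv \<phi> f z) < e" if "dist x z < d" for x
    proof -
      have "\<bar>conv \<phi> f x - conv \<phi> f z\<bar> = \<bar>LINT y|lebesgue. \<phi> (x - y) * f y - \<phi> (z - y) * f y\<bar>"
        unfolding conv_def by (simp add: int)
      also have "\<dots> \<le> (LINT y|lebesgue. \<bar>\<phi> (x - y) * f y - \<phi> (z - y) * f y\<bar>)"
        by (rule integral_abs_bound)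
      also have "\<dots> \<le> (LINT y|lebesgue. e' * \<bar>f y\<bar>)"
      proof (rule integral_mono)
        show "\<bar>\<phi> (x - y) * f y - \<phi> (z - y) * f y\<bar> \<le> e' * \<bar>f y\<bar>" for y
        proof -
          have "\<bar>\<phi> (x - y) - \<phi> (z - y)\<bar> \<le> e'"
            using d(2)[of "x - z" "z - y"] that by (auto simp: dist_norm algebra_simps)
          then show ?thesis by (simp add: abs_mult mult_right_mono flip: left_diff_distrib)
        qed
      qed (use int assms(3) in auto)
      also have "\<dots> = e' * I" by (simp add: I_def)
      also have "\<dots> < e" using \<open>e > 0\<close> \<open>I \<ge> 0\<close> by (simp add: e'_def field_simps)
      finally show ?thesis by (simp add: dist_norm)
    qed
    with \<open>d > 0\<close> show "\<exists>s>0. \<forall>x. x \<noteq> z \<and> dist x z < s \<longrightarrow> dist (conv \<phi> f x) (conv \<phi> f z) < e" by blast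
  qed
qed

text \<open>The error of the linear approximation of the kernel is at most \<open>e |h|\<close> at every point, hence that
  of the convolution at most \<open>e |h|\<close> times the \<open>L\<^sup>1\<close> norm of \<open>f\<close>.\<close>

lemma conv_has_derivative:
  fixes \<phi> :: "'a::euclidean_space \<Rightarrow> real"
  assumes C: "Ck (Suc 0) \<phi>" and R: "\<And>x. norm x > R \<Longrightarrow> \<phi> x = 0" and f: "integrable lebesgue f"
  shows "(conv \<phi> f has_derivative (\<lambda>h. conv (\<lambda>x. frechet_derivative \<phi> (at x) h) f z)) (at z)"
proof -
  let ?D = "\<lambda>h x. frechet_derivative \<phi> (at x) h"
  have cont: "continuous_on UNIV (?D i)" if "i \<in> Basis" for i using C that by simp
  have D_sum: "?D h = (\<lambda>x. \<Sum>i\<in>Basis. (h \<bullet> i) * ?D i x)" for h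
    by (rule ext) (rule C1_frechet_basis[OF C])
  have cont': "continuous_on UNIV (?D h)" for h
    by (subst D_sum) (intro continuous_intros cont)
  have D0: "norm x > R \<Longrightarrow> ?D h x = 0" for h x
    by (rule frechet_derivative_zero_outside[where R=R]) (use R in auto)
  have D_eq: "(\<lambda>h. conv (?D h) f z) = (\<lambda>h. \<Sum>i\<in>Basis. (h \<bullet> i) * conv (?D i) f z)"
  proof
    fix h show "conv (?D h) f z = (\<Sum>i\<in>Basis. (h \<bullet> i) * conv (?D i) f z)"
      by (subst D_sum, rule conv_linear_sum[where R=R]) (use cont D0 f in auto)
  qed
  have bl: "bounded_linear (\<lambda>h. conv (?D h) f z)"
    unfolding D_eq
    by (intro bounded_linear_sum bounded_linear_mult_const bounded_linear_inner_left)
  note int = conv_integrable[OF Ck_imp_continuous[OF C] R f]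
  define I where "I = (LINT y|lebesgue. \<bar>f y\<bar>)"
  have "I \<ge> 0" by (simp add: I_def)
  show ?thesis
    unfolding has_derivative_at_alt
  proof (intro conjI bl allI impI)
    fix e :: real assume "e > 0"
    define e' where "e' = e / (I + 1)"
    have "e' > 0" using \<open>e > 0\<close> \<open>I \<ge> 0\<close> by (simp add: e'_def)
    then obtain d where d: "d > 0" "\<And>x h. norm h < d \<Longrightarrow> \<bar>\<phi> (x + h) - \<phi> x - ?D h x\<bar> \<le> e' * norm h"
      using C1_uniformly_differentiable[OF C R] by metis
    have "norm (conv \<phi> f y - conv \<phi> f z - conv (?D (y - z)) f z) \<le> e * norm (y - z)"
      if y: "norm (y - z) < d" for y
    proof -
      note intD = conv_integrable[OF cont'[of "y - z"] D0 f, where z=z]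
      have "\<bar>conv \<phi> f y - conv \<phi> f z - conv (?D (y - z)) f z\<bar>
        = \<bar>LINT w|lebesgue. \<phi> (y - w) * f w - \<phi> (z - w) * f w - ?D (y - z) (z - w) * f w\<bar>"
        unfolding conv_def using intD by (simp add: int)
      also have "\<dots> \<le> (LINT w|lebesgue. \<bar>\<phi> (y - w) * f w - \<phi> (z - w) * f w - ?D (y - z) (z - w) * f w\<bar>)"
        by (rule integral_abs_bound)
      also have "\<dots> \<le> (LINT w|lebesgue. (e' * norm (y - z)) * \<bar>f w\<bar>)"
      proof (rule integral_mono)
        show "\<bar>\<phi> (y - w) * f w - \<phi> (z - w) * f w - ?D (y - z) (z - w) * f w\<bar> \<le> (e' * norm (y - z)) * \<bar>f w\<bar>" for w
          using d(2)[OF y, of "z - w"]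
          by (simp add: abs_mult mult_right_mono flip: left_diff_distrib)
      qed (use int intD f in auto)
      also have "\<dots> = e' * I * norm (y - z)" by (simp add: I_def)
      also have "\<dots> \<le> e * norm (y - z)"
        using \<open>e > 0\<close> \<open>I \<ge> 0\<close> by (intro mult_right_mono) (auto simp: e'_def field_simps)
      finally show ?thesis by simp
    qed
    with \<open>d > 0\<close> show "\<exists>d>0. \<forall>y. norm (y - z) < d \<longrightarrow>
        norm (conv \<phi> f y - conv \<phi> f z - conv (?D (y - z)) f z) \<le> e * norm (y - z)" by blast
  qed
qed

lemma conv_C1:
  assumes C: "Ck (Suc 0) \<phi>" and R: "\<And>x. norm x > R \<Longrightarrow> \<phi> x = 0" and f: "integrable lebesgue f"
  shows "Ck (Suc 0) (conv \<phi> f)"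
    and "frechet_derivative (conv \<phi> f) (at z) h = conv (\<lambda>x. frechet_derivative \<phi> (at x) h) f z"
proof -
  show "Ck (Suc 0) (conv \<phi> f)"
  proof (rule Ck_SucI[OF conv_has_derivative[OF C R f]])
    fix i :: 'a assume "i \<in> Basis"
    then show "Ck 0 (\<lambda>x. conv (\<lambda>x. frechet_derivative \<phi> (at x) i) f x)"
      unfolding Ck.simps
      by (intro conv_continuous[where R=R] frechet_derivative_zero_outside[where R=R] f)
        (use C R in auto)
  qed
  show "frechet_derivative (conv \<phi> f) (at z) h = conv (\<lambda>x. frechet_derivative \<phi> (at x) h) f z"
    by (simp add: frechet_derivative_eqI[OF conv_has_derivative[OF C R f]])
qed

section \<open>Translations and reflections\<close>

lemma lebesgue_distr_plus: "distr lebesgue lebesgue (\<lambda>x. t + x :: 'a::euclidean_space) = lebesgue"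
  and measurable_lebesgue_plus: "(\<lambda>x. t + x :: 'a) \<in> lebesgue \<rightarrow>\<^sub>M lebesgue"
proof -
  have T: "(\<lambda>x. t + (\<Sum>j\<in>Basis. (1 * (x \<bullet> j)) *\<^sub>R j)) = (\<lambda>x. t + x)"
    by (simp add: euclidean_representation)
  show "distr lebesgue lebesgue (\<lambda>x. t + x) = lebesgue"
    using lebesgue_affine_euclidean[where c="\<lambda>_::'a. 1" and t=t] unfolding T
    by (simp add: density_1)
  show "(\<lambda>x. t + x) \<in> lebesgue \<rightarrow>\<^sub>M lebesgue"
    using lebesgue_affine_measurable[where c="\<lambda>_::'a. 1" and t=t] unfolding T by simp
qed

lemma lebesgue_distr_minus: "distr lebesgue lebesgue (\<lambda>x. t - x :: 'a::euclidean_space) = lebesgue"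
  and measurable_lebesgue_minus: "(\<lambda>x. t - x :: 'a) \<in> lebesgue \<rightarrow>\<^sub>M lebesgue"
proof -
  have T: "(\<lambda>x. t + (\<Sum>j\<in>Basis. ((-1) * (x \<bullet> j)) *\<^sub>R j)) = (\<lambda>x. t - x)"
    by (simp add: sum_negf euclidean_representation)
  show "distr lebesgue lebesgue (\<lambda>x. t - x) = lebesgue"
    using lebesgue_affine_euclidean[where c="\<lambda>_::'a. -1" and t=t] unfolding T
    by (simp add: density_1)
  show "(\<lambda>x. t - x) \<in> lebesgue \<rightarrow>\<^sub>M lebesgue"
    using lebesgue_affine_measurable[where c="\<lambda>_::'a. -1" and t=t] unfolding T by simp
qed

lemma
  fixes f :: "'a::euclidean_space \<Rightarrow> real"
  assumes "integrable lebesgue f"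
  shows integrable_translate: "integrable lebesgue (\<lambda>x. f (x + t))"
    and integral_translate: "(LINT x|lebesgue. f (x + t)) = (LINT x|lebesgue. f x)"
proof -
  have "integrable (distr lebesgue lebesgue (\<lambda>x. t + x)) f"
    by (simp add: lebesgue_distr_plus assms)
  then show "integrable lebesgue (\<lambda>x. f (x + t))"
    by (subst add.commute) (rule integrable_distr[OF measurable_lebesgue_plus])
  have "(LINT x|distr lebesgue lebesgue (\<lambda>x. t + x). f x) = (LINT x|lebesgue. f (t + x))"
    by (rule integral_distr[OF measurable_lebesgue_plus]) (simp add: assms borel_measurable_integrable)
  then show "(LINT x|lebesgue. f (x + t)) = (LINT x|lebesgue. f x)"
    unfolding lebesgue_distr_plus by (simp only: add.commute)
qed

lemma
  fixes f :: "'a::euclidean_space \<Rightarrow> real"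
  assumes "integrable lebesgue f"
  shows integrable_reflect_point: "integrable lebesgue (\<lambda>x. f (t - x))"
    and integral_reflect_point: "(LINT x|lebesgue. f (t - x)) = (LINT x|lebesgue. f x)"
proof -
  have "integrable (distr lebesgue lebesgue (\<lambda>x. t - x)) f"
    by (simp add: lebesgue_distr_minus assms)
  then show "integrable lebesgue (\<lambda>x. f (t - x))"
    by (rule integrable_distr[OF measurable_lebesgue_minus])
  have "(LINT x|distr lebesgue lebesgue (\<lambda>x. t - x). f x) = (LINT x|lebesgue. f (t - x))"
    by (rule integral_distr[OF measurable_lebesgue_minus]) (simp add: assms borel_measurable_integrable)
  then show "(LINT x|lebesgue. f (t - x)) = (LINT x|lebesgue. f x)"
    by (simp add: lebesgue_distr_minus)
qed

text \<open>By translation invariance difference quotients have integral zero, and they converge to the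
  derivative uniformly and inside a fixed ball.\<close>

lemma integral_frechet_derivative_zero:
  fixes f :: "'a::euclidean_space \<Rightarrow> real"
  assumes C: "Ck (Suc 0) f" and R: "\<And>x. norm x > R \<Longrightarrow> f x = 0" and b: "b \<in> Basis"
  shows "integrable lebesgue (\<lambda>x. frechet_derivative f (at x) b)"
    and "(LINT x|lebesgue. frechet_derivative f (at x) b) = 0"
proof -
  let ?D = "\<lambda>x. frechet_derivative f (at x) b"
  have D0: "?D x = 0" if "norm x > R" for x
    by (rule frechet_derivative_zero_outside[where R=R]) (use that R in auto)
  show iD: "integrable lebesgue ?D"
    by (rule integrable_continuous_bounded_support[where R=R]) (use C b D0 in auto)
  have if': "integrable lebesgue f"
    by (rule integrable_continuous_bounded_support[where R=R, OF Ck_imp_continuous[OF C] R])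
  define B :: "'a set" where "B = cball 0 (R + 1)"
  have iB: "integrable lebesgue (indicator B :: 'a \<Rightarrow> real)"
    using emeasure_lborel_cball_finite[of 0 "R + 1"] by (simp add: B_def integrable_indicator_iff less_top)
  define m where "m = measure lebesgue B"
  have "m \<ge> 0" by (simp add: m_def)
  have "\<bar>LINT x|lebesgue. ?D x\<bar> \<le> e * m" if e: "e > 0" for e
  proof -
    obtain d where d: "d > 0" "\<And>x h. norm h < d \<Longrightarrow>
        \<bar>f (x + h) - f x - frechet_derivative f (at x) h\<bar> \<le> e * norm h"
      using C1_uniformly_differentiable[OF C R e] by metis
    define t where "t = min 1 (d / 2)"
    have t: "t > 0" "t \<le> 1" "t < d" using d(1) by (auto simp: t_def min_def)
    have nb: "norm b = 1" using b by simp
    have lin: "frechet_derivative f (at x) (t *\<^sub>R b) = t * ?D x" for x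
      using linear_scale[OF has_derivative_linear[OF Ck_has_derivative[OF C]]] by simp
    \<comment> \<open>Steps have length at most \<open>1\<close>, so that everything happens in the ball of radius \<open>R + 1\<close>.\<close>
    have pt: "\<bar>f (x + t *\<^sub>R b) - f x - t * ?D x\<bar> \<le> e * t * indicator B x" for x
    proof (cases "x \<in> B")
      case True
      then show ?thesis using d(2)[of "t *\<^sub>R b" x] t nb by (simp add: lin)
    next
      case False
      then have x: "norm x > R + 1" by (simp add: B_def)
      have "norm x \<le> norm (x + t *\<^sub>R b) + norm (t *\<^sub>R b)"
        using norm_triangle_ineq4[of "x + t *\<^sub>R b" "t *\<^sub>R b"] by simp
      then have "norm (x + t *\<^sub>R b) > R" using x t nb by simp
      then show ?thesis using R D0[of x] x False by simp
    qed
    have "(LINT x|lebesgue. f (x + t *\<^sub>R b) - f x - t * ?D x) = - (t * (LINT x|lebesgue. ?D x))"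
      using integrable_translate[OF if'] if' iD by (simp add: integral_translate[OF if'])
    then have "t * \<bar>LINT x|lebesgue. ?D x\<bar> = \<bar>LINT x|lebesgue. f (x + t *\<^sub>R b) - f x - t * ?D x\<bar>"
      using t by (simp add: abs_mult)
    also have "\<dots> \<le> (LINT x|lebesgue. \<bar>f (x + t *\<^sub>R b) - f x - t * ?D x\<bar>)"
      by (rule integral_abs_bound)
    also have "\<dots> \<le> (LINT x|lebesgue. e * t * indicator B x)"
      by (rule integral_mono) (use integrable_translate[OF if'] if' iD iB pt in auto)
    also have "\<dots> = t * (e * m)"
      by (simp add: m_def B_def)
    finally show ?thesis using t by simp
  qed
  note bound = this
  show "(LINT x|lebesgue. ?D x) = 0"
  proof (rule ccontr)
    assume "(LINT x|lebesgue. ?D x) \<noteq> 0"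
    then have "\<bar>LINT x|lebesgue. ?D x\<bar> / (m + 1) > 0" using \<open>m \<ge> 0\<close> by simp
    from bound[OF this] \<open>m \<ge> 0\<close> \<open>(LINT x|lebesgue. ?D x) \<noteq> 0\<close> show False
      by (simp add: field_simps)
  qed
qed

section \<open>Mollification in \<open>L\<^sup>1\<close>\<close>

lemma lmeasurable_inner_compact:
  assumes A: "A \<in> lmeasurable" and "e > 0"
  obtains K where "compact K" "K \<subseteq> A" "measure lebesgue (A - K) < e"
proof -
  have "e / 2 > 0" using \<open>e > 0\<close> by simp
  obtain T where T: "closed T" "T \<subseteq> A" "A - T \<in> lmeasurable" "emeasure lebesgue (A - T) < ennreal (e / 2)"
    using sets_lebesgue_inner_closed[OF _ \<open>e / 2 > 0\<close>] A fmeasurableD by metis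
  have mT: "measure lebesgue (A - T) < e / 2"
    using T(3,4) \<open>e > 0\<close> by (simp add: emeasure_eq_measure2 ennreal_less_iff)
  have ball: "A - cball 0 (real n) \<in> lmeasurable" for n
    by (intro fmeasurable.Diff A lmeasurable_cball)
  have "(\<lambda>n. measure lebesgue (A - cball 0 (real n))) \<longlonglongrightarrow> measure lebesgue (\<Inter>n. A - cball 0 (real n))"
    by (rule Lim_measure_decseq)
      (use ball in \<open>auto simp: decseq_def fmeasurableD fmeasurableD2 simp del: emeasure_completion\<close>)
  moreover have "(\<Inter>n. A - cball 0 (real n)) = {}"
    using real_arch_simple by fastforce
  ultimately have "(\<lambda>n. measure lebesgue (A - cball 0 (real n))) \<longlonglongrightarrow> 0"
    by (simp only: measure_empty)
  then have "\<forall>\<^sub>F n in sequentially. measure lebesgue (A - cball 0 (real n)) < e / 2"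
    by (rule order_tendstoD(2)) (rule \<open>e / 2 > 0\<close>)
  then obtain n where n: "measure lebesgue (A - cball 0 (real n)) < e / 2"
    by (auto simp: eventually_sequentially)
  have "measure lebesgue (A - T \<inter> cball 0 (real n))
      \<le> measure lebesgue (A - T) + measure lebesgue (A - cball 0 (real n))"
    using measure_Un_le[of "A - T" lebesgue "A - cball 0 (real n)"] T(3) ball[of n]
    by (simp add: Diff_Int fmeasurableD)
  then show ?thesis
    using T(1,2) n mT closed_Int_compact[OF T(1) compact_cball]
    by (intro that[of "T \<inter> cball 0 (real n)"]) auto
qed

text \<open>For the indicator of \<open>A\<close> choose a compact \<open>K\<close> and an open \<open>U\<close> with \<open>K \<subseteq> A \<subseteq> U\<close> and \<open>U - K\<close> small:
  a short translation does not lead from \<open>K\<close> out of \<open>U\<close>, so that indicator and translate differ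
  only where the point or its translate lies in \<open>U - K\<close>. Linear combinations and dominated limits
  follow.\<close>

lemma L1_translation_continuous:
  fixes f :: "'a::euclidean_space \<Rightarrow> real"
  assumes "integrable lebesgue f"
  shows "\<forall>e>0. \<exists>d>0. \<forall>h. norm h < d \<longrightarrow> (LINT x|lebesgue. \<bar>f (x + h) - f x\<bar>) < e"
  using assms
proof (induction rule: integrable_induct)
  case (base A c)
  show ?case
  proof (intro allI impI)
    fix e :: real assume "e > 0"
    define e' where "e' = e / (4 * (\<bar>c\<bar> + 1))"
    have "e' > 0" using \<open>e > 0\<close> by (simp add: e'_def)
    have A: "A \<in> lmeasurable" using base by (simp add: fmeasurable_def)
    obtain U where U: "open U" "A \<subseteq> U" "U - A \<in> lmeasurable" "measure lebesgue (U - A) < e'"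
    proof -
      obtain U where "open U" "A \<subseteq> U" "U - A \<in> lmeasurable" "emeasure lebesgue (U - A) < ennreal e'"
        using sets_lebesgue_outer_open[OF _ \<open>e' > 0\<close>] A fmeasurableD by metis
      then show ?thesis using that \<open>e' > 0\<close> by (simp add: emeasure_eq_measure2 ennreal_less_iff)
    qed
    have "U = (U - A) \<union> A" using U(2) by auto
    then have Um: "U \<in> lmeasurable" using fmeasurable.Un[OF U(3) A] by metis
    obtain K where K: "compact K" "K \<subseteq> A" "measure lebesgue (A - K) < e'"
      using lmeasurable_inner_compact[OF A \<open>e' > 0\<close>] by metis
    have "K \<in> lmeasurable" using K(1) by (rule lmeasurable_compact)
    have UK: "U - K \<in> lmeasurable" using Um \<open>K \<in> lmeasurable\<close> by (rule fmeasurable.Diff)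
    have "measure lebesgue (U - K) \<le> measure lebesgue (U - A) + measure lebesgue (A - K)"
    proof -
      have "U - K = (U - A) \<union> (A - K)" using U K by auto
      then show ?thesis
        using measure_Un_le[of "U - A" lebesgue "A - K"] U A \<open>K \<in> lmeasurable\<close>
        by (simp add: fmeasurableD sets.Diff)
    qed
    then have mUK: "measure lebesgue (U - K) < 2 * e'" using U K by simp
    obtain d where d: "d > 0" "\<And>x y. x \<in> K \<Longrightarrow> y \<in> - U \<Longrightarrow> d \<le> dist x y"
    proof -
      have "K \<inter> - U = {}" using K U by auto
      then have "\<exists>d>0. \<forall>x\<in>K. \<forall>y\<in>-U. d \<le> dist x y"
        by (intro separate_compact_closed K(1) closed_Compl U(1))
      then show ?thesis using that by blast
    qed
    have "(LINT x|lebesgue. \<bar>indicator A (x + h) *\<^sub>R c - indicator A x *\<^sub>R c\<bar>) < e" if h: "norm h < d" for h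
    proof -
      have iUK: "integrable lebesgue (indicator (U - K) :: 'a \<Rightarrow> real)"
        using UK by (simp add: integrable_indicator_iff fmeasurable_def del: emeasure_completion)
      have iA: "integrable lebesgue (\<lambda>x. indicator A x *\<^sub>R c)"
        using A by (auto simp: fmeasurable_def simp del: emeasure_completion)
      have near: "x + h \<in> U" if "x \<in> K" for x
        using d(2)[OF that, of "x + h"] h by (auto simp: dist_norm)
      have near': "x \<in> U" if "x + h \<in> K" for x
        using d(2)[OF that, of x] h by (auto simp: dist_norm)
      have pt: "\<bar>indicator A (x + h) *\<^sub>R c - indicator A x *\<^sub>R c\<bar>
          \<le> \<bar>c\<bar> * (indicator (U - K) (x + h) + indicator (U - K) x)" for x
        using near[of x] near'[of x] K(2) U(2) by (auto simp: indicator_def)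
      have "(LINT x|lebesgue. \<bar>indicator A (x + h) *\<^sub>R c - indicator A x *\<^sub>R c\<bar>)
        \<le> (LINT x|lebesgue. \<bar>c\<bar> * (indicator (U - K) (x + h) + indicator (U - K) x))"
        by (rule integral_mono) (use integrable_translate[OF iA, of h] integrable_translate[OF iUK, of h] iA iUK pt in auto)
      also have "\<dots> = \<bar>c\<bar> * (2 * measure lebesgue (U - K))"
        using integrable_translate[OF iUK, of h] iUK UK
        by (simp add: integral_translate[OF iUK, of h])
      also have "\<dots> \<le> \<bar>c\<bar> * (4 * e')" using mUK by (intro mult_left_mono) auto
      also have "\<dots> < e" using \<open>e > 0\<close> by (simp add: e'_def field_simps)
      finally show ?thesis .
    qed
    then show "\<exists>d>0. \<forall>h. norm h < d \<longrightarrow>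
        (LINT x|lebesgue. \<bar>indicator A (x + h) *\<^sub>R c - indicator A x *\<^sub>R c\<bar>) < e"
      using d(1) by blast
  qed
next
  case (add f g)
  show ?case
  proof (intro allI impI)
    fix e :: real assume "e > 0"
    then have "e / 2 > 0" by simp
    obtain d1 where d1: "d1 > 0" "\<And>h. norm h < d1 \<Longrightarrow> (LINT x|lebesgue. \<bar>f (x + h) - f x\<bar>) < e / 2"
      using add.IH(1) \<open>e / 2 > 0\<close> by metis
    obtain d2 where d2: "d2 > 0" "\<And>h. norm h < d2 \<Longrightarrow> (LINT x|lebesgue. \<bar>g (x + h) - g x\<bar>) < e / 2"
      using add.IH(2) \<open>e / 2 > 0\<close> by metis
    have "(LINT x|lebesgue. \<bar>(f (x + h) + g (x + h)) - (f x + g x)\<bar>) < e" if "norm h < min d1 d2" for h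
    proof -
      note i = integrable_translate[OF add.hyps(1), of h] integrable_translate[OF add.hyps(2), of h] add.hyps
      have "(LINT x|lebesgue. \<bar>(f (x + h) + g (x + h)) - (f x + g x)\<bar>)
        \<le> (LINT x|lebesgue. \<bar>f (x + h) - f x\<bar> + \<bar>g (x + h) - g x\<bar>)"
        by (rule integral_mono) (use i in auto)
      also have "\<dots> = (LINT x|lebesgue. \<bar>f (x + h) - f x\<bar>) + (LINT x|lebesgue. \<bar>g (x + h) - g x\<bar>)"
        by (rule Bochner_Integration.integral_add) (use i in auto)
      finally show ?thesis using d1(2)[of h] d2(2)[of h] that by simp
    qed
    then show "\<exists>d>0. \<forall>h. norm h < d \<longrightarrow> (LINT x|lebesgue. \<bar>(f (x + h) + g (x + h)) - (f x + g x)\<bar>) < e"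
      using d1(1) d2(1) by (intro exI[of _ "min d1 d2"]) auto
  qed
next
  case (lim f s)
  show ?case
  proof (intro allI impI)
    fix e :: real assume "e > 0"
    then have "e / 3 > 0" by simp
    have "(\<lambda>i. LINT x|lebesgue. \<bar>s i x - f x\<bar>) \<longlonglongrightarrow> (LINT x|(lebesgue::'a measure). 0)"
    proof (rule integral_dominated_convergence[where w="\<lambda>x. 3 * \<bar>f x\<bar>"])
      show "AE x in lebesgue. (\<lambda>i. \<bar>s i x - f x\<bar>) \<longlonglongrightarrow> 0"
        using lim.hyps(2) by (intro AE_I2 tendsto_rabs_zero LIM_zero) simp
      show "AE x in lebesgue. norm \<bar>s i x - f x\<bar> \<le> 3 * \<bar>f x\<bar>" for i
      proof (rule AE_I2)
        fix x :: 'a assume "x \<in> space lebesgue"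
        then have "\<bar>s i x\<bar> \<le> 2 * \<bar>f x\<bar>" using lim.hyps(3)[of x i] by simp
        then show "norm \<bar>s i x - f x\<bar> \<le> 3 * \<bar>f x\<bar>" by simp
      qed
    qed (use lim.hyps in auto)
    then have "\<forall>\<^sub>F i in sequentially. (LINT x|lebesgue. \<bar>s i x - f x\<bar>) < e / 3"
      using \<open>e / 3 > 0\<close> by (intro order_tendstoD(2)[where y=0]) simp_all
    then obtain i where i: "(LINT x|lebesgue. \<bar>s i x - f x\<bar>) < e / 3"
      by (auto simp: eventually_sequentially)
    obtain d where d: "d > 0" "\<And>h. norm h < d \<Longrightarrow> (LINT x|lebesgue. \<bar>s i (x + h) - s i x\<bar>) < e / 3"
      using lim.IH \<open>e / 3 > 0\<close> by metis
    have "(LINT x|lebesgue. \<bar>f (x + h) - f x\<bar>) < e" if "norm h < d" for h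
    proof -
      have if': "integrable lebesgue (\<lambda>x. \<bar>s i x - f x\<bar>)" using lim.hyps by auto
      note j = integrable_translate[OF lim.hyps(1)[of i], of h] integrable_translate[OF lim.hyps(4), of h]
        integrable_translate[OF if', of h] lim.hyps(1)[of i] lim.hyps(4) if'
      have "(LINT x|lebesgue. \<bar>f (x + h) - f x\<bar>)
        \<le> (LINT x|lebesgue. \<bar>s i (x + h) - f (x + h)\<bar> + \<bar>s i x - f x\<bar> + \<bar>s i (x + h) - s i x\<bar>)"
        by (rule integral_mono) (use j in auto)
      also have "\<dots> = (LINT x|lebesgue. \<bar>s i (x + h) - f (x + h)\<bar>) + (LINT x|lebesgue. \<bar>s i x - f x\<bar>)
          + (LINT x|lebesgue. \<bar>s i (x + h) - s i x\<bar>)"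
        using j by simp
      finally show ?thesis using i d(2)[OF that] integral_translate[OF if', of h] by simp
    qed
    then show "\<exists>d>0. \<forall>h. norm h < d \<longrightarrow> (LINT x|lebesgue. \<bar>f (x + h) - f x\<bar>) < e"
      using d(1) by blast
  qed
qed

lemma conv_alt:
  fixes \<phi> :: "'a::euclidean_space \<Rightarrow> real"
  assumes "continuous_on UNIV \<phi>" "\<And>x. norm x > R \<Longrightarrow> \<phi> x = 0" "integrable lebesgue f"
  shows "conv \<phi> f z = (LINT w|lebesgue. \<phi> w * f (z - w))"
    and "integrable lebesgue (\<lambda>w. \<phi> w * f (z - w))"
proof -
  note i = conv_integrable[OF assms, where z=z]
  show "conv \<phi> f z = (LINT w|lebesgue. \<phi> w * f (z - w))"
    unfolding conv_def using integral_reflect_point[OF i, where t=z] by simp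
  show "integrable lebesgue (\<lambda>w. \<phi> w * f (z - w))"
    using integrable_reflect_point[OF i, where t=z] by simp
qed

lemma conv_cong_AE:
  fixes \<phi> :: "'a::euclidean_space \<Rightarrow> real"
  assumes "continuous_on UNIV \<phi>" "f \<in> borel_measurable lebesgue" "g \<in> borel_measurable lebesgue"
    "AE x in lebesgue. f x = g x"
  shows "conv \<phi> f z = conv \<phi> g z"
proof -
  have "continuous_on UNIV (\<lambda>y. \<phi> (z - y))"
    by (intro continuous_on_compose2[OF assms(1)] continuous_intros) auto
  then have "(\<lambda>y. \<phi> (z - y)) \<in> borel_measurable lebesgue"
    by (intro measurable_completion) (simp add: borel_measurable_continuous_onI)
  then show ?thesis
    unfolding conv_def using assms by (intro integral_cong_AE borel_measurable_times) auto
qed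

text \<open>The error at \<open>z\<close> is the mean of \<open>f (z - w) - f z\<close> with respect to the kernel, and Tonelli's
  theorem moves the integral over \<open>z\<close> inside. Borel measurability of \<open>f\<close> yields the joint
  measurability of \<open>(z, w) \<mapsto> f (z - w)\<close> in the product of the Borel algebras.\<close>

text \<open>Neither the mollification nor the integrals of the differences change when \<open>f\<close> is replaced by a
  Borel measurable function that equals it almost everywhere.\<close>

lemma conv_L1_error_borel:
  fixes f :: "'a::euclidean_space \<Rightarrow> real"
  assumes f: "integrable lebesgue f" and fm: "f \<in> borel_measurable borel"
    and d: "\<And>h. norm h < d \<Longrightarrow> (LINT x|lebesgue. \<bar>f (x + h) - f x\<bar>) \<le> e"
    and cont: "continuous_on UNIV \<phi>" and pos: "\<And>x. \<phi> x \<ge> 0" and int1: "(LINT x|lebesgue. \<phi> x) = 1"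
    and supp: "\<And>x. \<phi> x \<noteq> 0 \<Longrightarrow> norm x < d" and "e \<ge> 0"
  shows "(\<integral>\<^sup>+z. ennreal \<bar>conv \<phi> f z - f z\<bar> \<partial>lebesgue) \<le> ennreal e"
proof -
  have R: "\<phi> x = 0" if "norm x > d" for x using supp[of x] that by fastforce
  have alt: "conv \<phi> f z = (LINT w|lebesgue. \<phi> w * f (z - w))"
    "integrable lebesgue (\<lambda>w. \<phi> w * f (z - w))" for z
    by (rule conv_alt[where R=d, OF cont _ f]; use R in blast)+
  have i\<phi>: "integrable lebesgue \<phi>" by (rule integrable_continuous_bounded_support[OF cont R])
  have \<phi>m[measurable]: "\<phi> \<in> borel_measurable borel" using cont by (rule borel_measurable_continuous_onI)
  note fm[measurable]
  have "ennreal \<bar>conv \<phi> f z - f z\<bar> \<le> (\<integral>\<^sup>+w. ennreal (\<phi> w * \<bar>f (z - w) - f z\<bar>) \<partial>lborel)" for z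
  proof -
    have "f z = (LINT w|lebesgue. \<phi> w * f z)" using int1 by simp
    then have "\<bar>conv \<phi> f z - f z\<bar> = \<bar>LINT w|lebesgue. \<phi> w * f (z - w) - \<phi> w * f z\<bar>"
      using alt[of z] i\<phi> int1 by simp
    also have "\<dots> \<le> (LINT w|lebesgue. \<bar>\<phi> w * f (z - w) - \<phi> w * f z\<bar>)" by (rule integral_abs_bound)
    also have "\<dots> = (LINT w|lebesgue. \<phi> w * \<bar>f (z - w) - f z\<bar>)"
      using pos by (simp add: abs_mult flip: right_diff_distrib)
    finally have "ennreal \<bar>conv \<phi> f z - f z\<bar> \<le> ennreal (LINT w|lebesgue. \<phi> w * \<bar>f (z - w) - f z\<bar>)"
      by (rule ennreal_leI)
    also have "\<dots> = (\<integral>\<^sup>+w. ennreal (\<phi> w * \<bar>f (z - w) - f z\<bar>) \<partial>lebesgue)"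
    proof (rule nn_integral_eq_integral[symmetric])
      have "integrable lebesgue (\<lambda>w. \<bar>\<phi> w * f (z - w) - \<phi> w * f z\<bar>)" using alt[of z] i\<phi> by auto
      then show "integrable lebesgue (\<lambda>w. \<phi> w * \<bar>f (z - w) - f z\<bar>)"
        using pos by (simp add: abs_mult flip: right_diff_distrib)
    qed (simp add: pos)
    finally show ?thesis by (simp add: nn_integral_completion)
  qed
  then have "(\<integral>\<^sup>+z. ennreal \<bar>conv \<phi> f z - f z\<bar> \<partial>lebesgue)
      \<le> (\<integral>\<^sup>+z. \<integral>\<^sup>+w. ennreal (\<phi> w * \<bar>f (z - w) - f z\<bar>) \<partial>lborel \<partial>lborel)"
    unfolding nn_integral_completion by (intro nn_integral_mono) auto
  also have "\<dots> = (\<integral>\<^sup>+w. \<integral>\<^sup>+z. ennreal (\<phi> w * \<bar>f (z - w) - f z\<bar>) \<partial>lborel \<partial>lborel)"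
    by (rule lborel_pair.Fubini') measurable
  also have "\<dots> \<le> (\<integral>\<^sup>+w. ennreal (\<phi> w) * ennreal e \<partial>lborel)"
  proof (intro nn_integral_mono)
    fix w :: 'a
    have "(\<integral>\<^sup>+z. ennreal (\<phi> w * \<bar>f (z - w) - f z\<bar>) \<partial>lborel)
        = ennreal (\<phi> w) * (\<integral>\<^sup>+z. ennreal \<bar>f (z - w) - f z\<bar> \<partial>lborel)"
      by (simp add: ennreal_mult' pos nn_integral_cmult)
    also have "(\<integral>\<^sup>+z. ennreal \<bar>f (z - w) - f z\<bar> \<partial>lborel) = ennreal (LINT z|lebesgue. \<bar>f (z + (- w)) - f z\<bar>)"
      unfolding nn_integral_completion[of lborel, symmetric]
      by (subst nn_integral_eq_integral) (use integrable_translate[OF f, of "- w"] f in auto)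
    also have "ennreal (\<phi> w) * \<dots> \<le> ennreal (\<phi> w) * ennreal e"
    proof (cases "\<phi> w = 0")
      case False
      then show ?thesis using d[of "- w"] supp[of w] by (intro mult_left_mono ennreal_leI) auto
    qed simp
    finally show "(\<integral>\<^sup>+z. ennreal (\<phi> w * \<bar>f (z - w) - f z\<bar>) \<partial>lborel) \<le> ennreal (\<phi> w) * ennreal e" .
  qed
  also have "\<dots> = (\<integral>\<^sup>+w. ennreal (\<phi> w) \<partial>lborel) * ennreal e"
    by (rule nn_integral_multc) measurable
  also have "(\<integral>\<^sup>+w. ennreal (\<phi> w) \<partial>lborel) = 1"
    unfolding nn_integral_completion[of lborel, symmetric]
    using nn_integral_eq_integral[OF i\<phi>] pos int1 by simp
  finally show ?thesis by simp
qed

lemma conv_L1_error: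
  fixes f :: "'a::euclidean_space \<Rightarrow> real"
  assumes f: "integrable lebesgue f"
    and d: "\<And>h. norm h < d \<Longrightarrow> (LINT x|lebesgue. \<bar>f (x + h) - f x\<bar>) \<le> e"
    and cont: "continuous_on UNIV \<phi>" and pos: "\<And>x. \<phi> x \<ge> 0" and int1: "(LINT x|lebesgue. \<phi> x) = 1"
    and supp: "\<And>x. \<phi> x \<noteq> 0 \<Longrightarrow> norm x < d" and "e \<ge> 0"
  shows "integrable lebesgue (conv \<phi> f)" and "(LINT z|lebesgue. \<bar>conv \<phi> f z - f z\<bar>) \<le> e"
proof -
  have R: "\<phi> x = 0" if "norm x > d" for x using supp[of x] that by fastforce
  obtain g where g: "g \<in> borel_measurable lborel" "AE x in lborel. f x = g x"
    using completion_ex_borel_measurable_real[OF borel_measurable_integrable[OF f]] by blast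
  have gm: "g \<in> borel_measurable borel" using g(1) by simp
  have gm': "g \<in> borel_measurable lebesgue" using g(1) by (rule measurable_completion)
  have fg: "AE x in lebesgue. f x = g x" using g(2) by (rule AE_completion)
  have ig: "integrable lebesgue g"
    using f gm' fg by (rule Bochner_Integration.integrable_cong_AE_imp)
  have tr: "(LINT x|lebesgue. \<bar>g (x + h) - g x\<bar>) = (LINT x|lebesgue. \<bar>f (x + h) - f x\<bar>)" for h
  proof (rule integral_cong_AE)
    have "AE x in distr lebesgue lebesgue (\<lambda>x. h + x). f x = g x" unfolding lebesgue_distr_plus by (rule fg)
    then have "AE x in lebesgue. f (h + x) = g (h + x)"
      by (rule AE_distrD[OF measurable_lebesgue_plus])
    then show "AE x in lebesgue. \<bar>g (x + h) - g x\<bar> = \<bar>f (x + h) - f x\<bar>"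
      using fg by eventually_elim (simp add: add.commute)
  qed (use integrable_translate[OF f, of h] integrable_translate[OF ig, of h] f ig in auto)
  have cv: "conv \<phi> f z = conv \<phi> g z" for z
    by (rule conv_cong_AE[OF cont _ gm' fg]) (use f in auto)
  have bound: "(\<integral>\<^sup>+z. ennreal \<bar>conv \<phi> g z - g z\<bar> \<partial>lebesgue) \<le> ennreal e"
    by (rule conv_L1_error_borel[OF ig gm _ cont pos int1 supp \<open>e \<ge> 0\<close>]) (use d tr in auto)
  have cm: "conv \<phi> g \<in> borel_measurable lebesgue"
    using conv_continuous[OF cont R ig] by (intro measurable_completion) (simp add: borel_measurable_continuous_onI)
  have id: "integrable lebesgue (\<lambda>z. conv \<phi> g z - g z)"
  proof (rule integrableI_bounded)
    show "(\<integral>\<^sup>+z. ennreal (norm (conv \<phi> g z - g z)) \<partial>lebesgue) < \<infinity>"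
      using le_less_trans[OF bound ennreal_less_top] by simp
  qed (use cm gm' in auto)
  have "integrable lebesgue (\<lambda>z. (conv \<phi> g z - g z) + g z)"
    by (rule Bochner_Integration.integrable_add[OF id ig])
  then have icg: "integrable lebesgue (conv \<phi> g)" by simp
  have cveq: "conv \<phi> f = conv \<phi> g" using cv by auto
  show "integrable lebesgue (conv \<phi> f)" unfolding cveq by (rule icg)
  have "(LINT z|lebesgue. \<bar>conv \<phi> f z - f z\<bar>) = (LINT z|lebesgue. \<bar>conv \<phi> g z - g z\<bar>)"
    by (rule integral_cong_AE) (use fg cm gm' f in \<open>auto simp: cveq\<close>)
  also have "\<dots> \<le> e"
  proof -
    have "ennreal (LINT z|lebesgue. \<bar>conv \<phi> g z - g z\<bar>) \<le> ennreal e"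
      using bound nn_integral_eq_integral[of lebesgue "\<lambda>z. \<bar>conv \<phi> g z - g z\<bar>"] id by simp
    then show ?thesis using \<open>e \<ge> 0\<close> by simp
  qed
  finally show "(LINT z|lebesgue. \<bar>conv \<phi> f z - f z\<bar>) \<le> e" .
qed

lemma conv_L1_tendsto:
  fixes f :: "'a::euclidean_space \<Rightarrow> real" and \<phi> :: "nat \<Rightarrow> 'a \<Rightarrow> real"
  assumes f: "integrable lebesgue f"
    and cont: "\<And>k. continuous_on UNIV (\<phi> k)" and pos: "\<And>k x. \<phi> k x \<ge> 0"
    and int1: "\<And>k. (LINT x|lebesgue. \<phi> k x) = 1"
    and supp: "\<And>k x. \<phi> k x \<noteq> 0 \<Longrightarrow> norm x < \<delta> k" and \<delta>: "\<delta> \<longlonglongrightarrow> 0"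
  shows "integrable lebesgue (conv (\<phi> k) f)"
    and "(\<lambda>k. LINT z|lebesgue. \<bar>conv (\<phi> k) f z - f z\<bar>) \<longlonglongrightarrow> 0"
proof -
  define I where "I = (LINT x|lebesgue. \<bar>f x\<bar>)"
  have "I \<ge> 0" by (simp add: I_def)
  have iaf: "integrable lebesgue (\<lambda>x. \<bar>f x\<bar>)" using f by simp
  have "(LINT x|lebesgue. \<bar>f (x + h) - f x\<bar>) \<le> 2 * I" for h
  proof -
    have "(LINT x|lebesgue. \<bar>f (x + h) - f x\<bar>) \<le> (LINT x|lebesgue. \<bar>f (x + h)\<bar> + \<bar>f x\<bar>)"
      by (rule integral_mono) (use integrable_translate[OF f, of h] f in auto)
    also have "\<dots> = 2 * I"
      using integrable_translate[OF f, of h] f integral_translate[OF iaf, of h] by (simp add: I_def)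
    finally show ?thesis .
  qed
  \<comment> \<open>The difference of \<open>f\<close> and its translates is at most \<open>2 I\<close> in \<open>L\<^sup>1\<close>, so the error estimate
    applies with \<open>e = 2 I\<close>.\<close>
  then show "integrable lebesgue (conv (\<phi> k) f)"
    using \<open>I \<ge> 0\<close> supp[of k]
    by (intro conv_L1_error(1)[OF f _ cont[of k] pos int1[of k], of "\<delta> k" "2 * I"]) auto
  show "(\<lambda>k. LINT z|lebesgue. \<bar>conv (\<phi> k) f z - f z\<bar>) \<longlonglongrightarrow> 0"
  proof (rule LIMSEQ_I)
    fix e :: real assume "e > 0"
    then have "e / 2 > 0" by simp
    then obtain d where d: "d > 0" "\<And>h. norm h < d \<Longrightarrow> (LINT x|lebesgue. \<bar>f (x + h) - f x\<bar>) < e / 2"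
      using L1_translation_continuous[OF f] by metis
    have "\<forall>\<^sub>F k in sequentially. \<delta> k < d" by (rule order_tendstoD(2)[OF \<delta> d(1)])
    then obtain N where N: "\<And>k. k \<ge> N \<Longrightarrow> \<delta> k < d" by (auto simp: eventually_sequentially)
    have "norm ((LINT z|lebesgue. \<bar>conv (\<phi> k) f z - f z\<bar>) - 0) < e" if "k \<ge> N" for k
    proof -
      have "(LINT z|lebesgue. \<bar>conv (\<phi> k) f z - f z\<bar>) \<le> e / 2"
      proof (rule conv_L1_error(2)[OF f _ cont[of k] pos int1[of k], of d])
        show "(LINT x|lebesgue. \<bar>f (x + h) - f x\<bar>) \<le> e / 2" if "norm h < d" for h
          using d(2)[OF that] by simp
        show "norm x < d" if "\<phi> k x \<noteq> 0" for x
          using supp[OF that] N[OF \<open>k \<ge> N\<close>] by simp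
      qed (use \<open>e > 0\<close> in simp)
      moreover have "(LINT z|lebesgue. \<bar>conv (\<phi> k) f z - f z\<bar>) \<ge> 0" by simp
      ultimately show ?thesis using \<open>e > 0\<close> by (simp del: integral_nonneg_AE)
    qed
    then show "\<exists>N. \<forall>k\<ge>N. norm ((LINT z|lebesgue. \<bar>conv (\<phi> k) f z - f z\<bar>) - 0) < e" by blast
  qed
qed

text \<open>The dominating functions vary but converge in \<open>L\<^sup>1\<close>. As \<open>|X\<^sub>k - X| \<le> G\<^sub>k + G \<le> 2 G + |G\<^sub>k - G|\<close>,
  the difference exceeds its truncation at \<open>2 G\<close> by at most \<open>|G\<^sub>k - G|\<close>, and the truncations have
  a fixed majorant.\<close>

lemma generalized_dominated_convergence:
  fixes X G :: "nat \<Rightarrow> 'a \<Rightarrow> real" and Xlim Glim :: "'a \<Rightarrow> real"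
  assumes G: "\<And>k. integrable M (G k)" "integrable M Glim" and Xm: "\<And>k. X k \<in> borel_measurable M"
    and Xlimm: "Xlim \<in> borel_measurable M"
    and dom: "\<And>k x. x \<in> space M \<Longrightarrow> \<bar>X k x\<bar> \<le> G k x"
    and lim: "AE x in M. (\<lambda>k. X k x) \<longlonglongrightarrow> Xlim x" "AE x in M. (\<lambda>k. G k x) \<longlonglongrightarrow> Glim x"
    and L1: "(\<lambda>k. LINT x|M. \<bar>G k x - Glim x\<bar>) \<longlonglongrightarrow> 0"
  shows "(\<lambda>k. LINT x|M. X k x) \<longlonglongrightarrow> (LINT x|M. Xlim x)"
proof -
  have XlimG: "AE x in M. \<bar>Xlim x\<bar> \<le> Glim x"
    using lim AE_space
  proof eventually_elim
    case (elim x)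
    show ?case
      by (rule LIMSEQ_le[OF tendsto_rabs[OF elim(1)] elim(2)]) (use dom[OF elim(3)] in auto)
  qed
  have iX: "integrable M (X k)" for k
    by (rule Bochner_Integration.integrable_bound[OF G(1)[of k] Xm]) (use dom[of _ k] in fastforce)
  have iXlim: "integrable M Xlim"
    by (rule Bochner_Integration.integrable_bound[OF G(2) Xlimm]) (use XlimG in \<open>eventually_elim, auto\<close>)
  define Y where "Y k x = min \<bar>X k x - Xlim x\<bar> (2 * \<bar>Glim x\<bar>)" for k x
  have iY: "integrable M (Y k)" for k
    unfolding Y_def using iX[of k] iXlim G by (intro integrable_min) auto
  have "(\<lambda>k. LINT x|M. Y k x) \<longlonglongrightarrow> (LINT x|M. 0)"
  proof (rule integral_dominated_convergence[where w="\<lambda>x. 2 * \<bar>Glim x\<bar>"])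
    show "AE x in M. (\<lambda>k. Y k x) \<longlonglongrightarrow> 0"
      using lim(1)
    proof eventually_elim
      case (elim x)
      have "(\<lambda>k. Y k x) \<longlonglongrightarrow> min \<bar>Xlim x - Xlim x\<bar> (2 * \<bar>Glim x\<bar>)"
        unfolding Y_def by (intro tendsto_intros elim)
      then show ?case by simp
    qed
    show "AE x in M. norm (Y k x) \<le> 2 * \<bar>Glim x\<bar>" for k by (auto simp: Y_def)
  qed (use G iY in \<open>auto simp: borel_measurable_integrable\<close>)
  then have sum0: "(\<lambda>k. (LINT x|M. Y k x) + (LINT x|M. \<bar>G k x - Glim x\<bar>)) \<longlonglongrightarrow> 0"
    using tendsto_add[OF _ L1] by fastforce
  have "\<bar>(LINT x|M. X k x) - (LINT x|M. Xlim x)\<bar> \<le> (LINT x|M. Y k x) + (LINT x|M. \<bar>G k x - Glim x\<bar>)" for k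
  proof -
    have "\<bar>(LINT x|M. X k x) - (LINT x|M. Xlim x)\<bar> = \<bar>LINT x|M. X k x - Xlim x\<bar>"
      using iX[of k] iXlim by simp
    also have "\<dots> \<le> (LINT x|M. \<bar>X k x - Xlim x\<bar>)" by (rule integral_abs_bound)
    also have "\<dots> \<le> (LINT x|M. Y k x + \<bar>G k x - Glim x\<bar>)"
    proof (rule integral_mono_AE)
      show "AE x in M. \<bar>X k x - Xlim x\<bar> \<le> Y k x + \<bar>G k x - Glim x\<bar>"
        using XlimG AE_space
      proof eventually_elim
        case (elim x)
        then show ?case using dom[OF elim(2), of k] by (auto simp: Y_def min_def)
      qed
    qed (use iX[of k] iXlim iY[of k] G in auto)
    also have "\<dots> = (LINT x|M. Y k x) + (LINT x|M. \<bar>G k x - Glim x\<bar>)"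
      using iY[of k] G by simp
    finally show ?thesis .
  qed
  then have "(\<lambda>k. (LINT x|M. X k x) - (LINT x|M. Xlim x)) \<longlonglongrightarrow> 0"
    by (intro Lim_null_comparison[OF _ sum0]) auto
  then show ?thesis by (rule LIM_zero_cancel)
qed

lemma LIMSEQ_subseqI:
  fixes X :: "nat \<Rightarrow> real"
  assumes "\<And>r :: nat \<Rightarrow> nat. strict_mono r \<Longrightarrow> \<exists>s :: nat \<Rightarrow> nat. strict_mono s \<and> (\<lambda>k. X (r (s k))) \<longlonglongrightarrow> L"
  shows "X \<longlonglongrightarrow> L"
proof (rule ccontr)
  assume "\<not> X \<longlonglongrightarrow> L"
  then obtain e where e: "e > 0" "\<And>N. \<exists>n\<ge>N. \<not> norm (X n - L) < e"
    unfolding LIMSEQ_iff by blast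
  then have "infinite {n. \<not> norm (X n - L) < e}" by (simp add: infinite_nat_iff_unbounded_le)
  then obtain r :: "nat \<Rightarrow> nat" where r: "strict_mono r" "\<And>n. \<not> norm (X (r n) - L) < e"
    using infinite_enumerate by blast
  obtain s where "(\<lambda>k. X (r (s k))) \<longlonglongrightarrow> L" using assms[OF r(1)] by blast
  then show False using r(2) e(1) LIMSEQ_D[of "\<lambda>k. X (r (s k))" L e] by blast
qed

text \<open>The mollifications of \<open>F\<close> converge in \<open>L\<^sup>1\<close> and can serve as varying majorants. Convergence
  almost everywhere is available along subsequences only, whence the detour through
  \<open>LIMSEQ_subseqI\<close>.\<close>

lemma conv_product_tendsto:
  fixes \<phi> :: "nat \<Rightarrow> 'a::euclidean_space \<Rightarrow> real"
  assumes cont: "\<And>k. continuous_on UNIV (\<phi> k)" and pos: "\<And>k x. \<phi> k x \<ge> 0"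
    and int1: "\<And>k. (LINT x|lebesgue. \<phi> k x) = 1"
    and supp: "\<And>k x. \<phi> k x \<noteq> 0 \<Longrightarrow> norm x < \<delta> k" and \<delta>: "\<delta> \<longlonglongrightarrow> 0"
    and b: "integrable lebesgue b" and w: "integrable lebesgue w" and F: "integrable lebesgue F"
    and \<eta>m: "\<eta> \<in> borel_measurable lebesgue" and \<eta>M: "\<And>z. \<bar>\<eta> z\<bar> \<le> M"
    and dom: "\<And>k z. \<eta> z \<noteq> 0 \<Longrightarrow> \<bar>conv (\<phi> k) b z * conv (\<phi> k) w z\<bar> \<le> conv (\<phi> k) F z"
  shows "(\<lambda>k. LINT z|lebesgue. \<eta> z * (conv (\<phi> k) b z * conv (\<phi> k) w z))
    \<longlonglongrightarrow> (LINT z|lebesgue. \<eta> z * (b z * w z))"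
proof (rule LIMSEQ_subseqI)
  fix r :: "nat \<Rightarrow> nat" assume r: "strict_mono r"
  have ic: "integrable lebesgue (conv (\<phi> k) f)" if "integrable lebesgue f" for f k
    by (rule conv_L1_tendsto(1)[where \<phi>=\<phi> and \<delta>=\<delta>, OF that cont pos int1 supp \<delta>])
  have L1: "(\<lambda>k. LINT z|lebesgue. \<bar>conv (\<phi> k) f z - f z\<bar>) \<longlonglongrightarrow> 0" if "integrable lebesgue f" for f
    by (rule conv_L1_tendsto(2)[where \<phi>=\<phi> and \<delta>=\<delta>, OF that cont pos int1 supp \<delta>])
  have "M \<ge> 0" using \<eta>M[of undefined] by simp
  define E where "E f k z = \<bar>conv (\<phi> (r k)) f z - f z\<bar>" for f k z
  have iE: "integrable lebesgue (E f k)" if "integrable lebesgue f" for f k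
    unfolding E_def using ic[OF that, where k="r k"] that by auto
  have E0: "(\<lambda>k. LINT z|lebesgue. E f k z) \<longlonglongrightarrow> 0" if "integrable lebesgue f" for f
    unfolding E_def using LIMSEQ_subseq_LIMSEQ[OF L1[OF that] r] by (simp add: o_def)
  have "(\<lambda>k. LINT z|lebesgue. norm (E b k z + E w k z + E F k z)) \<longlonglongrightarrow> 0"
  proof -
    have "(LINT z|lebesgue. norm (E b k z + E w k z + E F k z))
        = (LINT z|lebesgue. E b k z) + (LINT z|lebesgue. E w k z) + (LINT z|lebesgue. E F k z)" for k
    proof -
      have "(LINT z|lebesgue. norm (E b k z + E w k z + E F k z)) = (LINT z|lebesgue. E b k z + E w k z + E F k z)"
        by (rule Bochner_Integration.integral_cong) (auto simp: E_def)
      then show ?thesis using iE[OF b, of k] iE[OF w, of k] iE[OF F, of k] by simp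
    qed
    then show ?thesis using tendsto_add[OF tendsto_add[OF E0[OF b] E0[OF w]] E0[OF F]] by simp
  qed
  then obtain s where s: "strict_mono s"
    "AE z in lebesgue. (\<lambda>k. E b (s k) z + E w (s k) z + E F (s k) z) \<longlonglongrightarrow> 0"
    using tendsto_L1_AE_subseq[of lebesgue "\<lambda>k z. E b k z + E w k z + E F k z"]
      iE[OF b] iE[OF w] iE[OF F] by auto
  have AE3: "AE z in lebesgue. (\<lambda>k. conv (\<phi> (r (s k))) b z) \<longlonglongrightarrow> b z \<and>
      (\<lambda>k. conv (\<phi> (r (s k))) w z) \<longlonglongrightarrow> w z \<and> (\<lambda>k. conv (\<phi> (r (s k))) F z) \<longlonglongrightarrow> F z"
    using s(2)
  proof eventually_elim
    case (elim z)
    have "(\<lambda>k. conv (\<phi> (r (s k))) f z - f z) \<longlonglongrightarrow> 0"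
      if "\<And>k. E f (s k) z \<le> E b (s k) z + E w (s k) z + E F (s k) z" for f
      by (rule Lim_null_comparison[OF _ elim]) (use that in \<open>auto simp: E_def\<close>)
    note * = LIM_zero_cancel[OF this]
    show ?case by (intro conjI *) (auto simp: E_def)
  qed
  have cm: "conv (\<phi> k) f \<in> borel_measurable lebesgue" if "integrable lebesgue f" for f k
    using ic[OF that, where k=k] by (rule borel_measurable_integrable)
  have "(\<lambda>k. LINT z|lebesgue. \<eta> z * (conv (\<phi> (r (s k))) b z * conv (\<phi> (r (s k))) w z))
    \<longlonglongrightarrow> (LINT z|lebesgue. \<eta> z * (b z * w z))"
  proof (rule generalized_dominated_convergence[where G="\<lambda>k z. M * \<bar>conv (\<phi> (r (s k))) F z\<bar>" and Glim="\<lambda>z. M * \<bar>F z\<bar>"])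
    show "integrable lebesgue (\<lambda>z. M * \<bar>conv (\<phi> (r (s k))) F z\<bar>)" for k
      using ic[OF F] by auto
    show "(\<lambda>z. \<eta> z * (conv (\<phi> (r (s k))) b z * conv (\<phi> (r (s k))) w z)) \<in> borel_measurable lebesgue" for k
      by (intro borel_measurable_times \<eta>m cm b w)
    show "(\<lambda>z. \<eta> z * (b z * w z)) \<in> borel_measurable lebesgue"
      using b w by (intro borel_measurable_times \<eta>m) auto
    show "\<bar>\<eta> z * (conv (\<phi> (r (s k))) b z * conv (\<phi> (r (s k))) w z)\<bar> \<le> M * \<bar>conv (\<phi> (r (s k))) F z\<bar>" for k z
    proof (cases "\<eta> z = 0")
      case False
      have "\<bar>\<eta> z\<bar> * \<bar>conv (\<phi> (r (s k))) b z * conv (\<phi> (r (s k))) w z\<bar> \<le> M * \<bar>conv (\<phi> (r (s k))) F z\<bar>"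
        by (rule mult_mono[OF \<eta>M]) (use dom[OF False, of "r (s k)"] \<open>M \<ge> 0\<close> in auto)
      then show ?thesis by (simp only: abs_mult)
    qed (use \<open>M \<ge> 0\<close> in simp)
    show "AE z in lebesgue. (\<lambda>k. \<eta> z * (conv (\<phi> (r (s k))) b z * conv (\<phi> (r (s k))) w z)) \<longlonglongrightarrow> \<eta> z * (b z * w z)"
      using AE3 by eventually_elim (intro tendsto_intros, auto)
    show "AE z in lebesgue. (\<lambda>k. M * \<bar>conv (\<phi> (r (s k))) F z\<bar>) \<longlonglongrightarrow> M * \<bar>F z\<bar>"
      using AE3 by eventually_elim (intro tendsto_intros, auto)
    show "(\<lambda>k. LINT z|lebesgue. \<bar>M * \<bar>conv (\<phi> (r (s k))) F z\<bar> - M * \<bar>F z\<bar>\<bar>) \<longlonglongrightarrow> 0"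
    proof (rule Lim_null_comparison)
      show "(\<lambda>k. M * (LINT z|lebesgue. E F (s k) z)) \<longlonglongrightarrow> 0"
        using tendsto_mult_right_zero[OF LIMSEQ_subseq_LIMSEQ[OF E0[OF F] s(1)], of M] by (simp add: o_def)
      show "\<forall>\<^sub>F k in sequentially. norm (LINT z|lebesgue. \<bar>M * \<bar>conv (\<phi> (r (s k))) F z\<bar> - M * \<bar>F z\<bar>\<bar>)
          \<le> M * (LINT z|lebesgue. E F (s k) z)"
      proof (rule always_eventually, rule allI)
        fix k
        have "\<bar>M * \<bar>conv (\<phi> (r (s k))) F z\<bar> - M * \<bar>F z\<bar>\<bar> \<le> M * E F (s k) z" for z
        proof -
          have "\<bar>M * \<bar>conv (\<phi> (r (s k))) F z\<bar> - M * \<bar>F z\<bar>\<bar> = M * \<bar>\<bar>conv (\<phi> (r (s k))) F z\<bar> - \<bar>F z\<bar>\<bar>"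
            using \<open>M \<ge> 0\<close> by (simp add: abs_mult flip: right_diff_distrib)
          also have "\<dots> \<le> M * E F (s k) z"
            unfolding E_def using \<open>M \<ge> 0\<close> by (intro mult_left_mono abs_triangle_ineq3)
          finally show ?thesis .
        qed
        then have "(LINT z|lebesgue. \<bar>M * \<bar>conv (\<phi> (r (s k))) F z\<bar> - M * \<bar>F z\<bar>\<bar>) \<le> (LINT z|lebesgue. M * E F (s k) z)"
          using iE[OF F, of "s k"] ic[OF F, where k="r (s k)"] F by (intro integral_mono) auto
        then show "norm (LINT z|lebesgue. \<bar>M * \<bar>conv (\<phi> (r (s k))) F z\<bar> - M * \<bar>F z\<bar>\<bar>)
          \<le> M * (LINT z|lebesgue. E F (s k) z)" by simp
      qed
    qed
  qed (use F in auto)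
  with s(1) show "\<exists>s. strict_mono s \<and> (\<lambda>k. LINT z|lebesgue. \<eta> z * (conv (\<phi> (r (s k))) b z * conv (\<phi> (r (s k))) w z))
    \<longlonglongrightarrow> (LINT z|lebesgue. \<eta> z * (b z * w z))" by blast
qed

lemma flat_exp_1: "flat_exp 1 t = (if t > 0 then exp (- (1 / t)) else 0)"
  by (simp add: flat_exp_def)

text \<open>Scaling by \<open>\<epsilon>\<close> in space and \<open>\<epsilon>\<^sup>2\<close> in time gives the height \<open>C / \<epsilon> ^ (n + 2)\<close>; this parabolic
  dimension is the one that occurs in the bound on \<open>q\<close>.\<close>

lemma parabolic_kernel_exists:
  "\<exists>C>0. \<forall>\<epsilon>. 0 < \<epsilon> \<longrightarrow> \<epsilon> \<le> 1 \<longrightarrow> (\<exists>\<phi> :: (real^'n) \<times> real \<Rightarrow> real. (\<forall>k. Ck k \<phi>) \<and> (\<forall>z. 0 \<le> \<phi> z) \<and>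
    (\<forall>z. \<phi> z \<noteq> 0 \<longrightarrow> norm (fst z) < \<epsilon> \<and> \<bar>snd z\<bar> < \<epsilon>\<^sup>2) \<and> (LINT z|lebesgue. \<phi> z) = 1 \<and>
    (\<forall>z. \<phi> z \<le> C / \<epsilon> ^ (CARD('n) + 2)))"
proof -
  define V where "V = unit_ball_vol (real CARD('n))"
  have "V > 0" by (simp add: V_def)
  define C where "C = exp 2 * 2 ^ CARD('n) / V"
  have "C > 0" using \<open>V > 0\<close> by (simp add: C_def)
  have "\<exists>\<phi> :: (real^'n) \<times> real \<Rightarrow> real. (\<forall>k. Ck k \<phi>) \<and> (\<forall>z. 0 \<le> \<phi> z) \<and>
    (\<forall>z. \<phi> z \<noteq> 0 \<longrightarrow> norm (fst z) < \<epsilon> \<and> \<bar>snd z\<bar> < \<epsilon>\<^sup>2) \<and> (LINT z|lebesgue. \<phi> z) = 1 \<and>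
    (\<forall>z. \<phi> z \<le> C / \<epsilon> ^ (CARD('n) + 2))" if \<epsilon>: "0 < \<epsilon>" "\<epsilon> \<le> 1" for \<epsilon> :: real
  proof -
    define T :: "(real^'n) \<times> real \<Rightarrow> (real^'n) \<times> real" where "T z = (fst z /\<^sub>R \<epsilon>, snd z / \<epsilon>\<^sup>2)" for z
    have T: "bounded_linear T"
      unfolding T_def by (intro bounded_linear_Pair bounded_linear_compose[OF bounded_linear_scaleR_right bounded_linear_fst]
          bounded_linear_compose[OF bounded_linear_divide bounded_linear_snd])
    define g where "g z = flat_exp 1 (1 - T z \<bullet> T z)" for z
    have gC: "Ck k g" for k
      using Ck_affine_vimage[OF T bump_algebra_Ck[OF bump_algebra.intros(1)], where k=k and c=0] by (simp add: g_def[abs_def])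
    have g0: "0 \<le> g z" and g1: "g z \<le> 1" for z by (auto simp: g_def flat_exp_1)
    have TT: "T z \<bullet> T z = (norm (fst z) / \<epsilon>)\<^sup>2 + (snd z / \<epsilon>\<^sup>2)\<^sup>2" for z
      using \<epsilon>(1) by (simp add: T_def inner_prod_def power2_norm_eq_inner[symmetric] power2_eq_square power_divide divide_inverse)
    have supp: "norm (fst z) < \<epsilon> \<and> \<bar>snd z\<bar> < \<epsilon>\<^sup>2" if "g z \<noteq> 0" for z
    proof -
      have "T z \<bullet> T z < 1" using that by (auto simp: g_def flat_exp_1 split: if_splits)
      then have "(norm (fst z) / \<epsilon>)\<^sup>2 < 1\<^sup>2" "(snd z / \<epsilon>\<^sup>2)\<^sup>2 < 1\<^sup>2"
        unfolding TT using zero_le_power2[of "norm (fst z) / \<epsilon>"] zero_le_power2[of "snd z / \<epsilon>\<^sup>2"] by (simp_all, linarith+)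
      then have "\<bar>norm (fst z) / \<epsilon>\<bar> < 1" "\<bar>snd z / \<epsilon>\<^sup>2\<bar> < 1"
        using abs_square_less_1 by (metis one_power2)+
      then show ?thesis using \<epsilon> by (simp_all add: abs_divide)
    qed
    have R: "g z = 0" if "norm z > 2" for z
    proof (rule ccontr)
      assume "g z \<noteq> 0"
      from supp[OF this] have "norm (fst z) < 1" "\<bar>snd z\<bar> < 1"
        using \<epsilon> power_le_one[of \<epsilon> 2] by auto
      moreover have "norm z \<le> norm (fst z) + norm (snd z)"
        by (metis norm_Pair_le prod.collapse)
      ultimately show False using that by simp
    qed
    have ig: "integrable lebesgue g"
      by (rule integrable_continuous_bounded_support[OF Ck_imp_continuous[OF gC[of 0]] R])
    \<comment> \<open>The normalising integral is bounded from below by the contribution of a cylinder of half the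
      size, on which the profile is at least \<open>exp (-2)\<close>.\<close>
    define B :: "((real^'n) \<times> real) set" where "B = cball 0 (\<epsilon> / 2) \<times> cball 0 (\<epsilon>\<^sup>2 / 2)"
    have eB: "emeasure lborel B = ennreal (V * (\<epsilon> / 2) ^ CARD('n) * \<epsilon>\<^sup>2)"
    proof -
      have "emeasure lborel B = emeasure lborel (cball (0::real^'n) (\<epsilon> / 2)) * emeasure lborel (cball (0::real) (\<epsilon>\<^sup>2 / 2))"
        unfolding B_def by (subst lborel_prod[symmetric]) (rule lborel.emeasure_pair_measure_Times, auto)
      also have "emeasure lborel (cball (0::real^'n) (\<epsilon> / 2)) = ennreal (V * (\<epsilon> / 2) ^ CARD('n))"
        using \<epsilon> by (subst emeasure_cball) (auto simp: V_def)
      also have "emeasure lborel (cball (0::real) (\<epsilon>\<^sup>2 / 2)) = ennreal (\<epsilon>\<^sup>2)"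
        by (simp add: cball_eq_atLeastAtMost)
      finally show ?thesis using \<open>V > 0\<close> \<epsilon> by (simp add: ennreal_mult')
    qed
    have Bs: "B \<in> sets lborel" unfolding B_def by (simp add: borel_Times)
    have iB: "integrable lebesgue (indicator B :: _ \<Rightarrow> real)"
      using Bs eB by (simp add: integrable_indicator_iff)
    have mB: "measure lebesgue B = V * (\<epsilon> / 2) ^ CARD('n) * \<epsilon>\<^sup>2"
      using eB Bs \<open>V > 0\<close> \<epsilon> by (simp add: measure_def)
    have gB: "exp (-2) * indicator B z \<le> g z" for z
    proof (cases "z \<in> B")
      case True
      then have "norm (fst z) \<le> \<epsilon> / 2" "\<bar>snd z\<bar> \<le> \<epsilon>\<^sup>2 / 2" by (auto simp: B_def mem_Times_iff)
      then have "norm (fst z) / \<epsilon> \<le> 1 / 2" "\<bar>snd z / \<epsilon>\<^sup>2\<bar> \<le> 1 / 2"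
        using \<epsilon> by (auto simp: field_simps abs_divide)
      then have "(norm (fst z) / \<epsilon>)\<^sup>2 \<le> (1 / 2)\<^sup>2" "(snd z / \<epsilon>\<^sup>2)\<^sup>2 \<le> (1 / 2)\<^sup>2"
        using \<epsilon> by (auto intro!: power_mono simp flip: abs_le_square_iff)
      then have *: "1 - T z \<bullet> T z \<ge> 1 / 2" unfolding TT by (simp add: power2_eq_square)
      then have "1 / (1 - T z \<bullet> T z) \<le> 2" by (simp add: field_simps)
      then show ?thesis using * True by (auto simp: g_def flat_exp_1)
    qed (simp add: g0)
    define c where "c = (LINT z|lebesgue. g z)"
    have "exp (-2) * (V * (\<epsilon> / 2) ^ CARD('n) * \<epsilon>\<^sup>2) = (LINT z|lebesgue. exp (-2) * indicator B z)"
      using Bs by (simp add: mB)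
    also have "\<dots> \<le> c" unfolding c_def by (rule integral_mono) (use iB ig gB in auto)
    finally have c: "exp (-2) * (V * (\<epsilon> / 2) ^ CARD('n) * \<epsilon>\<^sup>2) \<le> c" .
    have cC: "exp (-2) * (V * (\<epsilon> / 2) ^ CARD('n) * \<epsilon>\<^sup>2) = \<epsilon> ^ (CARD('n) + 2) / C"
      using \<open>V > 0\<close> by (simp add: C_def exp_minus field_simps power_add power2_eq_square power_divide)
    have "c > 0" using c \<open>C > 0\<close> \<epsilon> unfolding cC by (meson divide_pos_pos less_le_trans zero_less_power)
    have "g z / c \<le> C / \<epsilon> ^ (CARD('n) + 2)" for z
    proof -
      have "g z / c \<le> 1 / c" using g1 \<open>c > 0\<close> by (simp add: divide_right_mono)
      also have "\<dots> \<le> 1 / (\<epsilon> ^ (CARD('n) + 2) / C)"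
        using c \<epsilon> \<open>C > 0\<close> \<open>c > 0\<close> unfolding cC by (intro divide_left_mono) (auto intro!: divide_pos_pos mult_pos_pos)
      finally show ?thesis by simp
    qed
    moreover have "Ck k (\<lambda>z. g z / c)" for k
      by (rule Ck_linear_image[OF bounded_linear_divide gC])
    ultimately show ?thesis
      using g0 supp \<open>c > 0\<close> by (intro exI[of _ "\<lambda>z. g z / c"]) (auto simp: c_def)
  qed
  with \<open>C > 0\<close> show ?thesis by blast
qed

section \<open>Mollification in the double phase setting\<close>

text \<open>Convexity as a bound from below by an affine function: unlike the power itself, such a bound can
  be averaged termwise, which gives Jensen's inequality.\<close>

lemma powr_tangent_le:
  fixes s t m :: real
  assumes "s \<ge> 0" "t \<ge> 0" "m \<ge> 1"
  shows "t powr m + m * t powr (m - 1) * (s - t) \<le> s powr m"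
proof -
  consider "t = 0" | "s = 0" "t > 0" | "s > 0" "t > 0" using assms by fastforce
  then show ?thesis
  proof cases
    case 2
    have "t powr (m - 1) * t = t powr m" using 2 by (simp add: powr_diff)
    then have "t powr m + m * t powr (m - 1) * (s - t) = (1 - m) * t powr m"
      using 2 by (simp add: algebra_simps)
    then show ?thesis using assms 2 by (simp add: mult_nonpos_nonneg)
  next
    case 3
    have "t powr m * (1 + m * (s / t - 1)) \<le> t powr m * (s / t) powr m"
    proof (rule mult_left_mono)
      define x where "x = s / t"
      have "x > 0" using 3 by (simp add: x_def)
      have "convex_on {0<..} (\<lambda>x::real. x powr m)" by (rule powr_convex[OF assms(3)])
      then have "x powr m - 1 powr m \<ge> (m * 1 powr (m - 1)) * (x - 1)"
        by (rule convex_on_imp_above_tangent[where A="{0<..}"])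
          (use \<open>x > 0\<close> in \<open>auto intro!: derivative_eq_intros simp: interior_open\<close>)
      then show "1 + m * (s / t - 1) \<le> (s / t) powr m" by (simp add: x_def)
    qed simp
    moreover have "t powr m * (s / t) powr m = s powr m" using 3 by (simp add: powr_divide)
    moreover have "t powr (m - 1) * t = t powr m" using 3 by (simp add: powr_diff)
    then have "t powr m * (1 + m * (s / t - 1)) = t powr m + m * t powr (m - 1) * (s - t)"
      using 3 by (simp add: field_simps)
    ultimately show ?thesis by simp
  qed (use assms in simp)
qed

lemma powr_young_crude:
  fixes s t m :: real
  assumes "s \<ge> 0" "t \<ge> 0" "m > 1"
  shows "s powr (m - 1) * t \<le> s powr m + t powr m"
proof -
  have eq: "x powr (m - 1) * x = x powr m" if "x \<ge> 0" for x :: real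
    using that by (cases "x = 0") (auto simp: powr_diff)
  show ?thesis
  proof (cases "t \<le> s")
    case True
    then have "s powr (m - 1) * t \<le> s powr (m - 1) * s" by (simp add: mult_left_mono)
    then show ?thesis using eq[of s] assms by (simp add: add_increasing2)
  next
    case False
    then have "s powr (m - 1) * t \<le> t powr (m - 1) * t"
      using assms by (intro mult_right_mono powr_mono2) auto
    then show ?thesis using eq[of t] assms by (simp add: add_increasing)
  qed
qed

lemma conv_abs_le:
  fixes \<phi> :: "'a::euclidean_space \<Rightarrow> real"
  assumes "\<And>x. 0 \<le> \<phi> x"
  shows "\<bar>conv \<phi> f z\<bar> \<le> conv \<phi> (\<lambda>y. \<bar>f y\<bar>) z"
proof -
  have "\<bar>conv \<phi> f z\<bar> \<le> (LINT y|lebesgue. \<bar>\<phi> (z - y) * f y\<bar>)"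
    unfolding conv_def by (rule integral_abs_bound)
  then show ?thesis using assms by (simp add: abs_mult conv_def)
qed

locale mollifier =
  fixes \<phi> :: "'a::euclidean_space \<Rightarrow> real" and R :: real
  assumes cont: "continuous_on UNIV \<phi>" and R: "\<And>x. norm x > R \<Longrightarrow> \<phi> x = 0"
    and pos: "\<And>x. 0 \<le> \<phi> x" and int1: "(LINT x|lebesgue. \<phi> x) = 1"
begin

lemma int: "integrable lebesgue \<phi>"
  by (rule integrable_continuous_bounded_support[OF cont R])

lemma conv_int: "integrable lebesgue f \<Longrightarrow> integrable lebesgue (\<lambda>y. \<phi> (z - y) * f y)"
  by (rule conv_integrable[OF cont R])

lemma int_reflect: "integrable lebesgue (\<lambda>y. \<phi> (z - y))" "(LINT y|lebesgue. \<phi> (z - y)) = 1"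
  using integrable_reflect_point[OF int, of z] integral_reflect_point[OF int, of z] int1 by auto

lemma conv_affine: "integrable lebesgue f \<Longrightarrow>
    (LINT y|lebesgue. \<phi> (z - y) * (c + d * f y)) = c + d * conv \<phi> f z"
    "integrable lebesgue f \<Longrightarrow> integrable lebesgue (\<lambda>y. \<phi> (z - y) * (c + d * f y))"
proof -
  assume f: "integrable lebesgue f"
  have *: "(\<lambda>y. \<phi> (z - y) * (c + d * f y)) = (\<lambda>y. c * \<phi> (z - y) + d * (\<phi> (z - y) * f y))"
    by (auto simp: algebra_simps)
  show "(LINT y|lebesgue. \<phi> (z - y) * (c + d * f y)) = c + d * conv \<phi> f z"
    unfolding * using int_reflect[of z] conv_int[OF f, of z] by (simp add: conv_def)
  show "integrable lebesgue (\<lambda>y. \<phi> (z - y) * (c + d * f y))"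
    unfolding * using int_reflect[of z] conv_int[OF f, of z] by simp
qed

lemma conv_ge_affine:
  assumes f: "integrable lebesgue f" and G: "integrable lebesgue G"
    and "\<And>y. \<phi> (z - y) \<noteq> 0 \<Longrightarrow> c + d * f y \<le> G y"
  shows "c + d * conv \<phi> f z \<le> conv \<phi> G z"
proof -
  have "c + d * conv \<phi> f z = (LINT y|lebesgue. \<phi> (z - y) * (c + d * f y))"
    by (simp add: conv_affine(1)[OF f])
  also have "\<dots> \<le> conv \<phi> G z"
    unfolding conv_def
  proof (rule integral_mono[OF conv_affine(2)[OF f] conv_int[OF G]])
    show "\<phi> (z - y) * (c + d * f y) \<le> \<phi> (z - y) * G y" for y
      by (cases "\<phi> (z - y) = 0") (use assms(3) pos in \<open>auto intro: mult_left_mono\<close>)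
  qed
  finally show ?thesis .
qed

lemma conv_nonneg: "(\<And>y. \<phi> (z - y) \<noteq> 0 \<Longrightarrow> 0 \<le> f y) \<Longrightarrow> 0 \<le> conv \<phi> f z"
  unfolding conv_def using pos by (intro integral_nonneg_AE AE_I2) (metis mult_eq_0_iff mult_nonneg_nonneg order_refl)

text \<open>Jensen's inequality, by averaging the tangent at the mollified value.\<close>

lemma conv_powr_le:
  assumes g: "integrable lebesgue g" and G: "integrable lebesgue G" and m: "m \<ge> 1"
    and g0: "\<And>y. 0 \<le> g y" and "\<And>y. \<phi> (z - y) \<noteq> 0 \<Longrightarrow> g y powr m \<le> G y"
  shows "conv \<phi> g z powr m \<le> conv \<phi> G z"
proof -
  define t where "t = conv \<phi> g z"
  have "t \<ge> 0" unfolding t_def by (rule conv_nonneg) (rule g0)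
  have "(t powr m - m * t powr (m - 1) * t) + m * t powr (m - 1) * conv \<phi> g z \<le> conv \<phi> G z"
  proof (rule conv_ge_affine[OF g G])
    fix y assume "\<phi> (z - y) \<noteq> 0"
    then show "t powr m - m * t powr (m - 1) * t + m * t powr (m - 1) * g y \<le> G y"
      using assms(5)[of y] powr_tangent_le[OF g0[of y] \<open>t \<ge> 0\<close> m] by (simp add: algebra_simps)
  qed
  then show ?thesis by (simp add: t_def)
qed

text \<open>The coefficient inside the mollification is replaced by the constant \<open>max 0 (a y - \<kappa>)\<close>, which is
  a lower bound for it on the support of the kernel; with a constant coefficient Jensen's
  inequality applies. Going back to \<open>a y\<close> costs \<open>\<kappa>\<close> times the \<open>q\<close>-th power of the mollified
  function, and \<open>M\<close> bounds this cost by the \<open>p\<close>-th power.\<close>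

lemma conv_double_phase_le:
  assumes g: "integrable lebesgue g" and G: "integrable lebesgue G" and pq: "1 \<le> p" "p \<le> q"
    and g0: "\<And>y. 0 \<le> g y" and \<kappa>: "0 \<le> \<kappa>"
    and a0: "\<And>y. \<phi> (z - y) \<noteq> 0 \<Longrightarrow> 0 \<le> a y"
    and osc: "\<And>y y'. \<phi> (z - y) \<noteq> 0 \<Longrightarrow> \<phi> (z - y') \<noteq> 0 \<Longrightarrow> a y \<le> a y' + \<kappa>"
    and GG: "\<And>y. \<phi> (z - y) \<noteq> 0 \<Longrightarrow> g y powr p + a y * g y powr q \<le> G y"
    and M: "\<kappa> * conv \<phi> g z powr (q - p) \<le> M"
    and y: "\<phi> (z - y) \<noteq> 0"
  shows "conv \<phi> g z powr p + a y * conv \<phi> g z powr q \<le> (1 + M) * conv \<phi> G z"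
proof -
  define t where "t = conv \<phi> g z"
  have "t \<ge> 0" unfolding t_def by (rule conv_nonneg) (rule g0)
  define m where "m = max 0 (a y - \<kappa>)"
  have "m \<ge> 0" by (simp add: m_def)
  define s where "s = p * t powr (p - 1) + m * (q * t powr (q - 1))"
  have "(t powr p + m * t powr q - s * t) + s * conv \<phi> g z \<le> conv \<phi> G z"
  proof (rule conv_ge_affine[OF g G])
    fix y' assume y': "\<phi> (z - y') \<noteq> 0"
    have "m \<le> a y'" using a0[OF y'] osc[OF y y'] by (simp add: m_def)
    have "t powr p + p * t powr (p - 1) * (g y' - t) \<le> g y' powr p"
      by (rule powr_tangent_le[OF g0 \<open>t \<ge> 0\<close> pq(1)])
    moreover have "m * (t powr q + q * t powr (q - 1) * (g y' - t)) \<le> m * g y' powr q"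
      using pq by (intro mult_left_mono powr_tangent_le g0 \<open>t \<ge> 0\<close> \<open>m \<ge> 0\<close>) auto
    moreover have "m * g y' powr q \<le> a y' * g y' powr q"
      using \<open>m \<le> a y'\<close> by (intro mult_right_mono) auto
    ultimately show "t powr p + m * t powr q - s * t + s * g y' \<le> G y'"
      using GG[OF y'] by (simp add: s_def algebra_simps)
  qed
  then have main: "t powr p + m * t powr q \<le> conv \<phi> G z" by (simp add: t_def)
  have "M \<ge> 0" using M \<kappa> by (meson mult_nonneg_nonneg order_trans powr_ge_zero)
  have "t powr q = t powr (q - p) * t powr p" by (simp flip: powr_add)
  then have "\<kappa> * t powr q \<le> M * t powr p"
    using mult_right_mono[OF M, of "t powr p"] by (simp add: t_def mult.assoc)
  moreover have "a y * t powr q \<le> (m + \<kappa>) * t powr q"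
    by (intro mult_right_mono) (auto simp: m_def)
  ultimately have "t powr p + a y * t powr q \<le> (1 + M) * t powr p + m * t powr q"
    by (simp add: algebra_simps)
  also have "\<dots> \<le> (1 + M) * (t powr p + m * t powr q)"
    using \<open>M \<ge> 0\<close> \<open>m \<ge> 0\<close> by (simp add: algebra_simps)
  also have "\<dots> \<le> (1 + M) * conv \<phi> G z" using main \<open>M \<ge> 0\<close> by (intro mult_left_mono) auto
  finally show ?thesis by (simp add: t_def)
qed

text \<open>Young's inequality is applied at each point \<open>y\<close> of the support of the kernel, to the flux at \<open>y\<close>
  and the mollified value of \<open>|w|\<close> at \<open>z\<close>. The energy of the latter, with the coefficient at \<open>y\<close>,
  is under control for all these \<open>y\<close> at once.\<close>

lemma conv_flux_product_le:
  assumes b: "integrable lebesgue b" and w: "integrable lebesgue w"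
    and F: "integrable lebesgue F" and G: "integrable lebesgue G" and pq: "1 < p" "p \<le> q"
    and f0: "\<And>y. 0 \<le> f y" and \<kappa>: "0 \<le> \<kappa>" and C: "0 \<le> C"
    and a0: "\<And>y. \<phi> (z - y) \<noteq> 0 \<Longrightarrow> 0 \<le> a y"
    and osc: "\<And>y y'. \<phi> (z - y) \<noteq> 0 \<Longrightarrow> \<phi> (z - y') \<noteq> 0 \<Longrightarrow> a y \<le> a y' + \<kappa>"
    and bb: "\<And>y. \<phi> (z - y) \<noteq> 0 \<Longrightarrow> \<bar>b y\<bar> \<le> C * (f y powr (p - 1) + a y * f y powr (q - 1))"
    and FF: "\<And>y. \<phi> (z - y) \<noteq> 0 \<Longrightarrow> f y powr p + a y * f y powr q \<le> F y"
    and GG: "\<And>y. \<phi> (z - y) \<noteq> 0 \<Longrightarrow> \<bar>w y\<bar> powr p + a y * \<bar>w y\<bar> powr q \<le> G y"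
    and M: "\<kappa> * conv \<phi> (\<lambda>y. \<bar>w y\<bar>) z powr (q - p) \<le> M"
  shows "\<bar>conv \<phi> b z * conv \<phi> w z\<bar> \<le> conv \<phi> (\<lambda>y. C * F y + C * (1 + M) * G y) z"
proof -
  define t where "t = conv \<phi> (\<lambda>y. \<bar>w y\<bar>) z"
  have "t \<ge> 0" unfolding t_def by (rule conv_nonneg) simp
  have aw: "integrable lebesgue (\<lambda>y. \<bar>w y\<bar>)" and ab: "integrable lebesgue (\<lambda>y. \<bar>b y\<bar>)" using w b by auto
  define D where "D = (1 + M) * conv \<phi> G z"
  have D: "t powr p + a y * t powr q \<le> D" if "\<phi> (z - y) \<noteq> 0" for y
    unfolding t_def D_def
    by (rule conv_double_phase_le[OF aw G _ pq(2) _ \<kappa> a0 osc GG M that]) (use pq in auto)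
  have "\<bar>conv \<phi> b z * conv \<phi> w z\<bar> \<le> conv \<phi> (\<lambda>y. \<bar>b y\<bar>) z * t"
    unfolding abs_mult t_def by (intro mult_mono conv_abs_le pos conv_nonneg) auto
  also have "\<dots> \<le> C * conv \<phi> F z + C * D"
  proof -
    have "- (C * D) + t * conv \<phi> (\<lambda>y. \<bar>b y\<bar>) z \<le> conv \<phi> (\<lambda>y. C * F y) z"
    proof (rule conv_ge_affine[OF ab])
      fix y assume y: "\<phi> (z - y) \<noteq> 0"
      have "t * \<bar>b y\<bar> \<le> C * (f y powr (p - 1) * t + a y * (f y powr (q - 1) * t))"
        using mult_left_mono[OF bb[OF y] \<open>t \<ge> 0\<close>] by (simp add: algebra_simps)
      also have "\<dots> \<le> C * ((f y powr p + t powr p) + a y * (f y powr q + t powr q))"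
        using pq by (intro mult_left_mono add_mono powr_young_crude C a0[OF y] f0 \<open>t \<ge> 0\<close>) auto
      also have "\<dots> = C * (f y powr p + a y * f y powr q) + C * (t powr p + a y * t powr q)"
        by (simp add: algebra_simps)
      also have "\<dots> \<le> C * F y + C * D"
        using C by (intro add_mono mult_left_mono FF[OF y] D[OF y])
      finally show "- (C * D) + t * \<bar>b y\<bar> \<le> C * F y" by simp
    qed (use F in simp)
    moreover have "conv \<phi> (\<lambda>y. C * F y) z = C * conv \<phi> F z"
      using conv_affine(1)[OF F, of z 0 C] by (simp add: conv_def)
    ultimately show ?thesis by (simp add: mult.commute)
  qed
  also have "\<dots> = conv \<phi> (\<lambda>y. C * F y + C * (1 + M) * G y) z"
  proof -
    have "(\<lambda>y. \<phi> (z - y) * (C * F y + C * (1 + M) * G y))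
        = (\<lambda>y. C * (\<phi> (z - y) * F y) + C * (1 + M) * (\<phi> (z - y) * G y))"
      by (auto simp: algebra_simps)
    then show ?thesis
      unfolding conv_def D_def using conv_int[OF F, of z] conv_int[OF G, of z] by simp
  qed
  finally show ?thesis .
qed

end

section \<open>The energy identity\<close>

abbreviation pd :: "('a::euclidean_space \<Rightarrow> real) \<Rightarrow> 'a \<Rightarrow> 'a \<Rightarrow> real" where
  "pd f b z \<equiv> frechet_derivative f (at z) b"

abbreviation xdir :: "'n \<Rightarrow> (real^'n) \<times> real" where "xdir j \<equiv> (axis j 1, 0)"
abbreviation tdir :: "(real^'n) \<times> real" where "tdir \<equiv> (0, 1)"

lemma xdir_Basis: "xdir j \<in> Basis" and tdir_Basis: "tdir \<in> Basis"
  by (auto simp: Basis_prod_def axis_in_Basis_iff)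

lemma pd_mult:
  assumes "Ck (Suc 0) f" "Ck (Suc 0) g"
  shows "pd (\<lambda>x. f x * g x) h x = f x * pd g h x + pd f h x * g x"
  using frechet_derivative_eqI[OF has_derivative_mult[OF Ck_has_derivative[OF assms(1)] Ck_has_derivative[OF assms(2)]]]
  by simp

lemma pd_reflect:
  assumes "Ck (Suc 0) \<phi>"
  shows "pd (\<lambda>y. \<phi> (z - y)) h y = - pd \<phi> h (z - y)"
proof -
  have "((\<lambda>y. z - y) has_derivative (\<lambda>h. - h)) (at y)" by (auto intro!: derivative_eq_intros)
  from diff_chain_at[OF this Ck_has_derivative[OF assms]]
  have "((\<lambda>y. \<phi> (z - y)) has_derivative (\<lambda>h. frechet_derivative \<phi> (at (z - y)) (- h))) (at y)"
    by (simp add: o_def)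
  moreover have "frechet_derivative \<phi> (at (z - y)) (- h) = - pd \<phi> h (z - y)"
    by (rule linear_neg[OF has_derivative_linear[OF Ck_has_derivative[OF assms]]])
  ultimately show ?thesis by (simp add: frechet_derivative_eqI)
qed

lemma Ck_pd_continuous: "Ck (Suc 0) f \<Longrightarrow> b \<in> Basis \<Longrightarrow> continuous_on UNIV (pd f b)"
  by simp

text \<open>Testing with \<open>y \<mapsto> \<phi> (z - y)\<close> turns the weak equations into pointwise equations for the mollified
  functions at \<open>z\<close>. They may be multiplied by \<open>\<eta>\<close> times the mollified \<open>v\<close>, and two integrations by
  parts give the identity.\<close>

lemma mollified_energy_identity:
  fixes v :: "(real^'n) \<times> real \<Rightarrow> real" and V B :: "'n \<Rightarrow> (real^'n) \<times> real \<Rightarrow> real"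
  assumes v: "integrable lebesgue v" and B: "\<And>j. integrable lebesgue (B j)"
    and W1: "\<And>\<zeta> j. test_function Q \<zeta> \<Longrightarrow>
      (LINT z|lebesgue. v z * pd \<zeta> (xdir j) z) = - (LINT z|lebesgue. V j z * \<zeta> z)"
    and W2: "\<And>\<zeta>. test_function Q \<zeta> \<Longrightarrow>
      (LINT z|lebesgue. v z * pd \<zeta> tdir z) = (\<Sum>j\<in>UNIV. LINT z|lebesgue. B j z * pd \<zeta> (xdir j) z)"
    and \<phi>: "Ck (Suc 0) \<phi>" and R: "\<And>x. norm x > R \<Longrightarrow> \<phi> x = 0"
    and \<eta>: "Ck (Suc 0) \<eta>" and R': "\<And>x. norm x > R' \<Longrightarrow> \<eta> x = 0"
    and test: "\<And>z. \<eta> z \<noteq> 0 \<Longrightarrow> test_function Q (\<lambda>y. \<phi> (z - y))"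
  shows "(1/2) * (LINT z|lebesgue. pd \<eta> tdir z * (conv \<phi> v z * conv \<phi> v z)) =
    (\<Sum>j\<in>UNIV. (LINT z|lebesgue. pd \<eta> (xdir j) z * (conv \<phi> (B j) z * conv \<phi> v z))
             + (LINT z|lebesgue. \<eta> z * (conv \<phi> (B j) z * conv \<phi> (V j) z)))"
proof -
  let ?w = "conv \<phi> v" and ?c = "\<lambda>j. conv \<phi> (B j)"
  have w: "Ck (Suc 0) ?w" and dw: "pd ?w h z = conv (pd \<phi> h) v z" for h z
    by (rule conv_C1(1)[where R=R, OF \<phi> _ v] conv_C1(2)[where R=R, OF \<phi> _ v]; use R in blast)+
  have c: "Ck (Suc 0) (?c j)" and dc: "pd (?c j) h z = conv (pd \<phi> h) (B j) z" for j h z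
    by (rule conv_C1(1)[where R=R, OF \<phi> _ B] conv_C1(2)[where R=R, OF \<phi> _ B]; use R in blast)+
  have testing: "(LINT y|lebesgue. f y * pd (\<lambda>y. \<phi> (z - y)) h y) = - conv (pd \<phi> h) f z" for f h z
    unfolding conv_def pd_reflect[OF \<phi>] by (simp add: mult.commute)
  have wt: "pd ?w tdir z = (\<Sum>j\<in>UNIV. pd (?c j) (xdir j) z)" if "\<eta> z \<noteq> 0" for z
    using W2[OF test[OF that]] unfolding testing dw dc by (simp add: sum_negf)
  have wx: "pd ?w (xdir j) z = conv \<phi> (V j) z" if "\<eta> z \<noteq> 0" for z j
    using W1[OF test[OF that], of j] unfolding testing dw by (simp add: conv_def mult.commute)
  have \<eta>0: "pd \<eta> h x = 0" if "norm x > R'" for h x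
    by (rule frechet_derivative_zero_outside[where R=R']) (use R' that in auto)
  note cont = Ck_pd_continuous[OF \<eta> tdir_Basis] Ck_pd_continuous[OF \<eta> xdir_Basis]
    Ck_pd_continuous[OF w tdir_Basis] Ck_pd_continuous[OF w xdir_Basis] Ck_pd_continuous[OF c xdir_Basis]
    Ck_imp_continuous[OF \<eta>] Ck_imp_continuous[OF w] Ck_imp_continuous[OF c]
  have int: "integrable lebesgue f"
    if "continuous_on UNIV f" "\<And>x. norm x > R' \<Longrightarrow> f x = 0" for f :: "(real^'n) \<times> real \<Rightarrow> real"
    using that by (rule integrable_continuous_bounded_support)
  have e1: "(LINT z|lebesgue. pd \<eta> tdir z * (?w z * ?w z)) = - 2 * (LINT z|lebesgue. \<eta> z * (?w z * pd ?w tdir z))"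
  proof -
    have "(LINT z|lebesgue. pd (\<lambda>z. \<eta> z * (?w z * ?w z)) tdir z) = 0"
      by (rule integral_frechet_derivative_zero(2)[where R=R', OF Ck_mult[OF \<eta> Ck_mult[OF w w]] _ tdir_Basis]) (simp add: R')
    moreover have "pd (\<lambda>z. \<eta> z * (?w z * ?w z)) tdir z = 2 * (\<eta> z * (?w z * pd ?w tdir z)) + pd \<eta> tdir z * (?w z * ?w z)" for z
      by (simp add: pd_mult[OF \<eta> Ck_mult[OF w w]] pd_mult[OF w w] algebra_simps del: Ck.simps)
    moreover have "integrable lebesgue (\<lambda>z. \<eta> z * (?w z * pd ?w tdir z))"
      "integrable lebesgue (\<lambda>z. pd \<eta> tdir z * (?w z * ?w z))"
      by (intro int continuous_intros cont; simp add: R' \<eta>0)+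
    ultimately show ?thesis by simp
  qed
  have e2: "(LINT z|lebesgue. \<eta> z * (?w z * pd (?c j) (xdir j) z)) =
      - (LINT z|lebesgue. pd \<eta> (xdir j) z * (?c j z * ?w z)) - (LINT z|lebesgue. \<eta> z * (?c j z * conv \<phi> (V j) z))" for j
  proof -
    have "(LINT z|lebesgue. pd (\<lambda>z. \<eta> z * (?c j z * ?w z)) (xdir j) z) = 0"
      by (rule integral_frechet_derivative_zero(2)[where R=R', OF Ck_mult[OF \<eta> Ck_mult[OF c w]] _ xdir_Basis]) (simp add: R')
    moreover have "pd (\<lambda>z. \<eta> z * (?c j z * ?w z)) (xdir j) z =
        \<eta> z * (?w z * pd (?c j) (xdir j) z) + pd \<eta> (xdir j) z * (?c j z * ?w z) + \<eta> z * (?c j z * pd ?w (xdir j) z)" for z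
      unfolding pd_mult[OF \<eta> Ck_mult[OF c w]] pd_mult[OF c w] by (simp add: algebra_simps)
    moreover have "integrable lebesgue (\<lambda>z. \<eta> z * (?w z * pd (?c j) (xdir j) z))"
      "integrable lebesgue (\<lambda>z. pd \<eta> (xdir j) z * (?c j z * ?w z))"
      "integrable lebesgue (\<lambda>z. \<eta> z * (?c j z * pd ?w (xdir j) z))"
      by (intro int continuous_intros cont; simp add: R' \<eta>0)+
    ultimately have "(LINT z|lebesgue. \<eta> z * (?w z * pd (?c j) (xdir j) z))
        + (LINT z|lebesgue. pd \<eta> (xdir j) z * (?c j z * ?w z)) + (LINT z|lebesgue. \<eta> z * (?c j z * pd ?w (xdir j) z)) = 0"
      by simp
    moreover have "(LINT z|lebesgue. \<eta> z * (?c j z * pd ?w (xdir j) z)) = (LINT z|lebesgue. \<eta> z * (?c j z * conv \<phi> (V j) z))"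
      by (intro arg_cong[where f="integral\<^sup>L lebesgue"]) (use wx in fastforce)
    ultimately show ?thesis by linarith
  qed
  have "(LINT z|lebesgue. \<eta> z * (?w z * pd ?w tdir z)) = (LINT z|lebesgue. (\<Sum>j\<in>UNIV. \<eta> z * (?w z * pd (?c j) (xdir j) z)))"
  proof (rule Bochner_Integration.integral_cong[OF refl])
    show "\<eta> z * (?w z * pd ?w tdir z) = (\<Sum>j\<in>UNIV. \<eta> z * (?w z * pd (?c j) (xdir j) z))" for z
      using wt[of z] by (cases "\<eta> z = 0") (simp_all add: sum_distrib_left)
  qed
  also have "\<dots> = (\<Sum>j\<in>UNIV. LINT z|lebesgue. \<eta> z * (?w z * pd (?c j) (xdir j) z))"
    by (rule Bochner_Integration.integral_sum) (intro int continuous_intros cont; simp add: R')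
  finally show ?thesis
    unfolding e1 e2 by (simp add: sum_subtractf sum_negf sum.distrib)
qed

lemma holder_quotient_le:
  fixes x :: "'a::real_normed_vector"
  assumes "0 < \<alpha>" "\<alpha> \<le> 1" "0 < \<epsilon>" "norm x \<le> 2 * \<epsilon>" "\<bar>t\<bar> \<le> 2 * \<epsilon>\<^sup>2"
  shows "norm x powr \<alpha> + \<bar>t\<bar> powr (\<alpha> / 2) \<le> 4 * \<epsilon> powr \<alpha>"
proof -
  have two: "(2::real) powr \<alpha> \<le> 2 powr 1" "(2::real) powr (\<alpha> / 2) \<le> 2 powr 1"
    using assms by (intro powr_mono; simp)+
  have "norm x powr \<alpha> \<le> (2 * \<epsilon>) powr \<alpha>" using assms by (intro powr_mono2) auto
  also have "\<dots> \<le> 2 * \<epsilon> powr \<alpha>" using two by (simp add: powr_mult mult_right_mono)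
  finally have 1: "norm x powr \<alpha> \<le> 2 * \<epsilon> powr \<alpha>" .
  have "\<bar>t\<bar> powr (\<alpha> / 2) \<le> (2 * \<epsilon>\<^sup>2) powr (\<alpha> / 2)" using assms by (intro powr_mono2) auto
  also have "\<dots> = 2 powr (\<alpha> / 2) * \<epsilon> powr \<alpha>"
    using assms by (simp add: powr_mult powr_powr flip: powr_numeral)
  also have "\<dots> \<le> 2 * \<epsilon> powr \<alpha>" using two by (simp add: mult_right_mono)
  finally show ?thesis using 1 by simp
qed

text \<open>Here the bound on \<open>q\<close> is used: a function whose \<open>p\<close>-th power is of order \<open>\<epsilon>\<close> to the power \<open>-N\<close>
  has a \<open>(q - p)\<close>-th power of order \<open>\<epsilon>\<close> to the power \<open>-N (q - p) / p\<close>, and this is compensated by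
  \<open>\<epsilon>\<^sup>\<alpha>\<close>.\<close>

lemma powr_divide_power_le:
  fixes I t \<epsilon> p q \<alpha> :: real
  assumes \<epsilon>: "0 < \<epsilon>" "\<epsilon> \<le> 1" and pq: "0 < p" "p \<le> q" "q \<le> p + p * \<alpha> / real N" and N: "N > 0" and I: "0 \<le> I"
    and t: "0 \<le> t" "t powr p \<le> I / \<epsilon> ^ N"
  shows "\<epsilon> powr \<alpha> * t powr (q - p) \<le> I powr ((q - p) / p)"
proof -
  define e where "e = (q - p) / p"
  have "e \<ge> 0" using pq by (simp add: e_def)
  have "t powr (q - p) = (t powr p) powr e" using pq by (simp add: e_def powr_powr)
  also have "\<dots> \<le> (I / \<epsilon> ^ N) powr e" using t \<open>e \<ge> 0\<close> by (intro powr_mono2) auto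
  also have "\<dots> = I powr e * \<epsilon> powr (- (real N * e))"
  proof -
    have "(\<epsilon> ^ N) powr e = \<epsilon> powr (real N * e)" using \<epsilon> by (simp add: powr_powr flip: powr_realpow)
    then show ?thesis using powr_divide[of I "\<epsilon> ^ N" e] \<epsilon> I by (simp add: powr_minus divide_inverse)
  qed
  finally have "t powr (q - p) \<le> I powr e * \<epsilon> powr (- (real N * e))" .
  then have "\<epsilon> powr \<alpha> * t powr (q - p) \<le> \<epsilon> powr \<alpha> * (I powr e * \<epsilon> powr (- (real N * e)))"
    by (rule mult_left_mono) simp
  also have "\<dots> = I powr e * (\<epsilon> powr \<alpha> * \<epsilon> powr (- (real N * e)))" by (simp only: mult.left_commute)
  also have "\<dots> \<le> I powr e * 1"
  proof (rule mult_left_mono)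
    have "(q - p) / p \<le> \<alpha> / real N" using pq N by (simp add: field_simps)
    then have "real N * e \<le> \<alpha>" using N by (simp add: e_def field_simps)
    then show "\<epsilon> powr \<alpha> * \<epsilon> powr (- (real N * e)) \<le> 1"
      using \<epsilon> by (simp add: powr_le1 flip: powr_add)
  qed simp
  finally show ?thesis by (simp add: e_def)
qed

lemma parabolic_test_function:
  fixes z :: "(real^'n) \<times> real"
  assumes \<phi>: "\<And>k. Ck k \<phi>" and supp: "\<And>z. \<phi> z \<noteq> 0 \<Longrightarrow> norm (fst z) < \<epsilon> \<and> \<bar>snd z\<bar> < \<epsilon>\<^sup>2"
    and box: "\<And>y. norm (fst z - fst y) \<le> \<epsilon> \<Longrightarrow> \<bar>snd z - snd y\<bar> \<le> \<epsilon>\<^sup>2 \<Longrightarrow> y \<in> Q"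
  shows "test_function Q (\<lambda>y. \<phi> (z - y))"
proof -
  define S where "S = {y :: (real^'n) \<times> real. norm (fst z - fst y) \<le> \<epsilon> \<and> \<bar>snd z - snd y\<bar> \<le> \<epsilon>\<^sup>2}"
  have "closed S"
    unfolding S_def by (intro closed_Collect_conj closed_Collect_le continuous_intros)
  have "{y. \<phi> (z - y) \<noteq> 0} \<subseteq> S" unfolding S_def using supp by fastforce
  then have cl: "closure {y. \<phi> (z - y) \<noteq> 0} \<subseteq> S" using \<open>closed S\<close> by (rule closure_minimal)
  have "bounded S"
  proof -
    have "S \<subseteq> cball (fst z) \<epsilon> \<times> cball (snd z) (\<epsilon>\<^sup>2)" by (auto simp: S_def dist_norm)
    then show ?thesis by (rule bounded_subset[OF bounded_Times[OF bounded_cball bounded_cball]])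
  qed
  then have "compact (closure {y. \<phi> (z - y) \<noteq> 0})"
    using cl by (meson bounded_subset closed_closure compact_eq_bounded_closed)
  moreover have "Ck k (\<lambda>y. \<phi> (z - y))" for k
    using Ck_affine_vimage[OF bounded_linear_minus[OF bounded_linear_ident] \<phi>[of k], of z] by simp
  moreover have "S \<subseteq> Q" using box by (auto simp: S_def)
  ultimately show ?thesis using cl by (auto simp: test_function_def)
qed

text \<open>The limit of \<open>mollified_energy_identity\<close> along kernels of size tending to \<open>0\<close>. The functions \<open>f\<close>,
  \<open>F\<close> and \<open>G\<close> are majorants: \<open>f\<close> of the size of the gradient that determines the flux, \<open>F\<close> and \<open>G\<close>
  of the energies.\<close>

lemma energy_identity:
  fixes v :: "(real^'n) \<times> real \<Rightarrow> real" and V B :: "'n \<Rightarrow> (real^'n) \<times> real \<Rightarrow> real"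
    and Q :: "((real^'n) \<times> real) set"
  assumes v: "integrable lebesgue v" "integrable lebesgue (\<lambda>z. v z * v z)"
    and V: "\<And>j. integrable lebesgue (V j)" and B: "\<And>j. integrable lebesgue (B j)"
    and W1: "\<And>\<zeta> j. test_function Q \<zeta> \<Longrightarrow>
      (LINT z|lebesgue. v z * pd \<zeta> (xdir j) z) = - (LINT z|lebesgue. V j z * \<zeta> z)"
    and W2: "\<And>\<zeta>. test_function Q \<zeta> \<Longrightarrow>
      (LINT z|lebesgue. v z * pd \<zeta> tdir z) = (\<Sum>j\<in>UNIV. LINT z|lebesgue. B j z * pd \<zeta> (xdir j) z)"
    and pq: "1 < p" "p \<le> q" "q \<le> p + p * \<alpha> / (real CARD('n) + 2)" and \<alpha>: "0 < \<alpha>" "\<alpha> \<le> 1"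
    and a0: "\<And>y. y \<in> Q \<Longrightarrow> 0 \<le> a y"
    and hol: "\<And>y y'. y \<in> Q \<Longrightarrow> y' \<in> Q \<Longrightarrow>
      \<bar>a y - a y'\<bar> \<le> L * (norm (fst y - fst y') powr \<alpha> + \<bar>snd y - snd y'\<bar> powr (\<alpha> / 2))" and L: "0 \<le> L"
    and f0: "\<And>y. 0 \<le> f y" and C: "0 \<le> C"
    and bB: "\<And>y j. y \<in> Q \<Longrightarrow> \<bar>B j y\<bar> \<le> C * (f y powr (p - 1) + a y * f y powr (q - 1))"
    and F: "integrable lebesgue F" "\<And>y. y \<in> Q \<Longrightarrow> f y powr p + a y * f y powr q \<le> F y"
    and G: "integrable lebesgue G" "\<And>y. y \<in> Q \<Longrightarrow> \<bar>v y\<bar> powr p + a y * \<bar>v y\<bar> powr q \<le> G y"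
      "\<And>y j. y \<in> Q \<Longrightarrow> \<bar>V j y\<bar> powr p + a y * \<bar>V j y\<bar> powr q \<le> G y"
    and Q: "open Q" and K: "compact K" "K \<subseteq> Q"
    and \<eta>: "Ck (Suc 0) \<eta>" "\<And>z. z \<notin> K \<Longrightarrow> \<eta> z = 0"
  shows "(1/2) * (LINT z|lebesgue. pd \<eta> tdir z * (v z * v z)) =
    (\<Sum>j\<in>UNIV. (LINT z|lebesgue. pd \<eta> (xdir j) z * (B j z * v z))
             + (LINT z|lebesgue. \<eta> z * (B j z * V j z)))"
proof -
  have "\<exists>d>0. \<forall>x\<in>K. \<forall>y\<in>-Q. d \<le> dist x y"
    by (intro separate_compact_closed K(1) closed_Compl Q) (use K(2) in auto)
  then obtain d where d: "d > 0" "\<And>x y. x \<in> K \<Longrightarrow> y \<in> - Q \<Longrightarrow> d \<le> dist x y" by blast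
  \<comment> \<open>Points of a parabolic cylinder of size \<open>\<epsilon> \<le> 1\<close> have distance at most \<open>2 \<epsilon>\<close> from its centre, so
    that the cylinders centred in \<open>K\<close> stay in \<open>Q\<close>.\<close>
  define \<epsilon> where "\<epsilon> k = min 1 (d / 3) / real (Suc k)" for k
  have \<epsilon>: "0 < \<epsilon> k" "\<epsilon> k \<le> 1" "\<epsilon> k \<le> d / 3" for k
  proof -
    show "0 < \<epsilon> k" using d(1) by (simp add: \<epsilon>_def)
    have "\<epsilon> k \<le> min 1 (d / 3) / 1" unfolding \<epsilon>_def using d(1) by (intro divide_left_mono) auto
    then show "\<epsilon> k \<le> 1" "\<epsilon> k \<le> d / 3" by auto
  qed
  have \<epsilon>lim: "\<epsilon> \<longlonglongrightarrow> 0" unfolding \<epsilon>_def by (intro LIMSEQ_Suc lim_const_over_n)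
  obtain C\<phi> where C\<phi>: "C\<phi> > 0" "\<And>\<epsilon>. 0 < \<epsilon> \<Longrightarrow> \<epsilon> \<le> 1 \<Longrightarrow> (\<exists>\<phi> :: (real^'n) \<times> real \<Rightarrow> real. (\<forall>k. Ck k \<phi>) \<and> (\<forall>z. 0 \<le> \<phi> z) \<and>
    (\<forall>z. \<phi> z \<noteq> 0 \<longrightarrow> norm (fst z) < \<epsilon> \<and> \<bar>snd z\<bar> < \<epsilon>\<^sup>2) \<and> (LINT z|lebesgue. \<phi> z) = 1 \<and>
    (\<forall>z. \<phi> z \<le> C\<phi> / \<epsilon> ^ (CARD('n) + 2)))"
    using parabolic_kernel_exists[where 'n='n] by blast
  have "\<forall>i. \<exists>\<phi> :: (real^'n) \<times> real \<Rightarrow> real. (\<forall>k. Ck k \<phi>) \<and> (\<forall>z. 0 \<le> \<phi> z) \<and>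
    (\<forall>z. \<phi> z \<noteq> 0 \<longrightarrow> norm (fst z) < \<epsilon> i \<and> \<bar>snd z\<bar> < (\<epsilon> i)\<^sup>2) \<and> (LINT z|lebesgue. \<phi> z) = 1 \<and>
    (\<forall>z. \<phi> z \<le> C\<phi> / \<epsilon> i ^ (CARD('n) + 2))"
    using C\<phi>(2)[OF \<epsilon>(1,2)] by blast
  then obtain \<phi> :: "nat \<Rightarrow> (real^'n) \<times> real \<Rightarrow> real" where \<phi>: "\<forall>i. (\<forall>k. Ck k (\<phi> i)) \<and> (\<forall>z. 0 \<le> \<phi> i z) \<and>
    (\<forall>z. \<phi> i z \<noteq> 0 \<longrightarrow> norm (fst z) < \<epsilon> i \<and> \<bar>snd z\<bar> < (\<epsilon> i)\<^sup>2) \<and> (LINT z|lebesgue. \<phi> i z) = 1 \<and>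
    (\<forall>z. \<phi> i z \<le> C\<phi> / \<epsilon> i ^ (CARD('n) + 2))"
    by (rule choice[THEN exE])
  have \<phi>C: "Ck k (\<phi> i)" and \<phi>pos: "0 \<le> \<phi> i z"
    and \<phi>supp: "\<phi> i z \<noteq> 0 \<Longrightarrow> norm (fst z) < \<epsilon> i \<and> \<bar>snd z\<bar> < (\<epsilon> i)\<^sup>2"
    and \<phi>int: "(LINT z|lebesgue. \<phi> i z) = 1" and \<phi>le: "\<phi> i z \<le> C\<phi> / \<epsilon> i ^ (CARD('n) + 2)" for i k z
    using \<phi> by blast+
  have \<phi>n: "norm z < 2 * \<epsilon> i" if "\<phi> i z \<noteq> 0" for i z
  proof -
    have "(\<epsilon> i)\<^sup>2 \<le> \<epsilon> i" using \<epsilon>[of i] by (simp add: power2_eq_square mult_left_le)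
    moreover have "norm z \<le> norm (fst z) + norm (snd z)" by (metis norm_Pair_le prod.collapse)
    ultimately show ?thesis using \<phi>supp[OF that] by simp
  qed
  have \<phi>R: "\<phi> i z = 0" if "norm z > 2" for i z
    using \<phi>n[of i z] \<epsilon>(2)[of i] that by fastforce
  have mol: "mollifier (\<phi> i) 2" for i
    by unfold_locales (use Ck_imp_continuous[OF \<phi>C[of 0 i]] \<phi>R \<phi>pos \<phi>int in auto)
  have box: "y \<in> Q" if "z \<in> K" "norm (fst z - fst y) \<le> \<epsilon> i" "\<bar>snd z - snd y\<bar> \<le> (\<epsilon> i)\<^sup>2" for i z y
  proof (rule ccontr)
    assume "y \<notin> Q"
    then have "d \<le> dist z y" using d(2) that(1) by auto
    moreover have "(\<epsilon> i)\<^sup>2 \<le> \<epsilon> i" using \<epsilon>[of i] by (simp add: power2_eq_square mult_left_le)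
    moreover have "dist z y \<le> norm (fst z - fst y) + norm (snd z - snd y)"
      by (metis dist_norm norm_Pair_le prod.collapse fst_diff snd_diff)
    ultimately show False using that \<epsilon>[of i] d(1) by simp
  qed
  have inQ: "y \<in> Q" if "z \<in> K" "\<phi> i (z - y) \<noteq> 0" for i z y
    using box[OF that(1), of y i] \<phi>supp[OF that(2)] by simp
  have test: "test_function Q (\<lambda>y. \<phi> i (z - y))" if "z \<in> K" for i z
    by (rule parabolic_test_function[of "\<phi> i" "\<epsilon> i" z Q]) (use \<phi>C \<phi>supp box[OF that] in auto)
  define \<kappa> where "\<kappa> i = 4 * L * \<epsilon> i powr \<alpha>" for i
  have osc: "a y \<le> a y' + \<kappa> i" if "z \<in> K" "\<phi> i (z - y) \<noteq> 0" "\<phi> i (z - y') \<noteq> 0" for i z y y'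
  proof -
    have "norm (fst y - fst y') \<le> norm (fst z - fst y') + norm (fst z - fst y)"
      using norm_triangle_ineq4[of "fst z - fst y'" "fst z - fst y"] by simp
    then have "norm (fst y - fst y') \<le> 2 * \<epsilon> i" "\<bar>snd y - snd y'\<bar> \<le> 2 * (\<epsilon> i)\<^sup>2"
      using \<phi>supp[OF that(2)] \<phi>supp[OF that(3)] by auto
    then have "norm (fst y - fst y') powr \<alpha> + \<bar>snd y - snd y'\<bar> powr (\<alpha> / 2) \<le> 4 * \<epsilon> i powr \<alpha>"
      by (intro holder_quotient_le \<alpha> \<epsilon>)
    then have "\<bar>a y - a y'\<bar> \<le> L * (4 * \<epsilon> i powr \<alpha>)"
      using hol[OF inQ[OF that(1,2)] inQ[OF that(1,3)]] L by (meson mult_left_mono order_trans)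
    then show ?thesis by (simp add: \<kappa>_def)
  qed
  define GI where "GI = (LINT z|lebesgue. \<bar>G z\<bar>)"
  define M where "M = 4 * L * (C\<phi> * GI) powr ((q - p) / p)"
  have GI: "GI \<ge> 0" by (simp add: GI_def)
  \<comment> \<open>The mollified \<open>p\<close>-th power is at most the height of the kernel times the \<open>L\<^sup>1\<close> norm of \<open>G\<close>; the
    factor \<open>\<epsilon>\<^sup>\<alpha>\<close> in \<open>\<kappa>\<close> makes the bound independent of \<open>i\<close>.\<close>
  have Mbound: "\<kappa> i * conv (\<phi> i) (\<lambda>y. \<bar>w y\<bar>) z powr (q - p) \<le> M"
    if "z \<in> K" "integrable lebesgue w" "\<And>y. y \<in> Q \<Longrightarrow> \<bar>w y\<bar> powr p + a y * \<bar>w y\<bar> powr q \<le> G y" for w i z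
  proof -
    interpret mollifier "\<phi> i" 2 by (rule mol)
    let ?t = "conv (\<phi> i) (\<lambda>y. \<bar>w y\<bar>) z"
    have wG: "\<bar>w y\<bar> powr p \<le> \<bar>G y\<bar>" if "y \<in> Q" for y
    proof -
      have "0 \<le> a y * \<bar>w y\<bar> powr q" using a0[OF that] by simp
      then show ?thesis using \<open>\<And>y. y \<in> Q \<Longrightarrow> \<bar>w y\<bar> powr p + a y * \<bar>w y\<bar> powr q \<le> G y\<close>[OF that] by linarith
    qed
    have "?t powr p \<le> conv (\<phi> i) (\<lambda>y. \<bar>G y\<bar>) z"
      by (rule conv_powr_le) (use that(2) G(1) pq wG inQ[OF that(1)] in auto)
    also have "\<dots> \<le> (LINT y|lebesgue. C\<phi> / \<epsilon> i ^ (CARD('n) + 2) * \<bar>G y\<bar>)"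
      unfolding conv_def
    proof (rule integral_mono)
      show "\<phi> i (z - y) * \<bar>G y\<bar> \<le> C\<phi> / \<epsilon> i ^ (CARD('n) + 2) * \<bar>G y\<bar>" for y
        by (intro mult_right_mono \<phi>le) simp
    qed (use G(1) conv_int[of "\<lambda>y. \<bar>G y\<bar>" z] in auto)
    also have "\<dots> = C\<phi> * GI / \<epsilon> i ^ (CARD('n) + 2)" by (simp add: GI_def)
    finally have t: "?t powr p \<le> C\<phi> * GI / \<epsilon> i ^ (CARD('n) + 2)" .
    have "\<epsilon> i powr \<alpha> * ?t powr (q - p) \<le> (C\<phi> * GI) powr ((q - p) / p)"
      by (rule powr_divide_power_le[where N="CARD('n) + 2"])
        (use \<epsilon> pq t GI C\<phi>(1) in \<open>auto intro: conv_nonneg simp: add.commute\<close>)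
    then have "4 * L * (\<epsilon> i powr \<alpha> * ?t powr (q - p)) \<le> M"
      unfolding M_def using L by (intro mult_left_mono) auto
    then show ?thesis by (simp add: \<kappa>_def mult.assoc)
  qed
  have pdK: "z \<in> K" if "pd \<eta> h z \<noteq> 0" for z h
  proof (rule ccontr)
    assume "z \<notin> K"
    have "open (- K)" using compact_imp_closed[OF K(1)] by (rule open_Compl)
    then have "(\<eta> has_derivative (\<lambda>h. 0)) (at z)"
      using \<eta>(2) \<open>z \<notin> K\<close> by (intro has_derivative_transform_within_open[of "\<lambda>x. 0" "\<lambda>h. 0" z UNIV "- K" \<eta>]) auto
    then show False using that by (simp add: frechet_derivative_eqI)
  qed
  obtain RK where RK: "\<And>z. z \<in> K \<Longrightarrow> norm z \<le> RK"
    using compact_imp_bounded[OF K(1)] by (auto simp: bounded_iff)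
  have \<eta>R: "\<eta> z = 0" if "norm z > RK" for z using \<eta>(2)[of z] RK[of z] that by fastforce
  have pd_bdd: "\<exists>M. \<forall>z. \<bar>pd \<eta> b z\<bar> \<le> M" if "b \<in> Basis" for b
    using continuous_bounded_support_bounded[OF Ck_pd_continuous[OF \<eta>(1) that]
      frechet_derivative_zero_outside[where R=RK and f=\<eta>]] \<eta>R by blast
  have \<eta>_bdd: "\<exists>M. \<forall>z. \<bar>\<eta> z\<bar> \<le> M"
    using continuous_bounded_support_bounded[OF Ck_imp_continuous[OF \<eta>(1)] \<eta>R] by blast
  have cm: "g \<in> borel_measurable lebesgue" if "continuous_on UNIV g" for g :: "(real^'n) \<times> real \<Rightarrow> real"
    using that by (intro measurable_completion) (simp add: borel_measurable_continuous_onI)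
  have \<delta>lim: "(\<lambda>i. 2 * \<epsilon> i) \<longlonglongrightarrow> 0" using tendsto_mult_right_zero[OF \<epsilon>lim] by simp
  have lim: "(\<lambda>i. LINT z|lebesgue. g z * (conv (\<phi> i) b z * conv (\<phi> i) w z)) \<longlonglongrightarrow> (LINT z|lebesgue. g z * (b z * w z))"
    if H: "continuous_on UNIV g" "\<exists>M. \<forall>z. \<bar>g z\<bar> \<le> M" "integrable lebesgue b" "integrable lebesgue w" "integrable lebesgue D"
      "\<And>z i. g z \<noteq> 0 \<Longrightarrow> \<bar>conv (\<phi> i) b z * conv (\<phi> i) w z\<bar> \<le> conv (\<phi> i) D z" for g b w D
  proof -
    obtain M where M: "\<And>z. \<bar>g z\<bar> \<le> M" using H(2) by blast
    show ?thesis
      by (rule conv_product_tendsto[where \<delta>="\<lambda>i. 2 * \<epsilon> i" and M=M and F=D, OF _ \<phi>pos \<phi>int \<phi>n \<delta>lim H(3-5) cm[OF H(1)] M H(6)])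
        (rule Ck_imp_continuous[OF \<phi>C[of 0]])
  qed
  have flux: "\<bar>conv (\<phi> i) (B j) z * conv (\<phi> i) w z\<bar> \<le> conv (\<phi> i) (\<lambda>y. C * F y + C * (1 + M) * G y) z"
    if "z \<in> K" "integrable lebesgue w" "\<And>y. y \<in> Q \<Longrightarrow> \<bar>w y\<bar> powr p + a y * \<bar>w y\<bar> powr q \<le> G y" for w i z j
  proof -
    interpret mollifier "\<phi> i" 2 by (rule mol)
    show ?thesis
    proof (rule conv_flux_product_le[OF B that(2) F(1) G(1) pq(1,2), where f=f and \<kappa>="\<kappa> i" and a=a])
      show "0 \<le> \<kappa> i" using L by (simp add: \<kappa>_def)
      show "\<kappa> i * conv (\<phi> i) (\<lambda>y. \<bar>w y\<bar>) z powr (q - p) \<le> M" by (rule Mbound[OF that])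
      fix y assume y: "\<phi> i (z - y) \<noteq> 0"
      note yQ = inQ[OF that(1) y]
      show "0 \<le> a y" by (rule a0[OF yQ])
      show "\<bar>B j y\<bar> \<le> C * (f y powr (p - 1) + a y * f y powr (q - 1))" by (rule bB[OF yQ])
      show "f y powr p + a y * f y powr q \<le> F y" by (rule F(2)[OF yQ])
      show "\<bar>w y\<bar> powr p + a y * \<bar>w y\<bar> powr q \<le> G y" by (rule that(3)[OF yQ])
      show "a y \<le> a y' + \<kappa> i" if "\<phi> i (z - y') \<noteq> 0" for y' by (rule osc[OF \<open>z \<in> K\<close> y that])
    qed (rule f0 C)+
  qed
  have iD: "integrable lebesgue (\<lambda>y. C * F y + C * (1 + M) * G y)" using F(1) G(1) by simp
  have lim1: "(\<lambda>i. LINT z|lebesgue. pd \<eta> tdir z * (conv (\<phi> i) v z * conv (\<phi> i) v z)) \<longlonglongrightarrow> (LINT z|lebesgue. pd \<eta> tdir z * (v z * v z))"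
  proof (rule lim[OF Ck_pd_continuous[OF \<eta>(1) tdir_Basis] pd_bdd[OF tdir_Basis] v(1) v(1) v(2)])
    fix z i
    interpret mollifier "\<phi> i" 2 by (rule mol)
    have av: "integrable lebesgue (\<lambda>y. \<bar>v y\<bar>)" using v(1) by simp
    have "conv (\<phi> i) (\<lambda>y. \<bar>v y\<bar>) z powr 2 \<le> conv (\<phi> i) (\<lambda>y. v y * v y) z"
      by (rule conv_powr_le[OF av v(2)]) (auto simp: power2_eq_square)
    moreover have "\<bar>conv (\<phi> i) v z\<bar> * \<bar>conv (\<phi> i) v z\<bar> \<le> conv (\<phi> i) (\<lambda>y. \<bar>v y\<bar>) z * conv (\<phi> i) (\<lambda>y. \<bar>v y\<bar>) z"
      by (intro mult_mono conv_abs_le pos conv_nonneg) auto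
    moreover have "0 \<le> conv (\<phi> i) (\<lambda>y. \<bar>v y\<bar>) z" by (rule conv_nonneg) simp
    ultimately show "\<bar>conv (\<phi> i) v z * conv (\<phi> i) v z\<bar> \<le> conv (\<phi> i) (\<lambda>z. v z * v z) z"
      by (simp add: abs_mult power2_eq_square)
  qed
  have lim2: "(\<lambda>i. LINT z|lebesgue. pd \<eta> (xdir j) z * (conv (\<phi> i) (B j) z * conv (\<phi> i) v z)) \<longlonglongrightarrow> (LINT z|lebesgue. pd \<eta> (xdir j) z * (B j z * v z))" for j
    by (rule lim[OF Ck_pd_continuous[OF \<eta>(1) xdir_Basis] pd_bdd[OF xdir_Basis] B v(1) iD])
      (rule flux[OF pdK v(1) G(2)])
  have lim3: "(\<lambda>i. LINT z|lebesgue. \<eta> z * (conv (\<phi> i) (B j) z * conv (\<phi> i) (V j) z)) \<longlonglongrightarrow> (LINT z|lebesgue. \<eta> z * (B j z * V j z))" for j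
    by (rule lim[OF Ck_imp_continuous[OF \<eta>(1)] \<eta>_bdd B V iD]) (rule flux[OF _ V G(3)], use \<eta>(2) in blast)
  have id: "(1/2) * (LINT z|lebesgue. pd \<eta> tdir z * (conv (\<phi> i) v z * conv (\<phi> i) v z)) =
    (\<Sum>j\<in>UNIV. (LINT z|lebesgue. pd \<eta> (xdir j) z * (conv (\<phi> i) (B j) z * conv (\<phi> i) v z))
             + (LINT z|lebesgue. \<eta> z * (conv (\<phi> i) (B j) z * conv (\<phi> i) (V j) z)))" for i
    by (rule mollified_energy_identity[where Q=Q and R=2 and R'=RK, OF v(1) B W1 W2 \<phi>C \<phi>R \<eta>(1) \<eta>R test])
      (use \<eta>(2) in auto)
  have "(\<lambda>i. (1/2) * (LINT z|lebesgue. pd \<eta> tdir z * (conv (\<phi> i) v z * conv (\<phi> i) v z))) \<longlonglongrightarrow>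
      (\<Sum>j\<in>UNIV. (LINT z|lebesgue. pd \<eta> (xdir j) z * (B j z * v z)) + (LINT z|lebesgue. \<eta> z * (B j z * V j z)))"
    unfolding id by (intro tendsto_intros lim2 lim3)
  moreover have "(\<lambda>i. (1/2) * (LINT z|lebesgue. pd \<eta> tdir z * (conv (\<phi> i) v z * conv (\<phi> i) v z))) \<longlonglongrightarrow>
      (1/2) * (LINT z|lebesgue. pd \<eta> tdir z * (v z * v z))"
    by (intro tendsto_intros lim1)
  ultimately show ?thesis by (rule LIMSEQ_unique[symmetric])
qed

section \<open>The shifted double phase function\<close>

text \<open>The derivative in \<open>s\<close> of the double phase function with coefficient \<open>c\<close>, in closed form.\<close>

definition dflux :: "real \<Rightarrow> real \<Rightarrow> real \<Rightarrow> real \<Rightarrow> real" where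
  "dflux p q c s = p * s powr (p - 1) + c * q * s powr (q - 1)"

text \<open>The density of the shifted function \<open>H\<^sub>\<sigma>\<close>.\<close>

definition shift_flux :: "real \<Rightarrow> real \<Rightarrow> real \<Rightarrow> real \<Rightarrow> real \<Rightarrow> real" where
  "shift_flux p q c \<sigma> s = dflux p q c (\<sigma> + s) * s / (\<sigma> + s)"

lemma powr_diff_2_times_square: "0 < x \<Longrightarrow> x powr (m - 2) * x\<^sup>2 = x powr (m :: real)"
  using powr_add[of x "m - 2" 2] by simp

lemma dphase'_dflux: "s > 0 \<Longrightarrow> dphase' p q a z s = dflux p q (a z) s"
  by (simp add: dphase'_eq dflux_def)

text \<open>The natural number \<open>k\<close> bounds the growth of the density by the power \<open>k - 1\<close>. It is a natural
  number because the cut-off function is raised to this power.\<close>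

locale double_phase =
  fixes p q c \<sigma> :: real and k :: nat
  assumes p: "1 < p" and pq: "p \<le> q" and c: "0 \<le> c" and \<sigma>: "0 < \<sigma>" and k: "2 \<le> k" "q \<le> real k"
begin

abbreviation "H' \<equiv> dflux p q c"
abbreviation "G \<equiv> shift_flux p q c \<sigma>"

lemma dflux_nonneg: "0 \<le> s \<Longrightarrow> 0 \<le> H' s"
  using p pq c by (simp add: dflux_def)

lemma dflux_mono: "0 < s \<Longrightarrow> s \<le> t \<Longrightarrow> H' s \<le> H' t"
  unfolding dflux_def using p pq c by (intro add_mono mult_left_mono powr_mono2) auto

lemma dflux_scale: 
  assumes "1 \<le> l" "0 < s" shows "H' (l * s) \<le> l powr (q - 1) * H' s"
proof -
  have "l powr (p - 1) \<le> l powr (q - 1)" using assms pq by (intro powr_mono) auto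
  then have "p * (l powr (p - 1) * s powr (p - 1)) \<le> p * (l powr (q - 1) * s powr (p - 1))"
    using p by (intro mult_left_mono mult_right_mono) auto
  then show ?thesis using assms by (simp add: dflux_def powr_mult algebra_simps)
qed

lemma shift_flux_nonneg: "0 \<le> s \<Longrightarrow> 0 \<le> G s"
  unfolding shift_flux_def using \<sigma> by (simp add: dflux_nonneg)

lemma shift_flux_mono:
  assumes "0 \<le> s" "s \<le> t" shows "G s \<le> G t"
proof -
  have "s / (\<sigma> + s) \<le> t / (\<sigma> + t)" using assms \<sigma> by (simp add: field_simps)
  then have "H' (\<sigma> + s) * (s / (\<sigma> + s)) \<le> H' (\<sigma> + t) * (t / (\<sigma> + t))"
    using assms \<sigma> by (intro mult_mono dflux_mono dflux_nonneg) auto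
  then show ?thesis by (simp add: shift_flux_def)
qed

lemma shift_flux_alt:
  assumes "0 \<le> s"
  shows "G s = (p * (\<sigma> + s) powr (p - 2) + c * q * (\<sigma> + s) powr (q - 2)) * s"
proof -
  have "(\<sigma> + s) powr (m - 1) = (\<sigma> + s) powr (m - 2) * (\<sigma> + s)" for m
    using powr_add[of "\<sigma> + s" "m - 2" 1] assms \<sigma> by simp
  from this[of p] this[of q]
  have "H' (\<sigma> + s) = (p * (\<sigma> + s) powr (p - 2) + c * q * (\<sigma> + s) powr (q - 2)) * (\<sigma> + s)"
    unfolding dflux_def by (simp add: algebra_simps)
  then show ?thesis using assms \<sigma> by (simp add: shift_flux_def)
qed

lemma shift_flux_scale:
  assumes "1 \<le> l" "0 \<le> t" shows "G (l * t) \<le> l ^ (k - 1) * G t"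
proof -
  have *: "(\<sigma> + l * t) powr (m - 2) \<le> l ^ (k - 2) * (\<sigma> + t) powr (m - 2)" if "m \<le> real k" for m
  proof (cases "m \<ge> 2")
    case True
    have "\<sigma> + l * t \<le> l * (\<sigma> + t)" using assms \<sigma> by (simp add: algebra_simps)
    then have "(\<sigma> + l * t) powr (m - 2) \<le> (l * (\<sigma> + t)) powr (m - 2)"
      using True assms \<sigma> by (intro powr_mono2) auto
    also have "\<dots> = l powr (m - 2) * (\<sigma> + t) powr (m - 2)" using assms \<sigma> by (simp add: powr_mult)
    also have "l powr (m - 2) \<le> l powr (real (k - 2))" using assms that k by (intro powr_mono) auto
    also have "\<dots> = l ^ (k - 2)" using assms by (simp add: powr_realpow)
    finally show ?thesis by (simp add: mult_right_mono)
  next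
    case False
    have "\<sigma> + t \<le> \<sigma> + l * t" using assms by (simp add: mult_le_cancel_right1)
    then have "(\<sigma> + l * t) powr (m - 2) \<le> 1 * (\<sigma> + t) powr (m - 2)"
      using False assms \<sigma> powr_mono2'[of "m - 2" "\<sigma> + t" "\<sigma> + l * t"] by simp
    also have "\<dots> \<le> l ^ (k - 2) * (\<sigma> + t) powr (m - 2)"
      using assms by (intro mult_right_mono one_le_power) auto
    finally show ?thesis .
  qed
  have "G (l * t) = (p * (\<sigma> + l * t) powr (p - 2) + c * q * (\<sigma> + l * t) powr (q - 2)) * (l * t)"
    using assms by (simp add: shift_flux_alt)
  also have "\<dots> \<le> (p * (l ^ (k - 2) * (\<sigma> + t) powr (p - 2)) + c * q * (l ^ (k - 2) * (\<sigma> + t) powr (q - 2))) * (l * t)"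
    using p pq c k assms by (intro mult_right_mono add_mono mult_left_mono *) auto
  also have "\<dots> = l ^ Suc (k - 2) * G t"
    using assms by (simp add: shift_flux_alt algebra_simps)
  also have "Suc (k - 2) = k - 1" using k by simp
  finally show ?thesis .
qed

text \<open>If \<open>t \<le> \<delta> \<theta> s\<close>, the first term on the right suffices. Otherwise \<open>s < t / (\<delta> \<theta>)\<close>, and as \<open>G\<close> grows
  at most like the power \<open>k - 1\<close>, the factor \<open>\<theta> ^ (k - 1)\<close> cancels the powers of \<open>\<theta>\<close> in the
  denominator.\<close>

lemma shift_flux_young:
  assumes "0 \<le> s" "0 \<le> t" "0 \<le> \<theta>" "\<theta> \<le> 1" "0 < \<delta>" "\<delta> \<le> 1"
  shows "G s * \<theta> ^ (k - 1) * t \<le> \<delta> * (\<theta> ^ k * (G s * s)) + (1 / \<delta>) ^ (k - 1) * (G t * t)"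
proof -
  have k1: "\<theta> ^ k = \<theta> ^ (k - 1) * \<theta>" using k by (cases k) auto
  consider "t \<le> \<delta> * \<theta> * s" | "\<theta> = 0" | "\<delta> * \<theta> * s < t" "\<theta> > 0" using assms by fastforce
  then show ?thesis
  proof cases
    case 1
    have "G s * \<theta> ^ (k - 1) * t \<le> G s * \<theta> ^ (k - 1) * (\<delta> * \<theta> * s)"
      using assms 1 by (intro mult_left_mono mult_nonneg_nonneg shift_flux_nonneg) auto
    also have "\<dots> = \<delta> * (\<theta> ^ k * (G s * s))" by (simp add: k1 algebra_simps)
    finally show ?thesis using assms shift_flux_nonneg[of t] by (simp add: add_increasing2)
  next
    case 2
    then have z: "\<theta> ^ (k - 1) = 0" "\<theta> ^ k = 0" using k by simp_all
    show ?thesis unfolding z using assms shift_flux_nonneg[of t] by simp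
  next
    case 3
    define l where "l = 1 / (\<delta> * \<theta>)"
    have "\<delta> * \<theta> \<le> 1" using assms by (simp add: mult_le_one)
    then have "l \<ge> 1" using 3 assms by (simp add: l_def)
    have "s \<le> l * t" using 3 assms by (simp add: l_def field_simps)
    then have "G s \<le> l ^ (k - 1) * G t"
      using shift_flux_mono[of s "l * t"] shift_flux_scale[OF \<open>l \<ge> 1\<close>, of t] assms by simp
    then have "G s * (\<theta> ^ (k - 1) * t) \<le> (l ^ (k - 1) * G t) * (\<theta> ^ (k - 1) * t)"
      using assms by (intro mult_right_mono) auto
    also have "\<dots> = (1 / \<delta>) ^ (k - 1) * (G t * t)"
      using 3 assms by (simp add: l_def power_divide power_mult_distrib)
    finally show ?thesis
      using assms shift_flux_nonneg[of s] by (simp add: mult.assoc add_increasing)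
  qed
qed

lemma shift_flux_continuous: "continuous_on {0..} G"
  unfolding shift_flux_def dflux_def using \<sigma> by (intro continuous_intros) auto

text \<open>The density is increasing and doubles at a bounded rate, so that its primitive is comparable to
  \<open>s G(s)\<close>; the values on \<open>[s/2, s]\<close> suffice for the bound from below.\<close>

lemma primitive_shift_flux:
  assumes "0 \<le> s"
  shows "(LINT r:{0..s}|lebesgue. G r) \<le> s * G s"
    and "s * G s \<le> 2 ^ k * (LINT r:{0..s}|lebesgue. G r)"
    and "0 \<le> (LINT r:{0..s}|lebesgue. G r)"
proof -
  have int: "set_integrable lebesgue {x..y} G" if "0 \<le> x" for x y
  proof -
    have "integrable lborel (\<lambda>r. indicator {x..y} r *\<^sub>R G r)"
      by (rule borel_integrable_compact) (use that in \<open>auto intro: continuous_on_subset[OF shift_flux_continuous]\<close>)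
    then show ?thesis unfolding set_integrable_def
      by (metis integrable_completion borel_measurable_integrable)
  qed
  have const: "(LINT r:{x..y}|lebesgue. b) = (y - x) * b" "set_integrable lebesgue {x..y} (\<lambda>r. b)"
    if "x \<le> y" for x y b :: real
    using that by (simp_all add: set_lebesgue_integral_def set_integrable_def)
  have "(LINT r:{0..s}|lebesgue. G r) \<le> (LINT r:{0..s}|lebesgue. G s)"
    by (rule set_integral_mono[OF int const(2)]) (use assms shift_flux_mono in auto)
  then show "(LINT r:{0..s}|lebesgue. G r) \<le> s * G s" using assms by (simp add: const)
  show "0 \<le> (LINT r:{0..s}|lebesgue. G r)"
    unfolding set_lebesgue_integral_def by (intro integral_nonneg_AE AE_I2) (auto simp: indicator_def shift_flux_nonneg)
  have "s / 2 * G (s / 2) = (LINT r:{s/2..s}|lebesgue. G (s / 2))" using assms by (subst const) auto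
  also have "\<dots> \<le> (LINT r:{s/2..s}|lebesgue. G r)"
    by (rule set_integral_mono[OF const(2) int]) (use assms shift_flux_mono in auto)
  also have "\<dots> \<le> (LINT r:{0..s}|lebesgue. G r)"
    unfolding set_lebesgue_integral_def
    by (rule integral_mono) (use int[of "s/2" s] int[of 0 s] assms shift_flux_nonneg in \<open>auto simp: set_integrable_def indicator_def\<close>)
  finally have 1: "s / 2 * G (s / 2) \<le> (LINT r:{0..s}|lebesgue. G r)" .
  have "s * G s \<le> s * (2 ^ (k - 1) * G (s / 2))"
    using shift_flux_scale[of 2 "s / 2"] assms by (intro mult_left_mono) auto
  also have "\<dots> = 2 ^ k * (s / 2 * G (s / 2))" using k by (cases k) auto
  also have "\<dots> \<le> 2 ^ k * (LINT r:{0..s}|lebesgue. G r)" using 1 by (intro mult_left_mono) auto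
  finally show "s * G s \<le> 2 ^ k * (LINT r:{0..s}|lebesgue. G r)" .
qed

lemma power_le_shift:
  assumes m: "1 < m" and "0 \<le> s"
  shows "s powr m \<le> 2 * ((\<sigma> + s) powr (m - 2) * s\<^sup>2) + \<sigma> powr m"
proof -
  have nn: "0 \<le> 2 * ((\<sigma> + s) powr (m - 2) * s\<^sup>2)" by simp
  show ?thesis
  proof (cases "s \<le> \<sigma>")
    case True
    then have "s powr m \<le> \<sigma> powr m" using assms by (intro powr_mono2) auto
    then show ?thesis using nn by linarith
  next
    case False
    then have s: "s > 0" "s > \<sigma>" using \<sigma> by auto
    have "s powr (m - 2) \<le> 2 * (\<sigma> + s) powr (m - 2)"
    proof (cases "m \<ge> 2")
      case True
      then have "s powr (m - 2) \<le> (\<sigma> + s) powr (m - 2)" using s \<sigma> by (intro powr_mono2) auto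
      then show ?thesis using powr_ge_zero[of "\<sigma> + s" "m - 2"] by linarith
    next
      case False
      have "s powr (m - 2) = 2 powr (2 - m) * (2 * s) powr (m - 2)"
        using s by (simp add: powr_mult powr_diff field_simps)
      also have "\<dots> \<le> 2 powr 1 * (\<sigma> + s) powr (m - 2)"
        using False m s \<sigma> by (intro mult_mono powr_mono powr_mono2') auto
      finally show ?thesis by simp
    qed
    then have "s powr (m - 2) * s\<^sup>2 \<le> 2 * ((\<sigma> + s) powr (m - 2) * s\<^sup>2)"
      using mult_right_mono[of "s powr (m - 2)" "2 * (\<sigma> + s) powr (m - 2)" "s\<^sup>2"] by (simp add: mult.assoc)
    moreover have "s powr (m - 2) * s\<^sup>2 = s powr m"
      using s by (simp add: powr_diff_2_times_square)
    ultimately show ?thesis using powr_ge_zero[of \<sigma> m] by linarith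
  qed
qed

lemma double_phase_le_shift:
  assumes "0 \<le> s"
  shows "s powr p + c * s powr q \<le> 2 * (G s * s) + (\<sigma> powr p + c * \<sigma> powr q)"
proof -
  have "s powr p \<le> 2 * (p * (\<sigma> + s) powr (p - 2) * s\<^sup>2) + \<sigma> powr p"
    using power_le_shift[OF p assms] p mult_right_mono[of 1 p "(\<sigma> + s) powr (p - 2) * s\<^sup>2"] by simp
  moreover have "c * s powr q \<le> c * (2 * (q * (\<sigma> + s) powr (q - 2) * s\<^sup>2) + \<sigma> powr q)"
  proof (rule mult_left_mono[OF _ c])
    show "s powr q \<le> 2 * (q * (\<sigma> + s) powr (q - 2) * s\<^sup>2) + \<sigma> powr q"
      using power_le_shift[of q, OF _ assms] p pq mult_right_mono[of 1 q "(\<sigma> + s) powr (q - 2) * s\<^sup>2"] by simp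
  qed
  moreover have "G s * s = p * (\<sigma> + s) powr (p - 2) * s\<^sup>2 + c * (q * (\<sigma> + s) powr (q - 2) * s\<^sup>2)"
    using assms by (simp add: shift_flux_alt power2_eq_square algebra_simps)
  ultimately show ?thesis by (simp add: algebra_simps)
qed

end

text \<open>The maximum that occurs in the inequality. The exponents \<open>m / (m - 1)\<close> and \<open>2\<close> from Young's
  inequality lie between the two exponents, which are conjugate to \<open>max q 2\<close> and \<open>min p 2\<close>.\<close>

definition young_max :: "real \<Rightarrow> real \<Rightarrow> real \<Rightarrow> real" where
  "young_max p q x = max (x powr (min p 2 / (min p 2 - 1))) (x powr (max q 2 / (max q 2 - 1)))"

lemma young_max_nonneg: "0 \<le> young_max p q x"
  by (simp add: young_max_def le_max_iff_disj)

lemma young_max_ge: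
  assumes "0 < x" "max q 2 / (max q 2 - 1) \<le> e" "e \<le> min p 2 / (min p 2 - 1)"
  shows "x powr e \<le> young_max p q x"
proof (cases "x \<ge> 1")
  case True
  then have "x powr e \<le> x powr (min p 2 / (min p 2 - 1))" using assms by (intro powr_mono) auto
  then show ?thesis by (simp add: young_max_def)
next
  case False
  then have "x powr e \<le> x powr (max q 2 / (max q 2 - 1))" using assms by (intro powr_mono') auto
  then show ?thesis by (simp add: young_max_def)
qed

lemma conjugate_exponents:
  fixes p q m :: real
  assumes "1 < p" "p \<le> m" "m \<le> q"
  shows "max q 2 / (max q 2 - 1) \<le> 2" "2 \<le> min p 2 / (min p 2 - 1)"
    and "m < 2 \<Longrightarrow> 2 \<le> m / (m - 1)" "m < 2 \<Longrightarrow> m / (m - 1) \<le> min p 2 / (min p 2 - 1)"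
  using assms by (auto simp: field_simps min_def max_def)

text \<open>If \<open>s \<le> \<sigma>\<close> or \<open>m \<ge> 2\<close>, the weights \<open>(\<sigma> + s)\<close> and \<open>\<sigma>\<close> to the power \<open>m - 2\<close> compare in the right
  direction, and Young's inequality with exponent \<open>2\<close> gives \<open>x\<^sup>2\<close>. If \<open>s > \<sigma>\<close> and \<open>m < 2\<close>, the
  shifted energy is comparable to the \<open>m\<close>-th power of \<open>s\<close>, and the exponent \<open>m / (m - 1)\<close> takes
  over.\<close>

lemma power_young_shift:
  assumes p: "1 < p" "p \<le> m" "m \<le> q" and x: "0 < x" and s: "0 \<le> s" and \<sigma>: "0 < \<sigma>" and \<delta>: "0 < \<delta>" "\<delta> \<le> 1"
  shows "x * (\<sigma> powr (m - 1) * s) \<le> \<delta> * ((\<sigma> + s) powr (m - 2) * s\<^sup>2)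
    + (1 / \<delta> + (2 / \<delta>) powr (1 / (p - 1))) * young_max p q x * \<sigma> powr m"
proof -
  let ?Y = "young_max p q x"
  note ce = conjugate_exponents[OF p]
  have Y2: "x\<^sup>2 \<le> ?Y" using young_max_ge[OF x ce(1,2)] x by simp
  have Y0: "0 \<le> ?Y" using Y2 zero_le_power2[of x] by linarith
  have \<sigma>m: "\<sigma> powr (m - 1) = \<sigma> powr (m - 2) * \<sigma>" "\<sigma> powr m = \<sigma> powr (m - 2) * \<sigma>\<^sup>2"
    using \<sigma> powr_add[of \<sigma> "m - 2" 1] powr_add[of \<sigma> "m - 2" 2] by simp_all
  have split: "x * (\<sigma> powr (m - 1) * s) \<le> \<delta> * ((\<sigma> + s) powr (m - 2) * s\<^sup>2)
    + (1 / \<delta> + (2 / \<delta>) powr (1 / (p - 1))) * ?Y * \<sigma> powr m"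
    if "x * (\<sigma> powr (m - 1) * s) \<le> \<delta> * ((\<sigma> + s) powr (m - 2) * s\<^sup>2) + d * ?Y * \<sigma> powr m"
      "d \<le> 1 / \<delta> + (2 / \<delta>) powr (1 / (p - 1))" for d
    using that(1) mult_right_mono[OF mult_right_mono[OF that(2) Y0], of "\<sigma> powr m"] by simp
  show ?thesis
  proof (cases "s \<le> \<sigma> \<or> m \<ge> 2")
    case True
    have half: "\<sigma> powr (m - 2) \<le> 2 * (\<sigma> + s) powr (m - 2)"
    proof (cases "m \<ge> 2")
      case True
      then have "\<sigma> powr (m - 2) \<le> (\<sigma> + s) powr (m - 2)" using s \<sigma> by (intro powr_mono2) auto
      then show ?thesis using powr_ge_zero[of "\<sigma> + s" "m - 2"] by linarith
    next
      case m2: False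
      have "\<sigma> powr (m - 2) = 2 powr (2 - m) * (2 * \<sigma>) powr (m - 2)"
        using \<sigma> by (simp add: powr_mult powr_diff field_simps)
      also have "\<dots> \<le> 2 powr 1 * (\<sigma> + s) powr (m - 2)"
        using m2 p s \<sigma> True by (intro mult_mono powr_mono powr_mono2') auto
      finally show ?thesis by simp
    qed
    have "x * \<sigma> * s \<le> \<delta> / 2 * s\<^sup>2 + 1 / (2 * \<delta>) * (x\<^sup>2 * \<sigma>\<^sup>2)"
    proof -
      have "0 \<le> (\<delta> * s - x * \<sigma>)\<^sup>2 / (2 * \<delta>)" using \<delta> by simp
      also have "\<dots> = \<delta> / 2 * s\<^sup>2 - x * \<sigma> * s + 1 / (2 * \<delta>) * (x\<^sup>2 * \<sigma>\<^sup>2)"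
        using \<delta> by (simp add: power2_eq_square field_simps)
      finally show ?thesis by simp
    qed
    also have "\<dots> \<le> \<delta> / 2 * s\<^sup>2 + 1 / \<delta> * (?Y * \<sigma>\<^sup>2)"
      using \<delta> Y2 Y0 by (intro add_left_mono mult_mono mult_right_mono) (auto simp: field_simps)
    finally have "\<sigma> powr (m - 2) * (x * \<sigma> * s) \<le> \<sigma> powr (m - 2) * (\<delta> / 2 * s\<^sup>2 + 1 / \<delta> * (?Y * \<sigma>\<^sup>2))"
      by (rule mult_left_mono) simp
    then have "x * (\<sigma> powr (m - 1) * s) \<le> \<delta> / 2 * s\<^sup>2 * \<sigma> powr (m - 2) + 1 / \<delta> * ?Y * \<sigma> powr m"
      unfolding \<sigma>m by (simp add: algebra_simps)
    also have "\<delta> / 2 * s\<^sup>2 * \<sigma> powr (m - 2) \<le> \<delta> / 2 * s\<^sup>2 * (2 * (\<sigma> + s) powr (m - 2))"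
      using half \<delta> by (intro mult_left_mono) auto
    finally have "x * (\<sigma> powr (m - 1) * s) \<le> \<delta> * ((\<sigma> + s) powr (m - 2) * s\<^sup>2) + 1 / \<delta> * ?Y * \<sigma> powr m"
      by (simp add: algebra_simps)
    then show ?thesis by (rule split) simp
  next
    case False
    then have sm: "s > \<sigma>" "m < 2" "s > 0" using \<sigma> by auto
    have "s powr (m - 2) = 2 powr (2 - m) * (2 * s) powr (m - 2)"
      using sm by (simp add: powr_mult powr_diff field_simps)
    also have "\<dots> \<le> 2 powr 1 * (\<sigma> + s) powr (m - 2)"
      using sm p \<sigma> by (intro mult_mono powr_mono powr_mono2') auto
    finally have "s powr (m - 2) * s\<^sup>2 \<le> 2 * (\<sigma> + s) powr (m - 2) * s\<^sup>2" by (intro mult_right_mono) auto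
    moreover have "s powr (m - 2) * s\<^sup>2 = s powr m"
      using sm by (simp add: powr_diff_2_times_square)
    ultimately have half: "s powr m \<le> 2 * ((\<sigma> + s) powr (m - 2) * s\<^sup>2)" by simp
    show ?thesis
    proof (cases "x * \<sigma> powr (m - 1) \<le> \<delta> / 2 * s powr (m - 1)")
      case True
      have "x * \<sigma> powr (m - 1) * s \<le> \<delta> / 2 * s powr (m - 1) * s" using True sm by (intro mult_right_mono) auto
      also have "\<dots> = \<delta> / 2 * s powr m" using sm by (simp add: powr_diff)
      also have "\<dots> \<le> \<delta> * ((\<sigma> + s) powr (m - 2) * s\<^sup>2)" using half \<delta> by (simp add: field_simps)
      finally have "x * (\<sigma> powr (m - 1) * s) \<le> \<delta> * ((\<sigma> + s) powr (m - 2) * s\<^sup>2) + 0 * ?Y * \<sigma> powr m"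
        by (simp add: mult.assoc)
      then show ?thesis by (rule split) (use \<delta> in simp)
    next
      case False
      define e where "e = 1 / (m - 1)"
      have "e > 0" using p by (simp add: e_def)
      have "s powr (m - 1) \<le> 2 / \<delta> * x * \<sigma> powr (m - 1)" using False \<delta> by (simp add: field_simps)
      then have "(s powr (m - 1)) powr e \<le> (2 / \<delta> * x * \<sigma> powr (m - 1)) powr e"
        using \<open>e > 0\<close> by (intro powr_mono2) auto
      then have "s \<le> (2 / \<delta>) powr e * x powr e * \<sigma>"
      proof -
        have "(2 / \<delta> * x * \<sigma> powr (m - 1)) powr e = (2 / \<delta>) powr e * x powr e * (\<sigma> powr (m - 1)) powr e"
          using \<delta> x powr_mult[of "2 / \<delta> * x" "\<sigma> powr (m - 1)" e] powr_mult[of "2 / \<delta>" x e]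
          by (simp del: times_divide_eq_left)
        moreover have "(\<sigma> powr (m - 1)) powr e = \<sigma>" "(s powr (m - 1)) powr e = s"
          using p sm \<sigma> by (simp_all add: powr_powr e_def)
        ultimately show ?thesis using \<open>(s powr (m - 1)) powr e \<le> _\<close> by simp
      qed
      also have "\<dots> \<le> (2 / \<delta>) powr (1 / (p - 1)) * x powr e * \<sigma>"
      proof (intro mult_right_mono powr_mono)
        show "e \<le> 1 / (p - 1)" using p by (simp add: e_def frac_le)
        show "1 \<le> 2 / \<delta>" using \<delta> by simp
      qed (use \<sigma> in auto)
      finally have "x * \<sigma> powr (m - 1) * s \<le> x * \<sigma> powr (m - 1) * ((2 / \<delta>) powr (1 / (p - 1)) * x powr e * \<sigma>)"
        using x by (intro mult_left_mono) auto
      also have "\<dots> = (2 / \<delta>) powr (1 / (p - 1)) * (x * x powr e) * (\<sigma> powr (m - 1) * \<sigma>)"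
        by (simp add: algebra_simps)
      also have "\<sigma> powr (m - 1) * \<sigma> = \<sigma> powr m" using \<sigma> by (simp add: powr_diff)
      also have "x * x powr e = x powr (m / (m - 1))"
      proof -
        have "m / (m - 1) = 1 + e" using p by (simp add: e_def field_simps)
        then show ?thesis using x by (simp add: powr_add)
      qed
      also have "(2 / \<delta>) powr (1 / (p - 1)) * x powr (m / (m - 1)) * \<sigma> powr m \<le> (2 / \<delta>) powr (1 / (p - 1)) * ?Y * \<sigma> powr m"
        using ce sm by (intro mult_right_mono mult_left_mono young_max_ge[OF x]) auto
      finally have "x * (\<sigma> powr (m - 1) * s) \<le> (2 / \<delta>) powr (1 / (p - 1)) * ?Y * \<sigma> powr m" by (simp add: mult.assoc)
      moreover have "0 \<le> \<delta> * ((\<sigma> + s) powr (m - 2) * s\<^sup>2)" using \<delta> by simp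
      ultimately have "x * (\<sigma> powr (m - 1) * s) \<le> \<delta> * ((\<sigma> + s) powr (m - 2) * s\<^sup>2) + (2 / \<delta>) powr (1 / (p - 1)) * ?Y * \<sigma> powr m"
        by linarith
      then show ?thesis by (rule split) (use \<delta> in simp)
    qed
  qed
qed

lemma (in double_phase) dflux_young:
  assumes x: "0 < x" and s: "0 \<le> s" and \<delta>: "0 < \<delta>" "\<delta> \<le> 1"
  shows "x * H' \<sigma> * s \<le> \<delta> * (G s * s)
    + q * (1 / \<delta> + (2 / \<delta>) powr (1 / (p - 1))) * young_max p q x * (\<sigma> powr p + c * \<sigma> powr q)"
proof -
  define E where "E = (1 / \<delta> + (2 / \<delta>) powr (1 / (p - 1))) * young_max p q x"
  have "0 \<le> young_max p q x" by (rule young_max_nonneg)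
  then have E: "0 \<le> E" using \<delta> by (simp add: E_def)
  have 1: "x * (\<sigma> powr (p - 1) * s) \<le> \<delta> * ((\<sigma> + s) powr (p - 2) * s\<^sup>2) + E * \<sigma> powr p"
    unfolding E_def using p pq by (intro power_young_shift x s \<sigma> \<delta>) auto
  have 2: "x * (\<sigma> powr (q - 1) * s) \<le> \<delta> * ((\<sigma> + s) powr (q - 2) * s\<^sup>2) + E * \<sigma> powr q"
    unfolding E_def using p pq by (intro power_young_shift x s \<sigma> \<delta>) auto
  have "x * H' \<sigma> * s = p * (x * (\<sigma> powr (p - 1) * s)) + c * q * (x * (\<sigma> powr (q - 1) * s))"
    by (simp add: dflux_def algebra_simps)
  also have "\<dots> \<le> p * (\<delta> * ((\<sigma> + s) powr (p - 2) * s\<^sup>2) + E * \<sigma> powr p) + c * q * (\<delta> * ((\<sigma> + s) powr (q - 2) * s\<^sup>2) + E * \<sigma> powr q)"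
    using p pq c by (intro add_mono mult_left_mono 1 2) auto
  also have "\<dots> = \<delta> * (G s * s) + (p * (E * \<sigma> powr p) + c * q * (E * \<sigma> powr q))"
    using s by (simp add: shift_flux_alt power2_eq_square algebra_simps)
  also have "\<dots> \<le> \<delta> * (G s * s) + (q * (E * \<sigma> powr p) + c * q * (E * \<sigma> powr q))"
    using p pq E by (intro add_mono mult_right_mono order_refl) auto
  finally show ?thesis by (simp add: E_def algebra_simps)
qed

section \<open>Growth and monotonicity of the vector field\<close>

context double_phase
begin

text \<open>As long as \<open>|w| < \<sigma> / 2\<close>, the quantity \<open>1 + |\<xi>|\<close> is comparable to \<open>\<sigma> + |w|\<close> along the whole
  segment, and the bound on the derivative is integrated. For larger \<open>w\<close> the factor
  \<open>|w| / (\<sigma> + |w|)\<close> in \<open>G\<close> is bounded from below, and the bound on \<open>A\<close> itself suffices.\<close>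

lemma growth_shift_flux:
  fixes A :: "'m::euclidean_space \<Rightarrow> 'm"
  assumes diff: "\<And>\<xi>. A differentiable (at \<xi>)" and L: "0 \<le> L"
    and A1: "\<And>\<xi>. norm (A \<xi>) + (1 + norm \<xi>) * onorm (frechet_derivative A (at \<xi>)) \<le> L * H' (1 + norm \<xi>)"
    and \<sigma>P: "\<sigma> = 1 + norm P"
  shows "norm (A (P + w) - A P) \<le> 6 * L * G (norm w)"
proof -
  have bl: "bounded_linear (frechet_derivative A (at \<xi>))" for \<xi>
    using diff[of \<xi>] by (simp add: frechet_derivative_works has_derivative_bounded_linear)
  have on: "0 \<le> onorm (frechet_derivative A (at \<xi>))" for \<xi> by (rule onorm_pos_le[OF bl])
  let ?s = "\<sigma> + norm w"
  have \<sigma>1: "\<sigma> \<ge> 1" using \<sigma>P by simp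
  show ?thesis
  proof (cases "norm w < \<sigma> / 2")
    case True
    have "norm (A (P + w) - A P) \<le> (3 * L * H' ?s / ?s) * norm ((P + w) - P)"
    proof (rule differentiable_bound[OF convex_closed_segment[of P "P + w"]])
      fix \<xi> assume "\<xi> \<in> closed_segment P (P + w)"
      then obtain t where t: "0 \<le> t" "t \<le> 1" "\<xi> = (1 - t) *\<^sub>R P + t *\<^sub>R (P + w)"
        unfolding closed_segment_def by auto
      then have \<xi>: "\<xi> = P + t *\<^sub>R w" by (simp add: algebra_simps)
      have tw: "norm (t *\<^sub>R w) \<le> norm w" using t(1,2) by (simp add: mult_left_le_one_le)
      have up: "1 + norm \<xi> \<le> ?s" using norm_triangle_ineq[of P "t *\<^sub>R w"] tw by (simp add: \<xi> \<sigma>P)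
      have "norm P \<le> norm \<xi> + norm (t *\<^sub>R w)" using norm_triangle_ineq4[of \<xi> "t *\<^sub>R w"] by (simp add: \<xi>)
      then have low: "?s \<le> 3 * (1 + norm \<xi>)" using tw True by (simp add: \<sigma>P)
      show "(A has_derivative frechet_derivative A (at \<xi>)) (at \<xi> within closed_segment P (P + w))"
        using diff[of \<xi>] by (simp add: frechet_derivative_works has_derivative_at_withinI)
      have "(1 + norm \<xi>) * onorm (frechet_derivative A (at \<xi>)) \<le> L * H' (1 + norm \<xi>)"
        using A1[of \<xi>] norm_ge_zero[of "A \<xi>"] by linarith
      also have "\<dots> \<le> L * H' ?s" using up L by (intro mult_left_mono dflux_mono) (auto simp: add_pos_nonneg)
      finally have "3 * ((1 + norm \<xi>) * onorm (frechet_derivative A (at \<xi>))) \<le> 3 * L * H' ?s" by simp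
      moreover have "?s * onorm (frechet_derivative A (at \<xi>)) \<le> 3 * (1 + norm \<xi>) * onorm (frechet_derivative A (at \<xi>))"
        using low on by (intro mult_right_mono)
      ultimately have "?s * onorm (frechet_derivative A (at \<xi>)) \<le> 3 * L * H' ?s" by linarith
      moreover have "?s > 0" using \<sigma>1 by (simp add: add_pos_nonneg)
      ultimately show "onorm (frechet_derivative A (at \<xi>)) \<le> 3 * L * H' ?s / ?s"
        by (simp add: pos_le_divide_eq mult.commute)
    qed auto
    also have "\<dots> = 3 * L * G (norm w)" by (simp add: shift_flux_def)
    also have "\<dots> \<le> 6 * L * G (norm w)" using L shift_flux_nonneg[of "norm w"] by (intro mult_right_mono) auto
    finally show ?thesis .
  next
    case False
    have bound: "norm (A \<xi>) \<le> L * H' ?s" if "1 + norm \<xi> \<le> ?s" for \<xi>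
    proof -
      have "0 \<le> (1 + norm \<xi>) * onorm (frechet_derivative A (at \<xi>))" using on by simp
      then have "norm (A \<xi>) \<le> L * H' (1 + norm \<xi>)" using A1[of \<xi>] by linarith
      also have "\<dots> \<le> L * H' ?s" using that L by (intro mult_left_mono dflux_mono) (auto simp: add_pos_nonneg)
      finally show ?thesis .
    qed
    have "norm (A (P + w) - A P) \<le> norm (A (P + w)) + norm (A P)" by (rule norm_triangle_ineq4)
    also have "\<dots> \<le> L * H' ?s + L * H' ?s"
      by (rule add_mono[OF bound bound]) (use norm_triangle_ineq[of P w] in \<open>simp_all add: \<sigma>P\<close>)
    also have "\<dots> = 2 * L * H' ?s * 1" by simp
    also have "\<dots> \<le> 2 * L * H' ?s * (3 * norm w / ?s)"
      using False \<sigma>1 L by (intro mult_left_mono mult_nonneg_nonneg dflux_nonneg) (auto simp: pos_le_divide_eq add_pos_nonneg)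
    also have "\<dots> = 6 * L * G (norm w)" by (simp add: shift_flux_def)
    finally show ?thesis .
  qed
qed

text \<open>The segment may pass close to \<open>0\<close>, where ellipticity is of a different order. The derivative of
  \<open>t \<mapsto> A (P + t w) \<bullet> w\<close> is nonnegative everywhere, so a quarter of the segment suffices, on which
  \<open>1 + |\<xi>|\<close> is comparable to \<open>\<sigma> + |w|\<close>: the first quarter if \<open>|w| \<le> 2 |P|\<close>, the last one
  otherwise.\<close>

lemma monotonicity_shift_flux:
  fixes A :: "'m::euclidean_space \<Rightarrow> 'm"
  assumes diff: "\<And>\<xi>. A differentiable (at \<xi>)" and \<nu>: "0 \<le> \<nu>"
    and A2: "\<And>\<xi> \<zeta>. frechet_derivative A (at \<xi>) \<zeta> \<bullet> \<zeta> \<ge>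
      \<nu> * (p * (p - 1) * (1 + norm \<xi>) powr (p - 2) + c * q * (q - 1) * (1 + norm \<xi>) powr (q - 2)) * (norm \<zeta>)\<^sup>2"
    and \<sigma>P: "\<sigma> = 1 + norm P"
  shows "(A (P + w) - A P) \<bullet> w \<ge> \<nu> * (p - 1) * 6 powr (1 - q) / 4 * (G (norm w) * norm w)"
proof -
  define f where "f t = A (P + t *\<^sub>R w) \<bullet> w" for t
  define f' where "f' t = frechet_derivative A (at (P + t *\<^sub>R w)) w \<bullet> w" for t
  have der: "(f has_real_derivative f' t) (at t)" for t
  proof -
    have "((\<lambda>t. P + t *\<^sub>R w) has_derivative (\<lambda>h. h *\<^sub>R w)) (at t)" by (auto intro!: derivative_eq_intros)
    from diff_chain_at[OF this, of A "frechet_derivative A (at (P + t *\<^sub>R w))"] diff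
    have "((\<lambda>t. A (P + t *\<^sub>R w)) has_derivative (\<lambda>h. frechet_derivative A (at (P + t *\<^sub>R w)) (h *\<^sub>R w))) (at t)"
      by (simp add: o_def frechet_derivative_works)
    then have "(f has_derivative (\<lambda>h. frechet_derivative A (at (P + t *\<^sub>R w)) (h *\<^sub>R w) \<bullet> w)) (at t)"
      unfolding f_def by (rule has_derivative_inner_left)
    moreover have "linear (frechet_derivative A (at (P + t *\<^sub>R w)))"
      using diff by (simp add: linear_frechet_derivative)
    then have "(\<lambda>h. frechet_derivative A (at (P + t *\<^sub>R w)) (h *\<^sub>R w) \<bullet> w) = (*) (f' t)"
      by (auto simp: linear_scale f'_def)
    ultimately show ?thesis by (simp add: has_field_derivative_def)
  qed
  let ?s = "\<sigma> + norm w"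
  have s0: "?s > 0" using \<sigma> by (simp add: add_pos_nonneg)
  \<comment> \<open>\<open>K x\<close> is \<open>H'(x) / x\<close> and bounds \<open>H''\<close> from below up to the factor \<open>p - 1\<close>.\<close>
  define K where "K x = p * x powr (p - 2) + c * q * x powr (q - 2)" for x
  have Kx: "K x = H' x / x" if "x > 0" for x
  proof -
    have "x powr (m - 1) = x powr (m - 2) * x" for m using powr_add[of x "m - 2" 1] that by simp
    from this[of p] this[of q] show ?thesis using that by (simp add: K_def dflux_def field_simps)
  qed
  have f'_ge: "f' t \<ge> \<nu> * (p - 1) * K (1 + norm (P + t *\<^sub>R w)) * (norm w)\<^sup>2" for t
  proof -
    let ?x = "1 + norm (P + t *\<^sub>R w)"
    have "(p - 1) * K ?x \<le> p * (p - 1) * ?x powr (p - 2) + c * q * (q - 1) * ?x powr (q - 2)"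
    proof -
      have "(p - 1) * (c * q * ?x powr (q - 2)) \<le> (q - 1) * (c * q * ?x powr (q - 2))"
        using p pq c by (intro mult_right_mono) auto
      then show ?thesis by (simp add: K_def algebra_simps)
    qed
    then have "\<nu> * ((p - 1) * K ?x) * (norm w)\<^sup>2 \<le> \<nu> * (p * (p - 1) * ?x powr (p - 2) + c * q * (q - 1) * ?x powr (q - 2)) * (norm w)\<^sup>2"
      using \<nu> by (intro mult_right_mono mult_left_mono) auto
    also have "\<dots> \<le> f' t" unfolding f'_def by (rule A2)
    finally show ?thesis by (simp add: mult.assoc)
  qed
  have K0: "0 \<le> K x" for x unfolding K_def using p pq c by simp
  have f'0: "f' t \<ge> 0" for t
  proof -
    have "0 \<le> \<nu> * (p - 1) * K (1 + norm (P + t *\<^sub>R w)) * (norm w)\<^sup>2" using \<nu> p K0 by simp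
    then show ?thesis using f'_ge[of t] by linarith
  qed
  have mono: "f x \<le> f y" if "x \<le> y" for x y
    using that der f'0 by (metis DERIV_nonneg_imp_nondecreasing)
  have "\<exists>x y. 0 \<le> x \<and> y \<le> 1 \<and> y - x = 1/4 \<and> (\<forall>t\<in>{x..y}. ?s / 6 \<le> 1 + norm (P + t *\<^sub>R w))"
  proof (cases "norm w \<le> 2 * norm P")
    case True
    have "?s / 6 \<le> 1 + norm (P + t *\<^sub>R w)" if "t \<in> {0..1/4}" for t
    proof -
      have "norm P \<le> norm (P + t *\<^sub>R w) + norm (t *\<^sub>R w)"
        using norm_triangle_ineq4[of "P + t *\<^sub>R w" "t *\<^sub>R w"] by simp
      moreover have "t * norm w \<le> 1/4 * norm w" using that by (intro mult_right_mono) auto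
      then have "norm (t *\<^sub>R w) \<le> 1/4 * norm w" using that by simp
      ultimately show ?thesis using True \<sigma>P by simp
    qed
    then show ?thesis by (intro exI[of _ 0] exI[of _ "1/4"]) auto
  next
    case False
    have "?s / 6 \<le> 1 + norm (P + t *\<^sub>R w)" if "t \<in> {3/4..1}" for t
    proof -
      have "norm (t *\<^sub>R w) \<le> norm (P + t *\<^sub>R w) + norm P"
        using norm_triangle_ineq4[of "P + t *\<^sub>R w" P] by simp
      moreover have "t * norm w \<ge> 3/4 * norm w" using that by (intro mult_right_mono) auto
      then have "norm (t *\<^sub>R w) \<ge> 3/4 * norm w" using that by simp
      ultimately show ?thesis using False \<sigma>P by simp
    qed
    then show ?thesis by (intro exI[of _ "3/4"] exI[of _ 1]) auto
  qed
  then obtain x y where xy: "0 \<le> x" "y \<le> 1" "y - x = 1/4" "\<And>t. t \<in> {x..y} \<Longrightarrow> ?s / 6 \<le> 1 + norm (P + t *\<^sub>R w)"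
    by blast
  have "x < y" using xy(3) by simp
  have "\<exists>z. x < z \<and> z < y \<and> f y - f x = (y - x) * f' z"
    by (rule MVT2[OF \<open>x < y\<close>]) (rule der)
  then obtain t where t: "x < t" "t < y" "f y - f x = (y - x) * f' t" by blast
  let ?x = "1 + norm (P + t *\<^sub>R w)"
  have low: "?s / 6 \<le> ?x" using xy(4)[of t] t by auto
  have "norm (t *\<^sub>R w) \<le> norm w" using t xy by (simp add: mult_left_le_one_le)
  then have up: "?x \<le> ?s" using norm_triangle_ineq[of P "t *\<^sub>R w"] by (simp add: \<sigma>P)
  have "6 * (?s / 6) = ?s" by simp
  then have "H' ?s \<le> 6 powr (q - 1) * H' (?s / 6)" using dflux_scale[of 6 "?s / 6"] s0 by (simp only:)
  also have "\<dots> \<le> 6 powr (q - 1) * H' ?x" using low s0 by (intro mult_left_mono dflux_mono) auto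
  finally have "6 powr (1 - q) * H' ?s \<le> H' ?x" by (simp add: powr_diff field_simps)
  then have "6 powr (1 - q) * H' ?s / ?s \<le> H' ?x / ?x"
    using up s0 by (intro frac_le dflux_nonneg) (auto simp: add_pos_nonneg)
  also have "\<dots> = K ?x" by (rule Kx[symmetric]) (simp add: add_pos_nonneg)
  finally have "\<nu> * (p - 1) * (6 powr (1 - q) * H' ?s / ?s) * (norm w)\<^sup>2 \<le> \<nu> * (p - 1) * K ?x * (norm w)\<^sup>2"
    using \<nu> p by (intro mult_right_mono mult_left_mono) auto
  also have "\<dots> \<le> f' t" by (rule f'_ge)
  finally have f't: "\<nu> * (p - 1) * (6 powr (1 - q) * H' ?s / ?s) * (norm w)\<^sup>2 \<le> f' t" .
  then have "\<nu> * (p - 1) * 6 powr (1 - q) / 4 * (G (norm w) * norm w) \<le> (y - x) * f' t"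
  proof -
    obtain S where S: "S = ?s" by simp
    have "G (norm w) = H' S * norm w / S" by (simp add: shift_flux_def S)
    then have "\<nu> * (p - 1) * 6 powr (1 - q) / 4 * (G (norm w) * norm w)
        = (1 / 4) * (\<nu> * (p - 1) * (6 powr (1 - q) * H' S / S) * (norm w)\<^sup>2)"
      by (simp add: power2_eq_square)
    then show ?thesis
      unfolding xy(3) S by (simp only:) (rule mult_left_mono[OF f't], simp)
  qed
  also have "\<dots> = f y - f x" using t by simp
  also have "\<dots> \<le> f 1 - f 0" using mono[OF xy(1)] mono[OF xy(2)] by simp
  also have "\<dots> = (A (P + w) - A P) \<bullet> w" by (simp add: f_def inner_diff_left)
  finally show ?thesis .
qed

end

text \<open>The flux with the coefficient \<open>d\<close> is first compared with the one with \<open>c\<close>. This produces a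
  product of two small factors; bounding one of them by \<open>2\<close> leaves a single power of the factor in
  the conclusion. That factor is \<open>C\<^sub>1\<close> if \<open>R = r\<^sub>2 + \<surd>\<rho>\<^sub>2\<close>.\<close>

lemma frozen_coefficient_error:
  fixes p q L \<sigma> R \<beta> \<alpha> c d e :: real
  assumes pq: "1 < p" "p \<le> q" and L: "0 \<le> L" and c: "0 \<le> c" "0 \<le> d" and \<sigma>: "1 \<le> \<sigma>"
    and R: "0 < R" "R \<le> 2" and \<beta>: "0 < \<beta>" "\<beta> \<le> 1" and cd: "\<bar>c - d\<bar> \<le> L * (2 * R powr \<alpha>)"
    and e: "e \<le> L * R powr \<beta> * (dflux p q c \<sigma> + dflux p q d \<sigma>) + L * \<bar>c - d\<bar> * \<sigma> powr (q - 1)"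
  shows "e \<le> (2 * L + 4 * q * L\<^sup>2 + 2 * L\<^sup>2) * (R powr \<beta> + R powr \<alpha> * \<sigma> powr (q - p)) * dflux p q c \<sigma>"
proof -
  define h where "h = dflux p q c \<sigma>"
  define x where "x = R powr \<alpha> * \<sigma> powr (q - p)"
  define y where "y = R powr \<beta>"
  have x0: "0 \<le> x" and y0: "0 \<le> y" by (simp_all add: x_def y_def)
  have y2: "y \<le> 2"
  proof -
    have "R powr \<beta> \<le> 2 powr \<beta>" using R \<beta> by (intro powr_mono2) auto
    also have "\<dots> \<le> 2 powr 1" using \<beta> by (intro powr_mono) auto
    finally show ?thesis by (simp add: y_def)
  qed
  have \<sigma>h: "\<sigma> powr (p - 1) \<le> h"
  proof -
    have "1 * \<sigma> powr (p - 1) \<le> p * \<sigma> powr (p - 1)" using pq by (intro mult_right_mono) auto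
    moreover have "0 \<le> c * q * \<sigma> powr (q - 1)" using c pq by simp
    ultimately show ?thesis by (simp add: h_def dflux_def)
  qed
  have "\<bar>c - d\<bar> * \<sigma> powr (q - 1) \<le> L * (2 * R powr \<alpha>) * \<sigma> powr (q - 1)"
    using cd by (intro mult_right_mono) auto
  also have "\<dots> = 2 * L * x * \<sigma> powr (p - 1)"
  proof -
    have "\<sigma> powr (q - 1) = \<sigma> powr (q - p) * \<sigma> powr (p - 1)" by (simp flip: powr_add)
    then show ?thesis by (simp add: x_def)
  qed
  also have "\<dots> \<le> 2 * L * x * h" using \<sigma>h L x0 by (intro mult_left_mono) auto
  finally have cd': "\<bar>c - d\<bar> * \<sigma> powr (q - 1) \<le> 2 * L * x * h" .
  have "d * q * \<sigma> powr (q - 1) \<le> (c + \<bar>c - d\<bar>) * q * \<sigma> powr (q - 1)"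
    using pq by (intro mult_right_mono) auto
  then have "dflux p q d \<sigma> \<le> h + q * (\<bar>c - d\<bar> * \<sigma> powr (q - 1))"
    by (simp add: h_def dflux_def algebra_simps)
  also have "\<dots> \<le> h + q * (2 * L * x * h)" using cd' pq by (intro add_left_mono mult_left_mono) auto
  finally have d: "dflux p q d \<sigma> \<le> h + q * (2 * L * x * h)" .
  have h0: "0 \<le> h" using \<sigma>h powr_ge_zero[of \<sigma> "p - 1"] by linarith
  have "e \<le> L * y * (h + dflux p q d \<sigma>) + L * (\<bar>c - d\<bar> * \<sigma> powr (q - 1))"
    using e by (simp add: h_def y_def mult.assoc)
  also have "\<dots> \<le> L * y * (h + (h + q * (2 * L * x * h))) + L * (2 * L * x * h)"
    using d cd' L y0 by (intro add_mono mult_left_mono order_refl) auto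
  also have "\<dots> = 2 * L * y * h + 2 * q * L\<^sup>2 * x * h * y + 2 * L\<^sup>2 * x * h"
    by (simp add: power2_eq_square algebra_simps)
  also have "\<dots> \<le> 2 * L * y * h + 2 * q * L\<^sup>2 * x * h * 2 + 2 * L\<^sup>2 * x * h"
    using y2 pq x0 h0 by (intro add_mono mult_left_mono order_refl) auto
  also have "\<dots> \<le> (2 * L + 4 * q * L\<^sup>2 + 2 * L\<^sup>2) * (y + x) * h"
  proof -
    have "(2 * L + 4 * q * L\<^sup>2 + 2 * L\<^sup>2) * (y + x) * h = (2 * L * y * h + 2 * q * L\<^sup>2 * x * h * 2 + 2 * L\<^sup>2 * x * h)
        + (2 * L * x * h + (4 * q * L\<^sup>2 + 2 * L\<^sup>2) * y * h)"
      by (simp add: algebra_simps)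
    moreover have "0 \<le> 2 * L * x * h + (4 * q * L\<^sup>2 + 2 * L\<^sup>2) * y * h" using L x0 y0 h0 pq by simp
    ultimately show ?thesis by linarith
  qed
  finally show ?thesis by (simp add: h_def x_def y_def)
qed

section \<open>Slicing Lebesgue measurable functions\<close>

lemma borel_measurable_lebesgue_AE:
  fixes f :: "'a::euclidean_space \<Rightarrow> 'b::topological_space"
  assumes g: "g \<in> borel_measurable lebesgue" and ae: "AE x in lebesgue. f x = g x"
  shows "f \<in> borel_measurable lebesgue"
proof (rule measurableI)
  fix S :: "'b set" assume "S \<in> sets borel"
  then have "g -` S \<inter> space lebesgue \<in> sets lebesgue" using g by (rule measurable_sets[rotated])
  then show "f -` S \<inter> space lebesgue \<in> sets lebesgue"
    by (rule completion.in_sets_AE[rotated]) (use ae in \<open>auto elim: eventually_mono\<close>)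
qed simp

lemma AE_slices:
  fixes P :: "'a::euclidean_space \<times> 'b::euclidean_space \<Rightarrow> bool"
  assumes "AE z in lborel. P z"
  shows "AE t in lborel. AE x in lborel. P (x, t)"
proof -
  obtain N where N': "{z \<in> space lborel. \<not> P z} \<subseteq> N" "emeasure lborel N = 0" "N \<in> sets lborel"
    by (rule AE_E[OF assms])
  then have N: "N \<in> sets borel" "emeasure lborel N = 0" "{z. \<not> P z} \<subseteq> N" by simp_all
  have "AE z in (lborel \<Otimes>\<^sub>M lborel :: ('a \<times> 'b) measure). z \<notin> N"
    unfolding lborel_prod using N by (intro AE_not_in) auto
  then have "AE x in lborel. AE t in lborel. (x, t) \<notin> N" by (rule lborel_pair.AE_pair)
  moreover have "{z \<in> space (lborel \<Otimes>\<^sub>M lborel :: ('a \<times> 'b) measure). (fst z, snd z) \<notin> N} \<in> sets (lborel \<Otimes>\<^sub>M lborel)"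
    unfolding lborel_prod using N(1) by (auto simp: Compl_eq[symmetric] intro: borel_comp)
  ultimately have "AE t in lborel. AE x in lborel. (x, t) \<notin> N"
    using lborel_pair.AE_commute[of "\<lambda>x t. (x, t) \<notin> N"] by blast
  then show ?thesis using N(3) by (auto elim!: eventually_mono)
qed

text \<open>A Lebesgue measurable function on a product has measurable slices only almost everywhere, so
  Fubini's theorem is applied to a Borel representative.\<close>

lemma integral_lebesgue_slices:
  fixes f :: "'a::euclidean_space \<times> 'b::euclidean_space \<Rightarrow> real"
  assumes f: "integrable lebesgue f"
  obtains h where "integrable lborel h" "integral\<^sup>L lebesgue f = (LINT t|lborel. h t)"
    "AE t in lborel. h t = (LINT x|lebesgue. f (x, t))"
proof -
  obtain g where g: "g \<in> borel_measurable lborel" "AE z in lborel. f z = g z"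
    using completion_ex_borel_measurable_real[OF borel_measurable_integrable[OF f]] by blast
  have gm: "g \<in> borel_measurable lebesgue" using g(1) by (rule measurable_completion)
  have "integrable lebesgue g"
    using f gm AE_completion[OF g(2)] by (rule Bochner_Integration.integrable_cong_AE_imp)
  then have ig: "integrable lborel g" using integrable_completion[OF g(1)] by simp
  have fg: "integral\<^sup>L lebesgue f = integral\<^sup>L lborel g"
    using integral_cong_AE[of f lebesgue g] f gm AE_completion[OF g(2)] integral_completion[OF g(1)] by simp
  have ig': "integrable (lborel \<Otimes>\<^sub>M lborel) (case_prod (\<lambda>x t. g (x, t)))"
    unfolding lborel_prod using ig by simp
  have "AE t in lborel. (LINT x|lborel. g (x, t)) = (LINT x|lebesgue. f (x, t))"
    using AE_slices[OF g(2)]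
  proof eventually_elim
    case (elim t)
    have gt: "(\<lambda>x. g (x, t)) \<in> borel_measurable lborel" using g(1) by simp
    have gtl: "(\<lambda>x. g (x, t)) \<in> borel_measurable lebesgue" using gt by (rule measurable_completion)
    have ae: "AE x in lebesgue. f (x, t) = g (x, t)" using elim by (rule AE_completion)
    have "(LINT x|lebesgue. f (x, t)) = (LINT x|lebesgue. g (x, t))"
      by (rule integral_cong_AE[OF borel_measurable_lebesgue_AE[OF gtl ae] gtl ae])
    then show ?case using integral_completion[OF gt] by simp
  qed
  moreover have "(LINT t|lborel. LINT x|lborel. g (x, t)) = integral\<^sup>L lborel g"
    using lborel_pair.integral_snd[OF ig'] unfolding lborel_prod by simp
  ultimately show ?thesis
    using that[of "\<lambda>t. LINT x|lborel. g (x, t)"] lborel_pair.integrable_snd[OF ig'] fg by simp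
qed

text \<open>This transfers the definition of the weak gradient, which concerns almost every time, to
  space-time.\<close>

lemma integral_eqI_slices:
  fixes f g :: "'a::euclidean_space \<times> 'b::euclidean_space \<Rightarrow> real"
  assumes "integrable lebesgue f" "integrable lebesgue g"
    and eq: "AE t in lborel. (LINT x|lebesgue. f (x, t)) = (LINT x|lebesgue. g (x, t))"
  shows "integral\<^sup>L lebesgue f = integral\<^sup>L lebesgue g"
proof -
  obtain h where h: "integrable lborel h" "integral\<^sup>L lebesgue f = (LINT t|lborel. h t)"
    "AE t in lborel. h t = (LINT x|lebesgue. f (x, t))" using integral_lebesgue_slices[OF assms(1)] by blast
  obtain k where k: "integrable lborel k" "integral\<^sup>L lebesgue g = (LINT t|lborel. k t)"
    "AE t in lborel. k t = (LINT x|lebesgue. g (x, t))" using integral_lebesgue_slices[OF assms(2)] by blast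
  have "(LINT t|lborel. h t) = (LINT t|lborel. k t)"
  proof (rule integral_cong_AE)
    show "AE t in lborel. h t = k t" using h(3) k(3) eq by eventually_elim simp
  qed (use h k in auto)
  then show ?thesis using h k by simp
qed

lemma nn_integral_lebesgue_slices:
  fixes f :: "'a::euclidean_space \<times> 'b::euclidean_space \<Rightarrow> real"
  assumes f: "f \<in> borel_measurable lebesgue"
  shows "(\<integral>\<^sup>+z. ennreal (f z) \<partial>lebesgue) = (\<integral>\<^sup>+t. \<integral>\<^sup>+x. ennreal (f (x, t)) \<partial>lebesgue \<partial>lebesgue)"
    and "(\<lambda>t. \<integral>\<^sup>+x. ennreal (f (x, t)) \<partial>lebesgue) \<in> borel_measurable lebesgue"
proof -
  obtain g where g: "g \<in> borel_measurable lborel" "AE z in lborel. f z = g z"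
    using completion_ex_borel_measurable_real[OF f] by blast
  have g': "(\<lambda>z. ennreal (g z)) \<in> borel_measurable (lborel \<Otimes>\<^sub>M lborel)" unfolding lborel_prod using g(1) by measurable
  have ae: "AE t in lborel. (\<integral>\<^sup>+x. ennreal (f (x, t)) \<partial>lborel) = (\<integral>\<^sup>+x. ennreal (g (x, t)) \<partial>lborel)"
    using AE_slices[OF g(2)]
  proof eventually_elim
    case (elim t)
    show ?case by (rule nn_integral_cong_AE) (use elim in \<open>auto elim: eventually_mono\<close>)
  qed
  have "(\<integral>\<^sup>+z. ennreal (f z) \<partial>lebesgue) = (\<integral>\<^sup>+z. ennreal (g z) \<partial>lborel)"
    unfolding nn_integral_completion by (rule nn_integral_cong_AE) (use g(2) in \<open>auto elim: eventually_mono\<close>)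
  also have "\<dots> = (\<integral>\<^sup>+t. \<integral>\<^sup>+x. ennreal (g (x, t)) \<partial>lborel \<partial>lborel)"
    using lborel_pair.nn_integral_snd[OF g'] unfolding lborel_prod by simp
  also have "\<dots> = (\<integral>\<^sup>+t. \<integral>\<^sup>+x. ennreal (f (x, t)) \<partial>lborel \<partial>lborel)"
    by (rule nn_integral_cong_AE) (use ae in \<open>auto elim: eventually_mono\<close>)
  finally show "(\<integral>\<^sup>+z. ennreal (f z) \<partial>lebesgue) = (\<integral>\<^sup>+t. \<integral>\<^sup>+x. ennreal (f (x, t)) \<partial>lebesgue \<partial>lebesgue)"
    by (simp add: nn_integral_completion)
  have "(\<lambda>t. \<integral>\<^sup>+x. ennreal (g (x, t)) \<partial>lborel) \<in> borel_measurable lborel"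
    using g(1) by measurable
  from borel_measurable_lebesgue_AE[OF measurable_completion[OF this] AE_completion[OF ae]]
  show "(\<lambda>t. \<integral>\<^sup>+x. ennreal (f (x, t)) \<partial>lebesgue) \<in> borel_measurable lebesgue"
    by (simp add: nn_integral_completion)
qed

section \<open>Test functions\<close>

lemma test_function_facts:
  fixes \<zeta> :: "'a::euclidean_space \<Rightarrow> real"
  assumes "test_function U \<zeta>"
  obtains R where "Ck (Suc 0) \<zeta>" "\<And>z. z \<notin> U \<Longrightarrow> \<zeta> z = 0" "\<And>z h. z \<notin> U \<Longrightarrow> pd \<zeta> h z = 0"
    "\<And>z. norm z > R \<Longrightarrow> \<zeta> z = 0"
proof -
  define K where "K = closure {x. \<zeta> x \<noteq> 0}"
  have C: "Ck (Suc 0) \<zeta>" using assms unfolding test_function_def by blast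
  have K: "compact K" "K \<subseteq> U" using assms by (simp_all add: test_function_def K_def)
  have 0: "\<zeta> z = 0" if "z \<notin> K" for z
    using that closure_subset[of "{x. \<zeta> x \<noteq> 0}"] unfolding K_def by blast
  have pd0: "pd \<zeta> h z = 0" if "z \<notin> K" for z h
  proof -
    have "((\<lambda>x. 0) has_derivative (\<lambda>h. 0)) (at z)" by (rule has_derivative_const)
    then have "(\<zeta> has_derivative (\<lambda>h. 0)) (at z)"
      by (rule has_derivative_transform_within_open[where s="- K"])
        (use that 0 compact_imp_closed[OF K(1)] in \<open>auto simp: open_Compl\<close>)
    then show ?thesis by (simp add: frechet_derivative_eqI)
  qed
  obtain R where R: "\<And>z. z \<in> K \<Longrightarrow> norm z \<le> R"
    using compact_imp_bounded[OF K(1)] by (auto simp: bounded_iff)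
  show ?thesis
  proof (rule that[of R, OF C])
    show "\<zeta> z = 0" if "z \<notin> U" for z using 0 K(2) that by blast
    show "pd \<zeta> h z = 0" if "z \<notin> U" for z h using pd0 K(2) that by blast
    show "\<zeta> z = 0" if "norm z > R" for z using 0[of z] R[of z] that by (metis not_le)
  qed
qed

lemma integrable_mult_continuous_bounded_support:
  fixes f g :: "'a::euclidean_space \<Rightarrow> real"
  assumes f: "integrable lebesgue f" and g: "continuous_on UNIV g" "\<And>x. norm x > R \<Longrightarrow> g x = 0"
  shows "integrable lebesgue (\<lambda>x. f x * g x)"
proof -
  obtain M where M: "\<And>x. \<bar>g x\<bar> \<le> M" using continuous_bounded_support_bounded[OF g] by blast
  have gm: "g \<in> borel_measurable lebesgue"
    using g(1) by (intro measurable_completion) (simp add: borel_measurable_continuous_onI)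
  have "norm (f x * g x) \<le> norm (M * f x)" for x
  proof -
    have "\<bar>f x\<bar> * \<bar>g x\<bar> \<le> \<bar>f x\<bar> * \<bar>M\<bar>" using M[of x] by (intro mult_left_mono) auto
    then show ?thesis by (simp add: abs_mult mult.commute)
  qed
  then show ?thesis
    using f gm by (intro Bochner_Integration.integrable_bound[OF integrable_mult_right[OF f, of M]]) auto
qed

lemma test_function_integrable:
  fixes \<zeta> :: "'a::euclidean_space \<Rightarrow> real"
  assumes \<zeta>: "test_function U \<zeta>" and f: "integrable lebesgue f"
  shows "integrable lebesgue (\<lambda>z. f z * \<zeta> z)" "b \<in> Basis \<Longrightarrow> integrable lebesgue (\<lambda>z. f z * pd \<zeta> b z)"
proof -
  obtain R where R: "Ck (Suc 0) \<zeta>" "\<And>z. norm z > R \<Longrightarrow> \<zeta> z = 0" using test_function_facts[OF \<zeta>] by metis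
  show "integrable lebesgue (\<lambda>z. f z * \<zeta> z)"
    by (rule integrable_mult_continuous_bounded_support[OF f Ck_imp_continuous[OF R(1)] R(2)])
  show "integrable lebesgue (\<lambda>z. f z * pd \<zeta> b z)" if "b \<in> Basis"
    by (rule integrable_mult_continuous_bounded_support[OF f Ck_pd_continuous[OF R(1) that], of R])
      (rule frechet_derivative_zero_outside[where R=R], use R(2) in auto)
qed

text \<open>With it the affine map can be subtracted from the weak equations.\<close>

lemma integral_C1_by_parts:
  fixes \<zeta> :: "'a::euclidean_space \<Rightarrow> real"
  assumes \<zeta>: "test_function U \<zeta>" and l: "Ck (Suc 0) l" and b: "b \<in> Basis"
  shows "(LINT z|lebesgue. indicator U z * l z * pd \<zeta> b z) = - (LINT z|lebesgue. indicator U z * pd l b z * \<zeta> z)"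
proof -
  obtain R where R: "Ck (Suc 0) \<zeta>" "\<And>z. z \<notin> U \<Longrightarrow> \<zeta> z = 0" "\<And>z h. z \<notin> U \<Longrightarrow> pd \<zeta> h z = 0"
    "\<And>z. norm z > R \<Longrightarrow> \<zeta> z = 0" using test_function_facts[OF \<zeta>] by metis
  have e: "indicator U z * l z * pd \<zeta> b z = l z * pd \<zeta> b z"
    "indicator U z * pd l b z * \<zeta> z = pd l b z * \<zeta> z" for z
    using R(2,3) by (metis indicator_simps mult_1 mult_zero_left mult_zero_right)+
  have "(LINT z|lebesgue. pd (\<lambda>z. l z * \<zeta> z) b z) = 0"
    by (rule integral_frechet_derivative_zero(2)[where R=R, OF Ck_mult[OF l R(1)] _ b]) (simp add: R(4))
  moreover have "integrable lebesgue (\<lambda>z. l z * pd \<zeta> b z)"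
  proof (rule integrable_continuous_bounded_support[where R=R])
    show "continuous_on UNIV (\<lambda>z. l z * pd \<zeta> b z)"
      by (intro continuous_on_mult Ck_imp_continuous[OF l] Ck_pd_continuous[OF R(1) b])
    show "l z * pd \<zeta> b z = 0" if "norm z > R" for z
      using frechet_derivative_zero_outside[where R=R and f=\<zeta>] R(4) that by simp
  qed
  moreover have "integrable lebesgue (\<lambda>z. pd l b z * \<zeta> z)"
    by (rule integrable_continuous_bounded_support[where R=R])
      (auto simp: R(4) intro!: continuous_on_mult Ck_imp_continuous[OF R(1)] Ck_pd_continuous[OF l b])
  ultimately show ?thesis unfolding e by (simp add: pd_mult[OF l R(1)])
qed

lemma test_function_slice:
  fixes \<zeta> :: "(real^'n) \<times> real \<Rightarrow> real"
  assumes \<zeta>: "test_function U \<zeta>" and U: "U \<subseteq> \<Omega> \<times> I"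
  shows "test_function \<Omega> (\<lambda>x. \<zeta> (x, t))"
    and "frechet_derivative (\<lambda>x. \<zeta> (x, t)) (at x) (axis j 1) = pd \<zeta> (xdir j) (x, t)"
proof -
  let ?K = "closure {z. \<zeta> z \<noteq> 0}"
  have K: "compact ?K" "?K \<subseteq> U" and C: "Ck k \<zeta>" for k using \<zeta> by (auto simp: test_function_def)
  have bl: "bounded_linear (\<lambda>x::real^'n. (x, 0::real))"
    by (intro bounded_linear_Pair bounded_linear_ident bounded_linear_zero)
  have 1: "Ck k (\<lambda>x. \<zeta> (x, t))" for k
    using Ck_affine_vimage[OF bl C, of k "(0, t)"] by simp
  have cK: "compact (fst ` ?K)" by (rule compact_continuous_image[OF _ K(1)]) (intro continuous_intros)
  have "x \<in> fst ` ?K" if "\<zeta> (x, t) \<noteq> 0" for x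
    using that closure_subset[of "{z. \<zeta> z \<noteq> 0}"] by force
  then have sub: "closure {x. \<zeta> (x, t) \<noteq> 0} \<subseteq> fst ` ?K"
    by (intro closure_minimal compact_imp_closed[OF cK]) auto
  then have "compact (closure {x. \<zeta> (x, t) \<noteq> 0})"
    using bounded_subset[OF compact_imp_bounded[OF cK]] by (simp add: compact_eq_bounded_closed)
  moreover have "fst ` ?K \<subseteq> \<Omega>" using K(2) U by auto
  ultimately show "test_function \<Omega> (\<lambda>x. \<zeta> (x, t))"
    using 1 sub by (auto simp: test_function_def)
  have d: "((\<lambda>x. (x, t)) has_derivative (\<lambda>h. (h, 0))) (at x)"
    by (auto intro!: derivative_eq_intros)
  from diff_chain_at[OF d Ck_has_derivative[OF C[of "Suc 0"]]]
  have "((\<lambda>x. \<zeta> (x, t)) has_derivative (\<lambda>h. frechet_derivative \<zeta> (at (x, t)) (h, 0))) (at x)"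
    by (simp add: o_def)
  then show "frechet_derivative (\<lambda>x. \<zeta> (x, t)) (at x) (axis j 1) = pd \<zeta> (xdir j) (x, t)"
    by (simp add: frechet_derivative_eqI)
qed

section \<open>Weak solutions on a cylinder\<close>

lemma powr_one_plus_le:
  fixes s m :: real
  assumes "0 \<le> s" "0 < m"
  shows "(1 + s) powr m \<le> 2 powr m * (1 + s powr m)"
proof -
  have "(1 + s) powr m \<le> (2 * max 1 s) powr m" using assms by (intro powr_mono2) auto
  also have "\<dots> = 2 powr m * max 1 s powr m" using assms by (simp add: powr_mult)
  also have "max 1 s powr m \<le> 1 + s powr m" using assms by (auto simp: max_def)
  finally show ?thesis by (simp add: mult_left_mono)
qed

lemma matrix_component_le: "\<bar>(X :: real^'n^'m) $ i $ j\<bar> \<le> norm X"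
  by (metis Finite_Cartesian_Product.norm_nth_le order_trans real_norm_def)

lemma inner_matrix: "(X :: real^'n^'m) \<bullet> Y = (\<Sum>i\<in>UNIV. \<Sum>j\<in>UNIV. X $ i $ j * Y $ i $ j)"
  by (simp add: inner_vec_def)

text \<open>Joint continuity yields measurability of \<open>z \<mapsto> A z (Du z)\<close>. Locally in \<open>\<xi>\<close> the field is Lipschitz
  uniformly in \<open>z\<close> by the first structure condition, and at fixed \<open>\<xi>\<close> it is continuous in \<open>z\<close> by
  the third.\<close>

lemma structure_continuous:
  fixes A :: "(real^'n) \<times> real \<Rightarrow> real^'n^'N \<Rightarrow> real^'n^'N"
  assumes pq: "1 < p" "p \<le> q" and L: "0 \<le> L" and \<alpha>: "0 < \<alpha>" and \<beta>: "0 < \<beta>"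
    and a: "\<And>z. z \<in> U \<Longrightarrow> 0 \<le> a z \<and> a z \<le> L"
    and hol: "\<And>z z'. z \<in> U \<Longrightarrow> z' \<in> U \<Longrightarrow>
      \<bar>a z - a z'\<bar> \<le> L * (norm (fst z - fst z') powr \<alpha> + \<bar>snd z - snd z'\<bar> powr (\<alpha> / 2))"
    and A1: "condA1 p q L U a A" and A3: "condA3 p q L \<beta> U a A"
  shows "continuous_on (U \<times> UNIV) (\<lambda>y. A (fst y) (snd y))"
  unfolding continuous_on_def
proof
  fix y0 assume "y0 \<in> U \<times> (UNIV :: (real^'n^'N) set)"
  then obtain z0 \<xi>0 where y0: "y0 = (z0, \<xi>0)" and z0: "z0 \<in> U" by auto
  let ?F = "at y0 within U \<times> UNIV"
  define D where "D = dflux p q L (2 + norm \<xi>0)"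
  have D: "dflux p q (a z) (1 + norm \<xi>) \<le> D" if "z \<in> U" "norm \<xi> \<le> 1 + norm \<xi>0" for z \<xi>
  proof -
    have "dflux p q (a z) y \<le> dflux p q L Y" if "0 \<le> y" "y \<le> Y" for y Y
      unfolding dflux_def using that a[OF \<open>z \<in> U\<close>] pq
      by (intro add_mono mult_mono mult_left_mono powr_mono2) (auto simp: add_nonneg_nonneg)
    then show ?thesis unfolding D_def using that by (simp add: add_nonneg_nonneg)
  qed
  have xi: "norm (A z \<xi> - A z \<xi>0) \<le> L * D * norm (\<xi> - \<xi>0)" if z: "z \<in> U" and \<xi>: "norm (\<xi> - \<xi>0) \<le> 1" for z \<xi>
  proof (rule differentiable_bound[OF convex_cball[of \<xi>0 1]])
    fix \<zeta> assume "\<zeta> \<in> cball \<xi>0 1"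
    then have \<zeta>: "norm \<zeta> \<le> 1 + norm \<xi>0"
      using norm_triangle_ineq[of "\<zeta> - \<xi>0" \<xi>0] by (simp add: dist_norm norm_minus_commute)
    have diff: "A z differentiable (at \<zeta>)"
      and b: "norm (A z \<zeta>) + (1 + norm \<zeta>) * onorm (frechet_derivative (A z) (at \<zeta>)) \<le> L * dphase' p q a z (1 + norm \<zeta>)"
      using A1 z by (auto simp: condA1_def)
    show "(A z has_derivative frechet_derivative (A z) (at \<zeta>)) (at \<zeta> within cball \<xi>0 1)"
      using diff by (simp add: frechet_derivative_works has_derivative_at_withinI)
    have on: "0 \<le> onorm (frechet_derivative (A z) (at \<zeta>))"
      using diff by (intro onorm_pos_le) (simp add: frechet_derivative_works has_derivative_bounded_linear)
    have "1 * onorm (frechet_derivative (A z) (at \<zeta>)) \<le> (1 + norm \<zeta>) * onorm (frechet_derivative (A z) (at \<zeta>))"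
      using on by (intro mult_right_mono) auto
    also have "\<dots> \<le> L * dphase' p q a z (1 + norm \<zeta>)" using b norm_ge_zero[of "A z \<zeta>"] by linarith
    also have "dphase' p q a z (1 + norm \<zeta>) = dflux p q (a z) (1 + norm \<zeta>)"
      by (rule dphase'_dflux) (simp add: add_pos_nonneg)
    also have "L * dflux p q (a z) (1 + norm \<zeta>) \<le> L * D" using D[OF z \<zeta>] L by (rule mult_left_mono)
    finally show "onorm (frechet_derivative (A z) (at \<zeta>)) \<le> L * D" by simp
  qed (use \<xi> in \<open>auto simp: dist_norm norm_minus_commute\<close>)
  define w where "w y = norm (fst (fst y) - fst z0)" for y :: "((real^'n) \<times> real) \<times> (real^'n^'N)"
  define s where "s y = \<bar>snd (fst y) - snd z0\<bar>" for y :: "((real^'n) \<times> real) \<times> (real^'n^'N)"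
  have zz: "norm (A z \<xi>0 - A z0 \<xi>0) \<le> L * (norm (fst z - fst z0) + sqrt \<bar>snd z - snd z0\<bar>) powr \<beta> * (2 * D)
      + L * (L * (norm (fst z - fst z0) powr \<alpha> + \<bar>snd z - snd z0\<bar> powr (\<alpha> / 2))) * (1 + norm \<xi>0) powr (q - 1)" if z: "z \<in> U" for z
  proof -
    have "norm (A z \<xi>0 - A z0 \<xi>0) \<le> L * (norm (fst z - fst z0) + sqrt \<bar>snd z - snd z0\<bar>) powr \<beta>
        * (dphase' p q a z (1 + norm \<xi>0) + dphase' p q a z0 (1 + norm \<xi>0))
        + L * \<bar>a z - a z0\<bar> * (1 + norm \<xi>0) powr (q - 1)"
      using A3 z z0 unfolding condA3_def case_prod_beta prod.collapse by blast
    also have "\<dots> \<le> L * (norm (fst z - fst z0) + sqrt \<bar>snd z - snd z0\<bar>) powr \<beta> * (2 * D)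
      + L * (L * (norm (fst z - fst z0) powr \<alpha> + \<bar>snd z - snd z0\<bar> powr (\<alpha> / 2))) * (1 + norm \<xi>0) powr (q - 1)"
    proof (intro add_mono mult_left_mono mult_right_mono)
      have e: "dphase' p q a z (1 + norm \<xi>0) = dflux p q (a z) (1 + norm \<xi>0)" for z
        by (rule dphase'_dflux) (simp add: add_pos_nonneg)
      show "dphase' p q a z (1 + norm \<xi>0) + dphase' p q a z0 (1 + norm \<xi>0) \<le> 2 * D"
        using D[OF z, of \<xi>0] D[OF z0, of \<xi>0] by (simp add: e)
    qed (use L hol[OF z z0] in auto)
    finally show ?thesis .
  qed
  have F: "\<forall>\<^sub>F y in ?F. y \<in> U \<times> UNIV" by (simp add: eventually_at_filter)
  have near: "\<forall>\<^sub>F y in ?F. norm (snd y - \<xi>0) < 1"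
  proof -
    have "((\<lambda>y. norm (snd y - \<xi>0)) \<longlongrightarrow> norm (snd y0 - \<xi>0)) ?F" by (intro tendsto_intros)
    then show ?thesis by (rule order_tendstoD(2)) (simp add: y0)
  qed
  have w0: "(w \<longlongrightarrow> 0) ?F"
  proof -
    have "(w \<longlongrightarrow> norm (fst (fst y0) - fst z0)) ?F" unfolding w_def by (intro tendsto_intros)
    then show ?thesis by (simp add: y0)
  qed
  have s0: "(s \<longlongrightarrow> 0) ?F"
  proof -
    have "(s \<longlongrightarrow> \<bar>snd (fst y0) - snd z0\<bar>) ?F" unfolding s_def by (intro tendsto_intros)
    then show ?thesis by (simp add: y0)
  qed
  have x0: "((\<lambda>y. norm (snd y - \<xi>0)) \<longlongrightarrow> 0) ?F"
  proof -
    have "((\<lambda>y. norm (snd y - \<xi>0)) \<longlongrightarrow> norm (snd y0 - \<xi>0)) ?F" by (intro tendsto_intros)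
    then show ?thesis by (simp add: y0)
  qed
  have pw: "((\<lambda>y. g y powr m) \<longlongrightarrow> 0) ?F" if "(g \<longlongrightarrow> 0) ?F" "\<And>y. 0 \<le> g y" "0 < m"
    for g :: "((real^'n) \<times> real) \<times> (real^'n^'N) \<Rightarrow> real" and m
    using tendsto_powr'[OF that(1) tendsto_const, of m] that by simp
  have ws: "((\<lambda>y. w y + sqrt (s y)) \<longlongrightarrow> 0) ?F"
    using tendsto_add[OF w0 tendsto_real_sqrt[OF s0]] by simp
  have p1: "((\<lambda>y. (w y + sqrt (s y)) powr \<beta>) \<longlongrightarrow> 0) ?F"
    by (rule pw[OF ws]) (auto simp: w_def s_def \<beta>)
  have p2: "((\<lambda>y. w y powr \<alpha>) \<longlongrightarrow> 0) ?F" by (rule pw[OF w0]) (auto simp: w_def \<alpha>)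
  have p3: "((\<lambda>y. s y powr (\<alpha> / 2)) \<longlongrightarrow> 0) ?F" by (rule pw[OF s0]) (auto simp: s_def \<alpha>)
  define g where "g y = L * D * norm (snd y - \<xi>0) + (L * (w y + sqrt (s y)) powr \<beta> * (2 * D)
      + L * (L * (w y powr \<alpha> + s y powr (\<alpha> / 2))) * (1 + norm \<xi>0) powr (q - 1))"
    for y :: "((real^'n) \<times> real) \<times> (real^'n^'N)"
  have "(g \<longlongrightarrow> L * D * 0 + (L * 0 * (2 * D) + L * (L * (0 + 0)) * (1 + norm \<xi>0) powr (q - 1))) ?F"
    unfolding g_def by (intro tendsto_add tendsto_mult_left tendsto_mult_right p1 p2 p3 x0)
  then have g0: "(g \<longlongrightarrow> 0) ?F" by simp
  have "\<forall>\<^sub>F y in ?F. norm (A (fst y) (snd y) - A z0 \<xi>0) \<le> g y"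
    using F near
  proof eventually_elim
    case (elim y)
    then have yU: "fst y \<in> U" by auto
    have "norm (A (fst y) (snd y) - A z0 \<xi>0) \<le> norm (A (fst y) (snd y) - A (fst y) \<xi>0) + norm (A (fst y) \<xi>0 - A z0 \<xi>0)"
      using norm_triangle_ineq[of "A (fst y) (snd y) - A (fst y) \<xi>0" "A (fst y) \<xi>0 - A z0 \<xi>0"] by simp
    also have "\<dots> \<le> g y"
      unfolding g_def w_def s_def by (intro add_mono xi zz yU) (use elim in auto)
    finally show ?case .
  qed
  from Lim_null_comparison[OF this g0]
  show "((\<lambda>y. A (fst y) (snd y)) \<longlongrightarrow> A (fst y0) (snd y0)) ?F"
    by (simp add: y0 LIM_zero_iff)
qed

text \<open>A weak solution on a set \<open>Q\<close> that is compactly contained in its domain, together with the affine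
  map to be subtracted. The functions \<open>v\<close> and \<open>V\<close> are the difference and its spatial gradient; \<open>w\<close>
  is the rescaled \<open>|v|\<close>, where \<open>d\<close> stands for \<open>r\<^sub>2 - r\<^sub>1\<close>. Factors \<open>indicator Q\<close> extend functions
  by \<open>0\<close> to all of space-time, where they are mollified.\<close>

locale cylinder_solution =
  fixes \<Omega> :: "(real^'n) set" and T p q L \<alpha> \<beta> :: real and a :: "(real^'n) \<times> real \<Rightarrow> real"
    and A :: "(real^'n) \<times> real \<Rightarrow> real^'n^'N \<Rightarrow> real^'n^'N"
    and u :: "(real^'n) \<times> real \<Rightarrow> real^'N" and Du :: "(real^'n) \<times> real \<Rightarrow> real^'n^'N"
    and Q :: "((real^'n) \<times> real) set" and P :: "real^'n^'N" and b :: "real^'N" and x0 :: "real^'n" and d :: real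
  assumes \<Omega>: "open \<Omega>" and pq: "1 < p" "p \<le> q" and gap: "q \<le> p + p * \<alpha> / (real CARD('n) + 2)"
    and \<alpha>: "0 < \<alpha>" "\<alpha> \<le> 1" and \<beta>: "0 < \<beta>" and L: "0 \<le> L"
    and a: "\<And>z. z \<in> \<Omega> \<times> {0<..<T} \<Longrightarrow> 0 \<le> a z \<and> a z \<le> L"
    and hol: "\<And>z z'. z \<in> \<Omega> \<times> {0<..<T} \<Longrightarrow> z' \<in> \<Omega> \<times> {0<..<T} \<Longrightarrow>
      \<bar>a z - a z'\<bar> \<le> L * (norm (fst z - fst z') powr \<alpha> + \<bar>snd z - snd z'\<bar> powr (\<alpha> / 2))"
    and A1: "condA1 p q L (\<Omega> \<times> {0<..<T}) a A" and A3: "condA3 p q L \<beta> (\<Omega> \<times> {0<..<T}) a A"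
    and sol: "weak_solution p q a \<Omega> T A u Du"
    and Q: "open Q" "compact (closure Q)" "closure Q \<subseteq> \<Omega> \<times> {0<..<T}" and d: "0 < d" "d \<le> 1"
begin

definition v where "v z = u z - (P *v (fst z - x0) + b)"
definition V where "V z = Du z - P"
abbreviation \<sigma> where "\<sigma> \<equiv> 1 + norm P"
definition w where "w z = norm (v z) / d"

lemma QT: "z \<in> Q \<Longrightarrow> z \<in> \<Omega> \<times> {0<..<T}" using Q(3) closure_subset by blast

lemma Q_sets: "Q \<in> sets lebesgue" using Q(1) by (simp add: borel_open)

lemma Q_lmeasurable: "Q \<in> lmeasurable"
  using lmeasurable_open[OF bounded_subset[OF compact_imp_bounded[OF Q(2)] closure_subset] Q(1)] .

lemma int_Q: "integrable lebesgue (indicator Q :: _ \<Rightarrow> real)"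
  using Q_lmeasurable by (simp add: integrable_indicator_iff fmeasurable_def del: emeasure_completion)

lemma int_Q_const: "integrable lebesgue (\<lambda>z. indicator Q z * (c::real))"
  using int_Q by simp

lemma restrict_measurable:
  fixes f :: "_ \<Rightarrow> 'c::euclidean_space"
  assumes "set_borel_measurable lebesgue (\<Omega> \<times> {0<..<T}) f"
  shows "(\<lambda>z. indicator Q z *\<^sub>R f z) \<in> borel_measurable lebesgue"
proof -
  have "(\<lambda>z. indicator Q z *\<^sub>R (indicator (\<Omega> \<times> {0<..<T}) z *\<^sub>R f z)) \<in> borel_measurable lebesgue"
    by (rule borel_measurable_scaleR[OF borel_measurable_indicator[OF Q_sets] assms[unfolded set_borel_measurable_def]])
  moreover have "(\<lambda>z. indicator Q z *\<^sub>R (indicator (\<Omega> \<times> {0<..<T}) z *\<^sub>R f z)) = (\<lambda>z. indicator Q z *\<^sub>R f z)"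
    using QT by (auto simp: indicator_def)
  ultimately show ?thesis by simp
qed

lemma u_meas: "(\<lambda>z. indicator Q z *\<^sub>R u z) \<in> borel_measurable lebesgue"
  and Du_meas: "(\<lambda>z. indicator Q z *\<^sub>R Du z) \<in> borel_measurable lebesgue"
  using sol by (auto simp: weak_solution_def Lp_loc_W1p_loc_def Lp_loc_def intro!: restrict_measurable)

lemma affine_continuous: "continuous_on UNIV (\<lambda>z::(real^'n) \<times> real. P *v (fst z - x0) + b)"
  by (intro continuous_intros continuous_on_compose2[OF matrix_vector_mult_linear_continuous_on[of UNIV P]]) auto

lemma continuous_restrict_measurable:
  fixes f :: "_ \<Rightarrow> 'c::euclidean_space"
  assumes "continuous_on UNIV f"
  shows "(\<lambda>z. indicator Q z *\<^sub>R f z) \<in> borel_measurable lebesgue"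
  by (intro borel_measurable_scaleR borel_measurable_indicator Q_sets measurable_completion)
    (simp add: borel_measurable_continuous_onI[OF assms])

lemma v_meas: "(\<lambda>z. indicator Q z *\<^sub>R v z) \<in> borel_measurable lebesgue"
  using borel_measurable_diff[OF u_meas continuous_restrict_measurable[OF affine_continuous]]
  by (simp add: v_def scaleR_diff_right)

lemma V_meas: "(\<lambda>z. indicator Q z *\<^sub>R V z) \<in> borel_measurable lebesgue"
  using borel_measurable_diff[OF Du_meas continuous_restrict_measurable[OF continuous_on_const[of UNIV P]]]
  by (simp add: V_def scaleR_diff_right)

lemma A_meas: "(\<lambda>z. indicator Q z *\<^sub>R A z (Du z)) \<in> borel_measurable lebesgue"
proof -
  let ?U = "(\<Omega> \<times> {0<..<T}) \<times> (UNIV :: (real^'n^'N) set)"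
  have "continuous_on ?U (\<lambda>y. A (fst y) (snd y))"
    by (rule structure_continuous[OF pq L \<alpha>(1) \<beta> a hol A1 A3])
  moreover have "?U \<in> sets borel"
    by (intro borel_open open_Times \<Omega> open_UNIV open_greaterThanLessThan)
  ultimately have "(\<lambda>y. indicator ?U y *\<^sub>R A (fst y) (snd y)) \<in> borel_measurable borel"
    by (rule borel_measurable_continuous_on_indicator[rotated])
  moreover have "(\<lambda>z. (z, indicator Q z *\<^sub>R Du z)) \<in> borel_measurable lebesgue"
    by (intro borel_measurable_Pair Du_meas measurable_completion) simp
  ultimately have "(\<lambda>z. indicator ?U (z, indicator Q z *\<^sub>R Du z) *\<^sub>R A z (indicator Q z *\<^sub>R Du z)) \<in> borel_measurable lebesgue"
    using measurable_compose[of _ lebesgue borel _ borel] by fastforce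
  from borel_measurable_scaleR[OF borel_measurable_indicator[OF Q_sets] this]
  have "(\<lambda>z. indicator Q z *\<^sub>R (indicator ?U (z, indicator Q z *\<^sub>R Du z) *\<^sub>R A z (indicator Q z *\<^sub>R Du z))) \<in> borel_measurable lebesgue" .
  moreover have "(\<lambda>z. indicator Q z *\<^sub>R (indicator ?U (z, indicator Q z *\<^sub>R Du z) *\<^sub>R A z (indicator Q z *\<^sub>R Du z))) = (\<lambda>z. indicator Q z *\<^sub>R A z (Du z))"
    using QT by (auto simp: indicator_def)
  ultimately show ?thesis by simp
qed

lemma component_meas:
  assumes "(\<lambda>z. indicator Q z *\<^sub>R f z) \<in> borel_measurable lebesgue"
  shows "(\<lambda>z. indicator Q z * (f z :: real^'m) $ i) \<in> borel_measurable lebesgue"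
proof -
  have "(\<lambda>z. (indicator Q z *\<^sub>R f z) \<bullet> axis i 1) \<in> borel_measurable lebesgue"
    using assms by (intro borel_measurable_inner) auto
  then show ?thesis by (simp add: inner_axis)
qed

lemma matrix_component_meas:
  assumes "(\<lambda>z. indicator Q z *\<^sub>R f z) \<in> borel_measurable lebesgue"
  shows "(\<lambda>z. indicator Q z * (f z :: real^'n^'m) $ i $ j) \<in> borel_measurable lebesgue"
proof -
  have "(\<lambda>z. (indicator Q z *\<^sub>R f z) \<bullet> axis i (axis j 1)) \<in> borel_measurable lebesgue"
    using assms by (intro borel_measurable_inner) auto
  then show ?thesis by (simp add: inner_axis)
qed

text \<open>An integrable majorant of the double phase energy of \<open>1 + |Du|\<close>.\<close>

definition F where "F z = indicator Q z * (2 powr q * (1 + L + dphase p q a z (norm (Du z))))"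

lemma F_integrable: "integrable lebesgue F"
proof -
  have "Lp_loc (\<Omega> \<times> {0<..<T}) 1 (\<lambda>z. dphase p q a z (norm (Du z)))"
    using sol by (simp add: weak_solution_def)
  then have "set_integrable lebesgue (closure Q) (\<lambda>z. norm (dphase p q a z (norm (Du z))) powr 1)"
    using Q by (simp add: Lp_loc_def)
  then have "set_integrable lebesgue Q (\<lambda>z. norm (dphase p q a z (norm (Du z))) powr 1)"
    using set_integrable_subset[OF _ Q_sets closure_subset] by blast
  then have "integrable lebesgue (\<lambda>z. indicator Q z * (norm (dphase p q a z (norm (Du z))) powr 1))"
    by (simp add: set_integrable_def)
  moreover have "(\<lambda>z. indicator Q z * (norm (dphase p q a z (norm (Du z))) powr 1)) = (\<lambda>z. indicator Q z * dphase p q a z (norm (Du z)))"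
  proof
    fix z show "indicator Q z * (norm (dphase p q a z (norm (Du z))) powr 1) = indicator Q z * dphase p q a z (norm (Du z))"
      using a[OF QT[of z]] by (cases "z \<in> Q") (auto simp: dphase_def)
  qed
  ultimately have "integrable lebesgue (\<lambda>z. indicator Q z * (2 powr q * (1 + L)) + 2 powr q * (indicator Q z * dphase p q a z (norm (Du z))))"
    using int_Q_const by (intro Bochner_Integration.integrable_add integrable_mult_right) auto
  then show ?thesis unfolding F_def by (simp add: algebra_simps)
qed

lemma F_ge: "z \<in> Q \<Longrightarrow> (1 + norm (Du z)) powr p + a z * (1 + norm (Du z)) powr q \<le> F z"
proof -
  assume z: "z \<in> Q"
  note az = a[OF QT[OF z]]
  let ?s = "norm (Du z)"
  have "(1 + ?s) powr p \<le> 2 powr p * (1 + ?s powr p)" using pq by (intro powr_one_plus_le) auto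
  also have "\<dots> \<le> 2 powr q * (1 + ?s powr p)" using pq by (intro mult_right_mono powr_mono) auto
  finally have 1: "(1 + ?s) powr p \<le> 2 powr q * (1 + ?s powr p)" .
  have "a z * (1 + ?s) powr q \<le> a z * (2 powr q * (1 + ?s powr q))"
    using pq az by (intro mult_left_mono powr_one_plus_le) auto
  also have "\<dots> \<le> 2 powr q * (L + a z * ?s powr q)" using az by (simp add: algebra_simps mult_left_mono)
  finally show "(1 + norm (Du z)) powr p + a z * (1 + norm (Du z)) powr q \<le> F z"
    using 1 z by (simp add: F_def dphase_def algebra_simps)
qed

lemma F_ge_linear: "z \<in> Q \<Longrightarrow> 1 + norm (Du z) \<le> F z"
proof -
  assume z: "z \<in> Q"
  have "(1 + norm (Du z)) powr 1 \<le> (1 + norm (Du z)) powr p" using pq by (intro powr_mono) auto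
  moreover have "0 \<le> a z * (1 + norm (Du z)) powr q" using a[OF QT[OF z]] by simp
  ultimately show "1 + norm (Du z) \<le> F z" using F_ge[OF z] by (simp add: add_nonneg_nonneg)
qed

text \<open>The components of the weak equations. The first comes from the weak gradient of almost every time
  slice, the second from testing the system with \<open>\<zeta>\<close> times a unit vector.\<close>

lemma weak_equations:
  assumes \<zeta>: "test_function Q \<zeta>" and iu: "integrable lebesgue (\<lambda>z. indicator Q z * u z $ i)"
    and iDu: "\<And>j. integrable lebesgue (\<lambda>z. indicator Q z * Du z $ i $ j)"
    and iA: "\<And>j. integrable lebesgue (\<lambda>z. indicator Q z * A z (Du z) $ i $ j)"
  shows "(LINT z|lebesgue. indicator Q z * u z $ i * pd \<zeta> (xdir j) z) = - (LINT z|lebesgue. indicator Q z * Du z $ i $ j * \<zeta> z)"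
    and "(LINT z|lebesgue. indicator Q z * u z $ i * pd \<zeta> tdir z)
      = (\<Sum>j\<in>UNIV. LINT z|lebesgue. indicator Q z * A z (Du z) $ i $ j * pd \<zeta> (xdir j) z)"
proof -
  obtain R where R: "Ck (Suc 0) \<zeta>" "\<And>z. z \<notin> Q \<Longrightarrow> \<zeta> z = 0" "\<And>z h. z \<notin> Q \<Longrightarrow> pd \<zeta> h z = 0"
    using test_function_facts[OF \<zeta>] by metis
  have QO: "Q \<subseteq> \<Omega> \<times> {0<..<T}" using QT by blast
  have neg: "integrable lebesgue (\<lambda>z. - (indicator Q z * Du z $ i $ j * \<zeta> z))"
    using test_function_integrable(1)[OF \<zeta> iDu[of j]] by simp
  have slice: "AE t in lborel. (LINT x|lebesgue. indicator Q (x, t) * u (x, t) $ i * pd \<zeta> (xdir j) (x, t))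
      = (LINT x|lebesgue. - (indicator Q (x, t) * Du (x, t) $ i $ j * \<zeta> (x, t)))"
  proof -
    have "AE t in lebesgue. t \<in> {0<..<T} \<longrightarrow> W1p_loc \<Omega> p (\<lambda>x. u (x, t)) (\<lambda>x. Du (x, t))"
      using sol by (simp add: weak_solution_def Lp_loc_W1p_loc_def)
    then have "AE t in lborel. t \<in> {0<..<T} \<longrightarrow> W1p_loc \<Omega> p (\<lambda>x. u (x, t)) (\<lambda>x. Du (x, t))"
      by (simp only: AE_completion_iff)
    then show ?thesis
    proof eventually_elim
      case (elim t)
      show ?case
      proof (cases "t \<in> {0<..<T}")
        case True
        let ?\<zeta> = "\<lambda>x. \<zeta> (x, t)"
        have "weak_gradient \<Omega> (\<lambda>x. u (x, t)) (\<lambda>x. Du (x, t))" using elim True by (simp add: W1p_loc_def)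
        then have "(LINT x:\<Omega>|lebesgue. u (x, t) $ i * frechet_derivative ?\<zeta> (at x) (axis j 1))
            = - (LINT x:\<Omega>|lebesgue. Du (x, t) $ i $ j * ?\<zeta> x)"
          using test_function_slice(1)[OF \<zeta> QO, of t] by (simp add: weak_gradient_def)
        moreover have "(\<lambda>x. indicator \<Omega> x *\<^sub>R (u (x, t) $ i * frechet_derivative ?\<zeta> (at x) (axis j 1)))
            = (\<lambda>x. indicator Q (x, t) * u (x, t) $ i * pd \<zeta> (xdir j) (x, t))"
          unfolding test_function_slice(2)[OF \<zeta> QO] using QT R(3) by (fastforce simp: indicator_def)
        moreover have "(\<lambda>x. indicator \<Omega> x *\<^sub>R (Du (x, t) $ i $ j * ?\<zeta> x)) = (\<lambda>x. indicator Q (x, t) * Du (x, t) $ i $ j * \<zeta> (x, t))"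
          using QT R(2) by (fastforce simp: indicator_def)
        ultimately show ?thesis by (simp add: set_lebesgue_integral_def)
      next
        case False
        then have "(x, t) \<notin> Q" for x using QT by blast
        then show ?thesis by simp
      qed
    qed
  qed
  have "(LINT z|lebesgue. indicator Q z * u z $ i * pd \<zeta> (xdir j) z) = (LINT z|lebesgue. - (indicator Q z * Du z $ i $ j * \<zeta> z))"
    by (rule integral_eqI_slices[OF test_function_integrable(2)[OF \<zeta> iu xdir_Basis] neg slice])
  then show "(LINT z|lebesgue. indicator Q z * u z $ i * pd \<zeta> (xdir j) z) = - (LINT z|lebesgue. indicator Q z * Du z $ i $ j * \<zeta> z)"
    by simp
  define Z where "Z z = \<zeta> z *\<^sub>R (axis i 1 :: real^'N)" for z
  have "test_function (\<Omega> \<times> {0<..<T}) Z"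
  proof -
    have "Ck k Z" for k
      unfolding Z_def using \<zeta> by (intro Ck_linear_image[OF bounded_linear_scaleR_left]) (simp add: test_function_def)
    moreover have "{z. Z z \<noteq> 0} = {z. \<zeta> z \<noteq> 0}" by (auto simp: Z_def axis_eq_0_iff)
    ultimately show ?thesis using \<zeta> QO by (auto simp: test_function_def)
  qed
  then have eq: "- (LINT z:\<Omega> \<times> {0<..<T}|lebesgue. u z \<bullet> time_deriv Z z)
        + (LINT z:\<Omega> \<times> {0<..<T}|lebesgue. A z (Du z) \<bullet> space_grad Z z) = 0"
    using sol by (simp add: weak_solution_def)
  have td: "u z \<bullet> time_deriv Z z = u z $ i * pd \<zeta> tdir z" for z
  proof -
    have "((\<lambda>s. (fst z, s)) has_derivative (\<lambda>h. (0, h))) (at (snd z))" by (auto intro!: derivative_eq_intros)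
    from diff_chain_at[OF this, of \<zeta> "frechet_derivative \<zeta> (at z)"] Ck_has_derivative[OF R(1), of z]
    have "((\<lambda>s. \<zeta> (fst z, s)) has_derivative (\<lambda>h. pd \<zeta> (0, h) z)) (at (snd z))" by (simp add: o_def)
    then have "((\<lambda>s. Z (fst z, s)) has_derivative (\<lambda>h. pd \<zeta> (0, h) z *\<^sub>R axis i 1)) (at (snd z))"
      unfolding Z_def by (rule has_derivative_scaleR_left)
    moreover have "(\<lambda>h. pd \<zeta> (0, h) z *\<^sub>R axis i 1) = (\<lambda>h. h *\<^sub>R (pd \<zeta> tdir z *\<^sub>R (axis i 1 :: real^'N)))"
    proof
      fix h
      have "pd \<zeta> (h *\<^sub>R tdir) z = h * pd \<zeta> tdir z"
        using linear_scale[OF has_derivative_linear[OF Ck_has_derivative[OF R(1)]], of z h tdir] by simp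
      then show "pd \<zeta> (0, h) z *\<^sub>R axis i 1 = h *\<^sub>R (pd \<zeta> tdir z *\<^sub>R (axis i 1 :: real^'N))"
        by simp
    qed
    ultimately have "((\<lambda>s. Z (fst z, s)) has_vector_derivative (pd \<zeta> tdir z *\<^sub>R axis i 1)) (at (snd z))"
      by (simp add: has_vector_derivative_def)
    then have "time_deriv Z z = pd \<zeta> tdir z *\<^sub>R axis i 1"
      unfolding time_deriv_def by (rule vector_derivative_at)
    then show ?thesis by (simp add: inner_axis)
  qed
  have sg: "A z (Du z) \<bullet> space_grad Z z = (\<Sum>j\<in>UNIV. A z (Du z) $ i $ j * pd \<zeta> (xdir j) z)" for z
  proof -
    have "((\<lambda>x. (x, snd z)) has_derivative (\<lambda>h. (h, 0))) (at (fst z))" by (auto intro!: derivative_eq_intros)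
    from diff_chain_at[OF this, of \<zeta> "frechet_derivative \<zeta> (at z)"] Ck_has_derivative[OF R(1), of z]
    have "((\<lambda>x. \<zeta> (x, snd z)) has_derivative (\<lambda>h. pd \<zeta> (h, 0) z)) (at (fst z))" by (simp add: o_def)
    then have "((\<lambda>x. Z (x, snd z)) has_derivative (\<lambda>h. pd \<zeta> (h, 0) z *\<^sub>R axis i 1)) (at (fst z))"
      unfolding Z_def by (rule has_derivative_scaleR_left)
    then have fd: "frechet_derivative (\<lambda>x. Z (x, snd z)) (at (fst z)) = (\<lambda>h. pd \<zeta> (h, 0) z *\<^sub>R axis i 1)"
      by (rule frechet_derivative_eqI)
    have "space_grad Z z $ k $ j = (if k = i then pd \<zeta> (xdir j) z else 0)" for k j
      by (simp add: space_grad_def jacobian_def fd matrix_def axis_def)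
    then have "A z (Du z) \<bullet> space_grad Z z = (\<Sum>k\<in>UNIV. \<Sum>j\<in>UNIV. A z (Du z) $ k $ j * (if k = i then pd \<zeta> (xdir j) z else 0))"
      by (simp add: inner_matrix)
    also have "\<dots> = (\<Sum>k\<in>UNIV. if k = i then (\<Sum>j\<in>UNIV. A z (Du z) $ k $ j * pd \<zeta> (xdir j) z) else 0)"
      by (intro sum.cong) auto
    finally show ?thesis by simp
  qed
  have "(LINT z:\<Omega> \<times> {0<..<T}|lebesgue. u z \<bullet> time_deriv Z z) = (LINT z|lebesgue. indicator Q z * u z $ i * pd \<zeta> tdir z)"
    unfolding set_lebesgue_integral_def td
    by (intro arg_cong[where f="integral\<^sup>L lebesgue"] ext) (use QT R(3) in \<open>auto simp: indicator_def\<close>)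
  moreover have "(LINT z:\<Omega> \<times> {0<..<T}|lebesgue. A z (Du z) \<bullet> space_grad Z z)
      = (LINT z|lebesgue. (\<Sum>j\<in>UNIV. indicator Q z * A z (Du z) $ i $ j * pd \<zeta> (xdir j) z))"
    unfolding set_lebesgue_integral_def sg
    by (intro arg_cong[where f="integral\<^sup>L lebesgue"] ext) (use QT R(3) in \<open>auto simp: indicator_def\<close>)
  moreover have "\<dots> = (\<Sum>j\<in>UNIV. LINT z|lebesgue. indicator Q z * A z (Du z) $ i $ j * pd \<zeta> (xdir j) z)"
    by (rule Bochner_Integration.integral_sum) (rule test_function_integrable(2)[OF \<zeta> iA xdir_Basis])
  ultimately show "(LINT z|lebesgue. indicator Q z * u z $ i * pd \<zeta> tdir z)
      = (\<Sum>j\<in>UNIV. LINT z|lebesgue. indicator Q z * A z (Du z) $ i $ j * pd \<zeta> (xdir j) z)"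
    using eq by simp
qed

end

definition growth_power :: "real \<Rightarrow> nat" where "growth_power q = nat \<lceil>max 2 q\<rceil>"

lemma growth_power: "2 \<le> growth_power q" "q \<le> real (growth_power q)"
  unfolding growth_power_def by linarith+

text \<open>The situation in which the right-hand side of the inequality is finite.\<close>

locale finite_energy_solution = cylinder_solution \<Omega> T p q L \<alpha> \<beta> a A u Du Q P b x0 d
  for \<Omega> :: "(real^'n) set" and T p q L \<alpha> \<beta> :: real and a :: "(real^'n) \<times> real \<Rightarrow> real"
    and A :: "(real^'n) \<times> real \<Rightarrow> real^'n^'N \<Rightarrow> real^'n^'N"
    and u :: "(real^'n) \<times> real \<Rightarrow> real^'N" and Du :: "(real^'n) \<times> real \<Rightarrow> real^'n^'N"
    and Q :: "((real^'n) \<times> real) set" and P :: "real^'n^'N" and b :: "real^'N" and x0 :: "real^'n" and d :: real +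
  assumes v2: "integrable lebesgue (\<lambda>z. indicator Q z * (norm (v z))\<^sup>2)"
    and w2: "integrable lebesgue (\<lambda>z. indicator Q z * (shift_flux p q (a z) \<sigma> (w z) * w z))"
begin

abbreviation k :: nat where "k \<equiv> growth_power q"

lemmas k = growth_power[of q]

lemma dp: "z \<in> Q \<Longrightarrow> double_phase p q (a z) \<sigma> k"
  using pq a[OF QT] k by unfold_locales (auto simp: add_pos_nonneg)

lemma integrableI_Q:
  assumes "(\<lambda>z. indicator Q z * f z) \<in> borel_measurable lebesgue" "integrable lebesgue g"
    and "\<And>z. z \<in> Q \<Longrightarrow> \<bar>f z\<bar> \<le> g z"
  shows "integrable lebesgue (\<lambda>z. indicator Q z * (f z :: real))"
  by (rule Bochner_Integration.integrable_bound[OF assms(2,1)])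
    (rule AE_I2, use assms(3) in \<open>force simp: indicator_def\<close>)

lemma A_bound:
  assumes z: "z \<in> Q"
  shows "norm (A z (Du z)) \<le> L * q * ((1 + norm (Du z)) powr (p - 1) + a z * (1 + norm (Du z)) powr (q - 1))"
proof -
  let ?f = "1 + norm (Du z)"
  have diff: "A z differentiable (at (Du z))"
    and b: "norm (A z (Du z)) + ?f * onorm (frechet_derivative (A z) (at (Du z))) \<le> L * dphase' p q a z ?f"
    using A1 QT[OF z] unfolding condA1_def by blast+
  have "0 \<le> onorm (frechet_derivative (A z) (at (Du z)))"
    using diff by (intro onorm_pos_le) (simp add: frechet_derivative_works has_derivative_bounded_linear)
  then have "0 \<le> ?f * onorm (frechet_derivative (A z) (at (Du z)))" by simp
  then have "norm (A z (Du z)) \<le> L * dphase' p q a z ?f" using b by linarith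
  also have "dphase' p q a z ?f = dflux p q (a z) ?f" by (rule dphase'_dflux) (simp add: add_pos_nonneg)
  also have "L * \<dots> \<le> L * (q * (?f powr (p - 1) + a z * ?f powr (q - 1)))"
  proof (rule mult_left_mono[OF _ L])
    have "p * ?f powr (p - 1) \<le> q * ?f powr (p - 1)" using pq by (intro mult_right_mono) auto
    then show "dflux p q (a z) ?f \<le> q * (?f powr (p - 1) + a z * ?f powr (q - 1))"
      by (simp add: dflux_def algebra_simps)
  qed
  finally show ?thesis by (simp add: mult.assoc)
qed

lemma flux_le_F:
  assumes z: "z \<in> Q"
  shows "(1 + norm (Du z)) powr (p - 1) + a z * (1 + norm (Du z)) powr (q - 1) \<le> F z"
proof -
  have az: "0 \<le> a z" using a[OF QT[OF z]] by simp
  have "(1 + norm (Du z)) powr (p - 1) + a z * (1 + norm (Du z)) powr (q - 1)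
      \<le> (1 + norm (Du z)) powr p + a z * (1 + norm (Du z)) powr q"
    using az by (intro add_mono mult_left_mono powr_mono) auto
  then show ?thesis using F_ge[OF z] by linarith
qed

lemma Lq_nonneg: "0 \<le> L * q" using L pq by simp

lemma A_integrable: "integrable lebesgue (\<lambda>z. indicator Q z * A z (Du z) $ i $ j)"
proof (rule integrableI_Q[OF matrix_component_meas[OF A_meas], of "\<lambda>z. L * q * F z"])
  show "integrable lebesgue (\<lambda>z. L * q * F z)" using F_integrable by simp
  show "\<bar>A z (Du z) $ i $ j\<bar> \<le> L * q * F z" if "z \<in> Q" for z
    using matrix_component_le[of "A z (Du z)" i j] A_bound[OF that]
      mult_left_mono[OF flux_le_F[OF that] Lq_nonneg] by linarith
qed

lemma Du_integrable: "integrable lebesgue (\<lambda>z. indicator Q z * Du z $ i $ j)"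
proof (rule integrableI_Q[OF matrix_component_meas[OF Du_meas] F_integrable])
  show "\<bar>Du z $ i $ j\<bar> \<le> F z" if "z \<in> Q" for z
    using matrix_component_le[of "Du z" i j] F_ge_linear[OF that] by linarith
qed

lemma V_integrable: "integrable lebesgue (\<lambda>z. indicator Q z * V z $ i $ j)"
proof -
  have "integrable lebesgue (\<lambda>z. indicator Q z * Du z $ i $ j - indicator Q z * P $ i $ j)"
    using Du_integrable int_Q_const by (rule Bochner_Integration.integrable_diff)
  then show ?thesis by (simp add: V_def right_diff_distrib)
qed

lemma v_integrable: "integrable lebesgue (\<lambda>z. indicator Q z * v z $ i)"
proof (rule integrableI_Q[OF component_meas[OF v_meas], of "\<lambda>z. indicator Q z * 1 + indicator Q z * (norm (v z))\<^sup>2"])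
  show "integrable lebesgue (\<lambda>z. indicator Q z * 1 + indicator Q z * (norm (v z))\<^sup>2)"
    using int_Q_const v2 by (rule Bochner_Integration.integrable_add)
  show "\<bar>v z $ i\<bar> \<le> indicator Q z * 1 + indicator Q z * (norm (v z))\<^sup>2" if "z \<in> Q" for z
  proof -
    have "\<bar>v z $ i\<bar> \<le> norm (v z)" by (rule component_le_norm_cart)
    also have "norm (v z) \<le> 1 + (norm (v z))\<^sup>2"
    proof -
      have "(norm (v z) - 1 / 2)\<^sup>2 = (norm (v z))\<^sup>2 - norm (v z) + 1 / 4"
        by (simp add: power2_eq_square algebra_simps)
      then show ?thesis using zero_le_power2[of "norm (v z) - 1 / 2"] by linarith
    qed
    finally show ?thesis using that by simp
  qed
qed

lemma v_sq_integrable: "integrable lebesgue (\<lambda>z. indicator Q z * v z $ i * (indicator Q z * v z $ i))"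
proof -
  have "integrable lebesgue (\<lambda>z. indicator Q z * (v z $ i * v z $ i))"
  proof (rule integrableI_Q[OF _ v2])
    have "(\<lambda>z. indicator Q z * v z $ i * (indicator Q z * v z $ i)) \<in> borel_measurable lebesgue"
      by (rule borel_measurable_times[OF component_meas[OF v_meas] component_meas[OF v_meas]])
    then show "(\<lambda>z. indicator Q z * (v z $ i * v z $ i)) \<in> borel_measurable lebesgue"
      by (rule measurable_cong[THEN iffD1, rotated]) (simp add: indicator_def)
    show "\<bar>v z $ i * v z $ i\<bar> \<le> indicator Q z * (norm (v z))\<^sup>2" if "z \<in> Q" for z
    proof -
      have "\<bar>v z $ i\<bar> * \<bar>v z $ i\<bar> \<le> norm (v z) * norm (v z)"
        by (intro mult_mono component_le_norm_cart) auto
      then show ?thesis using that by (simp add: power2_eq_square)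
    qed
  qed
  then show ?thesis
    by (rule Bochner_Integration.integrable_cong[THEN iffD1, rotated 2]) (auto simp: indicator_def)
qed

abbreviation aff :: "'N \<Rightarrow> (real^'n) \<times> real \<Rightarrow> real" where "aff i z \<equiv> (P *v (fst z - x0) + b) $ i"

lemma aff_has_derivative: "((\<lambda>z. aff i z) has_derivative (\<lambda>h. (P *v fst h) $ i)) (at (z :: (real^'n) \<times> real))"
proof -
  have bl: "bounded_linear (\<lambda>x. (P *v x) $ i)"
    by (intro bounded_linear_compose[OF bounded_linear_vec_nth] matrix_vector_mul_bounded_linear)
  have "((\<lambda>z::(real^'n)\<times>real. fst z - x0) has_derivative fst) (at z)" by (auto intro!: derivative_eq_intros)
  from bounded_linear.has_derivative[OF bl this]
  have "((\<lambda>z. (P *v (fst z - x0)) $ i + b $ i) has_derivative (\<lambda>h. (P *v fst h) $ i)) (at z)"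
    by (auto intro!: derivative_eq_intros)
  then show ?thesis by simp
qed

lemma aff_C1: "Ck (Suc 0) (\<lambda>z. aff i z)"
  by (rule Ck_SucI[OF aff_has_derivative]) (rule Ck_const)

lemma aff_pd: "pd (\<lambda>z. aff i z) (xdir j) z = P $ i $ j" "pd (\<lambda>z. aff i z) tdir z = 0"
  unfolding frechet_derivative_eqI[OF aff_has_derivative]
  by (simp_all add: matrix_vector_mult_basis column_def)

lemma aff_integrable: "integrable lebesgue (\<lambda>z. indicator Q z * aff i z)"
proof -
  have "continuous_on (closure Q) (\<lambda>z. aff i z)"
    by (rule continuous_on_subset[OF Ck_imp_continuous[OF aff_C1]]) simp
  then have "integrable lborel (\<lambda>z. indicator (closure Q) z *\<^sub>R aff i z)"
    by (rule borel_integrable_compact[OF Q(2)])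
  then have "set_integrable lebesgue (closure Q) (\<lambda>z. aff i z)"
    unfolding set_integrable_def
    using integrable_completion[OF borel_measurable_integrable[of lborel "\<lambda>z. indicator (closure Q) z *\<^sub>R aff i z"]] by blast
  from set_integrable_subset[OF this Q_sets closure_subset]
  show ?thesis by (simp add: set_integrable_def)
qed

lemma u_integrable: "integrable lebesgue (\<lambda>z. indicator Q z * u z $ i)"
proof -
  have "integrable lebesgue (\<lambda>z. indicator Q z * v z $ i + indicator Q z * aff i z)"
    using v_integrable aff_integrable by (rule Bochner_Integration.integrable_add)
  then show ?thesis by (simp add: v_def flip: distrib_left)
qed

text \<open>The flux minus a constant matrix. As divergence and time derivative of constants vanish, \<open>v\<close> and
  \<open>Bf\<close> satisfy the same equations as \<open>u\<close> and the flux.\<close>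

definition Bf where "Bf A0 i j z = indicator Q z * (A z (Du z) - A0) $ i $ j"

lemma Bf_alt: "Bf A0 i j z = indicator Q z * A z (Du z) $ i $ j - indicator Q z * A0 $ i $ j"
  by (simp add: Bf_def right_diff_distrib)

lemma Bf_integrable: "integrable lebesgue (Bf A0 i j)"
  unfolding Bf_alt[abs_def] using A_integrable int_Q_const by (rule Bochner_Integration.integrable_diff)

lemma equations_minus_affine:
  assumes \<zeta>: "test_function Q \<zeta>"
  shows "(LINT z|lebesgue. indicator Q z * v z $ i * pd \<zeta> (xdir j) z) = - (LINT z|lebesgue. indicator Q z * V z $ i $ j * \<zeta> z)"
    and "(LINT z|lebesgue. indicator Q z * v z $ i * pd \<zeta> tdir z) = (\<Sum>j\<in>UNIV. LINT z|lebesgue. Bf A0 i j z * pd \<zeta> (xdir j) z)"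
proof -
  note ti = test_function_integrable[OF \<zeta>]
  note we = weak_equations[OF \<zeta> u_integrable Du_integrable A_integrable]
  have v: "indicator Q z * v z $ i * h = indicator Q z * u z $ i * h - indicator Q z * aff i z * h" for z and h :: real
    by (simp add: v_def algebra_simps)
  have V: "indicator Q z * V z $ i $ j * h = indicator Q z * Du z $ i $ j * h - indicator Q z * P $ i $ j * h" for z and h :: real
    by (simp add: V_def algebra_simps)
  have ax: "(LINT z|lebesgue. indicator Q z * aff i z * pd \<zeta> (xdir j) z) = - (LINT z|lebesgue. indicator Q z * P $ i $ j * \<zeta> z)"
    using integral_C1_by_parts[OF \<zeta> aff_C1 xdir_Basis, of i j] by (simp only: aff_pd)
  have at': "(LINT z|lebesgue. indicator Q z * aff i z * pd \<zeta> tdir z) = 0"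
    using integral_C1_by_parts[OF \<zeta> aff_C1 tdir_Basis, of i] by (simp only: aff_pd) simp
  have c: "(LINT z|lebesgue. indicator Q z * A0 $ i $ j * pd \<zeta> (xdir j) z) = 0" for j
    using integral_C1_by_parts[OF \<zeta> Ck_const xdir_Basis, of "A0 $ i $ j" j]
    by (simp add: frechet_derivative_eqI[OF has_derivative_const])
  show "(LINT z|lebesgue. indicator Q z * v z $ i * pd \<zeta> (xdir j) z) = - (LINT z|lebesgue. indicator Q z * V z $ i $ j * \<zeta> z)"
    unfolding v V
    using ti(2)[OF u_integrable xdir_Basis, of i j] ti(2)[OF aff_integrable xdir_Basis, of i j]
      ti(1)[OF Du_integrable, of i j] ti(1)[OF int_Q_const, of "P $ i $ j"] we(1)[of i j] ax by simp
  have "(LINT z|lebesgue. Bf A0 i j z * pd \<zeta> (xdir j) z) = (LINT z|lebesgue. indicator Q z * A z (Du z) $ i $ j * pd \<zeta> (xdir j) z)" for j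
    unfolding Bf_alt left_diff_distrib
    using ti(2)[OF A_integrable xdir_Basis, of i j j] ti(2)[OF int_Q_const xdir_Basis, of "A0 $ i $ j" j] c[of j] by simp
  then show "(LINT z|lebesgue. indicator Q z * v z $ i * pd \<zeta> tdir z) = (\<Sum>j\<in>UNIV. LINT z|lebesgue. Bf A0 i j z * pd \<zeta> (xdir j) z)"
    unfolding v
    using ti(2)[OF u_integrable tdir_Basis, of i] ti(2)[OF aff_integrable tdir_Basis, of i] we(2)[of i] at' by simp
qed

text \<open>An integrable majorant of the double phase energies of both \<open>v\<close> and \<open>V\<close>. It is the finite energy
  of \<open>w\<close> that makes \<open>v\<close> an admissible factor.\<close>

definition Gv where "Gv z = 2 * (indicator Q z * (shift_flux p q (a z) \<sigma> (w z) * w z))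
  + indicator Q z * (\<sigma> powr p + L * \<sigma> powr q) + \<sigma> powr q * F z"

lemma Gv_integrable: "integrable lebesgue Gv"
  unfolding Gv_def[abs_def] using w2 int_Q_const F_integrable by (intro Bochner_Integration.integrable_add integrable_mult_right)

lemma \<sigma>: "1 \<le> \<sigma>" by simp

lemma F_nonneg: "z \<in> Q \<Longrightarrow> 0 \<le> F z" using F_ge_linear[of z] norm_ge_zero[of "Du z"] by linarith

lemma w_nonneg: "0 \<le> w z" using d by (simp add: w_def)

lemma v_le_Gv:
  assumes z: "z \<in> Q"
  shows "norm (v z) powr p + a z * norm (v z) powr q \<le> Gv z"
proof -
  interpret double_phase p q "a z" \<sigma> k by (rule dp[OF z])
  have az: "0 \<le> a z" "a z \<le> L" using a[OF QT[OF z]] by auto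
  have vw: "norm (v z) \<le> w z" using d by (simp add: w_def field_simps mult_left_le_one_le)
  have "norm (v z) powr p + a z * norm (v z) powr q \<le> w z powr p + a z * w z powr q"
    using vw p pq az by (intro add_mono mult_left_mono powr_mono2) auto
  also have "\<dots> \<le> 2 * (shift_flux p q (a z) \<sigma> (w z) * w z) + (\<sigma> powr p + a z * \<sigma> powr q)"
    by (rule double_phase_le_shift[OF w_nonneg])
  also have "\<dots> \<le> 2 * (shift_flux p q (a z) \<sigma> (w z) * w z) + (\<sigma> powr p + L * \<sigma> powr q)"
    using az by (intro add_left_mono mult_right_mono) auto
  also have "\<dots> \<le> Gv z" using z F_nonneg[OF z] by (simp add: Gv_def)
  finally show ?thesis .
qed

lemma V_le_Gv:
  assumes z: "z \<in> Q"
  shows "norm (V z) powr p + a z * norm (V z) powr q \<le> Gv z"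
proof -
  interpret double_phase p q "a z" \<sigma> k by (rule dp[OF z])
  have az: "0 \<le> a z" "a z \<le> L" using a[OF QT[OF z]] by auto
  let ?f = "1 + norm (Du z)"
  have "norm (V z) \<le> norm (Du z) + norm P" unfolding V_def by (rule norm_triangle_ineq4)
  also have "\<dots> \<le> \<sigma> * ?f" by (simp add: algebra_simps)
  finally have V: "norm (V z) \<le> \<sigma> * ?f" .
  have "norm (V z) powr m \<le> \<sigma> powr q * ?f powr m" if "0 \<le> m" "m \<le> q" for m
  proof -
    have "norm (V z) powr m \<le> (\<sigma> * ?f) powr m" using V that by (intro powr_mono2) auto
    also have "\<dots> = \<sigma> powr m * ?f powr m" by (simp add: powr_mult add_nonneg_nonneg)
    also have "\<dots> \<le> \<sigma> powr q * ?f powr m" using that by (intro mult_right_mono powr_mono) auto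
    finally show ?thesis .
  qed
  then have "norm (V z) powr p + a z * norm (V z) powr q \<le> \<sigma> powr q * ?f powr p + a z * (\<sigma> powr q * ?f powr q)"
    using p pq az by (intro add_mono mult_left_mono) auto
  also have "\<dots> = \<sigma> powr q * (?f powr p + a z * ?f powr q)" by (simp add: algebra_simps)
  also have "\<dots> \<le> \<sigma> powr q * F z" using F_ge[OF z] by (intro mult_left_mono) auto
  also have "\<dots> \<le> Gv z"
    using z az shift_flux_nonneg[OF w_nonneg, of z] w_nonneg[of z] L by (simp add: Gv_def)
  finally show ?thesis .
qed

lemma Bf_bound:
  assumes z: "z \<in> Q"
  shows "norm (A z (Du z) - A0) \<le> (L * q + norm A0) * ((1 + norm (Du z)) powr (p - 1) + a z * (1 + norm (Du z)) powr (q - 1))"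
proof -
  have az: "0 \<le> a z" using a[OF QT[OF z]] by simp
  let ?s = "(1 + norm (Du z)) powr (p - 1) + a z * (1 + norm (Du z)) powr (q - 1)"
  have "1 \<le> (1 + norm (Du z)) powr (p - 1)" using pq by (intro ge_one_powr_ge_zero) auto
  moreover have "0 \<le> a z * (1 + norm (Du z)) powr (q - 1)" using az by simp
  ultimately have "1 \<le> ?s" by linarith
  then have "norm A0 * 1 \<le> norm A0 * ?s" by (intro mult_left_mono) auto
  then show ?thesis using norm_triangle_ineq4[of "A z (Du z)" A0] A_bound[OF z] by (simp add: distrib_right)
qed

lemma flux_product_le:
  assumes z: "z \<in> Q" and s: "0 \<le> s" "s powr p + a z * s powr q \<le> Gv z"
  shows "norm (A z (Du z) - A0) * s \<le> (L * q + norm A0) * (F z + Gv z)"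
proof -
  have az: "0 \<le> a z" using a[OF QT[OF z]] by simp
  let ?f = "1 + norm (Du z)"
  have "(?f powr (p - 1) + a z * ?f powr (q - 1)) * s = ?f powr (p - 1) * s + a z * (?f powr (q - 1) * s)"
    by (simp add: algebra_simps)
  also have "\<dots> \<le> (?f powr p + s powr p) + a z * (?f powr q + s powr q)"
    using pq az s by (intro add_mono mult_left_mono powr_young_crude) auto
  also have "\<dots> \<le> F z + Gv z" using F_ge[OF z] s by (simp add: algebra_simps)
  finally have "(L * q + norm A0) * ((?f powr (p - 1) + a z * ?f powr (q - 1)) * s) \<le> (L * q + norm A0) * (F z + Gv z)"
    using Lq_nonneg by (intro mult_left_mono) auto
  then show ?thesis using mult_right_mono[OF Bf_bound[OF z, of A0] s(1)] by (simp add: mult.assoc)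
qed

lemma product_integrable:
  assumes W: "(\<lambda>z. indicator Q z * W z) \<in> borel_measurable lebesgue" and "\<And>z. z \<in> Q \<Longrightarrow> \<bar>W z\<bar> powr p + a z * \<bar>W z\<bar> powr q \<le> Gv z"
  shows "integrable lebesgue (\<lambda>z. Bf A0 i j z * (indicator Q z * W z))"
proof -
  have "integrable lebesgue (\<lambda>z. indicator Q z * ((A z (Du z) - A0) $ i $ j * W z))"
  proof (rule integrableI_Q)
    have "(\<lambda>z. Bf A0 i j z * (indicator Q z * W z)) \<in> borel_measurable lebesgue"
      by (rule borel_measurable_times[OF borel_measurable_integrable[OF Bf_integrable] W])
    then show "(\<lambda>z. indicator Q z * ((A z (Du z) - A0) $ i $ j * W z)) \<in> borel_measurable lebesgue"
      by (rule measurable_cong[THEN iffD1, rotated]) (simp add: Bf_def indicator_def)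
    show "integrable lebesgue (\<lambda>z. (L * q + norm A0) * (F z + Gv z))"
      using F_integrable Gv_integrable by simp
    fix z assume z: "z \<in> Q"
    have "\<bar>(A z (Du z) - A0) $ i $ j * W z\<bar> \<le> norm (A z (Du z) - A0) * \<bar>W z\<bar>"
      unfolding abs_mult by (intro mult_right_mono matrix_component_le) auto
    also have "\<dots> \<le> (L * q + norm A0) * (F z + Gv z)" using assms(2)[OF z] by (intro flux_product_le[OF z]) auto
    finally show "\<bar>(A z (Du z) - A0) $ i $ j * W z\<bar> \<le> (L * q + norm A0) * (F z + Gv z)" .
  qed
  then show ?thesis
    by (rule Bochner_Integration.integrable_cong[THEN iffD1, rotated 2]) (auto simp: Bf_def indicator_def)
qed

lemma component_powr_le:
  assumes z: "z \<in> Q" and "\<bar>x\<bar> \<le> y" "y powr p + a z * y powr q \<le> Gv z"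
  shows "\<bar>x\<bar> powr p + a z * \<bar>x\<bar> powr q \<le> Gv z"
proof -
  have "\<bar>x\<bar> powr p + a z * \<bar>x\<bar> powr q \<le> y powr p + a z * y powr q"
    using assms(2) pq a[OF QT[OF z]] by (intro add_mono mult_left_mono powr_mono2) auto
  then show ?thesis using assms(3) by linarith
qed

text \<open>The sum over the components of the scalar identities. The matrix \<open>A0\<close> is free and will be the
  value of the field at the centre of the cylinder.\<close>

lemma solution_energy_identity:
  assumes K: "compact K" "K \<subseteq> Q" and \<eta>: "Ck (Suc 0) \<eta>" "\<And>z. z \<notin> K \<Longrightarrow> \<eta> z = 0"
  shows "(1/2) * (LINT z|lebesgue. pd \<eta> tdir z * (indicator Q z * (norm (v z))\<^sup>2)) =
    (LINT z|lebesgue. indicator Q z * ((A z (Du z) - A0) \<bullet> (\<eta> z *\<^sub>R V z + (\<chi> i j. v z $ i * pd \<eta> (xdir j) z))))"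
    and "integrable lebesgue (\<lambda>z. indicator Q z * ((A z (Du z) - A0) \<bullet> (\<eta> z *\<^sub>R V z + (\<chi> i j. v z $ i * pd \<eta> (xdir j) z))))"
    and "integrable lebesgue (\<lambda>z. pd \<eta> tdir z * (indicator Q z * (norm (v z))\<^sup>2))"
proof -
  define vi where "vi i z = indicator Q z * v z $ i" for i z
  define Vf where "Vf i j z = indicator Q z * V z $ i $ j" for i j z
  obtain RK where RK: "\<And>z. z \<in> K \<Longrightarrow> norm z \<le> RK"
    using compact_imp_bounded[OF K(1)] by (auto simp: bounded_iff)
  have \<eta>R: "\<eta> z = 0" if "norm z > RK" for z using \<eta>(2)[of z] RK[of z] that by fastforce
  have pdR: "pd \<eta> h z = 0" if "norm z > RK" for z h
    by (rule frechet_derivative_zero_outside[where R=RK]) (use \<eta>R that in auto)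
  have vG: "\<bar>v z $ i\<bar> powr p + a z * \<bar>v z $ i\<bar> powr q \<le> Gv z" if "z \<in> Q" for z i
    by (rule component_powr_le[OF that component_le_norm_cart v_le_Gv[OF that]])
  have VG: "\<bar>V z $ i $ j\<bar> powr p + a z * \<bar>V z $ i $ j\<bar> powr q \<le> Gv z" if "z \<in> Q" for z i j
    by (rule component_powr_le[OF that matrix_component_le V_le_Gv[OF that]])
  have ei: "(1/2) * (LINT z|lebesgue. pd \<eta> tdir z * (vi i z * vi i z)) =
    (\<Sum>j\<in>UNIV. (LINT z|lebesgue. pd \<eta> (xdir j) z * (Bf A0 i j z * vi i z))
             + (LINT z|lebesgue. \<eta> z * (Bf A0 i j z * Vf i j z)))" for i
  proof (rule energy_identity[where Q=Q and p=p and q=q and \<alpha>=\<alpha> and a=a and L=L and C="L * q + norm A0"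
        and f="\<lambda>z. 1 + norm (Du z)" and F=F and G=Gv and K=K])
    show "integrable lebesgue (vi i)" unfolding vi_def[abs_def] by (rule v_integrable)
    show "integrable lebesgue (\<lambda>z. vi i z * vi i z)" unfolding vi_def by (rule v_sq_integrable)
    show "integrable lebesgue (Vf i j)" for j unfolding Vf_def[abs_def] by (rule V_integrable)
    show "integrable lebesgue (Bf A0 i j)" for j by (rule Bf_integrable)
    show "(LINT z|lebesgue. vi i z * pd \<zeta> (xdir j) z) = - (LINT z|lebesgue. Vf i j z * \<zeta> z)"
      if "test_function Q \<zeta>" for \<zeta> j
      unfolding vi_def Vf_def by (rule equations_minus_affine(1)[OF that])
    show "(LINT z|lebesgue. vi i z * pd \<zeta> tdir z) = (\<Sum>j\<in>UNIV. LINT z|lebesgue. Bf A0 i j z * pd \<zeta> (xdir j) z)"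
      if "test_function Q \<zeta>" for \<zeta>
      unfolding vi_def by (rule equations_minus_affine(2)[OF that])
    show "\<bar>Bf A0 i j y\<bar> \<le> (L * q + norm A0) * ((1 + norm (Du y)) powr (p - 1) + a y * (1 + norm (Du y)) powr (q - 1))"
      if "y \<in> Q" for y j
      using order_trans[OF matrix_component_le Bf_bound[OF that, of A0], of i j] that by (simp add: Bf_def)
    show "\<bar>vi i y\<bar> powr p + a y * \<bar>vi i y\<bar> powr q \<le> Gv y" if "y \<in> Q" for y
      using vG[OF that, of i] that by (simp add: vi_def)
    show "\<bar>Vf i j y\<bar> powr p + a y * \<bar>Vf i j y\<bar> powr q \<le> Gv y" if "y \<in> Q" for y j
      using VG[OF that, of i j] that by (simp add: Vf_def)
  qed (use pq gap \<alpha> a[OF QT] hol[OF QT QT] L Lq_nonneg F_integrable F_ge Gv_integrable Q K \<eta> in \<open>auto simp del: Ck.simps\<close>)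
  have im: "integrable lebesgue (\<lambda>z. g z * h z)"
    if "integrable lebesgue h" "continuous_on UNIV g" "\<And>z. norm z > RK \<Longrightarrow> g z = 0" for g h :: "(real^'n) \<times> real \<Rightarrow> real"
    using integrable_mult_continuous_bounded_support[OF that] by (simp add: mult.commute)
  have it: "integrable lebesgue (\<lambda>z. pd \<eta> tdir z * (vi i z * vi i z))" for i
    by (rule im[OF _ Ck_pd_continuous[OF \<eta>(1) tdir_Basis] pdR]) (use v_sq_integrable[of i] in \<open>simp_all add: vi_def\<close>)
  have ix: "integrable lebesgue (\<lambda>z. pd \<eta> (xdir j) z * (Bf A0 i j z * vi i z))" for i j
    by (rule im[OF _ Ck_pd_continuous[OF \<eta>(1) xdir_Basis] pdR])
      (use product_integrable[OF component_meas[OF v_meas] vG, of A0 i j] in \<open>simp_all add: vi_def\<close>)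
  have ie: "integrable lebesgue (\<lambda>z. \<eta> z * (Bf A0 i j z * Vf i j z))" for i j
    by (rule im[OF _ Ck_imp_continuous[OF \<eta>(1)] \<eta>R])
      (use product_integrable[OF matrix_component_meas[OF V_meas] VG, of A0 i j] in \<open>simp_all add: Vf_def\<close>)
  have sq: "(\<Sum>i\<in>UNIV. pd \<eta> tdir z * (vi i z * vi i z)) = pd \<eta> tdir z * (indicator Q z * (norm (v z))\<^sup>2)" for z
  proof -
    have "(norm (v z))\<^sup>2 = (\<Sum>i\<in>UNIV. v z $ i * v z $ i)"
      by (simp add: power2_norm_eq_inner inner_vec_def)
    then show ?thesis by (cases "z \<in> Q") (simp_all add: vi_def sum_distrib_left)
  qed
  have rhs: "(\<Sum>i\<in>UNIV. \<Sum>j\<in>UNIV. pd \<eta> (xdir j) z * (Bf A0 i j z * vi i z) + \<eta> z * (Bf A0 i j z * Vf i j z))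
      = indicator Q z * ((A z (Du z) - A0) \<bullet> (\<eta> z *\<^sub>R V z + (\<chi> i j. v z $ i * pd \<eta> (xdir j) z)))" for z
    unfolding inner_matrix
    by (cases "z \<in> Q") (simp_all add: Bf_def vi_def Vf_def algebra_simps)
  show "integrable lebesgue (\<lambda>z. indicator Q z * ((A z (Du z) - A0) \<bullet> (\<eta> z *\<^sub>R V z + (\<chi> i j. v z $ i * pd \<eta> (xdir j) z))))"
    unfolding rhs[symmetric] by (intro Bochner_Integration.integrable_sum Bochner_Integration.integrable_add ix ie)
  show "integrable lebesgue (\<lambda>z. pd \<eta> tdir z * (indicator Q z * (norm (v z))\<^sup>2))"
    unfolding sq[symmetric] by (intro Bochner_Integration.integrable_sum it)
  have "(1/2) * (LINT z|lebesgue. pd \<eta> tdir z * (indicator Q z * (norm (v z))\<^sup>2))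
      = (\<Sum>i\<in>UNIV. (1/2) * (LINT z|lebesgue. pd \<eta> tdir z * (vi i z * vi i z)))"
    unfolding sq[symmetric] by (subst Bochner_Integration.integral_sum[OF it]) (simp add: sum_distrib_left)
  also have "\<dots> = (\<Sum>i\<in>UNIV. \<Sum>j\<in>UNIV. LINT z|lebesgue. pd \<eta> (xdir j) z * (Bf A0 i j z * vi i z) + \<eta> z * (Bf A0 i j z * Vf i j z))"
    unfolding ei by (simp add: Bochner_Integration.integral_add[OF ix ie])
  also have "\<dots> = (LINT z|lebesgue. (\<Sum>i\<in>UNIV. \<Sum>j\<in>UNIV. pd \<eta> (xdir j) z * (Bf A0 i j z * vi i z) + \<eta> z * (Bf A0 i j z * Vf i j z)))"
    by (simp add: Bochner_Integration.integral_sum Bochner_Integration.integrable_sum ix ie)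
  finally show "(1/2) * (LINT z|lebesgue. pd \<eta> tdir z * (indicator Q z * (norm (v z))\<^sup>2)) =
    (LINT z|lebesgue. indicator Q z * ((A z (Du z) - A0) \<bullet> (\<eta> z *\<^sub>R V z + (\<chi> i j. v z $ i * pd \<eta> (xdir j) z))))"
    unfolding rhs .
qed

end

section \<open>Cut-off functions\<close>

text \<open>A \<open>C\<^sup>1\<close> transition from \<open>0\<close> to \<open>1\<close> on \<open>[0, 1]\<close>, composed of two squared positive parts.\<close>

definition step :: "real \<Rightarrow> real" where
  "step s = 1 - (max 0 (1 - (max 0 s)\<^sup>2))\<^sup>2"

definition step' :: "real \<Rightarrow> real" where
  "step' s = 4 * max 0 (1 - (max 0 s)\<^sup>2) * max 0 s"

lemma pos_part_sq_derivative: "((\<lambda>s::real. (max 0 s)\<^sup>2) has_real_derivative 2 * max 0 s) (at s)"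
proof -
  consider "s > 0" | "s < 0" | "s = 0" by linarith
  then show ?thesis
  proof cases
    case 1
    have "((\<lambda>s::real. s\<^sup>2) has_real_derivative 2 * max 0 s) (at s)"
      using 1 by (auto intro!: derivative_eq_intros)
    then show ?thesis
      by (rule has_field_derivative_transform_within_open[where S="{0<..}"]) (use 1 in auto)
  next
    case 2
    have "((\<lambda>s::real. 0) has_real_derivative 2 * max 0 s) (at s)" using 2 by simp
    then show ?thesis
      by (rule has_field_derivative_transform_within_open[where S="{..<0}"]) (use 2 in auto)
  next
    case 3
    have "(\<lambda>h::real. (max 0 h)\<^sup>2 / h) \<midarrow>0\<rightarrow> 0"
    proof (rule Lim_null_comparison)
      show "\<forall>\<^sub>F h in at (0::real). norm ((max 0 h)\<^sup>2 / h) \<le> \<bar>h\<bar>"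
        by (rule always_eventually) (auto simp: max_def power2_eq_square)
      show "(\<lambda>h::real. \<bar>h\<bar>) \<midarrow>0\<rightarrow> 0" by (rule tendsto_rabs_zero[OF tendsto_ident_at])
    qed
    then show ?thesis by (simp add: 3 DERIV_def)
  qed
qed

lemma step_derivative: "(step has_real_derivative step' s) (at s)"
proof -
  have "((\<lambda>s. 1 - (max 0 s)\<^sup>2) has_real_derivative - (2 * max 0 s)) (at s)"
    using DERIV_diff[OF DERIV_const pos_part_sq_derivative] by simp
  from DERIV_chain2[OF pos_part_sq_derivative this]
  have "((\<lambda>s. 1 - (max 0 (1 - (max 0 s)\<^sup>2))\<^sup>2) has_real_derivative 0 - 2 * max 0 (1 - (max 0 s)\<^sup>2) * - (2 * max 0 s)) (at s)"
    by (rule DERIV_diff[OF DERIV_const])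
  then show ?thesis by (simp add: step_def[abs_def] step'_def mult.assoc)
qed

lemma step'_continuous: "continuous_on UNIV step'"
  unfolding step'_def by (intro continuous_intros)

lemma step_bounds: "0 \<le> step s" "step s \<le> 1"
proof -
  have "max 0 (1 - (max 0 s)\<^sup>2) \<le> 1" "0 \<le> max 0 (1 - (max 0 s)\<^sup>2)" by auto
  then have "(max 0 (1 - (max 0 s)\<^sup>2))\<^sup>2 \<le> 1" by (intro power_le_one)
  then show "0 \<le> step s" "step s \<le> 1" by (simp_all add: step_def)
qed

lemma step_eq: "s \<le> 0 \<Longrightarrow> step s = 0" "1 \<le> s \<Longrightarrow> step s = 1"
proof -
  show "s \<le> 0 \<Longrightarrow> step s = 0" by (simp add: step_def)
  assume "1 \<le> s"
  then have "1 \<le> s\<^sup>2" by (rule one_le_power)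
  then have "max 0 (1 - (max 0 s)\<^sup>2) = 0" using \<open>1 \<le> s\<close> by simp
  then show "step s = 1" by (simp add: step_def)
qed

lemma step'_bounds: "0 \<le> step' s" "step' s \<le> 4" and step'_eq: "s \<le> 0 \<Longrightarrow> step' s = 0"
  and step'_ge: "1/4 \<le> s \<Longrightarrow> s \<le> 3/4 \<Longrightarrow> 1/4 \<le> step' s"
proof -
  show "0 \<le> step' s" by (simp add: step'_def)
  show "s \<le> 0 \<Longrightarrow> step' s = 0" by (simp add: step'_def)
  show "step' s \<le> 4"
  proof (cases "s \<le> 1")
    case True
    have "max 0 (1 - (max 0 s)\<^sup>2) * max 0 s \<le> 1 * 1" using True by (intro mult_mono) auto
    then show ?thesis by (simp add: step'_def)
  next
    case False
    then have "1 \<le> s\<^sup>2" by (intro one_le_power) auto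
    then have "max 0 (1 - (max 0 s)\<^sup>2) = 0" using False by simp
    then show ?thesis by (simp add: step'_def)
  qed
  assume s: "1/4 \<le> s" "s \<le> 3/4"
  then have "s\<^sup>2 \<le> (3/4)\<^sup>2" by (intro power_mono) auto
  then have "7/16 \<le> 1 - s\<^sup>2" by (simp add: power2_eq_square)
  then have "7/16 * (1/4) \<le> (1 - s\<^sup>2) * s" using s by (intro mult_mono) auto
  moreover have "step' s = 4 * ((1 - s\<^sup>2) * s)"
    using s \<open>7/16 \<le> 1 - s\<^sup>2\<close> by (simp add: step'_def max_def)
  ultimately show "1/4 \<le> step' s" by linarith
qed

text \<open>The spatial factor enters as a \<open>k\<close>-th power, so that the gradient is bounded by \<open>\<theta> ^ (k - 1)\<close>,
  the power that \<open>shift_flux_young\<close> can absorb. The time factor increases on an interval of length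
  \<open>(\<rho>2 - \<rho>1) / 2\<close> that ends at \<open>t0 - \<rho>1\<close> and decreases on \<open>(\<tau>, \<tau> + h)\<close>. The decrease has a good
  sign and is quantified on the middle half of this interval, where the slope of \<open>step\<close> is bounded
  from below.\<close>

lemma parabolic_cutoff:
  fixes x0 :: "real^'n" and t0 r1 r2 \<rho>1 \<rho>2 \<tau> h :: real and k :: nat
  assumes r: "0 < r1" "r1 < r2" and \<rho>: "0 < \<rho>1" "\<rho>1 < \<rho>2" and h: "0 < h"
    and \<tau>: "t0 - \<rho>1 \<le> \<tau>" "\<tau> + h \<le> t0 + (\<rho>1 + \<rho>2) / 2" and k: "2 \<le> k"
  obtains \<eta> \<theta> \<psi> where "Ck (Suc 0) \<eta>"
    "\<And>z. z \<notin> cball x0 ((r1 + r2) / 2) \<times> {t0 - (\<rho>1 + \<rho>2) / 2..t0 + (\<rho>1 + \<rho>2) / 2} \<Longrightarrow> \<eta> z = 0"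
    "\<And>z. \<eta> z = \<theta> (fst z) ^ k * \<psi> (snd z)"
    "\<And>x. 0 \<le> \<theta> x \<and> \<theta> x \<le> 1" "\<And>t. 0 \<le> \<psi> t \<and> \<psi> t \<le> (1::real)"
    "\<And>z. norm (\<chi> j. pd \<eta> (xdir j) z) \<le> 16 * real k / (r2 - r1) * (\<theta> (fst z) ^ (k - 1) * \<psi> (snd z))"
    "\<And>z. pd \<eta> tdir z \<le> 8 / (\<rho>2 - \<rho>1) - 1 / (4 * h) * indicator (cball x0 r1 \<times> {\<tau> + h / 4..\<tau> + 3 * h / 4}) z"
    "\<And>z. z \<in> cball x0 r1 \<times> {t0 - \<rho>1..\<tau>} \<Longrightarrow> \<eta> z = 1"
proof -
  define R where "R = (r1 + r2) / 2"
  \<comment> \<open>The spatial factor is a function of \<open>|x - x0|\<^sup>2\<close>, which is smooth at the centre; it equals \<open>1\<close>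
    for \<open>|x - x0| \<le> r1\<close> and \<open>0\<close> for \<open>|x - x0| \<ge> R\<close>.\<close>
  define D where "D = R\<^sup>2 - r1\<^sup>2"
  have R: "r1 < R" "0 < R" using r by (auto simp: R_def)
  have D: "D = (R - r1) * (R + r1)" by (simp add: D_def power2_eq_square algebra_simps)
  then have D0: "D > 0" using R r by simp
  define m where "m x = (R\<^sup>2 - (x - x0) \<bullet> (x - x0)) / D" for x
  define \<theta> where "\<theta> x = step (m x)" for x
  define \<rho> where "\<rho> = (\<rho>1 + \<rho>2) / 2"
  have \<rho>': "\<rho>1 < \<rho>" "\<rho> - \<rho>1 = (\<rho>2 - \<rho>1) / 2" using \<rho> by (auto simp: \<rho>_def field_simps)
  define up where "up t = (t - (t0 - \<rho>)) / (\<rho> - \<rho>1)" for t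
  define dn where "dn t = (t - \<tau>) / h" for t
  define \<psi> where "\<psi> t = step (up t) * (1 - step (dn t))" for t
  define \<psi>' where "\<psi>' t = step' (up t) / (\<rho> - \<rho>1) * (1 - step (dn t)) - step (up t) * (step' (dn t) / h)" for t
  define \<eta> where "\<eta> z = \<theta> (fst z) ^ k * \<psi> (snd z)" for z :: "(real^'n) \<times> real"
  define g where "g x = (real k * \<theta> x ^ (k - 1) * step' (m x) * (- 2 / D)) *\<^sub>R (x - x0)" for x
  have \<theta>: "0 \<le> \<theta> x" "\<theta> x \<le> 1" for x by (simp_all add: \<theta>_def step_bounds)
  have \<psi>: "0 \<le> \<psi> t" "\<psi> t \<le> 1" for t
  proof -
    have "step (up t) * (1 - step (dn t)) \<le> 1 * 1"
      using step_bounds[of "up t"] step_bounds[of "dn t"] by (intro mult_mono) auto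
    then show "0 \<le> \<psi> t" "\<psi> t \<le> 1"
      using step_bounds[of "up t"] step_bounds[of "dn t"] by (simp_all add: \<psi>_def)
  qed
  have dm: "(m has_derivative (\<lambda>y. (- 2 / D) * ((x - x0) \<bullet> y))) (at x)" for x
    unfolding m_def using D0 by (auto intro!: derivative_eq_intros simp: inner_commute field_simps)
  have d\<theta>: "(\<theta> has_derivative (\<lambda>y. step' (m x) * ((- 2 / D) * ((x - x0) \<bullet> y)))) (at x)" for x
    using diff_chain_at[OF dm step_derivative[unfolded has_field_derivative_def]]
    by (simp add: o_def \<theta>_def[abs_def])
  have d\<theta>k: "((\<lambda>x. \<theta> x ^ k) has_derivative (\<lambda>y. g x \<bullet> y)) (at x)" for x
  proof -
    have "((\<lambda>x. \<theta> x ^ k) has_derivative (\<lambda>y. real k * (step' (m x) * ((- 2 / D) * ((x - x0) \<bullet> y))) * \<theta> x ^ (k - 1))) (at x)"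
      by (rule has_derivative_power[OF d\<theta>, THEN has_derivative_eq_rhs]) (auto simp: algebra_simps)
    then show ?thesis by (rule has_derivative_eq_rhs) (auto simp: g_def algebra_simps)
  qed
  have dup: "(up has_real_derivative 1 / (\<rho> - \<rho>1)) (at t)" for t
    unfolding up_def using \<rho>' by (auto intro!: derivative_eq_intros)
  have ddn: "(dn has_real_derivative 1 / h) (at t)" for t
    unfolding dn_def using h by (auto intro!: derivative_eq_intros)
  have d\<psi>: "(\<psi> has_real_derivative \<psi>' t) (at t)" for t
  proof -
    have 1: "((\<lambda>t. step (up t)) has_real_derivative step' (up t) * (1 / (\<rho> - \<rho>1))) (at t)"
      by (rule DERIV_chain2[OF step_derivative dup])
    have 2: "((\<lambda>t. 1 - step (dn t)) has_real_derivative 0 - step' (dn t) * (1 / h)) (at t)"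
      by (rule DERIV_diff[OF DERIV_const DERIV_chain2[OF step_derivative ddn]])
    from DERIV_mult[OF 1 2] show ?thesis by (simp add: \<psi>_def[abs_def] \<psi>'_def algebra_simps)
  qed
  have d\<eta>: "(\<eta> has_derivative (\<lambda>y. \<theta> (fst z) ^ k * (\<psi>' (snd z) * snd y) + (g (fst z) \<bullet> fst y) * \<psi> (snd z))) (at z)" for z
  proof -
    have f: "(fst has_derivative fst) (at z)" and s: "(snd has_derivative snd) (at z)"
      by (auto intro!: derivative_eq_intros)
    have 1: "((\<lambda>z. \<theta> (fst z) ^ k) has_derivative (\<lambda>y. g (fst z) \<bullet> fst y)) (at z)"
      using diff_chain_at[OF f d\<theta>k] by (simp add: o_def)
    have 2: "((\<lambda>z. \<psi> (snd z)) has_derivative (\<lambda>y. \<psi>' (snd z) * snd y)) (at z)"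
      using diff_chain_at[OF s d\<psi>[unfolded has_field_derivative_def]] by (simp add: o_def)
    show ?thesis unfolding \<eta>_def[abs_def] by (rule has_derivative_mult[OF 1 2])
  qed
  have c\<theta>: "continuous_on UNIV \<theta>" by (rule has_derivative_continuous_on[OF d\<theta>]) 
  have c\<psi>: "continuous_on UNIV \<psi>"
    by (rule DERIV_continuous_on) (use d\<psi> in \<open>auto intro: has_field_derivative_at_within\<close>)
  have cstep: "continuous_on UNIV step"
    by (rule DERIV_continuous_on) (use step_derivative in \<open>auto intro: has_field_derivative_at_within\<close>)
  have c\<psi>': "continuous_on UNIV \<psi>'"
    unfolding \<psi>'_def up_def dn_def using \<rho>' h
    by (intro continuous_intros continuous_on_compose2[OF cstep] continuous_on_compose2[OF step'_continuous]) auto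
  have cg: "continuous_on UNIV g"
    unfolding g_def m_def using D0
    by (intro continuous_intros c\<theta> continuous_on_compose2[OF step'_continuous]) auto
  have pd\<eta>: "pd \<eta> y z = \<theta> (fst z) ^ k * (\<psi>' (snd z) * snd y) + (g (fst z) \<bullet> fst y) * \<psi> (snd z)" for y z
    by (simp add: frechet_derivative_eqI[OF d\<eta>])
  show ?thesis
  proof
    show "Ck (Suc 0) \<eta>"
    proof (rule Ck_SucI[OF d\<eta>])
      fix y :: "(real^'n) \<times> real"
      show "Ck 0 (\<lambda>z. \<theta> (fst z) ^ k * (\<psi>' (snd z) * snd y) + (g (fst z) \<bullet> fst y) * \<psi> (snd z))"
        unfolding Ck.simps
        by (intro continuous_intros continuous_on_compose2[OF c\<theta>] continuous_on_compose2[OF c\<psi>']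
            continuous_on_compose2[OF c\<psi>] continuous_on_compose2[OF cg]) auto
    qed
    show "\<eta> z = 0" if H: "z \<notin> cball x0 ((r1 + r2) / 2) \<times> {t0 - (\<rho>1 + \<rho>2) / 2..t0 + (\<rho>1 + \<rho>2) / 2}" for z
    proof -
      consider "norm (fst z - x0) > R" | "snd z < t0 - \<rho>" | "snd z > t0 + \<rho>"
        using H by (auto simp: R_def \<rho>_def mem_Times_iff dist_norm norm_minus_commute not_le)
      then show ?thesis
      proof cases
        case 1
        then have "R\<^sup>2 \<le> (norm (fst z - x0))\<^sup>2" using R by (intro power_mono) auto
        then have "m (fst z) \<le> 0" using D0 by (simp add: m_def power2_norm_eq_inner divide_nonpos_pos)
        then show ?thesis using k by (simp add: \<eta>_def \<theta>_def step_eq)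
      next
        case 2
        then have "up (snd z) \<le> 0" using \<rho>' by (simp add: up_def divide_nonpos_pos)
        then show ?thesis by (simp add: \<eta>_def \<psi>_def step_eq)
      next
        case 3
        then have "dn (snd z) \<ge> 1" using \<tau> h by (simp add: dn_def \<rho>_def field_simps)
        then show ?thesis by (simp add: \<eta>_def \<psi>_def step_eq)
      qed
    qed
    show "\<eta> z = \<theta> (fst z) ^ k * \<psi> (snd z)" for z by (simp add: \<eta>_def)
    show "0 \<le> \<theta> x \<and> \<theta> x \<le> 1" for x using \<theta> by simp
    show "0 \<le> \<psi> t \<and> \<psi> t \<le> 1" for t using \<psi> by simp
    show "norm (\<chi> j. pd \<eta> (xdir j) z) \<le> 16 * real k / (r2 - r1) * (\<theta> (fst z) ^ (k - 1) * \<psi> (snd z))" for z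
    proof -
      have "(\<chi> j. pd \<eta> (xdir j) z) = \<psi> (snd z) *\<^sub>R g (fst z)"
        by (simp add: vec_eq_iff pd\<eta> inner_axis)
      then have ng: "norm (\<chi> j. pd \<eta> (xdir j) z) = \<psi> (snd z) * norm (g (fst z))" using \<psi> by simp
      have "norm (g (fst z)) \<le> 16 * real k / (r2 - r1) * \<theta> (fst z) ^ (k - 1)"
      proof -
        have "step' (m x) * (2 / D) * norm (x - x0) \<le> 16 / (r2 - r1)" for x
        proof (cases "norm (x - x0) \<le> R")
          case True
          have "step' (m x) * (2 / D) * norm (x - x0) \<le> 4 * (2 / D) * R"
            using True D0 step'_bounds[of "m x"] by (intro mult_mono) auto
          also have "\<dots> = 8 / (R - r1) * (R / (R + r1))" unfolding D by simp
          also have "\<dots> \<le> 8 / (R - r1) * 1" using R r by (intro mult_left_mono) auto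
          also have "\<dots> = 8 / (R - r1)" by simp
          also have "\<dots> = 16 / (r2 - r1)" using r by (simp add: R_def field_simps)
          finally show ?thesis .
        next
          case False
          then have "R\<^sup>2 \<le> (norm (x - x0))\<^sup>2" using R by (intro power_mono) auto
          then have "m x \<le> 0" using D0 by (simp add: m_def power2_norm_eq_inner divide_nonpos_pos)
          then show ?thesis using r by (simp add: step'_eq)
        qed
        from mult_left_mono[OF this[of "fst z"], of "real k * \<theta> (fst z) ^ (k - 1)"]
        have "real k * \<theta> (fst z) ^ (k - 1) * (step' (m (fst z)) * (2 / D) * norm (fst z - x0)) \<le> real k * \<theta> (fst z) ^ (k - 1) * (16 / (r2 - r1))"
          using \<theta> by simp
        moreover have "norm (g x) = real k * \<theta> x ^ (k - 1) * (step' (m x) * (2 / D) * norm (x - x0))" for x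
          using \<theta>(1)[of x] step'_bounds(1)[of "m x"] D0 unfolding g_def norm_scaleR by (simp add: abs_mult)
        ultimately show ?thesis by (simp add: mult.commute mult.left_commute)
      qed
      from mult_left_mono[OF this, of "\<psi> (snd z)"] show ?thesis
        unfolding ng using \<psi>[of "snd z"] by (simp add: mult.commute mult.left_commute)
    qed
    show "pd \<eta> tdir z \<le> 8 / (\<rho>2 - \<rho>1) - 1 / (4 * h) * indicator (cball x0 r1 \<times> {\<tau> + h / 4..\<tau> + 3 * h / 4}) z" for z
    proof -
      let ?x = "fst z" and ?t = "snd z"
      have pd: "pd \<eta> tdir z = \<theta> ?x ^ k * \<psi>' ?t" by (simp add: pd\<eta>)
      have th: "0 \<le> \<theta> ?x ^ k" "\<theta> ?x ^ k \<le> 1" using \<theta> by (simp_all add: power_le_one)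
      have A: "step' (up ?t) / (\<rho> - \<rho>1) * (1 - step (dn ?t)) \<le> 8 / (\<rho>2 - \<rho>1)"
        and A0: "0 \<le> step' (up ?t) / (\<rho> - \<rho>1) * (1 - step (dn ?t))"
      proof -
        have "step' (up ?t) / (\<rho> - \<rho>1) * (1 - step (dn ?t)) \<le> 4 / (\<rho> - \<rho>1) * 1"
          using step'_bounds[of "up ?t"] step_bounds[of "dn ?t"] \<rho>' by (intro mult_mono divide_right_mono) auto
        also have "\<dots> = 8 / (\<rho>2 - \<rho>1)" using \<rho> by (simp add: \<rho>'(2) field_simps)
        finally show "step' (up ?t) / (\<rho> - \<rho>1) * (1 - step (dn ?t)) \<le> 8 / (\<rho>2 - \<rho>1)" .
        show "0 \<le> step' (up ?t) / (\<rho> - \<rho>1) * (1 - step (dn ?t))"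
          using step'_bounds[of "up ?t"] step_bounds[of "dn ?t"] \<rho>' by simp
      qed
      have B0: "0 \<le> step (up ?t) * (step' (dn ?t) / h)"
        using step_bounds[of "up ?t"] step'_bounds[of "dn ?t"] h by simp
      have "\<theta> ?x ^ k * (step' (up ?t) / (\<rho> - \<rho>1) * (1 - step (dn ?t))) \<le> 1 * (8 / (\<rho>2 - \<rho>1))"
        using th A A0 by (intro mult_mono) auto
      moreover have "1 / (4 * h) * indicator (cball x0 r1 \<times> {\<tau> + h / 4..\<tau> + 3 * h / 4}) z
          \<le> \<theta> ?x ^ k * (step (up ?t) * (step' (dn ?t) / h))"
      proof (cases "z \<in> cball x0 r1 \<times> {\<tau> + h / 4..\<tau> + 3 * h / 4}")
        case True
        then have x: "norm (?x - x0) \<le> r1" and t: "\<tau> + h / 4 \<le> ?t" "?t \<le> \<tau> + 3 * h / 4"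
          by (auto simp: mem_Times_iff dist_norm norm_minus_commute)
        have "(norm (?x - x0))\<^sup>2 \<le> r1\<^sup>2" using x by (intro power_mono) auto
        then have "D \<le> R\<^sup>2 - (?x - x0) \<bullet> (?x - x0)" by (simp add: D_def power2_norm_eq_inner)
        then have "1 \<le> m ?x" using D0 by (simp add: m_def)
        then have "\<theta> ?x = 1" by (simp add: \<theta>_def step_eq)
        moreover have "1 \<le> up ?t" using t \<tau> h \<rho>' by (simp add: up_def)
        then have "step (up ?t) = 1" by (simp add: step_eq)
        moreover have "1/4 \<le> step' (dn ?t)" using t h by (intro step'_ge) (auto simp: dn_def field_simps)
        ultimately show ?thesis using True h by (simp add: field_simps)
      next
        case False
        then have "indicator (cball x0 r1 \<times> {\<tau> + h / 4..\<tau> + 3 * h / 4}) z = (0::real)" by simp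
        then show ?thesis using mult_nonneg_nonneg[OF th(1) B0] by (simp only: mult_zero_right)
      qed
      ultimately show ?thesis unfolding pd \<psi>'_def by (simp add: right_diff_distrib)
    qed
    show "\<eta> z = 1" if "z \<in> cball x0 r1 \<times> {t0 - \<rho>1..\<tau>}" for z
    proof -
      from that have x: "norm (fst z - x0) \<le> r1" and t: "t0 - \<rho>1 \<le> snd z" "snd z \<le> \<tau>"
        by (auto simp: mem_Times_iff dist_norm norm_minus_commute)
      have "(norm (fst z - x0))\<^sup>2 \<le> r1\<^sup>2" using x by (intro power_mono) auto
      then have "D \<le> R\<^sup>2 - (fst z - x0) \<bullet> (fst z - x0)" by (simp add: D_def power2_norm_eq_inner)
      then have "1 \<le> m (fst z)" using D0 by (simp add: m_def)
      moreover have "1 \<le> up (snd z)" using t \<rho>' by (simp add: up_def)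
      moreover have "dn (snd z) \<le> 0" using t h by (simp add: dn_def divide_nonpos_pos)
      ultimately show ?thesis by (simp add: \<eta>_def \<theta>_def \<psi>_def step_eq)
    qed
  qed
qed

section \<open>Absorption\<close>

text \<open>The constant \<open>C\<close> with which the terms containing the gradient \<open>V\<close> are absorbed, at a single
  point: \<open>c\<close> is the value of the coefficient, \<open>B1\<close> the part of the flux that is monotone in \<open>V\<close>,
  \<open>B2\<close> the error from freezing the coefficients, and \<open>M\<close> the product of \<open>v\<close> with the gradient of
  the cut-off function \<open>\<theta> ^ k * \<psi>\<close>. The constant does not depend on any of these, nor on \<open>\<sigma>\<close>.\<close>

definition absorption_constant ::
  "'m::euclidean_space itself \<Rightarrow> real \<Rightarrow> real \<Rightarrow> nat \<Rightarrow> real \<Rightarrow> real \<Rightarrow> real \<Rightarrow> real \<Rightarrow> real \<Rightarrow> bool" where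
  "absorption_constant TYPE('m) p q k c0 L Co N C \<longleftrightarrow> 0 < C \<and>
    (\<forall>c \<sigma> x \<theta> \<psi> w. \<forall>B1 B2 V M :: 'm.
    0 \<le> c \<longrightarrow> 0 < \<sigma> \<longrightarrow> 0 < x \<longrightarrow> 0 \<le> \<theta> \<longrightarrow> \<theta> \<le> 1 \<longrightarrow> 0 \<le> \<psi> \<longrightarrow> \<psi> \<le> 1 \<longrightarrow> 0 \<le> w \<longrightarrow>
    c0 * (shift_flux p q c \<sigma> (norm V) * norm V) \<le> B1 \<bullet> V \<longrightarrow>
    norm B1 \<le> L * shift_flux p q c \<sigma> (norm V) \<longrightarrow>
    norm B2 \<le> Co * x * dflux p q c \<sigma> \<longrightarrow>
    norm M \<le> N * (\<theta> ^ (k - 1) * \<psi>) * w \<longrightarrow>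
    c0 / 2 * (\<theta> ^ k * \<psi> * (shift_flux p q c \<sigma> (norm V) * norm V)) \<le>
      (B1 + B2) \<bullet> ((\<theta> ^ k * \<psi>) *\<^sub>R V + M)
      + C * (shift_flux p q c \<sigma> w * w + young_max p q x * (\<sigma> powr p + c * \<sigma> powr q)))"

text \<open>Of the four products, \<open>B1 \<bullet> V\<close> is bounded from below by ellipticity. Young's inequality bounds
  \<open>B1 \<bullet> M\<close> and \<open>B2 \<bullet> V\<close> by small multiples of the same quantity, for which a quarter each is
  spent, and \<open>B2 \<bullet> M\<close> contains no gradient.\<close>

lemma absorption_constant_exists:
  fixes p q c0 L Co N :: real and k :: nat
  assumes pq: "1 < p" "p \<le> q" and k: "2 \<le> k" "q \<le> real k" and c0: "0 < c0" and L: "0 \<le> L" "0 \<le> Co" "0 \<le> N"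
  shows "\<exists>C. absorption_constant TYPE('m::euclidean_space) p q k c0 L Co N C"
proof -
  define d1 where "d1 = min 1 (c0 / (4 * (L * N + 1)))"
  define d2 where "d2 = min 1 (c0 / (4 * (Co + 1)))"
  have LN: "0 \<le> L * N" using L by simp
  have d1: "0 < d1" "d1 \<le> 1" "L * N * d1 \<le> c0 / 4"
  proof -
    show "0 < d1" "d1 \<le> 1" using c0 LN by (auto simp: d1_def add_nonneg_pos)
    have "L * N * d1 \<le> (L * N + 1) * (c0 / (4 * (L * N + 1)))"
      using LN c0 by (intro mult_mono) (auto simp: d1_def min_def)
    also have "\<dots> = c0 / 4" using LN by (simp add: field_simps)
    finally show "L * N * d1 \<le> c0 / 4" .
  qed
  have d2: "0 < d2" "d2 \<le> 1" "Co * d2 \<le> c0 / 4"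
  proof -
    show "0 < d2" "d2 \<le> 1" using c0 L by (auto simp: d2_def add_nonneg_pos)
    have "Co * d2 \<le> (Co + 1) * (c0 / (4 * (Co + 1)))"
      using L c0 by (intro mult_mono) (auto simp: d2_def min_def)
    also have "\<dots> = c0 / 4" using L by (simp add: field_simps)
    finally show "Co * d2 \<le> c0 / 4" .
  qed
  define Y where "Y d = q * (1 / d + (2 / d) powr (1 / (p - 1)))" for d
  have Y: "0 \<le> Y d" if "0 < d" for d using pq that by (simp add: Y_def)
  define C where "C = L * N * (1 / d1) ^ (k - 1) + Co * Y d2 + Co * N * (1 + Y 1) + 1"
  have Cterms: "0 \<le> L * N * (1 / d1) ^ (k - 1)" "0 \<le> Co * Y d2" "0 \<le> Co * N * (1 + Y 1)"
    using LN L d1 d2 Y by simp_all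
  have "C > 0" unfolding C_def using Cterms by linarith
  have "c0 / 2 * (\<theta> ^ k * \<psi> * (shift_flux p q c \<sigma> (norm V) * norm V)) \<le>
      (B1 + B2) \<bullet> ((\<theta> ^ k * \<psi>) *\<^sub>R V + M)
      + C * (shift_flux p q c \<sigma> w * w + young_max p q x * (\<sigma> powr p + c * \<sigma> powr q))"
    if c: "0 \<le> c" and \<sigma>: "0 < \<sigma>" and x: "0 < x" and \<theta>: "0 \<le> \<theta>" "\<theta> \<le> 1" and \<psi>: "0 \<le> \<psi>" "\<psi> \<le> 1" and w: "0 \<le> w"
      and ell: "c0 * (shift_flux p q c \<sigma> (norm V) * norm V) \<le> B1 \<bullet> V"
      and gr: "norm B1 \<le> L * shift_flux p q c \<sigma> (norm V)"
      and B2: "norm B2 \<le> Co * x * dflux p q c \<sigma>" and M: "norm M \<le> N * (\<theta> ^ (k - 1) * \<psi>) * w"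
    for c \<sigma> x \<theta> \<psi> w and B1 B2 V M :: 'm
  proof -
    interpret double_phase p q c \<sigma> k using pq c \<sigma> k by unfold_locales auto
    let ?s = "norm V"
    define \<eta> where "\<eta> = \<theta> ^ k * \<psi>"
    have \<eta>: "0 \<le> \<eta>" "\<eta> \<le> 1" using \<theta> \<psi> by (auto simp: \<eta>_def power_le_one mult_le_one)
    define E where "E = young_max p q x * (\<sigma> powr p + c * \<sigma> powr q)"
    have "0 \<le> young_max p q x" by (rule young_max_nonneg)
    then have E: "0 \<le> E" using c by (simp add: E_def)
    have gs: "0 \<le> G ?s * ?s" and gw: "0 \<le> G w * w" using shift_flux_nonneg w by simp_all
    have tk: "0 \<le> \<theta> ^ (k - 1) * \<psi>" "\<theta> ^ (k - 1) * \<psi> \<le> 1" using \<theta> \<psi> by (auto simp: power_le_one mult_le_one)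
    have h0: "0 \<le> x * H' \<sigma>" using x \<sigma> dflux_nonneg[of \<sigma>] by simp
    have 1: "\<eta> * (c0 * (G ?s * ?s)) \<le> \<eta> * (B1 \<bullet> V)" using ell \<eta> by (intro mult_left_mono) auto
    have 2: "- (B1 \<bullet> M) \<le> L * N * d1 * (\<eta> * (G ?s * ?s)) + L * N * (1 / d1) ^ (k - 1) * (G w * w)"
    proof -
      have "- (B1 \<bullet> M) \<le> norm B1 * norm M" using Cauchy_Schwarz_ineq2[of B1 M] by linarith
      also have "\<dots> \<le> (L * G ?s) * (N * (\<theta> ^ (k - 1) * \<psi>) * w)"
        using gr M L shift_flux_nonneg[of ?s] by (intro mult_mono) auto
      also have "\<dots> = L * N * (\<psi> * (G ?s * \<theta> ^ (k - 1) * w))" by (simp add: algebra_simps)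
      also have "\<dots> \<le> L * N * (\<psi> * (d1 * (\<theta> ^ k * (G ?s * ?s)) + (1 / d1) ^ (k - 1) * (G w * w)))"
        using LN \<psi> \<theta> d1 w by (intro mult_left_mono shift_flux_young) auto
      also have "\<dots> = L * N * d1 * (\<eta> * (G ?s * ?s)) + L * N * (1 / d1) ^ (k - 1) * (\<psi> * (G w * w))"
        by (simp add: \<eta>_def algebra_simps)
      also have "\<dots> \<le> L * N * d1 * (\<eta> * (G ?s * ?s)) + L * N * (1 / d1) ^ (k - 1) * (1 * (G w * w))"
        using Cterms \<psi> gw by (intro add_left_mono mult_left_mono mult_right_mono) auto
      finally show ?thesis by simp
    qed
    have 3: "- (\<eta> * (B2 \<bullet> V)) \<le> Co * d2 * (\<eta> * (G ?s * ?s)) + Co * Y d2 * E"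
    proof -
      have "- (B2 \<bullet> V) \<le> norm B2 * ?s" using Cauchy_Schwarz_ineq2[of B2 V] by linarith
      also have "\<dots> \<le> Co * x * H' \<sigma> * ?s" using B2 by (intro mult_right_mono) auto
      also have "\<dots> = Co * (x * H' \<sigma> * ?s)" by simp
      also have "\<dots> \<le> Co * (d2 * (G ?s * ?s) + Y d2 * E)"
        using dflux_young[OF x _ d2(1,2), of ?s] L by (intro mult_left_mono) (auto simp: Y_def E_def mult.assoc)
      finally have "\<eta> * (- (B2 \<bullet> V)) \<le> \<eta> * (Co * (d2 * (G ?s * ?s) + Y d2 * E))" using \<eta> by (intro mult_left_mono) auto
      also have "\<dots> = Co * d2 * (\<eta> * (G ?s * ?s)) + \<eta> * (Co * Y d2 * E)" by (simp add: algebra_simps)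
      also have "\<dots> \<le> Co * d2 * (\<eta> * (G ?s * ?s)) + 1 * (Co * Y d2 * E)"
        using \<eta> Cterms E by (intro add_left_mono mult_right_mono) auto
      finally show ?thesis by simp
    qed
    have 4: "- (B2 \<bullet> M) \<le> Co * N * (G w * w + Y 1 * E)"
    proof -
      have "- (B2 \<bullet> M) \<le> norm B2 * norm M" using Cauchy_Schwarz_ineq2[of B2 M] by linarith
      also have "\<dots> \<le> (Co * x * H' \<sigma>) * (N * (\<theta> ^ (k - 1) * \<psi>) * w)"
        using B2 M L x \<sigma> dflux_nonneg[of \<sigma>] by (intro mult_mono) auto
      also have "\<dots> = Co * N * ((\<theta> ^ (k - 1) * \<psi>) * (x * H' \<sigma> * w))" by (simp add: algebra_simps)
      also have "\<dots> \<le> Co * N * (1 * (x * H' \<sigma> * w))"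
        using tk L h0 w by (intro mult_left_mono mult_right_mono) auto
      also have "\<dots> \<le> Co * N * (1 * (G w * w) + Y 1 * E)"
        using dflux_young[OF x w, of 1] L by (intro mult_left_mono) (auto simp: Y_def E_def mult.assoc)
      finally show ?thesis by simp
    qed
    have "(c0 / 4 + c0 / 4) * (\<eta> * (G ?s * ?s)) \<ge> (L * N * d1 + Co * d2) * (\<eta> * (G ?s * ?s))"
      using d1 d2 \<eta> gs by (intro mult_right_mono add_mono) auto
    moreover have "(B1 + B2) \<bullet> (\<eta> *\<^sub>R V + M) = \<eta> * (B1 \<bullet> V) + B1 \<bullet> M + \<eta> * (B2 \<bullet> V) + B2 \<bullet> M"
      by (simp add: inner_add_left inner_add_right distrib_left)
    moreover have "L * N * (1 / d1) ^ (k - 1) * (G w * w) + Co * Y d2 * E + Co * N * (G w * w + Y 1 * E) \<le> C * (G w * w + E)"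
    proof -
      have "0 \<le> Co * N" using L by simp
      have "C * (G w * w + E) = (L * N * (1 / d1) ^ (k - 1) * (G w * w) + Co * Y d2 * E + Co * N * (G w * w + Y 1 * E))
          + (L * N * (1 / d1) ^ (k - 1) * E + Co * Y d2 * (G w * w) + Co * N * (E + Y 1 * (G w * w)) + (G w * w + E))"
        by (simp add: C_def algebra_simps)
      moreover have "0 \<le> L * N * (1 / d1) ^ (k - 1) * E" "0 \<le> Co * Y d2 * (G w * w)" "0 \<le> Co * N * (E + Y 1 * (G w * w))"
        using Cterms E gw \<open>0 \<le> Co * N\<close> Y[of 1] by simp_all
      ultimately show ?thesis using E gw by linarith
    qed
    ultimately have "c0 / 2 * (\<eta> * (G ?s * ?s)) \<le> (B1 + B2) \<bullet> (\<eta> *\<^sub>R V + M) + C * (G w * w + E)"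
      using 1 2 3 4 by (simp add: algebra_simps)
    then show ?thesis by (simp add: \<eta>_def E_def)
  qed
  with \<open>C > 0\<close> show ?thesis unfolding absorption_constant_def by blast
qed

section \<open>The Caccioppoli inequality\<close>

lemma norm_outer_product: "norm (\<chi> i j. (x :: real^'N) $ i * (y :: real^'n) $ j) \<le> norm x * norm y"
proof -
  have "(norm (\<chi> i j. x $ i * y $ j))\<^sup>2 = (norm x * norm y)\<^sup>2"
    unfolding power_mult_distrib power2_norm_eq_inner inner_matrix
    by (simp add: inner_vec_def sum_product algebra_simps)
  then show ?thesis by (simp add: power2_eq_iff_nonneg)
qed

lemma integrable_indicator_mult:
  assumes "S \<in> sets M" "integrable M f"
  shows "integrable M (\<lambda>z. indicator S z * (f z :: real))"
  using integrable_mult_indicator[OF assms] by simp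

context finite_energy_solution
begin

definition Gw where "Gw z = shift_flux p q (a z) \<sigma> (w z) * w z"
definition GV where "GV z = shift_flux p q (a z) \<sigma> (norm (V z)) * norm (V z)"

lemma Gw_nonneg: "z \<in> Q \<Longrightarrow> 0 \<le> Gw z"
  unfolding Gw_def using double_phase.shift_flux_nonneg[OF dp w_nonneg] w_nonneg by simp

lemma dphase_shift_eq: "dphase_shift p q a \<sigma> z s = (LINT r:{0..s}|lebesgue. shift_flux p q (a z) \<sigma> r)"
  unfolding dphase_shift_def set_lebesgue_integral_def
  by (rule Bochner_Integration.integral_cong)
    (auto simp: indicator_def shift_flux_def dphase'_dflux add_pos_nonneg)

text \<open>The right-hand side of the inequality, up to a constant: \<open>Y\<close> stands for the maximum of the powers
  of \<open>C\<^sub>1\<close> times \<open>H(z\<^sup>+, \<sigma>)\<close>.\<close>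

definition energy_rhs where
  "energy_rhs \<rho> C Y = 4 / \<rho> * (LINT z|lebesgue. indicator Q z * (norm (v z))\<^sup>2)
    + C * ((LINT z|lebesgue. indicator Q z * Gw z) + measure lebesgue Q * Y)"

text \<open>The pointwise absorption, integrated. The energy identity turns the product of flux and gradient
  of the test function into the time derivative of the cut-off function times \<open>|v|\<^sup>2\<close>: its
  increasing part contributes to the right-hand side, its decreasing part the integral over \<open>E\<close> on
  the left.\<close>

lemma energy_estimate:
  fixes \<nu> C r1 r2 \<rho>1 \<rho>2 t0 \<tau> h a1 :: real
  assumes Qc: "Q = cylinder r2 \<rho>2 (x0, t0)" and dr: "d = r2 - r1" and r: "0 < r1" "r1 < r2" "r2 \<le> 1"
    and \<rho>: "0 < \<rho>1" "\<rho>1 < \<rho>2" "\<rho>2 \<le> 1" and \<nu>: "0 < \<nu>" and A2: "condA2 p q \<nu> (\<Omega> \<times> {0<..<T}) a A" and \<beta>1: "\<beta> \<le> 1"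
    and a1: "\<And>z. z \<in> Q \<Longrightarrow> a z \<le> a1"
    and h: "0 < h" and \<tau>: "t0 - \<rho>1 \<le> \<tau>" "\<tau> + h \<le> t0 + (\<rho>1 + \<rho>2) / 2"
    and x: "x = (r2 + sqrt \<rho>2) powr \<beta> + (r2 + sqrt \<rho>2) powr \<alpha> * \<sigma> powr (q - p)"
    and C: "absorption_constant TYPE(real^'n^'N) p q k (\<nu> * (p - 1) * 6 powr (1 - q) / 4)
      (6 * L) (2 * L + 4 * q * L\<^sup>2 + 2 * L\<^sup>2) (16 * real k) C"
  defines "c0 \<equiv> \<nu> * (p - 1) * 6 powr (1 - q) / 4"
    and "E \<equiv> cball x0 r1 \<times> {\<tau> + h / 4..\<tau> + 3 * h / 4}"
    and "S \<equiv> cball x0 r1 \<times> {t0 - \<rho>1..\<tau>}"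
    and "R \<equiv> energy_rhs (\<rho>2 - \<rho>1) C (young_max p q x * (\<sigma> powr p + a1 * \<sigma> powr q))"
  shows "(\<integral>\<^sup>+z. ennreal (indicator S z * (c0 / 2 * GV z)) \<partial>lebesgue)
      + ennreal (1 / (8 * h) * (LINT z|lebesgue. indicator E z * (norm (v z))\<^sup>2)) \<le> ennreal R"
    and "integrable lebesgue (\<lambda>z. indicator E z * (norm (v z))\<^sup>2)"
proof -
  define z0 where "z0 = (x0, t0)"
  define Y where "Y = young_max p q x * (\<sigma> powr p + a1 * \<sigma> powr q)"
  have Qm: "z \<in> Q \<longleftrightarrow> norm (fst z - x0) < r2 \<and> snd z - t0 < \<rho>2 \<and> t0 - snd z < \<rho>2" for z
    by (cases z) (auto simp: Qc cylinder_def dist_norm norm_minus_commute)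
  note C0 = C[unfolded absorption_constant_def, THEN conjunct1]
    and C' = C[unfolded absorption_constant_def, THEN conjunct2, rule_format]
  have mid: "(r1 + r2) / 2 < r2" "(\<rho>1 + \<rho>2) / 2 < \<rho>2" using r \<rho> by simp_all
  have z0: "z0 \<in> Q" using r \<rho> by (simp add: Qm z0_def)
  have c0: "0 < c0" using \<nu> pq by (simp add: c0_def)
  have x_pos: "0 < x"
  proof -
    have "0 < r2 + sqrt \<rho>2" using r \<rho> by (intro add_pos_pos) auto
    then have "0 < (r2 + sqrt \<rho>2) powr \<beta>" by simp
    moreover have "0 \<le> (r2 + sqrt \<rho>2) powr \<alpha> * \<sigma> powr (q - p)" by simp
    ultimately show ?thesis unfolding x by linarith
  qed
  have ym: "0 \<le> young_max p q x" by (rule young_max_nonneg)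
  let ?K = "cball x0 ((r1 + r2) / 2) \<times> {t0 - (\<rho>1 + \<rho>2) / 2..t0 + (\<rho>1 + \<rho>2) / 2}"
  obtain \<eta> \<theta> \<psi> where \<eta>C: "Ck (Suc 0) \<eta>" and \<eta>0: "\<And>z. z \<notin> ?K \<Longrightarrow> \<eta> z = 0"
    and \<eta>: "\<And>z. \<eta> z = \<theta> (fst z) ^ k * \<psi> (snd z)"
    and \<theta>: "\<And>x. 0 \<le> \<theta> x \<and> \<theta> x \<le> 1" and \<psi>: "\<And>t. 0 \<le> \<psi> t \<and> \<psi> t \<le> (1::real)"
    and grad: "\<And>z. norm (\<chi> j. pd \<eta> (xdir j) z) \<le> 16 * real k / (r2 - r1) * (\<theta> (fst z) ^ (k - 1) * \<psi> (snd z))"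
    and dt: "\<And>z. pd \<eta> tdir z \<le> 8 / (\<rho>2 - \<rho>1) - 1 / (4 * h) * indicator E z"
    and \<eta>1: "\<And>z. z \<in> S \<Longrightarrow> \<eta> z = 1"
    by (rule parabolic_cutoff[OF r(1,2) \<rho>(1,2) h \<tau> k(1), of x0, folded E_def S_def]) (rule that; assumption)
  have K: "compact ?K" "?K \<subseteq> Q"
  proof -
    show "compact ?K" by (intro compact_Times compact_cball compact_Icc)
    show "?K \<subseteq> Q"
    proof
      fix z assume "z \<in> ?K"
      then have "norm (fst z - x0) \<le> (r1 + r2) / 2" "t0 - (\<rho>1 + \<rho>2) / 2 \<le> snd z" "snd z \<le> t0 + (\<rho>1 + \<rho>2) / 2"
        by (auto simp: mem_Times_iff dist_norm norm_minus_commute)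
      then show "z \<in> Q" unfolding Qm using mid r \<rho> h \<tau> by (intro conjI; linarith)
    qed
  qed
  have EQ: "E \<subseteq> Q"
    proof
      fix z assume "z \<in> E"
      then have "norm (fst z - x0) \<le> r1" "\<tau> + h / 4 \<le> snd z" "snd z \<le> \<tau> + 3 * h / 4"
        by (auto simp: E_def mem_Times_iff dist_norm norm_minus_commute)
      then show "z \<in> Q" unfolding Qm using mid r \<rho> h \<tau> by (intro conjI; linarith)
    qed
  have SQ: "S \<subseteq> Q"
    proof
      fix z assume "z \<in> S"
      then have "norm (fst z - x0) \<le> r1" "t0 - \<rho>1 \<le> snd z" "snd z \<le> \<tau>"
        by (auto simp: S_def mem_Times_iff dist_norm norm_minus_commute)
      then show "z \<in> Q" unfolding Qm using mid r \<rho> h \<tau> by (intro conjI; linarith)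
    qed
  define M where "M z = (\<chi> i j. v z $ i * pd \<eta> (xdir j) z)" for z
  \<comment> \<open>The constant subtracted from the flux is its value at the centre \<open>z0\<close> and the gradient \<open>P\<close>.\<close>
  define X1 where "X1 z = (A z (Du z) - A z0 P) \<bullet> (\<eta> z *\<^sub>R V z + M z)" for z
  have id: "(1/2) * (LINT z|lebesgue. pd \<eta> tdir z * (indicator Q z * (norm (v z))\<^sup>2)) = (LINT z|lebesgue. indicator Q z * X1 z)"
    and iX1: "integrable lebesgue (\<lambda>z. indicator Q z * X1 z)"
    and idt: "integrable lebesgue (\<lambda>z. pd \<eta> tdir z * (indicator Q z * (norm (v z))\<^sup>2))"
    unfolding X1_def M_def by (rule solution_energy_identity[OF K \<eta>C \<eta>0]; assumption)+
  have pointwise: "c0 / 2 * (\<eta> z * GV z) \<le> X1 z + C * (Gw z + Y)" if z: "z \<in> Q" for z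
  proof -
    interpret double_phase p q "a z" \<sigma> k by (rule dp[OF z])
    have zT: "z \<in> \<Omega> \<times> {0<..<T}" "z0 \<in> \<Omega> \<times> {0<..<T}" using QT z z0 by blast+
    have az: "0 \<le> a z" "a z \<le> a1" using a[OF zT(1)] a1[OF z] by auto
    have Du: "Du z = P + V z" by (simp add: V_def)
    have s1: "0 < 1 + norm \<xi>" for \<xi> :: "real^'n^'N" by (simp add: add_pos_nonneg)
    have diff: "A z differentiable (at \<xi>)" for \<xi> using A1 zT unfolding condA1_def by blast
    have A1': "norm (A z \<xi>) + (1 + norm \<xi>) * onorm (frechet_derivative (A z) (at \<xi>)) \<le> L * H' (1 + norm \<xi>)" for \<xi>
    proof -
      have "norm (A z \<xi>) + (1 + norm \<xi>) * onorm (frechet_derivative (A z) (at \<xi>)) \<le> L * dphase' p q a z (1 + norm \<xi>)"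
        using A1 zT unfolding condA1_def by blast
      then show ?thesis by (simp only: dphase'_dflux[OF s1])
    qed
    have A2': "frechet_derivative (A z) (at \<xi>) \<zeta> \<bullet> \<zeta> \<ge>
      \<nu> * (p * (p - 1) * (1 + norm \<xi>) powr (p - 2) + a z * q * (q - 1) * (1 + norm \<xi>) powr (q - 2)) * (norm \<zeta>)\<^sup>2" for \<xi> \<zeta>
    proof -
      have "frechet_derivative (A z) (at \<xi>) \<zeta> \<bullet> \<zeta> \<ge> \<nu> * dphase'' p q a z (1 + norm \<xi>) * (norm \<zeta>)\<^sup>2"
        using A2 zT unfolding condA2_def by blast
      then show ?thesis by (simp only: dphase''_eq[OF s1])
    qed
    have ell: "c0 * (G (norm (V z)) * norm (V z)) \<le> (A z (Du z) - A z P) \<bullet> V z"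
      unfolding Du c0_def by (rule monotonicity_shift_flux[OF diff _ A2' refl]) (use \<nu> in simp)
    have gr: "norm (A z (Du z) - A z P) \<le> 6 * L * G (norm (V z))"
      unfolding Du by (rule growth_shift_flux[OF diff L A1' refl])
    define Rr where "Rr = r2 + sqrt \<rho>2"
    have "sqrt \<rho>2 \<le> 1" "0 < sqrt \<rho>2" using \<rho> by simp_all
    then have Rr: "0 < Rr" "Rr \<le> 2" "r2 \<le> Rr" "sqrt \<rho>2 \<le> Rr" using r unfolding Rr_def by linarith+
    have zz: "norm (fst z - fst z0) \<le> r2" "\<bar>snd z - snd z0\<bar> \<le> \<rho>2" using z by (auto simp: Qm z0_def)
    have B2: "norm (A z P - A z0 P) \<le> (2 * L + 4 * q * L\<^sup>2 + 2 * L\<^sup>2) * x * H' \<sigma>"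
      unfolding x Rr_def[symmetric]
    proof (rule frozen_coefficient_error[where d="a z0"])
      show "\<bar>a z - a z0\<bar> \<le> L * (2 * Rr powr \<alpha>)"
      proof -
        have "norm (fst z - fst z0) powr \<alpha> \<le> Rr powr \<alpha>" using zz Rr \<alpha> by (intro powr_mono2) auto
        moreover have "\<bar>snd z - snd z0\<bar> powr (\<alpha> / 2) \<le> Rr powr \<alpha>"
        proof -
          have "\<bar>snd z - snd z0\<bar> powr (\<alpha> / 2) \<le> \<rho>2 powr (\<alpha> / 2)" using zz \<alpha> by (intro powr_mono2) auto
          also have "\<dots> = sqrt \<rho>2 powr \<alpha>" using \<rho> by (simp add: powr_powr flip: powr_half_sqrt)
          also have "\<dots> \<le> Rr powr \<alpha>" using Rr \<alpha> \<rho> by (intro powr_mono2) auto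
          finally show ?thesis .
        qed
        ultimately have "norm (fst z - fst z0) powr \<alpha> + \<bar>snd z - snd z0\<bar> powr (\<alpha> / 2) \<le> 2 * Rr powr \<alpha>" by linarith
        then show ?thesis using hol[OF zT] L by (meson mult_left_mono order_trans)
      qed
      have "norm (A z P - A z0 P) \<le> L * (norm (fst z - fst z0) + sqrt \<bar>snd z - snd z0\<bar>) powr \<beta>
        * (dphase' p q a z \<sigma> + dphase' p q a z0 \<sigma>) + L * \<bar>a z - a z0\<bar> * \<sigma> powr (q - 1)"
        using A3 zT unfolding condA3_def case_prod_beta prod.collapse by blast
      also have "\<dots> \<le> L * Rr powr \<beta> * (dphase' p q a z \<sigma> + dphase' p q a z0 \<sigma>) + L * \<bar>a z - a z0\<bar> * \<sigma> powr (q - 1)"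
      proof (intro add_right_mono mult_right_mono mult_left_mono L)
        have "sqrt \<bar>snd z - snd z0\<bar> \<le> sqrt \<rho>2" using zz by simp
        then have "norm (fst z - fst z0) + sqrt \<bar>snd z - snd z0\<bar> \<le> Rr" using zz unfolding Rr_def by linarith
        then show "(norm (fst z - fst z0) + sqrt \<bar>snd z - snd z0\<bar>) powr \<beta> \<le> Rr powr \<beta>"
          using \<beta> by (intro powr_mono2) auto
        show "0 \<le> dphase' p q a z \<sigma> + dphase' p q a z0 \<sigma>"
          using double_phase.dflux_nonneg[OF dp[OF z], of \<sigma>] double_phase.dflux_nonneg[OF dp[OF z0], of \<sigma>]
          by (simp add: dphase'_dflux[OF s1])
      qed
      also have "\<dots> = L * Rr powr \<beta> * (H' \<sigma> + dflux p q (a z0) \<sigma>) + L * \<bar>a z - a z0\<bar> * \<sigma> powr (q - 1)"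
        by (simp add: dphase'_dflux[OF s1])
      finally show "norm (A z P - A z0 P) \<le> L * Rr powr \<beta> * (H' \<sigma> + dflux p q (a z0) \<sigma>) + L * \<bar>a z - a z0\<bar> * \<sigma> powr (q - 1)" .
    qed (use p pq L az a[OF zT(2)] Rr \<beta> \<beta>1 in auto)
    have M: "norm (M z) \<le> 16 * real k * (\<theta> (fst z) ^ (k - 1) * \<psi> (snd z)) * w z"
    proof -
      have "norm (M z) \<le> norm (v z) * norm (\<chi> j. pd \<eta> (xdir j) z)"
        using norm_outer_product[of "v z" "\<chi> j. pd \<eta> (xdir j) z"] by (simp add: M_def)
      also have "\<dots> \<le> norm (v z) * (16 * real k / (r2 - r1) * (\<theta> (fst z) ^ (k - 1) * \<psi> (snd z)))"
        by (rule mult_left_mono[OF grad]) simp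
      finally show ?thesis unfolding w_def dr[symmetric] by (simp add: algebra_simps)
    qed
    have "c0 / 2 * (\<theta> (fst z) ^ k * \<psi> (snd z) * (G (norm (V z)) * norm (V z))) \<le>
        ((A z (Du z) - A z P) + (A z P - A z0 P)) \<bullet> ((\<theta> (fst z) ^ k * \<psi> (snd z)) *\<^sub>R V z + M z)
        + C * (G (w z) * w z + young_max p q x * (\<sigma> powr p + a z * \<sigma> powr q))"
      unfolding c0_def
      by (rule C'[OF az(1) s1 x_pos _ _ _ _ w_nonneg ell[unfolded c0_def] gr B2 M]) (use \<theta> \<psi> in auto)
    then have "c0 / 2 * (\<eta> z * GV z) \<le> X1 z + C * (Gw z + young_max p q x * (\<sigma> powr p + a z * \<sigma> powr q))"
      by (simp add: GV_def Gw_def X1_def \<eta>)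
    also have "\<dots> \<le> X1 z + C * (Gw z + Y)"
      unfolding Y_def using az ym C0 by (intro add_left_mono mult_left_mono mult_right_mono) auto
    finally show ?thesis .
  qed
  \<comment> \<open>An integrable function that dominates the energy of \<open>V\<close> on \<open>S\<close> and is nonnegative, so that the
    energy of \<open>V\<close> is seen to be integrable.\<close>
  define X where "X z = indicator Q z * X1 z + C * (indicator Q z * Gw z) + C * (indicator Q z * Y)" for z
  have iGw: "integrable lebesgue (\<lambda>z. indicator Q z * Gw z)" unfolding Gw_def by (rule w2)
  have iX: "integrable lebesgue X" unfolding X_def[abs_def]
    by (intro Bochner_Integration.integrable_add integrable_mult_right iX1 iGw int_Q_const)
  have GV0: "0 \<le> GV z" if "z \<in> Q" for z
    unfolding GV_def using double_phase.shift_flux_nonneg[OF dp[OF that]] by simp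
  have \<eta>nn: "0 \<le> \<eta> z" for z unfolding \<eta> using \<theta> \<psi> by simp
  have XQ: "X z = X1 z + C * (Gw z + Y)" if "z \<in> Q" for z using that by (simp add: X_def algebra_simps)
  have X0: "0 \<le> X z" for z
  proof (cases "z \<in> Q")
    case True
    have "0 \<le> c0 / 2 * (\<eta> z * GV z)" using c0 \<eta>nn GV0[OF True] by simp
    then show ?thesis using pointwise[OF True] XQ[OF True] by linarith
  qed (simp add: X_def)
  have SX: "indicator S z * (c0 / 2 * GV z) \<le> X z" for z
  proof (cases "z \<in> S")
    case True
    then have "z \<in> Q" using SQ by blast
    then show ?thesis using pointwise[of z] XQ[of z] True \<eta>1[OF True] by simp
  qed (simp add: X0)
  have E_sets: "E \<in> sets lebesgue"
  proof -
    have "closed E" unfolding E_def by (intro closed_Times closed_cball closed_atLeastAtMost)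
    then show ?thesis by (simp add: borel_closed)
  qed
  have iE': "integrable lebesgue (\<lambda>z. indicator E z * (indicator Q z * (norm (v z))\<^sup>2))"
    by (rule integrable_indicator_mult[OF E_sets v2])
  have EE: "indicator E z * (indicator Q z * (norm (v z))\<^sup>2) = indicator E z * (norm (v z))\<^sup>2" for z
    using EQ by (auto simp: indicator_def)
  show iE: "integrable lebesgue (\<lambda>z. indicator E z * (norm (v z))\<^sup>2)" using iE' unfolding EE .
  define IE where "IE = (LINT z|lebesgue. indicator E z * (norm (v z))\<^sup>2)"
  define Iv where "Iv = (LINT z|lebesgue. indicator Q z * (norm (v z))\<^sup>2)"
  have "(LINT z|lebesgue. pd \<eta> tdir z * (indicator Q z * (norm (v z))\<^sup>2))
      \<le> (LINT z|lebesgue. 8 / (\<rho>2 - \<rho>1) * (indicator Q z * (norm (v z))\<^sup>2) - 1 / (4 * h) * (indicator E z * (norm (v z))\<^sup>2))"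
  proof (rule integral_mono[OF idt])
    show "integrable lebesgue (\<lambda>z. 8 / (\<rho>2 - \<rho>1) * (indicator Q z * (norm (v z))\<^sup>2) - 1 / (4 * h) * (indicator E z * (norm (v z))\<^sup>2))"
      by (intro Bochner_Integration.integrable_diff integrable_mult_right v2 iE)
    show "pd \<eta> tdir z * (indicator Q z * (norm (v z))\<^sup>2)
        \<le> 8 / (\<rho>2 - \<rho>1) * (indicator Q z * (norm (v z))\<^sup>2) - 1 / (4 * h) * (indicator E z * (norm (v z))\<^sup>2)" for z
      using mult_right_mono[OF dt[of z], of "indicator Q z * (norm (v z))\<^sup>2"]
      by (simp only: left_diff_distrib mult.assoc EE) simp
  qed
  also have "\<dots> = 8 / (\<rho>2 - \<rho>1) * Iv - 1 / (4 * h) * IE"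
    unfolding IE_def Iv_def
    by (simp only: Bochner_Integration.integral_diff[OF integrable_mult_right[OF v2] integrable_mult_right[OF iE]]
        integral_mult_right_zero)
  finally have dtI: "(LINT z|lebesgue. pd \<eta> tdir z * (indicator Q z * (norm (v z))\<^sup>2)) \<le> 8 / (\<rho>2 - \<rho>1) * Iv - 1 / (4 * h) * IE" .
  have "(LINT z|lebesgue. X z) = (LINT z|lebesgue. indicator Q z * X1 z) + C * (LINT z|lebesgue. indicator Q z * Gw z) + C * (LINT z|lebesgue. indicator Q z * Y)"
    unfolding X_def[abs_def] using iX1 iGw int_Q_const[of Y] by simp
  also have "(LINT z|lebesgue. indicator Q z * Y) = measure lebesgue Q * Y"
    using int_Q by simp
  finally have IX: "(LINT z|lebesgue. X z) + 1 / (8 * h) * IE \<le> R"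
    using dtI unfolding id[symmetric] R_def energy_rhs_def Y_def[symmetric] Iv_def[symmetric]
    by (simp add: algebra_simps)
  have IE0: "0 \<le> IE" unfolding IE_def by (intro integral_nonneg_AE AE_I2) simp
  have "(\<integral>\<^sup>+z. ennreal (indicator S z * (c0 / 2 * GV z)) \<partial>lebesgue) \<le> (\<integral>\<^sup>+z. ennreal (X z) \<partial>lebesgue)"
    by (intro nn_integral_mono ennreal_leI SX)
  also have "\<dots> = ennreal (LINT z|lebesgue. X z)"
    by (rule nn_integral_eq_integral[OF iX]) (simp add: X0)
  finally have "(\<integral>\<^sup>+z. ennreal (indicator S z * (c0 / 2 * GV z)) \<partial>lebesgue) + ennreal (1 / (8 * h) * IE)
      \<le> ennreal (LINT z|lebesgue. X z) + ennreal (1 / (8 * h) * IE)" by (rule add_right_mono)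
  also have "\<dots> = ennreal ((LINT z|lebesgue. X z) + 1 / (8 * h) * IE)"
    using X0 IE0 h by (intro ennreal_plus[symmetric] integral_nonneg_AE AE_I2) auto
  also have "\<dots> \<le> ennreal R" by (rule ennreal_leI[OF IX])
  finally show "(\<integral>\<^sup>+z. ennreal (indicator S z * (c0 / 2 * GV z)) \<partial>lebesgue)
      + ennreal (1 / (8 * h) * (LINT z|lebesgue. indicator E z * (norm (v z))\<^sup>2)) \<le> ennreal R"
    unfolding IE_def .
qed

end

context cylinder_solution
begin

lemma coefficient_measurable: "(\<lambda>z. indicator Q z * a z) \<in> borel_measurable lebesgue"
proof -
  have "continuous_on Q a"
    unfolding continuous_on_def
  proof
    fix z0 assume z0: "z0 \<in> Q"
    define g where "g z = L * (norm (fst z - fst z0) powr \<alpha> + \<bar>snd z - snd z0\<bar> powr (\<alpha> / 2))" for z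
    have pw: "((\<lambda>y. h y powr m) \<longlongrightarrow> 0) (at z0 within Q)"
      if "(h \<longlongrightarrow> 0) (at z0 within Q)" "\<And>y. 0 \<le> h y" "0 < m" for h and m :: real
      using tendsto_powr'[OF that(1) tendsto_const, of m] that by simp
    have "((\<lambda>z. norm (fst z - fst z0)) \<longlongrightarrow> norm (fst z0 - fst z0)) (at z0 within Q)"
      "((\<lambda>z. \<bar>snd z - snd z0\<bar>) \<longlongrightarrow> \<bar>snd z0 - snd z0\<bar>) (at z0 within Q)"
      by (intro tendsto_intros)+
    then have "((\<lambda>z. norm (fst z - fst z0) powr \<alpha>) \<longlongrightarrow> 0) (at z0 within Q)"
      "((\<lambda>z. \<bar>snd z - snd z0\<bar> powr (\<alpha> / 2)) \<longlongrightarrow> 0) (at z0 within Q)"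
      using \<alpha> by (auto intro!: pw)
    from tendsto_mult_left[OF tendsto_add[OF this], of L]
    have "(g \<longlongrightarrow> 0) (at z0 within Q)" by (simp add: g_def[abs_def])
    moreover have "\<forall>\<^sub>F z in at z0 within Q. norm (a z - a z0) \<le> g z"
    proof -
      have "norm (a z - a z0) \<le> g z" if "z \<in> Q" for z
        using hol[OF QT[OF that] QT[OF z0]] unfolding g_def real_norm_def .
      then show ?thesis unfolding eventually_at_filter by (intro always_eventually) blast
    qed
    ultimately show "(a \<longlongrightarrow> a z0) (at z0 within Q)"
      by (rule LIM_zero_cancel[OF Lim_null_comparison, rotated])
  qed
  then have "(\<lambda>z. indicator Q z *\<^sub>R a z) \<in> borel_measurable borel"
    using Q(1) by (intro borel_measurable_continuous_on_indicator) auto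
  then show ?thesis by (intro measurable_completion) simp
qed

lemma shift_flux_measurable:
  assumes g: "(\<lambda>z. indicator Q z * g z) \<in> borel_measurable lebesgue"
  shows "(\<lambda>z. indicator Q z * (shift_flux p q (a z) \<sigma> (g z) * g z)) \<in> borel_measurable lebesgue"
proof -
  let ?a = "\<lambda>z. indicator Q z * a z" and ?g = "\<lambda>z. indicator Q z * g z"
  have "(\<lambda>z. indicator Q z * (shift_flux p q (?a z) \<sigma> (?g z) * ?g z)) \<in> borel_measurable lebesgue"
    unfolding shift_flux_def dflux_def
    by (intro borel_measurable_times borel_measurable_divide borel_measurable_add powr_real_measurable
        borel_measurable_const borel_measurable_indicator Q_sets coefficient_measurable g)
  moreover have "indicator Q z * (shift_flux p q (?a z) \<sigma> (?g z) * ?g z) = indicator Q z * (shift_flux p q (a z) \<sigma> (g z) * g z)" for z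
    by (cases "z \<in> Q") simp_all
  ultimately show ?thesis by simp
qed

lemma norm_measurable:
  assumes "(\<lambda>z. indicator Q z *\<^sub>R f z) \<in> borel_measurable lebesgue"
  shows "(\<lambda>z. indicator Q z * norm (f z :: 'c::euclidean_space)) \<in> borel_measurable lebesgue"
proof -
  have "(\<lambda>z. norm (indicator Q z *\<^sub>R f z)) \<in> borel_measurable lebesgue"
    using assms by measurable
  then show ?thesis by simp
qed

lemma v_sq_measurable: "(\<lambda>z. indicator Q z * (norm (v z))\<^sup>2) \<in> borel_measurable lebesgue"
proof -
  have "(\<lambda>z. (indicator Q z * norm (v z))\<^sup>2) \<in> borel_measurable lebesgue"
    by (rule borel_measurable_power[OF norm_measurable[OF v_meas]])
  moreover have "(indicator Q z * norm (v z))\<^sup>2 = indicator Q z * (norm (v z))\<^sup>2" for z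
    by (cases "z \<in> Q") simp_all
  ultimately show ?thesis by simp
qed

lemma w_measurable: "(\<lambda>z. indicator Q z * w z) \<in> borel_measurable lebesgue"
  using borel_measurable_divide[OF norm_measurable[OF v_meas] borel_measurable_const[of d]]
  by (simp add: w_def)

text \<open>The square integrals of two slices are comparable up to the distance of the slices in \<open>L\<^sup>2\<close>, in
  which the affine map cancels.\<close>

lemma slice_integrals:
  assumes K: "compact K" "K \<subseteq> \<Omega>" and t: "t \<in> {0<..<T}"
  shows "integrable lebesgue (\<lambda>x. indicator K x * (norm (v (x, t)))\<^sup>2)"
    and "s \<in> {0<..<T} \<Longrightarrow> (LINT x|lebesgue. indicator K x * (norm (v (x, t)))\<^sup>2)
      \<le> 2 * (LINT x|lebesgue. indicator K x * (norm (v (x, s)))\<^sup>2) + 2 * (LINT x:K|lebesgue. (norm (u (x, s) - u (x, t)))\<^sup>2)"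
proof -
  have Ks: "K \<in> sets lebesgue" using compact_imp_closed[OF K(1)] by (simp add: borel_closed)
  have sq2: "norm (a + b)^2 \<le> 2 * (norm a)^2 + 2 * (norm b)^2" for a b :: "real^'N"
  proof -
    have "norm (a + b)^2 \<le> (norm a + norm b)^2" by (intro power_mono norm_triangle_ineq) auto
    also have "\<dots> \<le> 2 * (norm a)^2 + 2 * (norm b)^2"
      using zero_le_power2[of "norm a - norm b"] by (simp add: power2_eq_square algebra_simps)
    finally show ?thesis .
  qed
  let ?l = "\<lambda>x. P *v (x - x0) + b"
  have cl: "continuous_on UNIV ?l"
    by (intro continuous_intros continuous_on_compose2[OF matrix_vector_mult_linear_continuous_on[of UNIV P]]) auto
  have lm: "(\<lambda>x. indicator K x *\<^sub>R ?l x) \<in> borel_measurable lebesgue"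
    by (intro borel_measurable_scaleR borel_measurable_indicator Ks measurable_completion)
      (simp add: borel_measurable_continuous_onI[OF cl])
  have li: "integrable lebesgue (\<lambda>x. indicator K x * (norm (?l x))\<^sup>2)"
  proof -
    have "integrable lborel (\<lambda>x. indicator K x *\<^sub>R (norm (?l x))\<^sup>2)"
      by (rule borel_integrable_compact[OF K(1)]) (intro continuous_intros continuous_on_subset[OF cl], auto)
    then show ?thesis
      using integrable_completion[OF borel_measurable_integrable[of lborel "\<lambda>x. indicator K x *\<^sub>R (norm (?l x))\<^sup>2"]] by simp
  qed
  have um: "(\<lambda>x. indicator K x *\<^sub>R u (x, t)) \<in> borel_measurable lebesgue"
    and ui: "integrable lebesgue (\<lambda>x. indicator K x * (norm (u (x, t)))\<^sup>2)" if t: "t \<in> {0<..<T}" for t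
  proof -
    have lp: "Lp_loc \<Omega> 2 (\<lambda>x. u (x, t))" using sol t by (simp add: weak_solution_def C_loc_L2_loc_def)
    have "(\<lambda>x. indicator K x *\<^sub>R (indicator \<Omega> x *\<^sub>R u (x, t))) \<in> borel_measurable lebesgue"
      using lp unfolding Lp_loc_def set_borel_measurable_def
      by (intro borel_measurable_scaleR[OF borel_measurable_indicator[OF Ks]]) blast
    moreover have "(\<lambda>x. indicator K x *\<^sub>R (indicator \<Omega> x *\<^sub>R u (x, t))) = (\<lambda>x. indicator K x *\<^sub>R u (x, t))"
      using K(2) by (intro ext) (auto simp: indicator_def)
    ultimately show "(\<lambda>x. indicator K x *\<^sub>R u (x, t)) \<in> borel_measurable lebesgue" by (simp only:)
    have "set_integrable lebesgue K (\<lambda>x. norm (u (x, t)) powr 2)" using lp K by (simp add: Lp_loc_def)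
    then show "integrable lebesgue (\<lambda>x. indicator K x * (norm (u (x, t)))\<^sup>2)" by (simp add: set_integrable_def)
  qed
  have sqm: "(\<lambda>x. indicator K x * (norm (f x))\<^sup>2) \<in> borel_measurable lebesgue"
    if "(\<lambda>x. indicator K x *\<^sub>R f x) \<in> borel_measurable lebesgue" for f :: "real^'n \<Rightarrow> real^'N"
  proof -
    have "(\<lambda>x. (norm (indicator K x *\<^sub>R f x))\<^sup>2) \<in> borel_measurable lebesgue"
      using that by measurable
    moreover have "(norm (indicator K x *\<^sub>R f x))\<^sup>2 = indicator K x * (norm (f x))\<^sup>2" for x by (simp add: indicator_def)
    ultimately show ?thesis by simp
  qed
  have bound: "integrable lebesgue (\<lambda>x. indicator K x * (norm (f x))\<^sup>2)"
    if "(\<lambda>x. indicator K x *\<^sub>R f x) \<in> borel_measurable lebesgue" "f = (\<lambda>x. g x + h x)"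
      "integrable lebesgue (\<lambda>x. indicator K x * (norm (g x))\<^sup>2)" "integrable lebesgue (\<lambda>x. indicator K x * (norm (h x))\<^sup>2)"
    for f g h :: "real^'n \<Rightarrow> real^'N"
  proof (rule Bochner_Integration.integrable_bound[OF _ sqm[OF that(1)]])
    show "integrable lebesgue (\<lambda>x. 2 * (indicator K x * (norm (g x))\<^sup>2) + 2 * (indicator K x * (norm (h x))\<^sup>2))"
      by (intro Bochner_Integration.integrable_add integrable_mult_right that)
    show "AE x in lebesgue. norm (indicator K x * (norm (f x))\<^sup>2) \<le> norm (2 * (indicator K x * (norm (g x))\<^sup>2) + 2 * (indicator K x * (norm (h x))\<^sup>2))"
      by (rule AE_I2) (use sq2 in \<open>simp add: indicator_def that(2)\<close>)
  qed
  have vi: "integrable lebesgue (\<lambda>x. indicator K x * (norm (v (x, t)))\<^sup>2)" if t: "t \<in> {0<..<T}" for t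
  proof (rule bound[of "\<lambda>x. v (x, t)" "\<lambda>x. u (x, t)" "\<lambda>x. - ?l x"])
    show "(\<lambda>x. indicator K x *\<^sub>R v (x, t)) \<in> borel_measurable lebesgue"
      using borel_measurable_diff[OF um[OF t] lm] by (simp add: v_def scaleR_diff_right)
    show "(\<lambda>x. v (x, t)) = (\<lambda>x. u (x, t) + - ?l x)" by (simp add: v_def fun_eq_iff)
    show "integrable lebesgue (\<lambda>x. indicator K x * (norm (- ?l x))\<^sup>2)" using li by (simp only: norm_minus_cancel)
  qed (rule ui[OF t])
  show "integrable lebesgue (\<lambda>x. indicator K x * (norm (v (x, t)))\<^sup>2)" by (rule vi[OF t])
  assume s: "s \<in> {0<..<T}"
  have di: "integrable lebesgue (\<lambda>x. indicator K x * (norm (u (x, s) - u (x, t)))\<^sup>2)"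
  proof (rule bound[of "\<lambda>x. u (x, s) - u (x, t)" "\<lambda>x. u (x, s)" "\<lambda>x. - u (x, t)"])
    show "(\<lambda>x. indicator K x *\<^sub>R (u (x, s) - u (x, t))) \<in> borel_measurable lebesgue"
      using borel_measurable_diff[OF um[OF s] um[OF t]] by (simp add: scaleR_diff_right)
    show "integrable lebesgue (\<lambda>x. indicator K x * (norm (- u (x, t)))\<^sup>2)" using ui[OF t] by (simp only: norm_minus_cancel)
  qed (use ui[OF s] in auto)
  have "(LINT x|lebesgue. indicator K x * (norm (v (x, t)))\<^sup>2)
      \<le> (LINT x|lebesgue. 2 * (indicator K x * (norm (v (x, s)))\<^sup>2) + 2 * (indicator K x * (norm (u (x, s) - u (x, t)))\<^sup>2))"
  proof (rule integral_mono[OF vi[OF t]])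
    show "integrable lebesgue (\<lambda>x. 2 * (indicator K x * (norm (v (x, s)))\<^sup>2) + 2 * (indicator K x * (norm (u (x, s) - u (x, t)))\<^sup>2))"
      by (intro Bochner_Integration.integrable_add integrable_mult_right vi[OF s] di)
    show "indicator K x * (norm (v (x, t)))\<^sup>2 \<le> 2 * (indicator K x * (norm (v (x, s)))\<^sup>2) + 2 * (indicator K x * (norm (u (x, s) - u (x, t)))\<^sup>2)" for x
    proof -
      have "v (x, t) = v (x, s) + - (u (x, s) - u (x, t))" by (simp add: v_def)
      then have "(norm (v (x, t)))\<^sup>2 \<le> 2 * (norm (v (x, s)))\<^sup>2 + 2 * (norm (u (x, s) - u (x, t)))\<^sup>2"
        using sq2[of "v (x, s)" "- (u (x, s) - u (x, t))"] unfolding norm_minus_cancel by metis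
      then show ?thesis by (simp add: indicator_def)
    qed
  qed
  also have "\<dots> = 2 * (LINT x|lebesgue. indicator K x * (norm (v (x, s)))\<^sup>2) + 2 * (LINT x|lebesgue. indicator K x * (norm (u (x, s) - u (x, t)))\<^sup>2)"
    using vi[OF s] di by simp
  finally show "(LINT x|lebesgue. indicator K x * (norm (v (x, t)))\<^sup>2)
      \<le> 2 * (LINT x|lebesgue. indicator K x * (norm (v (x, s)))\<^sup>2) + 2 * (LINT x:K|lebesgue. (norm (u (x, s) - u (x, t)))\<^sup>2)"
    by (simp add: set_lebesgue_integral_def)
qed

text \<open>If the bound fails at \<open>\<tau>\<close>, then continuity in \<open>L\<^sup>2\<close> gives \<open>\<integral>|v(\<cdot>, t)|\<^sup>2 > 16 R\<close> for all \<open>t\<close>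
  slightly larger than \<open>\<tau>\<close>, against the bound \<open>8 h R\<close> for the integral over an interval of length
  \<open>h / 2\<close>.\<close>

lemma slice_sup_le:
  assumes K: "compact K" "K \<subseteq> \<Omega>" and \<tau>: "0 < \<tau>" "\<tau> < \<tau>'" "\<tau>' < T" and R: "0 \<le> R"
    and est: "\<And>h. 0 < h \<Longrightarrow> \<tau> + h \<le> \<tau>' \<Longrightarrow>
      integrable lebesgue (\<lambda>z. indicator (K \<times> {\<tau> + h / 4..\<tau> + 3 * h / 4}) z * (norm (v z))\<^sup>2) \<and>
      (LINT z|lebesgue. indicator (K \<times> {\<tau> + h / 4..\<tau> + 3 * h / 4}) z * (norm (v z))\<^sup>2) \<le> 8 * h * R"
  shows "(LINT x|lebesgue. indicator K x * (norm (v (x, \<tau>)))\<^sup>2) \<le> 32 * R"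
proof (rule ccontr)
  define f where "f t = (LINT x|lebesgue. indicator K x * (norm (v (x, t)))\<^sup>2)" for t
  assume "\<not> (LINT x|lebesgue. indicator K x * (norm (v (x, \<tau>)))\<^sup>2) \<le> 32 * R"
  then have gt: "32 * R < f \<tau>" by (simp add: f_def)
  define e where "e = (f \<tau> - 32 * R) / 4"
  have e: "0 < e" "f \<tau> = 32 * R + 4 * e" using gt by (simp_all add: e_def field_simps)
  have \<tau>T: "\<tau> \<in> {0<..<T}" using \<tau> by simp
  have "((\<lambda>s. LINT x:K|lebesgue. (norm (u (x, s) - u (x, \<tau>)))\<^sup>2) \<longlongrightarrow> 0) (at \<tau> within {0<..<T})"
    using sol K \<tau>T by (simp add: weak_solution_def C_loc_L2_loc_def)
  from order_tendstoD(2)[OF this e(1)]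
  obtain \<delta> where \<delta>: "0 < \<delta>" "\<And>s. s \<in> {0<..<T} \<Longrightarrow> s \<noteq> \<tau> \<Longrightarrow> dist s \<tau> < \<delta> \<Longrightarrow>
      (LINT x:K|lebesgue. (norm (u (x, s) - u (x, \<tau>)))\<^sup>2) < e"
    unfolding eventually_at by blast
  define h where "h = min (\<delta> / 2) (\<tau>' - \<tau>)"
  have h: "0 < h" "h < \<delta>" "\<tau> + h \<le> \<tau>'" using \<delta>(1) \<tau> by (auto simp: h_def min_def)
  define J where "J = {\<tau> + h / 4..\<tau> + 3 * h / 4}"
  have low: "16 * R + e \<le> f t" if "t \<in> J" for t
  proof -
    have t: "t \<in> {0<..<T}" "t \<noteq> \<tau>" "dist t \<tau> < \<delta>" using that h \<tau> by (auto simp: J_def dist_real_def)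
    have "f \<tau> \<le> 2 * f t + 2 * (LINT x:K|lebesgue. (norm (u (x, t) - u (x, \<tau>)))\<^sup>2)"
      unfolding f_def by (rule slice_integrals(2)[OF K \<tau>T t(1)])
    then show ?thesis using \<delta>(2)[OF t] e(2) by linarith
  qed
  let ?g = "\<lambda>z. indicator (K \<times> J) z * (norm (v z))\<^sup>2"
  note est' = est[OF h(1,3), folded J_def]
  have ig: "integrable lebesgue ?g" using est' by blast
  have "ennreal (h / 2 * (16 * R + e)) = (\<integral>\<^sup>+t. ennreal (16 * R + e) * indicator J t \<partial>lebesgue)"
  proof -
    have J: "emeasure lebesgue J = ennreal (h / 2)" "J \<in> sets lebesgue" using h(1) by (simp_all add: J_def)
    have "ennreal (h / 2 * (16 * R + e)) = ennreal (16 * R + e) * ennreal (h / 2)"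
      using R e by (subst mult.commute) (rule ennreal_mult', simp)
    then show ?thesis by (simp only: nn_integral_cmult_indicator[OF J(2)] J(1))
  qed
  also have "\<dots> \<le> (\<integral>\<^sup>+t. \<integral>\<^sup>+x. ennreal (?g (x, t)) \<partial>lebesgue \<partial>lebesgue)"
  proof (rule nn_integral_mono)
    fix t :: real
    show "ennreal (16 * R + e) * indicator J t \<le> (\<integral>\<^sup>+x. ennreal (?g (x, t)) \<partial>lebesgue)"
    proof (cases "t \<in> J")
      case True
      then have t: "t \<in> {0<..<T}" using h \<tau> by (auto simp: J_def)
      have "(\<integral>\<^sup>+x. ennreal (?g (x, t)) \<partial>lebesgue) = (\<integral>\<^sup>+x. ennreal (indicator K x * (norm (v (x, t)))\<^sup>2) \<partial>lebesgue)"
        using True by (intro nn_integral_cong) (simp add: indicator_def)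
      also have "\<dots> = ennreal (f t)" unfolding f_def
        by (rule nn_integral_eq_integral[OF slice_integrals(1)[OF K t]]) simp
      finally show ?thesis using True low[OF True] by (simp add: ennreal_leI)
    qed simp
  qed
  also have "\<dots> = (\<integral>\<^sup>+z. ennreal (?g z) \<partial>lebesgue)"
    by (rule nn_integral_lebesgue_slices(1)[symmetric, OF borel_measurable_integrable[OF ig]])
  also have "\<dots> = ennreal (LINT z|lebesgue. ?g z)" by (rule nn_integral_eq_integral[OF ig]) simp
  also have "\<dots> \<le> ennreal (8 * h * R)" using est' by (intro ennreal_leI) blast
  finally have "h / 2 * (16 * R + e) \<le> 8 * h * R" using h R by (simp add: ennreal_le_iff)
  then show False using mult_pos_pos[OF e(1) h(1)] by (simp add: algebra_simps)
qed

end

context finite_energy_solution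
begin

text \<open>The two terms on the left are estimated separately: for every \<open>\<tau>\<close> the limit \<open>h \<rightarrow> 0\<close> bounds the
  slice at \<open>\<tau>\<close>, and the choice \<open>\<tau> = t0 + \<rho>1\<close> bounds the integral of the gradient over the whole
  small cylinder.\<close>

lemma caccioppoli_finite:
  fixes \<nu> C r1 r2 \<rho>1 \<rho>2 t0 a1 :: real
  assumes Qc: "Q = cylinder r2 \<rho>2 (x0, t0)" and dr: "d = r2 - r1" and r: "0 < r1" "r1 < r2" "r2 \<le> 1"
    and \<rho>: "0 < \<rho>1" "\<rho>1 < \<rho>2" "\<rho>2 \<le> 1" and \<nu>: "0 < \<nu>" and A2: "condA2 p q \<nu> (\<Omega> \<times> {0<..<T}) a A" and \<beta>1: "\<beta> \<le> 1"
    and a1: "\<And>z. z \<in> Q \<Longrightarrow> a z \<le> a1"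
    and x: "x = (r2 + sqrt \<rho>2) powr \<beta> + (r2 + sqrt \<rho>2) powr \<alpha> * \<sigma> powr (q - p)"
    and C: "absorption_constant TYPE(real^'n^'N) p q k (\<nu> * (p - 1) * 6 powr (1 - q) / 4)
      (6 * L) (2 * L + 4 * q * L\<^sup>2 + 2 * L\<^sup>2) (16 * real k) C"
  defines "c0 \<equiv> \<nu> * (p - 1) * 6 powr (1 - q) / 4"
    and "R \<equiv> energy_rhs (\<rho>2 - \<rho>1) C (young_max p q x * (\<sigma> powr p + a1 * \<sigma> powr q))"
  shows "esssup (lebesgue_on {t0 - \<rho>1<..<t0 + \<rho>1}) (\<lambda>t. \<integral>\<^sup>+x\<in>ball x0 r1. ennreal ((norm (v (x, t)))\<^sup>2) \<partial>lebesgue)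
      + (\<integral>\<^sup>+z\<in>cylinder r1 \<rho>1 (x0, t0). ennreal (dphase_shift p q a \<sigma> z (norm (V z))) \<partial>lebesgue)
      \<le> ennreal ((32 + 2 / c0) * R)"
proof -
  have c0: "0 < c0" using \<nu> pq by (simp add: c0_def)
  note C0 = C[unfolded absorption_constant_def, THEN conjunct1]
  have mid: "(\<rho>1 + \<rho>2) / 2 < \<rho>2" "\<rho>1 < (\<rho>1 + \<rho>2) / 2" using \<rho> by simp_all
  have QI: "z \<in> Q" if "norm (fst z - x0) < r2" "t0 - \<rho>2 < snd z" "snd z < t0 + \<rho>2" for z
    using that by (cases z) (auto simp: Qc cylinder_def dist_norm norm_minus_commute)
  have z0: "(x0, t0) \<in> Q" using r \<rho> by (intro QI) auto
  have a1_nn: "0 \<le> a1" using a1[OF z0] a[OF QT[OF z0]] by linarith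
  have ym: "0 \<le> young_max p q x" by (rule young_max_nonneg)
  have R0: "0 \<le> R"
  proof -
    have "0 \<le> indicator Q z * Gw z" for z using Gw_nonneg[of z] by (cases "z \<in> Q") auto
    then have "0 \<le> (LINT z|lebesgue. indicator Q z * Gw z)" by (intro integral_nonneg_AE AE_I2)
    moreover have "0 \<le> (LINT z|lebesgue. indicator Q z * (norm (v z))\<^sup>2)" by (intro integral_nonneg_AE AE_I2) simp
    ultimately show ?thesis unfolding R_def energy_rhs_def using \<rho> C0 ym a1_nn by simp
  qed
  note EE = energy_estimate[OF Qc dr r \<rho> \<nu> A2 \<beta>1 a1 _ _ _ x C, folded c0_def R_def]
  define K where "K = cball x0 r1"
  have K: "compact K" "K \<subseteq> \<Omega>"
  proof -
    show "compact K" by (simp add: K_def)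
    show "K \<subseteq> \<Omega>"
    proof
      fix x assume "x \<in> K"
      then have "(x, t0) \<in> Q" using r \<rho> by (intro QI) (auto simp: K_def dist_norm norm_minus_commute)
      then show "x \<in> \<Omega>" using QT by blast
    qed
  qed
  have timeT: "t \<in> {0<..<T}" if "t0 - \<rho>2 < t" "t < t0 + \<rho>2" for t
  proof -
    have "(x0, t) \<in> Q" using that r by (intro QI) auto
    then show ?thesis using QT by blast
  qed
  have slice: "(LINT x|lebesgue. indicator K x * (norm (v (x, \<tau>)))\<^sup>2) \<le> 32 * R"
    if \<tau>: "t0 - \<rho>1 < \<tau>" "\<tau> < t0 + \<rho>1" for \<tau>
  proof (rule slice_sup_le[OF K _ _ _ R0, where \<tau>'="t0 + (\<rho>1 + \<rho>2) / 2"])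
    have "\<tau> \<in> {0<..<T}" by (rule timeT) (use \<tau> \<rho> in linarith)+
    then show "0 < \<tau>" by simp
    show "\<tau> < t0 + (\<rho>1 + \<rho>2) / 2" using \<tau> mid by linarith
    have "t0 + (\<rho>1 + \<rho>2) / 2 \<in> {0<..<T}" by (rule timeT) (use mid \<rho> in linarith)+
    then show "t0 + (\<rho>1 + \<rho>2) / 2 < T" by simp
    fix h :: real assume h: "0 < h" "\<tau> + h \<le> t0 + (\<rho>1 + \<rho>2) / 2"
    have \<tau>': "t0 - \<rho>1 \<le> \<tau>" using \<tau> by simp
    let ?I = "LINT z|lebesgue. indicator (K \<times> {\<tau> + h / 4..\<tau> + 3 * h / 4}) z * (norm (v z))\<^sup>2"
    have "ennreal (1 / (8 * h) * ?I) \<le> ennreal R"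
      using order_trans[OF add_increasing[OF zero_le order_refl] EE(1)[OF _ h(1) \<tau>' h(2)]] unfolding K_def by simp
    then have "1 / (8 * h) * ?I \<le> R" using R0 by (simp only: ennreal_le_iff)
    then have "?I \<le> 8 * h * R" using h(1) by (simp add: field_simps)
    moreover have "integrable lebesgue (\<lambda>z. indicator (K \<times> {\<tau> + h / 4..\<tau> + 3 * h / 4}) z * (norm (v z))\<^sup>2)"
      unfolding K_def by (rule EE(2)[OF _ h(1) \<tau>' h(2)])
    ultimately show "integrable lebesgue (\<lambda>z. indicator (K \<times> {\<tau> + h / 4..\<tau> + 3 * h / 4}) z * (norm (v z))\<^sup>2) \<and> ?I \<le> 8 * h * R" by blast
  qed
  let ?I = "{t0 - \<rho>1<..<t0 + \<rho>1}"
  let ?\<Psi> = "\<lambda>t. \<integral>\<^sup>+x\<in>ball x0 r1. ennreal ((norm (v (x, t)))\<^sup>2) \<partial>lebesgue"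
  have \<Psi>le: "?\<Psi> \<tau> \<le> ennreal (32 * R)" if "\<tau> \<in> ?I" for \<tau>
  proof -
    have \<tau>T: "\<tau> \<in> {0<..<T}" by (rule timeT) (use that \<rho> in auto)
    have "?\<Psi> \<tau> \<le> (\<integral>\<^sup>+x. ennreal (indicator K x * (norm (v (x, \<tau>)))\<^sup>2) \<partial>lebesgue)"
      by (intro nn_integral_mono) (auto simp: indicator_def K_def)
    also have "\<dots> = ennreal (LINT x|lebesgue. indicator K x * (norm (v (x, \<tau>)))\<^sup>2)"
      by (rule nn_integral_eq_integral[OF slice_integrals(1)[OF K \<tau>T]]) simp
    also have "\<dots> \<le> ennreal (32 * R)" using slice that by (intro ennreal_leI) auto
    finally show ?thesis .
  qed
  have \<Psi>m: "?\<Psi> \<in> borel_measurable (lebesgue_on ?I)"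
  proof -
    let ?S = "ball x0 r1 \<times> ?I"
    have "open ?S" by (intro open_Times open_ball open_greaterThanLessThan)
    then have Ss: "?S \<in> sets lebesgue" by (simp add: borel_open)
    have SQ: "?S \<subseteq> Q"
    proof
      fix z assume "z \<in> ?S"
      then show "z \<in> Q" using r \<rho> by (intro QI) (auto simp: dist_norm norm_minus_commute)
    qed
    have "(\<lambda>z. indicator ?S z * (indicator Q z * (norm (v z))\<^sup>2)) \<in> borel_measurable lebesgue"
      by (rule borel_measurable_times[OF borel_measurable_indicator[OF Ss] v_sq_measurable])
    moreover have "indicator ?S z * (indicator Q z * (norm (v z))\<^sup>2) = indicator ?S z * (norm (v z))\<^sup>2" for z
      using SQ by (auto simp: indicator_def)
    ultimately have "(\<lambda>z. indicator ?S z * (norm (v z))\<^sup>2) \<in> borel_measurable lebesgue" by simp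
    from measurable_restrict_space1[OF nn_integral_lebesgue_slices(2)[OF this], of ?I]
    show ?thesis
    proof (rule measurable_cong[THEN iffD1, rotated])
      fix t assume "t \<in> space (lebesgue_on ?I)"
      then have "t \<in> ?I" by simp
      then show "(\<integral>\<^sup>+x. ennreal (indicator ?S (x, t) * (norm (v (x, t)))\<^sup>2) \<partial>lebesgue) = ?\<Psi> t"
        by (intro nn_integral_cong) (auto simp: indicator_def)
    qed
  qed
  have sup: "esssup (lebesgue_on ?I) ?\<Psi> \<le> ennreal (32 * R)"
    by (rule esssup_I[OF \<Psi>m]) (use \<Psi>le in \<open>auto intro!: AE_I2\<close>)
  have grad: "(\<integral>\<^sup>+z\<in>cylinder r1 \<rho>1 (x0, t0). ennreal (dphase_shift p q a \<sigma> z (norm (V z))) \<partial>lebesgue) \<le> ennreal (2 / c0 * R)"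
  proof -
    let ?S = "cball x0 r1 \<times> {t0 - \<rho>1..t0 + \<rho>1}"
    have "closed ?S" by (intro closed_Times closed_cball closed_atLeastAtMost)
    then have Ss: "?S \<in> sets lebesgue" by (simp add: borel_closed)
    have SQ: "?S \<subseteq> Q"
    proof
      fix z assume "z \<in> ?S"
      then show "z \<in> Q" using r \<rho> by (intro QI) (auto simp: dist_norm norm_minus_commute)
    qed
    define g where "g z = indicator ?S z * (c0 / 2 * GV z)" for z
    have gm: "g \<in> borel_measurable lebesgue"
    proof -
      have "(\<lambda>z. indicator Q z * GV z) \<in> borel_measurable lebesgue"
        unfolding GV_def by (rule shift_flux_measurable[OF norm_measurable[OF V_meas]])
      then have "(\<lambda>z. indicator ?S z * (c0 / 2 * (indicator Q z * GV z))) \<in> borel_measurable lebesgue"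
        by (rule borel_measurable_times[OF borel_measurable_indicator[OF Ss] borel_measurable_times[OF borel_measurable_const]])
      moreover have "indicator ?S z * (c0 / 2 * (indicator Q z * GV z)) = g z" for z
        using SQ by (auto simp: indicator_def g_def)
      ultimately show ?thesis by simp
    qed
    have "(\<integral>\<^sup>+z\<in>cylinder r1 \<rho>1 (x0, t0). ennreal (dphase_shift p q a \<sigma> z (norm (V z))) \<partial>lebesgue)
        \<le> (\<integral>\<^sup>+z. ennreal (2 / c0) * ennreal (g z) \<partial>lebesgue)"
    proof (rule nn_integral_mono)
      fix z :: "(real^'n) \<times> real"
      show "ennreal (dphase_shift p q a \<sigma> z (norm (V z))) * indicator (cylinder r1 \<rho>1 (x0, t0)) z \<le> ennreal (2 / c0) * ennreal (g z)"
      proof (cases "z \<in> cylinder r1 \<rho>1 (x0, t0)")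
        case True
        then have zS: "z \<in> ?S" by (auto simp: cylinder_def)
        then have zQ: "z \<in> Q" using SQ by blast
        have "dphase_shift p q a \<sigma> z (norm (V z)) \<le> norm (V z) * shift_flux p q (a z) \<sigma> (norm (V z))"
          unfolding dphase_shift_eq by (rule double_phase.primitive_shift_flux(1)[OF dp[OF zQ]]) simp
        then have "dphase_shift p q a \<sigma> z (norm (V z)) \<le> 2 / c0 * g z"
          using zS c0 by (simp add: g_def GV_def mult.commute)
        then have "ennreal (dphase_shift p q a \<sigma> z (norm (V z))) \<le> ennreal (2 / c0) * ennreal (g z)"
          using c0 by (simp add: ennreal_leI flip: ennreal_mult')
        then show ?thesis using True by simp
      qed simp
    qed
    also have "\<dots> = ennreal (2 / c0) * (\<integral>\<^sup>+z. ennreal (g z) \<partial>lebesgue)"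
      by (rule nn_integral_cmult) (use gm in measurable)
    also have "\<dots> \<le> ennreal (2 / c0) * ennreal R"
    proof (rule mult_left_mono)
      \<comment> \<open>Here the estimate is used with \<open>\<tau> = t0 + \<rho>1\<close> and \<open>h = (\<rho>2 - \<rho>1) / 2\<close>.\<close>
      have h: "0 < (\<rho>2 - \<rho>1) / 2" "t0 - \<rho>1 \<le> t0 + \<rho>1" "t0 + \<rho>1 + (\<rho>2 - \<rho>1) / 2 \<le> t0 + (\<rho>1 + \<rho>2) / 2"
        using \<rho> by (simp_all add: field_simps)
      show "(\<integral>\<^sup>+z. ennreal (g z) \<partial>lebesgue) \<le> ennreal R"
        using order_trans[OF add_increasing2[OF zero_le order_refl] EE(1)[OF _ h]] unfolding g_def by simp
    qed simp
    also have "\<dots> = ennreal (2 / c0 * R)" using c0 by (intro ennreal_mult'[symmetric]) simp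
    finally show ?thesis .
  qed
  have "esssup (lebesgue_on ?I) ?\<Psi> + (\<integral>\<^sup>+z\<in>cylinder r1 \<rho>1 (x0, t0). ennreal (dphase_shift p q a \<sigma> z (norm (V z))) \<partial>lebesgue)
      \<le> ennreal (32 * R) + ennreal (2 / c0 * R)" by (rule add_mono[OF sup grad])
  also have "\<dots> = ennreal ((32 + 2 / c0) * R)"
    using R0 c0 by (simp add: distrib_right flip: ennreal_plus)
  finally show ?thesis .
qed

end

theorem lemma3p1:
  fixes p q L \<nu> :: real
  assumes "CARD('n::finite) \<ge> 2" and "CARD('N::finite) > 1"
    and "2 * real CARD('n) / (real CARD('n) + 2) < p" and "p \<le> q"
    and "0 < \<nu>" and "\<nu> \<le> L"
  shows "\<exists>c>0. \<forall>(\<Omega> :: (real^'n) set) T \<alpha> \<beta>\<^sub>0 a A (u :: (real^'n) \<times> real \<Rightarrow> real^'N) Du.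
    open \<Omega> \<and> bounded \<Omega> \<and> 0 < T
    \<and> 0 < \<alpha> \<and> \<alpha> \<le> 1 \<and> q \<le> p + p * \<alpha> / (real CARD('n) + 2)
    \<and> 0 < \<beta>\<^sub>0 \<and> \<beta>\<^sub>0 < 1
    \<and> (\<forall>z\<in>\<Omega> \<times> {0<..<T}. 0 \<le> a z \<and> a z \<le> L)
    \<and> (\<forall>(x1, t1)\<in>\<Omega> \<times> {0<..<T}. \<forall>(x2, t2)\<in>\<Omega> \<times> {0<..<T}.
          \<bar>a (x1, t1) - a (x2, t2)\<bar>
            \<le> L * (norm (x1 - x2) powr \<alpha> + \<bar>t1 - t2\<bar> powr (\<alpha> / 2)))
    \<and> condA1 p q L (\<Omega> \<times> {0<..<T}) a A
    \<and> condA2 p q \<nu> (\<Omega> \<times> {0<..<T}) a A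
    \<and> condA3 p q L \<beta>\<^sub>0 (\<Omega> \<times> {0<..<T}) a A
    \<and> weak_solution p q a \<Omega> T A u Du
    \<longrightarrow>
    (\<forall>x\<^sub>0 t\<^sub>0 r1 r2 \<rho>1 \<rho>2 (P :: real^'n^'N) b z\<^sub>p.
      cylinder r1 \<rho>1 (x\<^sub>0, t\<^sub>0) \<subseteq> cylinder r2 \<rho>2 (x\<^sub>0, t\<^sub>0)
      \<and> compact (closure (cylinder r2 \<rho>2 (x\<^sub>0, t\<^sub>0)))
      \<and> closure (cylinder r2 \<rho>2 (x\<^sub>0, t\<^sub>0)) \<subseteq> \<Omega> \<times> {0<..<T}
      \<and> 0 < r1 \<and> r1 < r2 \<and> r2 \<le> 1 \<and> 0 < \<rho>1 \<and> \<rho>1 < \<rho>2 \<and> \<rho>2 \<le> 1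
      \<and> z\<^sub>p \<in> closure (cylinder r2 \<rho>2 (x\<^sub>0, t\<^sub>0))
      \<and> a z\<^sub>p = (SUP z\<in>cylinder r2 \<rho>2 (x\<^sub>0, t\<^sub>0). a z)
      \<longrightarrow>
      (let u\<^sub>l = (\<lambda>z. u z - (P *v (fst z - x\<^sub>0) + b));
           Du\<^sub>l = (\<lambda>z. Du z - P);
           C1 = (r2 + sqrt \<rho>2) powr \<beta>\<^sub>0
                + (r2 + sqrt \<rho>2) powr \<alpha> * (1 + norm P) powr (q - p);
           p' = min p 2;
           q' = max q 2
       in esssup (lebesgue_on {t\<^sub>0 - \<rho>1<..<t\<^sub>0 + \<rho>1})
            (\<lambda>t. \<integral>\<^sup>+x\<in>ball x\<^sub>0 r1. ennreal ((norm (u\<^sub>l (x, t)))\<^sup>2) \<partial>lebesgue)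
          + (\<integral>\<^sup>+z\<in>cylinder r1 \<rho>1 (x\<^sub>0, t\<^sub>0).
                ennreal (dphase_shift p q a (1 + norm P) z (norm (Du\<^sub>l z))) \<partial>lebesgue)
          \<le> ennreal c * (\<integral>\<^sup>+z\<in>cylinder r2 \<rho>2 (x\<^sub>0, t\<^sub>0).
                ennreal ((norm (u\<^sub>l z))\<^sup>2 / (\<rho>2 - \<rho>1)
                  + dphase_shift p q a (1 + norm P) z (norm (u\<^sub>l z) / (r2 - r1))) \<partial>lebesgue)
            + ennreal (c * measure lebesgue (cylinder r2 \<rho>2 (x\<^sub>0, t\<^sub>0))
                * max (C1 powr (p' / (p' - 1))) (C1 powr (q' / (q' - 1)))
                * dphase p q a z\<^sub>p (1 + norm P))))"
proof -
  \<comment> \<open>The constant is fixed before the solution and the cylinder: \<open>c0\<close> is the ellipticity constant of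
    \<open>monotonicity_shift_flux\<close>, and \<open>C\<close> depends on \<open>c0\<close>, \<open>p\<close>, \<open>q\<close> and \<open>L\<close> only.\<close>
  define k where "k = growth_power q"
  define c0 where "c0 = \<nu> * (p - 1) * 6 powr (1 - q) / 4"
  have n2: "1 \<le> 2 * real CARD('n) / (real CARD('n) + 2)" using assms(1) by (simp add: field_simps)
  have p1: "1 < p" using n2 assms(3) by linarith
  have L: "0 \<le> L" using assms(5,6) by linarith
  have c0: "0 < c0" using p1 assms(5) by (simp add: c0_def)
  have "0 \<le> 2 * L + 4 * q * L\<^sup>2 + 2 * L\<^sup>2" using L p1 assms(4) by simp
  then obtain C where C: "absorption_constant TYPE(real^'n^'N) p q k c0
      (6 * L) (2 * L + 4 * q * L\<^sup>2 + 2 * L\<^sup>2) (16 * real k) C"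
    using absorption_constant_exists[where 'm="real^'n^'N", OF p1 assms(4) growth_power c0, of "6 * L" "2 * L + 4 * q * L\<^sup>2 + 2 * L\<^sup>2" "16 * real k"] L
    unfolding k_def by auto
  note C0 = C[unfolded absorption_constant_def, THEN conjunct1]
  define c1 where "c1 = 4 + 2 ^ k * C"
  define c where "c = (32 + 2 / c0) * c1"
  have c1: "0 < c1" using C0 by (simp add: c1_def add_pos_pos)
  have cpos: "0 < c" using c0 c1 by (simp add: c_def add_pos_pos)
  show ?thesis
  proof (intro exI[of _ c] conjI cpos allI impI, unfold Let_def, goal_cases)
    case (1 \<Omega> T \<alpha> \<beta> a A u Du x0 t0 r1 r2 \<rho>1 \<rho>2 P b zp)
    define Q where "Q = cylinder r2 \<rho>2 (x0, t0)"
    note H1 = 1(1) and H2 = 1(2)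
    have r: "0 < r1" "r1 < r2" "r2 \<le> 1" and \<rho>: "0 < \<rho>1" "\<rho>1 < \<rho>2" "\<rho>2 \<le> 1" using H2 by blast+
    have aL: "\<forall>z\<in>\<Omega> \<times> {0<..<T}. 0 \<le> a z \<and> a z \<le> L" using H1 by blast
    have hol: "\<bar>a z - a z'\<bar> \<le> L * (norm (fst z - fst z') powr \<alpha> + \<bar>snd z - snd z'\<bar> powr (\<alpha> / 2))"
      if "z \<in> \<Omega> \<times> {0<..<T}" "z' \<in> \<Omega> \<times> {0<..<T}" for z z'
      using H1 that unfolding case_prod_beta prod.collapse by blast
    interpret cylinder_solution \<Omega> T p q L \<alpha> \<beta> a A u Du Q P b x0 "r2 - r1"
    proof unfold_locales
      show "open Q" unfolding Q_def cylinder_def by (intro open_Times open_ball open_greaterThanLessThan)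
    qed (use H1 H2 p1 assms(4) L aL hol r in \<open>auto simp: Q_def\<close>)
    let ?\<sigma> = "1 + norm P"
    define x where "x = (r2 + sqrt \<rho>2) powr \<beta> + (r2 + sqrt \<rho>2) powr \<alpha> * ?\<sigma> powr (q - p)"
    define Y where "Y = young_max p q x * (?\<sigma> powr p + a zp * ?\<sigma> powr q)"
    define I where "I = (\<integral>\<^sup>+z\<in>Q. ennreal ((norm (v z))\<^sup>2 / (\<rho>2 - \<rho>1) + dphase_shift p q a ?\<sigma> z (w z)) \<partial>lebesgue)"
    have azp: "a z \<le> a zp" if "z \<in> Q" for z
    proof -
      have "bdd_above (a ` Q)" using aL QT by (intro bdd_aboveI[of _ L]) auto
      then have "a z \<le> (SUP z\<in>Q. a z)" using that by (intro cSUP_upper) auto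
      then show ?thesis using H2 by (simp add: Q_def)
    qed
    have goal: "esssup (lebesgue_on {t0 - \<rho>1<..<t0 + \<rho>1}) (\<lambda>t. \<integral>\<^sup>+x\<in>ball x0 r1. ennreal ((norm (v (x, t)))\<^sup>2) \<partial>lebesgue)
      + (\<integral>\<^sup>+z\<in>cylinder r1 \<rho>1 (x0, t0). ennreal (dphase_shift p q a ?\<sigma> z (norm (V z))) \<partial>lebesgue)
      \<le> ennreal c * I + ennreal (c * measure lebesgue Q * Y)"
    proof (cases "I = \<infinity>")
      case True
      then show ?thesis using cpos by (simp add: ennreal_mult_top)
    next
      case False
      have dpQ: "double_phase p q (a z) ?\<sigma> k" if "z \<in> Q" for z
        using p1 assms(4) aL QT[OF that] growth_power by unfold_locales (auto simp: k_def add_pos_nonneg)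
      have wn: "0 \<le> w z" for z using r by (simp add: w_def)
      define g where "g z = shift_flux p q (a z) ?\<sigma> (w z) * w z" for z
      have ds: "dphase_shift p q a ?\<sigma> z s = (LINT r:{0..s}|lebesgue. shift_flux p q (a z) ?\<sigma> r)" for z s
        unfolding dphase_shift_def set_lebesgue_integral_def
        by (rule Bochner_Integration.integral_cong)
          (auto simp: indicator_def shift_flux_def dphase'_dflux add_pos_nonneg)
      have g_ds: "g z / 2 ^ k \<le> dphase_shift p q a ?\<sigma> z (w z)" and g0: "0 \<le> g z" if "z \<in> Q" for z
        using double_phase.primitive_shift_flux(2)[OF dpQ[OF that] wn[of z]] double_phase.shift_flux_nonneg[OF dpQ[OF that] wn[of z]] wn[of z]
        by (simp_all add: ds g_def field_simps)
      \<comment> \<open>Up to constants, the integrand on the right: \<open>g\<close> is comparable to the shifted energy of \<open>w\<close>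
        and, in contrast to the latter, given by a closed formula that is evidently measurable.\<close>
      define m where "m z = indicator Q z * (norm (v z))\<^sup>2 * (1 / (\<rho>2 - \<rho>1)) + indicator Q z * g z * (1 / 2 ^ k)" for z
      have gm: "(\<lambda>z. indicator Q z * g z) \<in> borel_measurable lebesgue"
        unfolding g_def by (rule shift_flux_measurable[OF w_measurable])
      have mI: "(\<integral>\<^sup>+z. ennreal (m z) \<partial>lebesgue) \<le> I"
        unfolding I_def
      proof (rule nn_integral_mono)
        show "ennreal (m z) \<le> ennreal ((norm (v z))\<^sup>2 / (\<rho>2 - \<rho>1) + dphase_shift p q a ?\<sigma> z (w z)) * indicator Q z" for z
          using g_ds[of z] by (cases "z \<in> Q") (auto simp: m_def intro!: ennreal_leI)
      qed
      have I1: "integrable lebesgue (\<lambda>z. indicator Q z * (norm (v z))\<^sup>2 * (1 / (\<rho>2 - \<rho>1)))"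
      proof (rule integrableI_bounded)
        have "(\<integral>\<^sup>+z. ennreal (norm (indicator Q z * (norm (v z))\<^sup>2 * (1 / (\<rho>2 - \<rho>1)))) \<partial>lebesgue) \<le> (\<integral>\<^sup>+z. ennreal (m z) \<partial>lebesgue)"
          using \<rho> g0 by (intro nn_integral_mono ennreal_leI) (auto simp: m_def indicator_def)
        also have "\<dots> < \<infinity>" using False by (intro le_less_trans[OF mI]) (simp add: less_top)
        finally show "(\<integral>\<^sup>+z. ennreal (norm (indicator Q z * (norm (v z))\<^sup>2 * (1 / (\<rho>2 - \<rho>1)))) \<partial>lebesgue) < \<infinity>" .
      qed (intro borel_measurable_times v_sq_measurable borel_measurable_const)
      have I2: "integrable lebesgue (\<lambda>z. indicator Q z * g z * (1 / 2 ^ k))"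
      proof (rule integrableI_bounded)
        have "(\<integral>\<^sup>+z. ennreal (norm (indicator Q z * g z * (1 / 2 ^ k))) \<partial>lebesgue) \<le> (\<integral>\<^sup>+z. ennreal (m z) \<partial>lebesgue)"
          using \<rho> g0 by (intro nn_integral_mono ennreal_leI) (auto simp: m_def indicator_def)
        also have "\<dots> < \<infinity>" using False by (intro le_less_trans[OF mI]) (simp add: less_top)
        finally show "(\<integral>\<^sup>+z. ennreal (norm (indicator Q z * g z * (1 / 2 ^ k))) \<partial>lebesgue) < \<infinity>" .
      qed (intro borel_measurable_times gm borel_measurable_const)
      have v2: "integrable lebesgue (\<lambda>z. indicator Q z * (norm (v z))\<^sup>2)"
        using integrable_mult_left[OF I1, of "\<rho>2 - \<rho>1"] \<rho> by simp
      have w2: "integrable lebesgue (\<lambda>z. indicator Q z * g z)"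
        using integrable_mult_left[OF I2, of "2 ^ k"] by simp
      interpret finite_energy_solution \<Omega> T p q L \<alpha> \<beta> a A u Du Q P b x0 "r2 - r1"
        by unfold_locales (use v2 w2 in \<open>simp_all add: g_def\<close>)
      define Iv where "Iv = (LINT z|lebesgue. indicator Q z * (norm (v z))\<^sup>2)"
      define Ig where "Ig = (LINT z|lebesgue. indicator Q z * g z)"
      have Iv0: "0 \<le> Iv" unfolding Iv_def by (intro integral_nonneg_AE AE_I2) simp
      have Ig0: "0 \<le> Ig" unfolding Ig_def by (intro integral_nonneg_AE AE_I2) (auto simp: indicator_def g0)
      have z0Q: "(x0, t0) \<in> Q" using r \<rho> by (simp add: Q_def cylinder_def)
      have "0 \<le> a zp" using azp[OF z0Q] bspec[OF aL QT[OF z0Q]] by linarith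
      moreover have "0 \<le> young_max p q x" by (rule young_max_nonneg)
      ultimately have Y0: "0 \<le> Y" by (simp add: Y_def)
      define J where "J = Iv * (1 / (\<rho>2 - \<rho>1)) + Ig * (1 / 2 ^ k)"
      have J0: "0 \<le> J" using Iv0 Ig0 \<rho> by (simp add: J_def)
      have "ennreal J = (\<integral>\<^sup>+z. ennreal (m z) \<partial>lebesgue)"
      proof -
        have "(LINT z|lebesgue. m z) = J" unfolding m_def J_def Iv_def Ig_def using I1 I2 by simp
        moreover have "integrable lebesgue m" unfolding m_def[abs_def] using I1 I2 by (rule Bochner_Integration.integrable_add)
        moreover have "0 \<le> m z" for z using g0[of z] \<rho> by (cases "z \<in> Q") (simp_all add: m_def)
        ultimately show ?thesis using nn_integral_eq_integral[of lebesgue m, OF _ AE_I2] by metis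
      qed
      then have JI: "ennreal J \<le> I" using mI by simp
      have "energy_rhs (\<rho>2 - \<rho>1) C Y \<le> c1 * (J + measure lebesgue Q * Y)"
      proof -
        have "energy_rhs (\<rho>2 - \<rho>1) C Y = 4 * (Iv * (1 / (\<rho>2 - \<rho>1))) + C * 2 ^ k * (Ig * (1 / 2 ^ k)) + C * (measure lebesgue Q * Y)"
          by (simp add: energy_rhs_def Iv_def Ig_def Gw_def g_def algebra_simps)
        also have "\<dots> \<le> c1 * (Iv * (1 / (\<rho>2 - \<rho>1))) + c1 * (Ig * (1 / 2 ^ k)) + c1 * (measure lebesgue Q * Y)"
        proof (intro add_mono mult_right_mono)
          have "1 * C \<le> 2 ^ k * C" using C0 by (intro mult_right_mono one_le_power) auto
          then have C: "C \<le> c1" using C0 unfolding c1_def by linarith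
          show "C \<le> c1" by (rule C)
          show "4 \<le> c1" "C * 2 ^ k \<le> c1" using C0 by (simp_all add: c1_def mult.commute)
        qed (use Iv0 Ig0 \<rho> Y0 in auto)
        finally show ?thesis by (simp add: J_def algebra_simps)
      qed
      then have "(32 + 2 / c0) * energy_rhs (\<rho>2 - \<rho>1) C Y \<le> (32 + 2 / c0) * (c1 * (J + measure lebesgue Q * Y))"
        using c0 by (intro mult_left_mono) auto
      also have "\<dots> = c * J + c * measure lebesgue Q * Y" by (simp add: c_def algebra_simps)
      finally have fin: "(32 + 2 / c0) * energy_rhs (\<rho>2 - \<rho>1) C Y \<le> c * J + c * measure lebesgue Q * Y" .
      have "esssup (lebesgue_on {t0 - \<rho>1<..<t0 + \<rho>1}) (\<lambda>t. \<integral>\<^sup>+x\<in>ball x0 r1. ennreal ((norm (v (x, t)))\<^sup>2) \<partial>lebesgue)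
        + (\<integral>\<^sup>+z\<in>cylinder r1 \<rho>1 (x0, t0). ennreal (dphase_shift p q a ?\<sigma> z (norm (V z))) \<partial>lebesgue)
        \<le> ennreal ((32 + 2 / c0) * energy_rhs (\<rho>2 - \<rho>1) C Y)"
        unfolding Y_def c0_def
        by (rule caccioppoli_finite[OF Q_def refl r \<rho> assms(5) _ _ azp x_def C[unfolded c0_def k_def]])
          (use H1 in auto)
      also have "\<dots> \<le> ennreal (c * J + c * measure lebesgue Q * Y)" by (rule ennreal_leI[OF fin])
      also have "\<dots> = ennreal c * ennreal J + ennreal (c * measure lebesgue Q * Y)"
        using cpos J0 Y0 by (simp add: ennreal_plus ennreal_mult')
      also have "\<dots> \<le> ennreal c * I + ennreal (c * measure lebesgue Q * Y)"
        using JI by (intro add_right_mono mult_left_mono) auto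
      finally show ?thesis .
    qed
    have "c * measure lebesgue Q * Y = c * measure lebesgue Q
        * max (x powr (min p 2 / (min p 2 - 1))) (x powr (max q 2 / (max q 2 - 1))) * dphase p q a zp ?\<sigma>"
      by (simp add: Y_def young_max_def dphase_def)
    with goal show ?case
      unfolding I_def v_def V_def w_def x_def Q_def by simp
  qed
qed

end
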